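(* Assume the Riemann hypothesis. Then for every $T>2\pi$, \[ \sum_{\substack{\rho''=\beta''+i\gamma'',\\ 0<\gamma''\leq T}} \left(\beta''-\frac{1}{2}\right) = \frac{2T}{2\pi}\log\log\frac{T}{2\pi} + \frac{1}{2\pi}\left(\frac{1}{2}\log 2 - 2\log\log 2\right)T - 2\,\mathrm{Li}\left(\frac{T}{2\pi}\right) + O\big((\log\log T)^2\big), \] where the implied constant is absolute.
   Context: $\zeta(s)$ is the Riemann zeta function and $\zeta''(s)$ its second derivative. The sum runs over the non-real zeros $\rho''=\beta''+i\gamma''$ of $\zeta''(s)$ with $0<\gamma''\le T$, counted with multiplicity. $\mathrm{Li}(x):=\int_2^x \frac{dt}{\log t}$. *)

theory Defs
  imports "HOL-Complex_Analysis.Complex_Analysis"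
begin

text \<open>
  The Riemann zeta function is the analytic continuation of its Dirichlet series to the plane
  without 1. The value at the pole is a junk value, fixed only to make the function unique.
\<close>
definition is_zeta :: "(complex \<Rightarrow> complex) \<Rightarrow> bool" where
  "is_zeta f \<longleftrightarrow> f holomorphic_on (- {1}) \<and> f 1 = 0 \<and>
     (\<forall>s. Re s > 1 \<longrightarrow> (\<lambda>n. of_nat (Suc n) powr (- s)) sums f s)"

lemma is_zeta_unique:
  assumes "is_zeta f" "is_zeta g"
  shows "f = g"
proof
  fix z :: complex
  have eq: "f s = g s" if "Re s > 1" for s
    using assms that sums_unique2 unfolding is_zeta_def by blast
  show "f z = g z"
  proof (cases "z = 1")
    case False
    show ?thesis
    proof (rule analytic_continuation_open[of "{s. Re s > 1}" "- {1}" f g])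
      show "open {s. Re s > 1}" by (rule open_halfspace_Re_gt)
      show "{s. Re s > 1} \<noteq> {}" by (auto intro: exI[of _ "2::complex"])
      show "connected (- {1::complex})"
        by (rule connected_punctured_universe) simp
    qed (use assms False eq in \<open>auto simp: is_zeta_def\<close>)
  qed (use assms in \<open>auto simp: is_zeta_def\<close>)
qed

text \<open>
  Existence of the continuation. With $N = n + 1$, \<open>taylor_rem K w n\<close> is the remainder of the
  Taylor expansion of $(N + 1)^{-w}$ around $N$. Summing over all $N$ expresses
  $w \zeta(w + 1)$ through the values at $w + 1, w + 2, \ldots$, which continues it one
  strip at a time to the left.
\<close>
definition ffz :: "nat \<Rightarrow> complex \<Rightarrow> complex" where
  "ffz k w = (\<Prod>i<k. - w - of_nat i)"

definition taylor_rem :: "nat \<Rightarrow> complex \<Rightarrow> nat \<Rightarrow> complex" where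
  "taylor_rem K w n = of_nat (Suc (Suc n)) powr (- w) -
     (\<Sum>i\<le>K. ffz i w * of_nat (Suc n) powr (- w - of_nat i) / fact i)"

lemma taylor_rem_bound:
  assumes "Re w > - real K"
  shows "norm (taylor_rem K w n) \<le> norm (ffz (Suc K) w) * real (Suc n) powr (- Re w - real (Suc K))"
proof -
  define S where "S = closed_segment (of_nat (Suc n) :: complex) (of_nat (Suc (Suc n)))"
  define f where "f = (\<lambda>i x. ffz i w * x powr (- w - of_nat i))"
  define B where "B = norm (ffz (Suc K) w) * real (Suc n) powr (- Re w - real (Suc K))"
  have S: "\<exists>r. x = of_real r \<and> r \<ge> real (Suc n)" if "x \<in> S" for x
  proof -
    have "S = of_real ` closed_segment (real (Suc n)) (real (Suc (Suc n)))"
      unfolding S_def closed_segment_of_real[symmetric] by simp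
    thus ?thesis using that by (auto simp: closed_segment_eq_real_ivl)
  qed
  have "norm (f 0 (of_nat (Suc (Suc n))) -
      (\<Sum>i\<le>K. f i (of_nat (Suc n)) * (of_nat (Suc (Suc n)) - of_nat (Suc n)) ^ i / fact i))
      \<le> B * norm (of_nat (Suc (Suc n)) - of_nat (Suc n) :: complex) ^ Suc K / fact K"
  proof (rule complex_Taylor[of S])
    show "convex S" by (simp add: S_def)
    fix x assume x: "x \<in> S"
    then obtain r where r: "x = of_real r" "r \<ge> real (Suc n)" using S by blast
    hence r0: "r > 0" by linarith
    hence nn: "x \<notin> \<real>\<^sub>\<le>\<^sub>0" using r by (auto simp: complex_nonpos_Reals_iff)
    show "(f i has_field_derivative f (Suc i) x) (at x within S)" for i
      unfolding f_def using nn
      by (auto intro!: derivative_eq_intros simp: ffz_def algebra_simps)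
    have "norm (x powr (- w - of_nat (Suc K))) = r powr (- Re w - real (Suc K))"
      using r r0 by (simp add: norm_powr_real_powr)
    also have "\<dots> \<le> real (Suc n) powr (- Re w - real (Suc K))"
      using r assms by (intro powr_mono2') auto
    finally show "norm (f (Suc K) x) \<le> B"
      unfolding f_def B_def norm_mult by (intro mult_left_mono) auto
  qed (auto simp: S_def)
  also have "\<dots> \<le> B"
  proof -
    have "B \<ge> 0" by (simp add: B_def)
    moreover have "(1::real) \<le> fact K" by (rule fact_ge_1)
    ultimately have "B / fact K \<le> B / 1" by (intro divide_left_mono) auto
    thus ?thesis by simp
  qed
  finally show ?thesis by (simp add: f_def B_def taylor_rem_def ffz_def)
qed

lemma holomorphic_suminf_taylor_rem:
  shows "(\<lambda>w. \<Sum>n. taylor_rem K w n) holomorphic_on {w. Re w > - real K}"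
    and "Re w > - real K \<Longrightarrow> summable (taylor_rem K w)"
proof -
  have cont: "continuous_on A (ffz (Suc K))" for A
    unfolding ffz_def by (intro continuous_intros)
  have main: "\<exists>M d. 0 < d \<and> cball x d \<subseteq> {w. Re w > - real K} \<and> summable M \<and>
      (\<forall>w\<in>cball x d. \<forall>n. norm (taylor_rem K w n) \<le> M n)" if x: "Re x > - real K" for x
  proof -
    define d where "d = (Re x + real K) / 2"
    have d: "d > 0" using x by (simp add: d_def)
    have Re: "Re w \<ge> - real K + d" if "w \<in> cball x d" for w
    proof -
      have "\<bar>Re (x - w)\<bar> \<le> d" using that abs_Re_le_cmod[of "x - w"] by (simp add: dist_norm)
      moreover have "2 * d = Re x + real K" by (simp add: d_def)
      ultimately show ?thesis unfolding minus_complex.sel by linarith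
    qed
    have "compact (ffz (Suc K) ` cball x d)"
      by (intro compact_continuous_image cont) auto
    hence "bounded (ffz (Suc K) ` cball x d)"
      by (rule compact_imp_bounded)
    then obtain C where "\<forall>z\<in>ffz (Suc K) ` cball x d. norm z \<le> C"
      unfolding bounded_iff ..
    hence C: "norm (ffz (Suc K) w) \<le> C" if "w \<in> cball x d" for w
      using that by blast
    define M where "M = (\<lambda>n. C * real (Suc n) powr (- 1 - d))"
    have "summable (\<lambda>n. real n powr (- 1 - d))"
      using d by (simp add: summable_real_powr_iff)
    hence "summable M"
      unfolding M_def by (intro summable_mult) (subst summable_Suc_iff)
    moreover have "norm (taylor_rem K w n) \<le> M n" if w: "w \<in> cball x d" for w n
    proof -
      have "norm (taylor_rem K w n) \<le> norm (ffz (Suc K) w) * real (Suc n) powr (- Re w - real (Suc K))"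
        using Re[OF w] d by (intro taylor_rem_bound) auto
      also have "\<dots> \<le> C * real (Suc n) powr (- 1 - d)"
        using C[OF w] Re[OF w] order_trans[OF norm_ge_zero C[OF w]]
        by (intro mult_mono powr_mono) auto
      finally show ?thesis by (simp add: M_def)
    qed
    moreover have "cball x d \<subseteq> {w. Re w > - real K}"
      using Re d by force
    ultimately show ?thesis using d by blast
  qed
  show "summable (taylor_rem K w)" if "Re w > - real K"
  proof -
    from main[OF that] obtain M d where *: "0 < d" "summable M"
      "\<forall>v\<in>cball w d. \<forall>n. norm (taylor_rem K v n) \<le> M n" by blast
    show ?thesis by (rule summable_comparison_test'[of M 0]) (use * in auto)
  qed
  show "(\<lambda>w. \<Sum>n. taylor_rem K w n) holomorphic_on {w. Re w > - real K}"
  proof (rule holomorphic_uniform_sequence)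
    show "open {w. Re w > - real K}" by (rule open_halfspace_Re_gt)
    show "(\<lambda>w. \<Sum>n<m. taylor_rem K w n) holomorphic_on {w. Re w > - real K}" for m
      unfolding taylor_rem_def ffz_def by (intro holomorphic_intros) (auto simp del: of_nat_Suc)
    fix x assume "x \<in> {w. Re w > - real K}"
    hence "Re x > - real K" by simp
    from main[OF this] obtain M d where *: "0 < d" "cball x d \<subseteq> {w. Re w > - real K}" "summable M"
      "\<forall>v\<in>cball x d. \<forall>n. norm (taylor_rem K v n) \<le> M n" by blast
    have "uniform_limit (cball x d) (\<lambda>m w. \<Sum>n<m. taylor_rem K w n) (\<lambda>w. \<Sum>n. taylor_rem K w n) sequentially"
      by (rule Weierstrass_m_test) (use * in auto)
    thus "\<exists>d>0. cball x d \<subseteq> {w. - real K < Re w} \<and>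
        uniform_limit (cball x d) (\<lambda>m w. \<Sum>n<m. taylor_rem K w n) (\<lambda>w. \<Sum>n. taylor_rem K w n) sequentially"
      using * by blast
  qed
qed

definition dser :: "complex \<Rightarrow> complex" where
  "dser s = (\<Sum>n. of_nat (Suc n) powr (- s))"

lemma dser_sums:
  assumes "Re s > 1"
  shows "(\<lambda>n. of_nat (Suc n) powr (- s)) sums dser s"
proof -
  have "summable (\<lambda>n. real n powr (- Re s))"
    using assms by (simp add: summable_real_powr_iff)
  hence "summable (\<lambda>n. real (Suc n) powr (- Re s))" by (subst summable_Suc_iff)
  hence "summable (\<lambda>n. of_nat (Suc n) powr (- s) :: complex)"
    by (rule summable_norm_cancel[OF summable_cong[THEN iffD1, rotated]])
       (auto intro!: always_eventually simp: norm_powr_real_powr simp del: of_nat_Suc)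
  thus ?thesis unfolding dser_def by (rule summable_sums)
qed

lemma dser_recurrence:
  assumes w: "Re w > 0"
  shows "w * dser (w + 1) = 1 + (\<Sum>n. taylor_rem (Suc K) w n) -
    (\<Sum>j=1..<Suc K. ffz j w / fact (Suc j) * ((w + of_nat j) * dser (w + of_nat j + 1)))"
proof -
  have lim: "(\<lambda>n. of_nat (Suc n) powr (- w) :: complex) \<longlonglongrightarrow> 0"
  proof (rule tendsto_norm_zero_cancel)
    have "(\<lambda>n. real (Suc n) powr (- Re w)) \<longlonglongrightarrow> 0"
      by (rule filterlim_compose[OF tendsto_neg_powr[OF _ filterlim_ident]
            filterlim_compose[OF filterlim_real_sequentially filterlim_Suc]]) (use w in auto)
    thus "(\<lambda>n. norm (of_nat (Suc n) powr (- w) :: complex)) \<longlonglongrightarrow> 0"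
      by (simp add: norm_powr_real_powr del: of_nat_Suc)
  qed
  have tele: "(\<lambda>n. of_nat (Suc (Suc n)) powr (- w) - of_nat (Suc n) powr (- w)) sums (0 - (1::complex))"
    using telescope_sums[OF lim] by simp
  have i: "(\<lambda>n. ffz (Suc j) w / fact (Suc j) * of_nat (Suc n) powr (- (w + of_nat j + 1))) sums
        (ffz (Suc j) w / fact (Suc j) * dser (w + of_nat j + 1))" for j
    by (intro sums_mult dser_sums) (use w in auto)
  have "(\<lambda>n. (of_nat (Suc (Suc n)) powr (- w) - of_nat (Suc n) powr (- w)) -
      (\<Sum>j\<le>K. ffz (Suc j) w / fact (Suc j) * of_nat (Suc n) powr (- (w + of_nat j + 1)))) sums
      ((0 - 1) - (\<Sum>j\<le>K. ffz (Suc j) w / fact (Suc j) * dser (w + of_nat j + 1)))"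
    by (intro sums_diff tele sums_sum i)
  also have "(\<lambda>n. (of_nat (Suc (Suc n)) powr (- w) - of_nat (Suc n) powr (- w)) -
      (\<Sum>j\<le>K. ffz (Suc j) w / fact (Suc j) * of_nat (Suc n) powr (- (w + of_nat j + 1)))) =
      taylor_rem (Suc K) w"
  proof
    fix n
    have e: "- (w + of_nat j + 1) = - w - of_nat (Suc j)" for j by simp
    show "(of_nat (Suc (Suc n)) powr (- w) - of_nat (Suc n) powr (- w)) -
      (\<Sum>j\<le>K. ffz (Suc j) w / fact (Suc j) * of_nat (Suc n) powr (- (w + of_nat j + 1))) =
      taylor_rem (Suc K) w n"
      unfolding taylor_rem_def sum.atMost_Suc_shift e
      by (simp add: ffz_def[of 0] del: of_nat_Suc fact_Suc)
  qed
  finally have "(\<Sum>n. taylor_rem (Suc K) w n) =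
      - 1 - (\<Sum>j\<le>K. ffz (Suc j) w / fact (Suc j) * dser (w + of_nat j + 1))"
    by (simp add: sums_iff)
  also have "(\<Sum>j\<le>K. ffz (Suc j) w / fact (Suc j) * dser (w + of_nat j + 1)) =
      (\<Sum>j\<le>K. - (ffz j w / fact (Suc j) * ((w + of_nat j) * dser (w + of_nat j + 1))))"
    by (intro sum.cong refl) (simp add: ffz_def algebra_simps diff_divide_distrib add_divide_distrib del: fact_Suc)
  also have "\<dots> = - (w * dser (w + 1)) -
      (\<Sum>j=1..<Suc K. ffz j w / fact (Suc j) * ((w + of_nat j) * dser (w + of_nat j + 1)))"
  proof -
    have "{..K} = insert 0 {1..<Suc K}" by auto
    thus ?thesis by (simp add: ffz_def sum_negf)
  qed
  finally show ?thesis by (simp add: algebra_simps)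
qed

lemma continuation_step:
  "K > 0 \<Longrightarrow> \<exists>g. g holomorphic_on {w. Re w > - real K} \<and>
     (\<forall>w. Re w > 0 \<longrightarrow> g w = w * dser (w + 1))"
proof (induction K)
  case (Suc K)
  obtain g where g: "K > 0 \<Longrightarrow> g holomorphic_on {w. Re w > - real K}"
      "K > 0 \<Longrightarrow> \<forall>w. Re w > 0 \<longrightarrow> g w = w * dser (w + 1)"
    using Suc.IH by blast
  define h where "h = (\<lambda>w. 1 + (\<Sum>n. taylor_rem (Suc K) w n) -
    (\<Sum>j=1..<Suc K. ffz j w / fact (Suc j) * g (w + of_nat j)))"
  have "(\<lambda>w. g (w + of_nat j)) holomorphic_on {w. Re w > - real (Suc K)}"
    if "j \<in> {1..<Suc K}" for j
  proof -
    have "(g \<circ> (\<lambda>w. w + of_nat j)) holomorphic_on {w. Re w > - real (Suc K)}"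
      by (rule holomorphic_on_compose_gen[OF _ g(1)]) (use that in \<open>auto intro!: holomorphic_intros\<close>)
    thus ?thesis by (simp add: o_def)
  qed
  hence "h holomorphic_on {w. Re w > - real (Suc K)}"
    unfolding h_def ffz_def
    by (intro holomorphic_intros holomorphic_suminf_taylor_rem) auto
  moreover have "h w = w * dser (w + 1)" if "Re w > 0" for w
  proof -
    have "(\<Sum>j=1..<Suc K. ffz j w / fact (Suc j) * g (w + of_nat j)) =
        (\<Sum>j=1..<Suc K. ffz j w / fact (Suc j) * ((w + of_nat j) * dser (w + of_nat j + 1)))"
      by (intro sum.cong refl, subst g(2)[rule_format]) (use that in auto)
    thus ?thesis unfolding h_def dser_recurrence[OF that, of K] by simp
  qed
  ultimately show ?case by blast
qed auto

lemma is_zeta_exists: "\<exists>f. is_zeta f"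
proof -
  obtain g where holo: "\<And>K. g K holomorphic_on {w. Re w > - real (Suc K)}"
    and g: "\<And>K w. Re w > 0 \<Longrightarrow> g K w = w * dser (w + 1)"
    using continuation_step[OF zero_less_Suc] by metis
  have eq: "g K w = g L w" if "Re w > - real (Suc K)" "K \<le> L" for K L w
  proof (rule analytic_continuation_open[of "{w. Re w > 0}" "{w. Re w > - real (Suc K)}" "g K" "g L"])
    show "open {w. Re w > 0}" "open {w. Re w > - real (Suc K)}" by (rule open_halfspace_Re_gt)+
    show "{w. Re w > 0} \<noteq> {}" by (auto intro: exI[of _ "1::complex"])
    show "connected {w. Re w > - real (Suc K)}" by (intro convex_connected convex_halfspace_Re_gt)
    show "g L holomorphic_on {w. Re w > - real (Suc K)}"
      by (rule holomorphic_on_subset[OF holo[of L]]) (use that in auto)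
  qed (use that holo g in auto)
  define G where "G = (\<lambda>w. g (nat \<lceil>- Re w\<rceil>) w)"
  have G: "G w = g K w" if "Re w > - real (Suc K)" for w K
  proof -
    have "- Re w < real (Suc (nat \<lceil>- Re w\<rceil>))" by linarith
    hence "Re w > - real (Suc (nat \<lceil>- Re w\<rceil>))" by linarith
    thus ?thesis unfolding G_def using eq that by (metis linorder_le_cases)
  qed
  have holoG: "G holomorphic_on UNIV"
  proof (rule holomorphic_on_subset)
    have "G holomorphic_on (\<Union>K. {w. Re w > - real (Suc K)})"
    proof (rule holomorphic_on_UN_open)
      show "G holomorphic_on {w. Re w > - real (Suc K)}" for K
        by (rule holomorphic_transform[OF holo[of K]]) (use G in auto)
    qed (rule open_halfspace_Re_gt)
    thus "G holomorphic_on (\<Union>K. {w. Re w > - real (Suc K)})" .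
    show "UNIV \<subseteq> (\<Union>K. {w. Re w > - real (Suc K)})"
    proof
      fix w
      obtain n where "real n > - Re w" using reals_Archimedean2 by blast
      hence "Re w > - real (Suc n)" by simp
      thus "w \<in> (\<Union>K. {w. Re w > - real (Suc K)})" by blast
    qed
  qed
  define f where "f = (\<lambda>s. if s = 1 then 0 else G (s - 1) / (s - 1))"
  have "(G \<circ> (\<lambda>s. s - 1)) holomorphic_on - {1}"
    by (rule holomorphic_on_compose_gen[OF _ holoG]) (auto intro!: holomorphic_intros)
  hence "(\<lambda>s. G (s - 1) / (s - 1)) holomorphic_on - {1}"
    unfolding o_def by (intro holomorphic_intros) auto
  hence "f holomorphic_on - {1}"
    by (rule holomorphic_transform) (auto simp: f_def)
  moreover have "f s = dser s" if "Re s > 1" for s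
  proof -
    have "s \<noteq> 1" using that by auto
    thus ?thesis using that G[of 0 "s - 1"] g[of "s - 1" 0] by (simp add: f_def)
  qed
  ultimately have "is_zeta f"
    using dser_sums unfolding is_zeta_def by (auto simp: f_def)
  thus ?thesis by blast
qed

definition zeta :: "complex \<Rightarrow> complex" where
  "zeta = (THE f. is_zeta f)"

lemma is_zeta_zeta: "is_zeta zeta"
  unfolding zeta_def using is_zeta_exists is_zeta_unique by (metis theI)

definition riemann_hypothesis :: bool where
  "riemann_hypothesis \<longleftrightarrow>
     (\<forall>s. zeta s = 0 \<and> 0 < Re s \<and> Re s < 1 \<longrightarrow> Re s = 1 / 2)"

definition zeta2 :: "complex \<Rightarrow> complex" where
  "zeta2 = (deriv ^^ 2) zeta"

definition zeta2_zeros :: "real \<Rightarrow> complex set" where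
  "zeta2_zeros T = {\<rho>. zeta2 \<rho> = 0 \<and> 0 < Im \<rho> \<and> Im \<rho> \<le> T}"

text \<open>
  The interval integral is oriented, so for $1 < x < 2$ this is
  $-\int_x^2 dt / \log t$, as intended.
\<close>
definition Li :: "real \<Rightarrow> real" where
  "Li x = (LBINT t=2..x. 1 / ln t)"

end

theory Submission
  imports Defs "HOL-Real_Asymp.Real_Asymp"
begin

text \<open>
  The sum is read off from the argument principle (Littlewood's lemma): \<open>2 pi\<close> times
  the sum is the imaginary part of the integral of \<open>(s - 1/2) (zeta2' / zeta2 - zeta' /
  zeta)\<close> around the rectangle with sides \<open>Re s = 1 - a\<close>, \<open>Re s =
  a\<close>, \<open>Im s = T0\<close>, \<open>Im s = T\<close>; under the Riemann hypothesis the
  zeros of \<open>zeta\<close> lie on \<open>Re s = 1/2\<close> and contribute nothing. The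
  integrand is the logarithmic derivative of \<open>zquot = zeta2 / zeta\<close>, weighted by
  \<open>s - 1/2\<close>. On the right side \<open>zquot s\<close> is close to \<open>(ln 2)^2
  2^(-s)\<close>, which gives the linear term. On the left side the functional equation gives
  \<open>zquot (1 - w)\<close> close to \<open>(lam w)^2\<close>, where \<open>lam\<close> is the
  logarithmic derivative of the gamma factor and is close to \<open>ln (t / (2 pi))\<close> in
  modulus; integrating \<open>2 ln (ln (t / (2 pi)))\<close> gives the main term. On the upper side,
  under the Riemann hypothesis, \<open>zquot\<close> is at distance \<open>y\<close> to the right of
  the critical line at most a power of \<open>ln T / y\<close>, so by a Jensen-type bound the change
  of its argument is \<open>O(ln (ln T) / y)\<close> for \<open>y \<ge> 1 / ln T\<close>, and the
  weight \<open>y\<close> turns the integral over \<open>y\<close> into \<open>O((ln (ln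
  T))^2)\<close>. The left half is the same after reflection, and for \<open>y < 1 / ln T\<close>
  the trivial bound \<open>O(ln T)\<close> for the arguments of \<open>zeta\<close> and
  \<open>zeta2\<close> suffices.
\<close>

section \<open>The zeta function\<close>

text \<open>Dividing by \<open>zeta\<close> is what brings the error down to double logarithms. The
  growth bound for \<open>zeta2\<close> alone is linear in the height and gives arguments of size ln
  T. Under the hypothesis \<open>zlog\<close>, and with it \<open>zquot = zlog' + zlog^2\<close>, is
  bounded by a power of ln T over a power of the distance from the critical line, so only the
  logarithm of a power of ln T enters. The terms T ln |zquot| at the upper corners are larger than
  the error term, but those of the vertical sides cancel exactly against those of the upper side, so
  no corner value has to be known. The upper side must not meet a zero. The estimate is therefore
  obtained at heights free of zeros and carried over to every height by letting t decrease to T.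
  Uniformity down to T = 2 pi rests on the finiteness of the set of zeros up to a given height. This
  is not automatic: zeros close to the real axis far to the left, and zeros accumulating at the
  pole, have to be excluded first. The functional equation is obtained by evaluating the Mellin
  transform of one function, \<open>hker\<close>, in two ways.\<close>

lemma zeta_holomorphic: "zeta holomorphic_on - {1}"
  using is_zeta_zeta by (simp add: is_zeta_def)

lemma zeta_holomorphic_on: "1 \<notin> A \<Longrightarrow> zeta holomorphic_on A"
  by (rule holomorphic_on_subset[OF zeta_holomorphic]) auto

lemma zeta_sums: "Re s > 1 \<Longrightarrow> (\<lambda>n. of_nat (Suc n) powr (- s)) sums zeta s"
  using is_zeta_zeta by (simp add: is_zeta_def)

text \<open>Conjugating both argument and value preserves all three clauses of
  \<open>is_zeta\<close>, so uniqueness of the continuation gives the symmetry.\<close>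

lemma zeta_cnj: "zeta (cnj s) = cnj (zeta s)"
proof -
  define f where "f = (\<lambda>s. cnj (zeta (cnj s)))"
  have "f holomorphic_on - {1}"
  proof -
    have "cnj ` (- {1}) = - {1}"
      by (auto simp: image_cnj_conv_vimage_cnj)
    hence "cnj \<circ> zeta \<circ> cnj holomorphic_on - {1}"
      by (intro holomorphic_on_compose_cnj_cnj) (auto simp: zeta_holomorphic)
    thus ?thesis by (simp add: f_def o_def)
  qed
  moreover have "f 1 = 0" using is_zeta_zeta by (simp add: f_def is_zeta_def)
  moreover have "(\<lambda>n. of_nat (Suc n) powr (- s)) sums f s" if "Re s > 1" for s
  proof -
    have "(\<lambda>n. cnj (of_nat (Suc n) powr (- cnj s))) sums cnj (zeta (cnj s))"
      using zeta_sums[of "cnj s"] that by (simp add: sums_cnj del: of_nat_Suc)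
    also have "(\<lambda>n. cnj (of_nat (Suc n) powr (- cnj s))) = (\<lambda>n. of_nat (Suc n) powr (- s))"
      by (intro ext) (subst cnj_powr, auto simp del: of_nat_Suc simp: complex_nonpos_Reals_iff)
    finally show ?thesis by (simp add: f_def)
  qed
  ultimately have "is_zeta f" by (simp add: is_zeta_def)
  hence "f = zeta" using is_zeta_unique is_zeta_zeta by blast
  thus ?thesis by (metis complex_cnj_cnj f_def)
qed

lemma deriv_cnj_symmetric:
  assumes "\<And>s. f (cnj s) = cnj (f s)" "f field_differentiable at s"
  shows "deriv f (cnj s) = cnj (deriv f s)"
proof -
  obtain D where D: "(f has_field_derivative D) (at s)"
    using assms(2) by (auto simp: field_differentiable_def)
  have "(cnj \<circ> f \<circ> cnj has_field_derivative cnj D) (at (cnj s))"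
    using D by (simp add: has_field_derivative_cnj_cnj)
  also have "cnj \<circ> f \<circ> cnj = f" using assms by (auto simp: fun_eq_iff)
  finally show ?thesis using D by (auto dest!: DERIV_imp_deriv)
qed

lemma zeta_deriv_cnj:
  assumes "s \<noteq> 1"
  shows "deriv zeta (cnj s) = cnj (deriv zeta s)"
  by (intro deriv_cnj_symmetric zeta_cnj holomorphic_on_imp_differentiable_at[OF zeta_holomorphic])
     (use assms in auto)

lemma zeta_deriv_holomorphic: "deriv zeta holomorphic_on - {1}"
  by (intro holomorphic_deriv zeta_holomorphic) auto

lemma zeta2_altdef: "zeta2 = deriv (deriv zeta)"
  by (simp add: zeta2_def numeral_2_eq_2)

lemma zeta2_holomorphic: "zeta2 holomorphic_on - {1}"
  unfolding zeta2_altdef by (intro holomorphic_deriv zeta_holomorphic) auto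

lemma zeta2_cnj:
  assumes "s \<noteq> 1"
  shows "zeta2 (cnj s) = cnj (zeta2 s)"
proof -
  \<comment> \<open>\<open>deriv_cnj_symmetric\<close> asks for the symmetry at every point, but the
    value of \<open>deriv zeta\<close> at the pole is unspecified. It is replaced by 0 there, which
    does not affect the derivative elsewhere.\<close>
  have hol: "(\<lambda>s. if s = 1 then 0 else deriv zeta s) holomorphic_on - {1}"
    by (rule holomorphic_transform[OF zeta_deriv_holomorphic]) auto
  have "deriv (\<lambda>s. if s = 1 then 0 else deriv zeta s) (cnj s) =
        cnj (deriv (\<lambda>s. if s = 1 then 0 else deriv zeta s) s)"
  proof (rule deriv_cnj_symmetric)
    show "(if cnj s = 1 then 0 else deriv zeta (cnj s)) = cnj (if s = 1 then 0 else deriv zeta s)" for s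
      by (simp add: zeta_deriv_cnj)
    from hol show "(\<lambda>s. if s = 1 then 0 else deriv zeta s) field_differentiable at s"
      by (rule holomorphic_on_imp_differentiable_at) (use assms in auto)
  qed
  moreover have "deriv (\<lambda>s. if s = 1 then 0 else deriv zeta s) z = deriv (deriv zeta) z" if "z \<noteq> 1" for z
    by (rule complex_derivative_transform_within_open[OF hol zeta_deriv_holomorphic]) (use that in auto)
  ultimately show ?thesis using assms by (simp add: zeta2_altdef)
qed

text \<open>The case \<open>K = 0\<close> of \<open>dser_recurrence\<close>, in which the finite sum
  is empty, continued analytically. At \<open>w = 0\<close> the left side is 0, while the right side
  is 1, the residue of \<open>zeta\<close> at its pole.\<close>

lemma zeta_continuation_at_minus_1:
  assumes "Re w > -1" "w \<noteq> 0"
  shows "w * zeta (w + 1) = 1 + (\<Sum>n. taylor_rem 1 w n)"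
proof (rule analytic_continuation_open[of "{w. Re w > 0}" "{w. Re w > -1} - {0}"
      "\<lambda>w. w * zeta (w + 1)" "\<lambda>w. 1 + (\<Sum>n. taylor_rem 1 w n)"])
  show "open {w. Re w > 0}" "open ({w. Re w > -1} - {0::complex})"
    by (auto intro: open_halfspace_Re_gt)
  show "{w. Re w > 0} \<noteq> {}" by (auto intro: exI[of _ 1])
  show "{w. 0 < Re w} \<subseteq> {w. - 1 < Re w} - {0}" by auto
  show "connected ({w. Re w > -1} - {0::complex})"
    by (rule connected_open_delete) (auto intro!: open_halfspace_Re_gt convex_connected convex_halfspace_Re_gt)
  show "w \<in> {w. Re w > -1} - {0}" using assms by auto
  show "(\<lambda>w. 1 + (\<Sum>n. taylor_rem 1 w n)) holomorphic_on {w. Re w > -1} - {0}"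
    by (rule holomorphic_on_subset[OF holomorphic_on_add[OF holomorphic_on_const holomorphic_suminf_taylor_rem(1)]]) auto
  have "(zeta \<circ> (\<lambda>w. w + 1)) holomorphic_on {w. Re w > -1} - {0}"
    by (rule holomorphic_on_compose_gen[OF _ zeta_holomorphic]) (auto intro!: holomorphic_intros)
  thus "(\<lambda>w. w * zeta (w + 1)) holomorphic_on {w. Re w > -1} - {0}"
    by (auto intro!: holomorphic_intros simp: o_def)
  fix z assume "z \<in> {w::complex. 0 < Re w}"
  hence "Re z > 0" by simp
  thus "z * zeta (z + 1) = 1 + (\<Sum>n. taylor_rem 1 z n)"
    using dser_recurrence[of z 0] dser_sums[of "z+1"] zeta_sums[of "z+1"] by (auto dest: sums_unique2)
qed

text \<open>In the continuation formula the remainder terms are at most |w| |w + 1| n^(- Re w - 2);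
  dividing by \<open>w\<close> leaves a bound linear in the height. The margin 1/10 keeps the
  exponent at most -11/10, so that the series converges uniformly. Only logarithms of such bounds
  matter later.\<close>

lemma zeta_growth:
  "\<exists>C>0. \<forall>s. Re s \<ge> 1/10 \<and> \<bar>Im s\<bar> \<ge> 1 \<longrightarrow> norm (zeta s) \<le> C * \<bar>Im s\<bar>"
proof -
  define S where "S = (\<Sum>n. real (Suc n) powr (- 11/10))"
  have sS: "summable (\<lambda>n. real (Suc n) powr (- 11/10))"
    by (subst summable_Suc_iff) (simp add: summable_real_powr_iff)
  have S: "S \<ge> 0" unfolding S_def by (intro suminf_nonneg sS) auto
  define Z where "Z = (\<Sum>n. real (Suc n) powr (-2))"
  have sZ: "summable (\<lambda>n. real (Suc n) powr (-2))"
    by (subst summable_Suc_iff) (simp add: summable_real_powr_iff)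
  have Z: "Z \<ge> 0" unfolding Z_def by (intro suminf_nonneg sZ) auto
  have "norm (zeta s) \<le> (1 + Z + 4 * S) * \<bar>Im s\<bar>" if s: "Re s \<ge> 1/10" "\<bar>Im s\<bar> \<ge> 1" for s
  proof (cases "Re s \<ge> 2")
    case True
    have "norm (zeta s) \<le> Z"
    proof -
      have b: "norm (of_nat (Suc n) powr (- s) :: complex) \<le> real (Suc n) powr (-2)" for n
        using True by (subst norm_powr_real_powr) (auto intro!: powr_mono simp del: of_nat_Suc)
      have "norm (\<Sum>n. of_nat (Suc n) powr (- s) :: complex) \<le> Z"
        unfolding Z_def by (rule norm_suminf_le[OF b sZ])
      thus ?thesis using zeta_sums[of s] True by (simp add: sums_iff)
    qed
    also have "\<dots> \<le> (1 + Z + 4 * S) * 1" using S by simp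
    also have "\<dots> \<le> (1 + Z + 4 * S) * \<bar>Im s\<bar>" using S Z s by (intro mult_left_mono) auto
    finally show ?thesis .
  next
    case False
    define w where "w = s - 1"
    have w: "Re w \<ge> - 9/10" "Re w < 1" "Im w = Im s" using s False by (auto simp: w_def)
    have w1: "norm w \<ge> 1" using abs_Im_le_cmod[of w] s w by linarith
    have "norm (\<Sum>n. taylor_rem 1 w n) \<le> (\<Sum>n. norm (ffz 2 w) * real (Suc n) powr (- 11/10))"
    proof (rule norm_suminf_le)
      show "summable (\<lambda>n. norm (ffz 2 w) * real (Suc n) powr (- 11/10))"
        by (intro summable_mult sS)
      fix n
      have "norm (taylor_rem 1 w n) \<le> norm (ffz (Suc 1) w) * real (Suc n) powr (- Re w - real (Suc 1))"
        by (rule taylor_rem_bound) (use w in auto)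
      also have "\<dots> \<le> norm (ffz 2 w) * real (Suc n) powr (- 11/10)"
        using w by (intro mult_mono powr_mono) (auto simp: numeral_2_eq_2)
      finally show "norm (taylor_rem 1 w n) \<le> norm (ffz 2 w) * real (Suc n) powr (- 11/10)" .
    qed
    also have "\<dots> = norm (ffz 2 w) * S" unfolding S_def by (rule suminf_mult[OF sS])
    also have "norm (ffz 2 w) = norm w * norm (w + 1)"
      by (simp add: ffz_def numeral_2_eq_2 norm_mult) (metis norm_minus_cancel add.commute minus_add_distrib uminus_add_conv_diff)
    finally have 1: "norm (\<Sum>n. taylor_rem 1 w n) \<le> norm w * norm (w + 1) * S" .
    have "w \<noteq> 0" using w1 by auto
    hence "w * zeta s = 1 + (\<Sum>n. taylor_rem 1 w n)"
      using zeta_continuation_at_minus_1[of w] w by (simp add: w_def)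
    hence "norm w * norm (zeta s) \<le> 1 + norm w * norm (w + 1) * S"
      using 1 norm_triangle_ineq[of 1 "\<Sum>n. taylor_rem 1 w n"] by (metis norm_mult norm_one add_left_mono order_trans)
    also have "\<dots> \<le> norm w * (1 + norm (w + 1) * S)" using w1 by (simp add: algebra_simps)
    finally have "norm (zeta s) \<le> 1 + norm (w + 1) * S" using w1
      by (subst (asm) mult_le_cancel_left_pos) auto
    also have "norm (w + 1) \<le> 4 * \<bar>Im s\<bar>"
      using cmod_le[of "w + 1"] w s by (auto simp: w_def)
    also have "1 + 4 * \<bar>Im s\<bar> * S \<le> \<bar>Im s\<bar> + 4 * \<bar>Im s\<bar> * S + Z * \<bar>Im s\<bar>"
      using s mult_nonneg_nonneg[OF Z abs_ge_zero[of "Im s"]] by simp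
    finally show ?thesis using S by (simp add: algebra_simps mult_right_mono)
  qed
  thus ?thesis using S Z by (intro exI[of _ "1 + Z + 4 * S"]) auto
qed

lemma zeta_right_tail:
  assumes "Re s \<ge> 2"
  shows "norm (zeta s - 1 - 2 powr (-s)) \<le> 2 * pi\<^sup>2 * 3 powr (- Re s)" (is ?A)
    and "norm (zeta s - 1) \<le> pi\<^sup>2 / 6 - 1" (is ?B)
proof -
  define f where "f = (\<lambda>n. of_nat (Suc n) powr (- s) :: complex)"
  have f: "f sums zeta s" unfolding f_def by (rule zeta_sums) (use assms in auto)
  have f2: "(\<lambda>n. f (n + 2)) sums (zeta s - 1 - 2 powr (-s))"
    using sums_split_initial_segment[OF f, of 2] by (simp add: f_def numeral_2_eq_2 algebra_simps)
  have f1: "(\<lambda>n. f (n + 1)) sums (zeta s - 1)"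
    using sums_split_initial_segment[OF f, of 1] by (simp add: f_def)
  have g: "(\<lambda>n. 1 / (real n + 1)\<^sup>2) sums (pi\<^sup>2 / 6)"
    using inverse_squares_sums by (simp add: add.commute)
  have g1: "(\<lambda>n. 1 / (real (n + 1) + 1)\<^sup>2) sums (pi\<^sup>2 / 6 - 1)"
    using sums_split_initial_segment[OF g, of 1] by (simp)
  have b1: "norm (f n) \<le> 1 / (real n + 1)\<^sup>2" for n
  proof -
    have "norm (f n) = real (Suc n) powr (- Re s)"
      by (simp add: f_def norm_powr_real_powr del: of_nat_Suc)
    also have "\<dots> \<le> real (Suc n) powr (- 2)" using assms by (intro powr_mono) auto
    also have "\<dots> = 1 / (real n + 1)\<^sup>2" by (simp add: powr_minus divide_simps powr_numeral add.commute)
    finally show ?thesis .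
  qed
  have "norm (\<Sum>n. f (n + 1)) \<le> (\<Sum>n. 1 / (real (n + 1) + 1)\<^sup>2)"
    by (rule norm_suminf_le[OF _ sums_summable[OF g1]]) (rule b1)
  thus ?B using f1 g1 by (simp add: sums_iff)
  have b2: "norm (f (n + 2)) \<le> 9 * 3 powr (- Re s) * (1 / (real n + 1)\<^sup>2)" for n
  proof -
    \<comment> \<open>A factor n^(-2) is kept for convergence; the rest is largest at the first
      term, 3^(2 - Re s).\<close>
    have "norm (f (n + 2)) = real (n + 3) powr (-2) * real (n + 3) powr (2 - Re s)"
      by (simp add: f_def norm_powr_real_powr flip: powr_add)
         (metis norm_powr_real_powr of_nat_numeral of_nat_add of_nat_Suc add.commute add.assoc numeral_3_eq_3 of_nat_0_le_iff uminus_complex.sel(1) Suc_1 add_Suc_right add_2_eq_Suc' norm_of_nat of_real_of_nat_eq Reals_of_nat Re_complex_of_real)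
    also have "\<dots> \<le> (1 / (real n + 1)\<^sup>2) * 3 powr (2 - Re s)"
    proof (intro mult_mono)
      have "real (n + 3) powr (-2) \<le> real (n + 1) powr (-2)" by (intro powr_mono2') auto
      also have "\<dots> = 1 / (real n + 1)\<^sup>2" by (simp add: powr_minus divide_simps powr_numeral add.commute)
      finally show "real (n + 3) powr (-2) \<le> 1 / (real n + 1)\<^sup>2" .
      show "real (n + 3) powr (2 - Re s) \<le> 3 powr (2 - Re s)"
        using assms by (intro powr_mono2') auto
    qed auto
    also have "3 powr (2 - Re s) = 9 * 3 powr (- Re s)" by (simp add: powr_diff powr_minus field_simps)
    finally show ?thesis by (simp add: mult_ac)
  qed
  have "norm (\<Sum>n. f (n + 2)) \<le> (\<Sum>n. 9 * 3 powr (- Re s) * (1 / (real n + 1)\<^sup>2))"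
    by (rule norm_suminf_le[OF b2 summable_mult[OF sums_summable[OF g]]])
  also have "\<dots> = 9 * 3 powr (- Re s) * (pi\<^sup>2 / 6)"
    using sums_mult[OF g, of "9 * 3 powr (- Re s)"] by (simp add: sums_iff)
  also have "\<dots> \<le> 2 * pi\<^sup>2 * 3 powr (- Re s)" by simp
  finally show ?A using f2 by (simp add: sums_iff)
qed

text \<open>The remainder \<open>R\<close> after two terms of the Dirichlet series is O(3^(- Re s)),
  and Cauchy's estimate on unit circles passes this on to its derivatives. Since zeta = 1 + u + R,
  the difference of \<open>zeta2\<close> and (ln 2)^2 u zeta consists of R'' and a multiple of u (u
  + R), and u^2 has modulus 4^(- Re s).\<close>

lemma zeta_right_asymptotics:
  "\<exists>C>0. \<forall>s. Re s \<ge> 3 \<longrightarrow> zeta s \<noteq> 0 \<and>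
     norm (deriv zeta s / zeta s) \<le> C * 2 powr (- Re s) \<and>
     norm (zeta2 s / zeta s - of_real ((ln 2)\<^sup>2) * 2 powr (-s)) \<le> C * 3 powr (- Re s)"
proof -
  define R where "R = (\<lambda>s. zeta s - 1 - 2 powr (-s))"
  \<comment> \<open>This is 1 - (pi^2 / 6 - 1), the lower bound for |zeta s| that the tail estimate
    leaves.\<close>
  define c where "c = 2 - pi\<^sup>2 / 6"
  have "pi\<^sup>2 < (3.2)\<^sup>2" using pi_approx by (intro power_strict_mono) auto
  hence c: "c > 0" by (simp add: c_def power2_eq_square)
  have holR: "R holomorphic_on - {1}"
    unfolding R_def by (intro holomorphic_intros zeta_holomorphic)
  have pw: "((\<lambda>z. 2 powr - z) has_field_derivative - (of_real (ln 2) * 2 powr - s)) (at s)" for s :: complex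
  proof -
    have "2 powr w = exp (w * of_real (ln 2))" for w :: complex
      using Ln_of_real[of 2] by (simp add: powr_def)
    thus ?thesis by (auto intro!: derivative_eq_intros)
  qed
  have R1: "deriv R s = deriv zeta s + of_real (ln 2) * 2 powr (-s)" if "s \<noteq> 1" for s
    unfolding R_def using that
    by (intro DERIV_imp_deriv)
       (auto intro!: derivative_eq_intros pw holomorphic_derivI[OF zeta_holomorphic])
  have R2: "deriv (deriv R) s = zeta2 s - of_real ((ln 2)\<^sup>2) * 2 powr (-s)" if "s \<noteq> 1" for s
  proof -
    have "deriv (deriv R) s = deriv (\<lambda>s. deriv zeta s + of_real (ln 2) * 2 powr (-s)) s"
      by (rule complex_derivative_transform_within_open[of _ "- {1}"])
         (use that R1 in \<open>auto intro!: holomorphic_intros holomorphic_deriv[OF holR] zeta_deriv_holomorphic\<close>)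
    also have "\<dots> = zeta2 s - of_real ((ln 2)\<^sup>2) * 2 powr (-s)"
      unfolding zeta2_altdef using that
      by (intro DERIV_imp_deriv)
         (auto intro!: derivative_eq_intros pw holomorphic_derivI[OF zeta_deriv_holomorphic]
               simp: power2_eq_square)
    finally show ?thesis .
  qed
  define A where "A = 20 * pi\<^sup>2 + 1"
  have main: "zeta s \<noteq> 0 \<and>
     norm (deriv zeta s / zeta s) \<le> (A / c) * 2 powr (- Re s) \<and>
     norm (zeta2 s / zeta s - of_real ((ln 2)\<^sup>2) * 2 powr (-s)) \<le> (A / c) * 3 powr (- Re s)" if s: "Re s \<ge> 3" for s
  proof -
    define u where "u = (2::complex) powr (-s)"
    have nu: "norm u = 2 powr (- Re s)" unfolding u_def by (subst norm_powr_real_powr) auto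
    have s1: "s \<noteq> 1" using s by auto
    have zc: "norm (zeta s) \<ge> c"
      using zeta_right_tail(2)[of s] s norm_triangle_ineq2[of 1 "1 - zeta s"]
      by (simp add: c_def norm_minus_commute)
    have der: "norm ((deriv ^^ n) R s) \<le> fact n * (6 * pi\<^sup>2 * 3 powr (- Re s)) / 1 ^ n" for n
    proof (rule Cauchy_inequality)
      have "1 \<notin> cball s 1"
      proof
        assume "1 \<in> cball s 1"
        thus False using complex_Re_le_cmod[of "s - 1"] s by (simp add: dist_norm)
      qed
      thus "R holomorphic_on ball s 1" "continuous_on (cball s 1) R"
        by (auto intro!: holomorphic_on_subset[OF holR] holomorphic_on_imp_continuous_on)
      fix x assume x: "norm (s - x) = 1"
      have Re: "Re x \<ge> Re s - 1" using complex_Re_le_cmod[of "s - x"] x by simp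
      have "norm (R x) \<le> 2 * pi\<^sup>2 * 3 powr (- Re x)"
        unfolding R_def by (rule zeta_right_tail) (use Re s in auto)
      also have "\<dots> \<le> 2 * pi\<^sup>2 * 3 powr (1 - Re s)"
        using Re by (intro mult_left_mono powr_mono) auto
      also have "3 powr (1 - Re s) = 3 * 3 powr (- Re s)" by (simp add: powr_diff powr_minus field_simps)
      finally show "norm (R x) \<le> 6 * pi\<^sup>2 * 3 powr (- Re s)" by simp
    qed auto
    have d1: "norm (deriv R s) \<le> 6 * pi\<^sup>2 * 3 powr (- Re s)" using der[of 1] by simp
    have d2: "norm (deriv (deriv R) s) \<le> 12 * pi\<^sup>2 * 3 powr (- Re s)"
      using der[of 2] by (simp add: numeral_2_eq_2)
    have d0: "norm (R s) \<le> 2 * pi\<^sup>2 * 3 powr (- Re s)"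
      unfolding R_def by (rule zeta_right_tail) (use s in auto)
    have p32: "3 powr (- Re s) \<le> (2::real) powr (- Re s)" using s by (intro powr_mono2') auto
    have ln2: "0 \<le> ln (2::real)" "ln (2::real) \<le> 1" using ln_2_less_1 by auto
    have "norm (deriv zeta s) = norm (deriv R s - of_real (ln 2) * u)" using R1[OF s1] by (simp add: u_def)
    also have "\<dots> \<le> norm (deriv R s) + ln 2 * norm u"
      using norm_triangle_ineq4[of "deriv R s" "of_real (ln 2) * u"] ln2 by (simp add: norm_mult)
    also have "\<dots> \<le> 6 * pi\<^sup>2 * 2 powr (- Re s) + 1 * 2 powr (- Re s)"
      using d1 p32 ln2 unfolding nu
      by (intro add_mono mult_right_mono) (auto intro: order_trans[OF _ mult_left_mono])
    also have "\<dots> \<le> A * 2 powr (- Re s)" by (simp add: A_def algebra_simps)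
    finally have e1: "norm (deriv zeta s) \<le> A * 2 powr (- Re s)" .
    have zeq: "zeta s = 1 + u + R s" by (simp add: R_def u_def)
    have "norm (zeta2 s - of_real ((ln 2)\<^sup>2) * u * zeta s) = norm (deriv (deriv R) s - of_real ((ln 2)\<^sup>2) * (u * (u + R s)))"
      unfolding R2[OF s1] by (simp add: zeq u_def algebra_simps)
    also have "\<dots> \<le> norm (deriv (deriv R) s) + norm (complex_of_real ((ln 2)\<^sup>2) * (u * (u + R s)))"
      by (rule order_trans[OF norm_triangle_ineq4]) simp
    also have "norm (complex_of_real ((ln 2)\<^sup>2) * (u * (u + R s))) \<le> 1 * (norm u * norm (u + R s))"
      unfolding norm_mult norm_of_real using ln2 by (intro mult_right_mono) (auto simp: power_le_one)
    also have "norm u * norm (u + R s) \<le> norm u * norm u + norm u * norm (R s)"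
      using norm_triangle_ineq[of u "R s"] by (metis distrib_left mult_left_mono norm_ge_zero)
    also have "norm u * norm u = 4 powr (- Re s)"
      unfolding nu by (simp flip: powr_mult)
    also have "\<dots> \<le> 3 powr (- Re s)" using s by (intro powr_mono2') auto
    also have "norm u * norm (R s) \<le> 1 * norm (R s)"
      unfolding nu using s by (intro mult_right_mono) (auto simp: powr_le_one_le powr_minus_divide ge_one_powr_ge_zero)
    finally have "norm (zeta2 s - of_real ((ln 2)\<^sup>2) * u * zeta s) \<le>
        norm (deriv (deriv R) s) + (3 powr (- Re s) + norm (R s))" by simp
    hence "norm (zeta2 s - of_real ((ln 2)\<^sup>2) * u * zeta s) \<le> A * 3 powr (- Re s)"
      using d0 d2 mult_nonneg_nonneg[OF zero_le_power2[of pi] powr_ge_zero[of 3 "- Re s"]]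
      unfolding A_def distrib_right mult.assoc by linarith
    hence e2: "norm (zeta2 s - of_real ((ln 2)\<^sup>2) * u * zeta s) / norm (zeta s) \<le> A * 3 powr (- Re s) / c"
      using zc c by (intro frac_le) (auto simp: A_def)
    have z0: "zeta s \<noteq> 0" using zc c by auto
    have "norm (deriv zeta s / zeta s) \<le> A * 2 powr (- Re s) / c"
      unfolding norm_divide using zc c e1 by (intro frac_le) (auto simp: A_def)
    moreover have "norm (zeta2 s / zeta s - of_real ((ln 2)\<^sup>2) * u) = norm (zeta2 s - of_real ((ln 2)\<^sup>2) * u * zeta s) / norm (zeta s)"
      using z0 by (simp add: divide_simps flip: norm_divide)
    ultimately show ?thesis using z0 e2 unfolding u_def by simp
  qed
  have "A / c > 0" using c by (auto simp: A_def intro!: divide_pos_pos add_nonneg_pos)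
  thus ?thesis using main by blast
qed

section \<open>Non-vanishing on the line \<open>Re s = 1\<close>\<close>

definition coprime_to_set :: "nat set \<Rightarrow> nat set" where
  "coprime_to_set P = {n. n > 0 \<and> (\<forall>p\<in>P. \<not> p dvd n)}"

lemma zeta_abs_summable_on:
  assumes "Re s > 1"
  shows "(\<lambda>n. of_nat n powr (- s) :: complex) summable_on A"
    and "(\<lambda>n. norm (of_nat n powr (- s) :: complex)) summable_on A"
proof -
  have eq: "norm (of_nat n powr (- s) :: complex) = real n powr (- Re s)" for n
    by (cases "n = 0") (auto simp: norm_powr_real_powr)
  have "summable (\<lambda>n. norm (of_nat n powr (- s) :: complex))"
    unfolding eq using assms by (simp add: summable_real_powr_iff)
  thus 2: "(\<lambda>n. norm (of_nat n powr (- s) :: complex)) summable_on A"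
    by (metis summable_on_UNIV_nonneg_real_iff norm_ge_zero summable_on_subset_banach subset_UNIV)
  show "(\<lambda>n. of_nat n powr (- s) :: complex) summable_on A"
    by (rule abs_summable_summable) (rule 2)
qed

lemma zeta_eq_infsum:
  assumes "Re s > 1"
  shows "zeta s = (\<Sum>\<^sub>\<infinity>n\<in>{0<..}. of_nat n powr (- s))"
proof -
  define I where "I = (\<Sum>\<^sub>\<infinity>n\<in>{0<..}. of_nat n powr (- s))"
  have "((\<lambda>n. of_nat n powr (- s) :: complex) has_sum I) {0<..}"
    unfolding I_def by (intro has_sum_infsum zeta_abs_summable_on assms)
  also have "{0<..} = Suc ` UNIV" by (auto simp: image_iff gr0_conv_Suc)
  finally have "((\<lambda>n. of_nat (Suc n) powr (- s) :: complex) has_sum I) UNIV"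
    by (subst (asm) has_sum_reindex) (auto simp: o_def)
  hence "(\<lambda>n. of_nat (Suc n) powr (- s) :: complex) sums I"
    by (rule has_sum_imp_sums)
  thus ?thesis unfolding I_def[symmetric] using zeta_sums[OF assms] by (simp add: sums_iff)
qed

text \<open>Among the numbers free of primes in \<open>P\<close>, the multiples of a new prime
  \<open>p\<close> contribute \<open>p powr (- s)\<close> times the whole sum, so removing them
  multiplies the sum by \<open>1 - p powr (- s)\<close>.\<close>

lemma euler_sieve:
  assumes s: "Re s > 1" and P: "finite P" "\<And>p. p \<in> P \<Longrightarrow> prime p"
  shows "(\<Sum>\<^sub>\<infinity>n\<in>coprime_to_set P. of_nat n powr (- s)) = zeta s * (\<Prod>p\<in>P. 1 - of_nat p powr (- s))"
  using P
proof (induction P rule: finite_induct)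
  case empty
  have "coprime_to_set {} = {0<..}" by (auto simp: coprime_to_set_def)
  thus ?case using zeta_eq_infsum[OF s] by simp
next
  case (insert p P)
  define f where "f = (\<lambda>n. of_nat n powr (- s) :: complex)"
  have p: "prime p" using insert by auto
  have split: "coprime_to_set P = coprime_to_set (insert p P) \<union> (*) p ` coprime_to_set P"
  proof (intro equalityI subsetI)
    fix n assume n: "n \<in> coprime_to_set P"
    show "n \<in> coprime_to_set (insert p P) \<union> (*) p ` coprime_to_set P"
    proof (cases "p dvd n")
      case True
      then obtain m where m: "n = p * m" by auto
      hence "m \<in> coprime_to_set P" using n by (auto simp: coprime_to_set_def)
      thus ?thesis using m by blast
    qed (use n in \<open>auto simp: coprime_to_set_def\<close>)
  next
    fix n assume n: "n \<in> coprime_to_set (insert p P) \<union> (*) p ` coprime_to_set P"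
    have "\<not> q dvd p * m" if "q \<in> P" "m \<in> coprime_to_set P" for q m
    proof -
      have "prime q" "p \<noteq> q" using that insert by auto
      hence "\<not> q dvd p" using primes_dvd_imp_eq[of q p] p by blast
      moreover have "\<not> q dvd m" using that by (simp add: coprime_to_set_def)
      ultimately show ?thesis using prime_dvd_mult_iff[OF \<open>prime q\<close>, of p m] by blast
    qed
    thus "n \<in> coprime_to_set P" using n p by (auto simp: coprime_to_set_def prime_gt_0_nat)
  qed
  have disj: "coprime_to_set (insert p P) \<inter> (*) p ` coprime_to_set P = {}"
    by (auto simp: coprime_to_set_def)
  have summ: "f summable_on A" for A unfolding f_def by (rule zeta_abs_summable_on[OF s])
  have inj: "inj_on ((*) p) A" for A using p by (auto simp: inj_on_def prime_gt_0_nat)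
  have "infsum f (coprime_to_set P) =
      infsum f (coprime_to_set (insert p P)) + infsum f ((*) p ` coprime_to_set P)"
    by (subst split, subst infsum_Un_disjoint[OF summ summ disj]) auto
  also have "infsum f ((*) p ` coprime_to_set P) = infsum (\<lambda>n. of_nat p powr (- s) * f n) (coprime_to_set P)"
    by (subst infsum_reindex[OF inj]) (auto simp: o_def f_def powr_times_real)
  also have "\<dots> = of_nat p powr (- s) * infsum f (coprime_to_set P)"
    by (rule infsum_cmult_right[OF summ])
  finally have "infsum f (coprime_to_set (insert p P)) =
      infsum f (coprime_to_set P) - of_nat p powr (- s) * infsum f (coprime_to_set P)"
    by (metis add_diff_cancel_right')
  also have "\<dots> = infsum f (coprime_to_set P) * (1 - of_nat p powr (- s))"
    by (simp add: right_diff_distrib mult.commute)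
  also have "infsum f (coprime_to_set P) = zeta s * (\<Prod>p\<in>P. 1 - of_nat p powr (- s))"
    unfolding f_def by (rule insert.IH) (use insert.prems in blast)
  finally show ?case using insert.hyps by (simp add: f_def mult_ac)
qed

text \<open>Apart from 1, a number without prime factors up to N exceeds N, so the sieved sum
  differs from 1 by at most a tail of an absolutely convergent series.\<close>

lemma euler_product_tendsto:
  assumes s: "Re s > 1"
  shows "(\<lambda>N. zeta s * (\<Prod>p | prime p \<and> p \<le> N. 1 - of_nat p powr (- s))) \<longlonglongrightarrow> 1"
proof -
  define f where "f = (\<lambda>n. of_nat n powr (- s) :: complex)"
  have nf: "norm (f n) = real n powr (- Re s)" for n
    by (cases "n = 0") (auto simp: norm_powr_real_powr f_def)
  have summ: "f summable_on A" for A unfolding f_def by (rule zeta_abs_summable_on[OF s])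
  have asumm: "(\<lambda>n. norm (f n)) summable_on A" for A unfolding f_def by (rule zeta_abs_summable_on[OF s])
  have srv: "summable (\<lambda>n. norm (f n))" unfolding nf using s by (simp add: summable_real_powr_iff)
  define T where "T = (\<lambda>N. \<Sum>n. norm (f (n + Suc N)))"
  have T0: "T \<longlonglongrightarrow> 0"
    unfolding T_def using LIMSEQ_Suc[OF suminf_exist_split2[OF srv]] by simp
  have "norm (zeta s * (\<Prod>p | prime p \<and> p \<le> N. 1 - of_nat p powr (- s)) - 1) \<le> T N" for N
  proof -
    define P where "P = {p. prime p \<and> p \<le> N}"
    have fin: "finite P" unfolding P_def by (rule finite_subset[of _ "{..N}"]) auto
    have 1: "1 \<in> coprime_to_set P" by (auto simp: coprime_to_set_def P_def)
    have "zeta s * (\<Prod>p\<in>P. 1 - of_nat p powr (- s)) = infsum f (coprime_to_set P)"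
      unfolding f_def by (rule euler_sieve[symmetric]) (use s fin in \<open>auto simp: P_def\<close>)
    also have "coprime_to_set P = {1} \<union> (coprime_to_set P - {1})" using 1 by auto
    also have "infsum f \<dots> = f 1 + infsum f (coprime_to_set P - {1})"
      by (subst infsum_Un_disjoint[OF summ summ]) auto
    finally have "norm (zeta s * (\<Prod>p\<in>P. 1 - of_nat p powr (- s)) - 1) = norm (infsum f (coprime_to_set P - {1}))"
      by (simp add: f_def)
    also have "\<dots> \<le> infsum (\<lambda>n. norm (f n)) (coprime_to_set P - {1})"
      by (rule norm_infsum_bound) (rule asumm)
    also have "\<dots> \<le> infsum (\<lambda>n. norm (f n)) {Suc N..}"
    proof (rule infsum_mono_neutral[OF asumm asumm])
      fix n assume n: "n \<in> coprime_to_set P - {1} - {Suc N..}"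
      hence "n \<noteq> 1" "n > 0" "n \<le> N" by (auto simp: coprime_to_set_def)
      then obtain p where "prime p" "p dvd n" using prime_factor_nat by blast
      hence "p \<in> P" using \<open>n \<le> N\<close> \<open>n > 0\<close> by (auto simp: P_def dest: dvd_imp_le)
      with \<open>p dvd n\<close> n show "norm (f n) \<le> 0" by (auto simp: coprime_to_set_def)
    qed auto
    also have "\<dots> = T N"
    proof -
      define I where "I = infsum (\<lambda>n. norm (f n)) {Suc N..}"
      have "((\<lambda>n. norm (f n)) has_sum I) {Suc N..}"
        unfolding I_def by (intro has_sum_infsum asumm)
      also have "{Suc N..} = (\<lambda>n. n + Suc N) ` UNIV"
      proof (intro equalityI subsetI)
        fix n assume "n \<in> {Suc N..}"
        thus "n \<in> (\<lambda>n. n + Suc N) ` UNIV" by (intro image_eqI[of _ _ "n - Suc N"]) auto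
      qed auto
      finally have "((\<lambda>n. norm (f (n + Suc N))) has_sum I) UNIV"
        by (subst (asm) has_sum_reindex) (auto simp: o_def inj_on_def)
      from sums_unique[OF has_sum_imp_sums[OF this]] have "I = T N" by (simp only: T_def)
      thus ?thesis by (simp only: I_def)
    qed
    finally show ?thesis by (simp add: P_def)
  qed
  hence "(\<lambda>N. zeta s * (\<Prod>p | prime p \<and> p \<le> N. 1 - of_nat p powr (- s)) - 1) \<longlonglongrightarrow> 0"
    by (intro Lim_null_comparison[OF _ T0] always_eventually allI)
  thus ?thesis by (simp add: LIM_zero_iff)
qed

text \<open>A zero would make the sequence in \<open>euler_product_tendsto\<close> constantly 0,
  although it tends to 1.\<close>

lemma zeta_nonzero_Re_gt_1:
  assumes "Re s > 1"
  shows "zeta s \<noteq> 0"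
  using euler_product_tendsto[OF assms] by (auto simp: tendsto_const_iff LIMSEQ_const_iff)

text \<open>Take logarithms. With z = exp(i t) the n-th coefficient of the series is -x^n / n times
  3 + 4 cos(n t) + cos(2 n t) = 2 (1 + cos(n t))^2, hence not positive.\<close>

lemma three_four_one_factor:
  fixes z :: complex
  assumes x: "0 < x" "x < 1" and z: "norm z = 1"
  shows "(1 - x) ^ 3 * norm (1 - of_real x * z) ^ 4 * norm (1 - of_real x * z\<^sup>2) \<le> 1"
proof -
  have ser: "(\<lambda>n. - Re (w ^ n) / real n) sums ln (norm (1 - w))" if "norm w < 1" for w :: complex
  proof -
    have "(\<lambda>n. (-1)^Suc n / of_nat n * (-w)^n) sums ln (1 + - w)"
      by (rule Ln_series) (use that in auto)
    hence ln: "(\<lambda>n. Re ((-1)^Suc n / of_nat n * (-w)^n)) sums Re (ln (1 + - w))"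
      by (rule sums_Re)
    have eq: "(-1)^Suc n / of_nat n * (-w)^n = - (w ^ n / of_nat n)" for n
    proof -
      have "(-1)^Suc n / of_nat n * (-w)^n = - (((-1)^n * (-w)^n) / of_nat n)"
        by simp
      also have "(-1)^n * (-w)^n = w ^ n" by (simp add: power_mult_distrib[symmetric])
      finally show ?thesis .
    qed
    have terms: "(\<lambda>n. Re ((-1)^Suc n / of_nat n * (-w)^n)) = (\<lambda>n. - Re (w ^ n) / real n)"
      unfolding eq by (rule ext) simp
    have "1 - w \<noteq> 0" using that by auto
    hence re: "Re (ln (1 + - w)) = ln (norm (1 - w))" by simp
    show ?thesis using ln unfolding terms re .
  qed
  define A where "A = 1 - x"
  define B where "B = norm (1 - of_real x * z)"
  define D where "D = norm (1 - of_real x * z\<^sup>2)"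
  have n: "norm (of_real x * z) < 1" "norm (of_real x * z\<^sup>2) < 1" "norm (of_real x :: complex) < 1"
    using x z by (auto simp: norm_mult norm_power)
  have "norm (1 - w) > 0" if "norm w < 1" for w :: complex using that by (cases "w = 1") simp_all
  with n x have pos: "A > 0" "B > 0" "D > 0" unfolding A_def B_def D_def by simp_all
  have sA: "(\<lambda>n. - Re (of_real x ^ n) / real n) sums ln A"
  proof -
    have "norm (1 - complex_of_real x) = A"
      using norm_of_real[of "1 - x", where ?'a = complex] x by (simp add: A_def)
    thus ?thesis using ser[OF n(3)] by simp
  qed
  have "(\<lambda>n. 3 * (- Re (of_real x ^ n) / real n) + 4 * (- Re ((of_real x * z) ^ n) / real n) +
           (- Re ((of_real x * z\<^sup>2) ^ n) / real n)) sums (3 * ln A + 4 * ln B + ln D)"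
    unfolding B_def D_def by (intro sums_add sums_mult sA ser n)
  moreover have "3 * (- Re (of_real x ^ n) / real n) + 4 * (- Re ((of_real x * z) ^ n) / real n) +
           (- Re ((of_real x * z\<^sup>2) ^ n) / real n) \<le> 0" for n
  proof -
    define v where "v = z ^ n"
    have v: "(Re v)\<^sup>2 + (Im v)\<^sup>2 = 1" using z by (simp add: v_def norm_power flip: cmod_power2)
    have "(z\<^sup>2) ^ n = v\<^sup>2" unfolding v_def by (metis power_mult mult.commute)
    hence e: "(of_real x * z) ^ n = of_real (x ^ n) * v" "(of_real x * z\<^sup>2) ^ n = of_real (x ^ n) * v\<^sup>2"
      by (simp_all add: v_def power_mult_distrib)
    have "3 * Re (of_real x ^ n) + 4 * Re ((of_real x * z) ^ n) + Re ((of_real x * z\<^sup>2) ^ n) =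
        x ^ n * (3 + 4 * Re v + ((Re v)\<^sup>2 - (Im v)\<^sup>2))"
      unfolding e by (simp add: algebra_simps power2_eq_square flip: of_real_power)
    also have "3 + 4 * Re v + ((Re v)\<^sup>2 - (Im v)\<^sup>2) = 2 * (1 + Re v)\<^sup>2"
      using v by (simp add: power2_eq_square algebra_simps)
    finally have "3 * Re (of_real x ^ n) + 4 * Re ((of_real x * z) ^ n) + Re ((of_real x * z\<^sup>2) ^ n) \<ge> 0"
      using x by simp
    hence "(3 * Re (of_real x ^ n) + 4 * Re ((of_real x * z) ^ n) + Re ((of_real x * z\<^sup>2) ^ n)) / real n \<ge> 0"
      by simp
    thus ?thesis by (simp add: add_divide_distrib)
  qed
  ultimately have "3 * ln A + 4 * ln B + ln D \<le> 0"
    by (rule sums_le[rotated 1, OF _ sums_zero])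
  also have "3 * ln A + 4 * ln B + ln D = ln (A ^ 3 * B ^ 4 * D)"
    using pos by (simp add: ln_mult ln_realpow)
  finally show ?thesis using pos by (simp add: A_def B_def D_def ln_le_zero_iff)
qed

text \<open>The inequality is applied to each Euler factor of the truncated products, so that no
  logarithm of \<open>zeta\<close> has to be chosen; the truncation disappears in the limit.\<close>

lemma three_four_one:
  assumes x: "x > 1"
  shows "norm (zeta (of_real x)) ^ 3 * norm (zeta (Complex x t)) ^ 4 * norm (zeta (Complex x (2 * t))) \<ge> 1"
proof -
  define P where "P = (\<lambda>s N. \<Prod>p | prime p \<and> p \<le> N. 1 - of_nat p powr (- s) :: complex)"
  define L where "L = (\<lambda>s N. zeta s * P s N)"
  define Z where "Z = norm (zeta (of_real x)) ^ 3 * norm (zeta (Complex x t)) ^ 4 * norm (zeta (Complex x (2 * t)))"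
  have lim: "L s \<longlonglongrightarrow> 1" if "Re s > 1" for s
    unfolding L_def P_def by (rule euler_product_tendsto[OF that])
  have "(\<lambda>N. norm (L (of_real x) N) ^ 3 * norm (L (Complex x t) N) ^ 4 * norm (L (Complex x (2 * t)) N))
      \<longlonglongrightarrow> norm (1::complex) ^ 3 * norm (1::complex) ^ 4 * norm (1::complex)"
    by (intro tendsto_intros lim) (use x in auto)
  moreover have "norm (L (of_real x) N) ^ 3 * norm (L (Complex x t) N) ^ 4 * norm (L (Complex x (2 * t)) N) \<le> Z" for N
  proof -
    have "norm (P (of_real x) N) ^ 3 * norm (P (Complex x t) N) ^ 4 * norm (P (Complex x (2 * t)) N) =
      (\<Prod>p | prime p \<and> p \<le> N. norm (1 - of_nat p powr (- of_real x) :: complex) ^ 3 *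
         norm (1 - of_nat p powr (- Complex x t)) ^ 4 * norm (1 - of_nat p powr (- Complex x (2 * t))))"
      by (simp only: P_def prod_norm[symmetric] prod_power_distrib prod.distrib)
    also have "\<dots> \<le> 1"
    proof (rule prod_le_1, safe)
      fix p :: nat assume p: "prime p"
      hence p1: "real p > 1" using prime_gt_1_nat by auto
      define y where "y = real p powr (- x)"
      define z where "z = complex_of_nat p powr (- (\<i> * of_real t))"
      have y: "0 < y" "y < 1" using p1 x by (auto simp: y_def powr_less_one)
      have z: "norm z = 1" unfolding z_def using p1 by (simp add: norm_powr_real_powr)
      have 0: "of_nat p powr (- of_real x) = complex_of_real y"
        using p1 powr_of_real[of "real p" "-x"] by (simp add: y_def)
      have 1: "of_nat p powr (- Complex x t) = of_real y * z"
      proof -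
        have "- Complex x t = - of_real x + - (\<i> * of_real t)" by (simp add: complex_eq_iff)
        thus ?thesis by (simp only: powr_add z_def 0[symmetric])
      qed
      have 2: "of_nat p powr (- Complex x (2*t)) = of_real y * z\<^sup>2"
      proof -
        have "- Complex x (2*t) = - of_real x + (- (\<i> * of_real t) + - (\<i> * of_real t))"
          by (simp add: complex_eq_iff)
        thus ?thesis by (simp only: powr_add z_def 0[symmetric] power2_eq_square)
      qed
      have "norm (1 - complex_of_real y) = 1 - y" using norm_of_real[of "1 - y", where ?'a = complex] y by simp
      thus "norm (1 - of_nat p powr (- of_real x) :: complex) ^ 3 *
         norm (1 - of_nat p powr (- Complex x t)) ^ 4 * norm (1 - of_nat p powr (- Complex x (2 * t))) \<le> 1"
        using three_four_one_factor[OF y z] unfolding 0 1 2 by simp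
    qed auto
    finally have "Z * (norm (P (of_real x) N) ^ 3 * norm (P (Complex x t) N) ^ 4 * norm (P (Complex x (2 * t)) N)) \<le> Z * 1"
      by (intro mult_left_mono) (auto simp: Z_def)
    thus ?thesis by (simp add: L_def Z_def norm_mult power_mult_distrib mult_ac)
  qed
  ultimately have "norm (1::complex) ^ 3 * norm (1::complex) ^ 4 * norm (1::complex) \<le> Z"
    by (intro LIMSEQ_le_const2) auto
  thus ?thesis by (simp add: Z_def)
qed

text \<open>The continuation formula writes \<open>(s - 1) * zeta s\<close> as a function
  holomorphic at the pole; all its remainder terms vanish there.\<close>

lemma zeta_pole_limit: "((\<lambda>x. of_real (x - 1) * zeta (of_real x)) \<longlongrightarrow> 1) (at_right 1)"
proof -
  define g where "g = (\<lambda>w. 1 + (\<Sum>n. taylor_rem 1 w n))"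
  have "g holomorphic_on {w. Re w > - real 1}"
    unfolding g_def by (intro holomorphic_on_add holomorphic_on_const holomorphic_suminf_taylor_rem)
  hence "continuous_on {w. Re w > - real 1} g" by (rule holomorphic_on_imp_continuous_on)
  hence "isCont g 0"
    by (rule continuous_on_interior) (auto simp: interior_open open_halfspace_Re_gt)
  hence "(g \<longlongrightarrow> g 0) (at 0)" by (simp add: isCont_def)
  moreover have "filterlim (\<lambda>x. of_real (x - 1) :: complex) (at 0) (at_right 1)"
  proof (rule filterlim_atI)
    have "((\<lambda>x. of_real (x - 1) :: complex) \<longlongrightarrow> of_real (1 - 1)) (at_right 1)"
      by (intro tendsto_intros)
    thus "((\<lambda>x. of_real (x - 1) :: complex) \<longlongrightarrow> 0) (at_right 1)" by simp
    show "\<forall>\<^sub>F x in at_right 1. complex_of_real (x - 1) \<noteq> 0"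
      by (auto simp: eventually_at_right_field intro!: exI[of _ 2])
  qed
  ultimately have lim: "((\<lambda>x. g (of_real (x - 1))) \<longlongrightarrow> g 0) (at_right 1)"
    by (rule filterlim_compose)
  have g0: "g 0 = 1"
    by (simp add: g_def taylor_rem_def ffz_def del: of_nat_Suc) simp
  have "\<forall>\<^sub>F x in at_right 1. g (of_real (x - 1)) = of_real (x - 1) * zeta (of_real x)"
    using zeta_continuation_at_minus_1[of "of_real (x - 1)" for x]
    by (auto simp: eventually_at_right_field g_def intro!: exI[of _ 2])
  from Lim_transform_eventually[OF lim this] show ?thesis by (simp only: g0)
qed

text \<open>A zero at 1 + it would supply four factors x - 1 against the three lost to the pole at
  1. The product in \<open>three_four_one\<close> would then tend to 0 as x decreases to 1, yet it
  stays at least 1.\<close>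

lemma zeta_nonzero_Re_eq_1:
  assumes t: "t \<noteq> 0"
  shows "zeta (Complex 1 t) \<noteq> 0"
proof
  assume z: "zeta (Complex 1 t) = 0"
  have path: "((\<lambda>x. Complex x t) \<longlongrightarrow> Complex 1 t) (at_right 1)" for t
    by (auto intro!: tendsto_intros)
  have "((\<lambda>x. zeta (Complex x (2 * t))) \<longlongrightarrow> zeta (Complex 1 (2 * t))) (at_right 1)"
  proof (rule isCont_tendsto_compose[OF _ path])
    show "isCont zeta (Complex 1 (2 * t))"
      by (intro field_differentiable_imp_continuous_at holomorphic_on_imp_differentiable_at[OF zeta_holomorphic])
         (use t in \<open>auto simp: complex_eq_iff\<close>)
  qed
  moreover have "((\<lambda>x. zeta (Complex x t) / of_real (x - 1)) \<longlongrightarrow> deriv zeta (Complex 1 t)) (at_right 1)"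
  proof -
    have "(zeta has_field_derivative deriv zeta (Complex 1 t)) (at (Complex 1 t))"
      by (rule holomorphic_derivI[OF zeta_holomorphic]) (use t in \<open>auto simp: complex_eq_iff\<close>)
    hence "((\<lambda>w. (zeta w - zeta (Complex 1 t)) / (w - Complex 1 t)) \<longlongrightarrow> deriv zeta (Complex 1 t)) (at (Complex 1 t))"
      by (simp add: has_field_derivative_iff)
    moreover have "filterlim (\<lambda>x. Complex x t) (at (Complex 1 t)) (at_right 1)"
      by (rule filterlim_atI[OF path]) (auto simp: eventually_at_right_field intro!: exI[of _ 2])
    ultimately have "((\<lambda>x. (zeta (Complex x t) - zeta (Complex 1 t)) / (Complex x t - Complex 1 t))
        \<longlongrightarrow> deriv zeta (Complex 1 t)) (at_right 1)"
      by (rule filterlim_compose)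
    moreover have "Complex x t - Complex 1 t = of_real (x - 1)" for x by (simp add: complex_eq_iff)
    ultimately show ?thesis by (simp only: z diff_zero)
  qed
  ultimately have "((\<lambda>x. (x - 1) * (norm (of_real (x - 1) * zeta (of_real x)) ^ 3 *
      norm (zeta (Complex x t) / of_real (x - 1)) ^ 4 * norm (zeta (Complex x (2 * t)))))
      \<longlongrightarrow> (1 - 1) * (norm (1::complex) ^ 3 * norm (deriv zeta (Complex 1 t)) ^ 4 * norm (zeta (Complex 1 (2 * t)))))
      (at_right 1)"
    by (intro tendsto_intros zeta_pole_limit)
  moreover have "\<forall>\<^sub>F x in at_right 1. (x - 1) * (norm (of_real (x - 1) * zeta (of_real x)) ^ 3 *
      norm (zeta (Complex x t) / of_real (x - 1)) ^ 4 * norm (zeta (Complex x (2 * t)))) \<ge> 1"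
    unfolding eventually_at_right_field
  proof (intro exI[of _ 2] conjI allI impI)
    fix x :: real assume x: "1 < x" "x < 2"
    define a where "a = norm (zeta (of_real x))"
    define b where "b = norm (zeta (Complex x t))"
    define d where "d = norm (zeta (Complex x (2 * t)))"
    define y where "y = x - 1"
    have "y > 0" using x by (simp add: y_def)
    hence "y * ((y * a) ^ 3 * (b / y) ^ 4 * d) = a ^ 3 * b ^ 4 * d"
      by (simp add: power_mult_distrib power_divide field_simps eval_nat_numeral)
    moreover have "norm (complex_of_real (x - 1)) = x - 1" using x by (subst norm_of_real) simp
    ultimately show "(x - 1) * (norm (of_real (x - 1) * zeta (of_real x)) ^ 3 *
      norm (zeta (Complex x t) / of_real (x - 1)) ^ 4 * norm (zeta (Complex x (2 * t)))) \<ge> 1"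
      using three_four_one[of x t] x(1) by (simp only: norm_mult norm_divide a_def b_def d_def y_def)
  qed auto
  ultimately have "(1 - 1) * (norm (1::complex) ^ 3 * norm (deriv zeta (Complex 1 t)) ^ 4 * norm (zeta (Complex 1 (2 * t)))) \<ge> 1"
    by (intro tendsto_lowerbound) auto
  thus False by simp
qed

lemma zeta_nonzero_Re_ge_1:
  assumes "Re s \<ge> 1" "Im s \<noteq> 0"
  shows "zeta s \<noteq> 0"
proof (cases "Re s = 1")
  case True
  hence eq: "Complex 1 (Im s) = s" by (simp add: complex_eq_iff)
  from zeta_nonzero_Re_eq_1[OF assms(2)] show ?thesis unfolding eq .
qed (use assms zeta_nonzero_Re_gt_1[of s] in auto)

section \<open>The functional equation\<close>

text \<open>Each term is the error of the trapezoidal rule for u^(-s) between consecutive integers,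
  as in Euler-Maclaurin summation. The error decays like n^(- Re s - 2), which is why the series
  reaches down to Re s > -1.\<close>

lemma zeta_trapezoid_sums:
  assumes s: "Re s > -1" "s \<noteq> 1"
  shows "(\<lambda>n. (of_nat (Suc n) powr (-s) + of_nat (Suc (Suc n)) powr (-s)) / 2 -
           (of_nat (Suc (Suc n)) powr (1-s) - of_nat (Suc n) powr (1-s)) / (1-s))
         sums (zeta s - 1/2 + 1/(1-s))"
proof -
  \<comment> \<open>The same terms as a combination of Taylor remainders, for which convergence and
    holomorphy of the sum are already known.\<close>
  define c where "c = (\<lambda>s n. taylor_rem 1 s n / 2 + taylor_rem 2 (s-1) n / (s-1))"
  define t where "t = (\<lambda>s n. (of_nat (Suc n) powr (-s) + of_nat (Suc (Suc n)) powr (-s)) / 2 -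
           (of_nat (Suc (Suc n)) powr (1-s) - of_nat (Suc n) powr (1-s)) / (1-s) :: complex)"
  have ct: "c s n = t s n" if "s \<noteq> 1" for s n
  proof -
    define N where "N = (of_nat (Suc n) :: complex)"
    define M where "M = (of_nat (Suc (Suc n)) :: complex)"
    have a: "taylor_rem 1 s n = M powr (-s) - (N powr (-s) - s * N powr (-s-1))"
      unfolding taylor_rem_def N_def[symmetric] M_def[symmetric] by (simp add: ffz_def)
    have b: "taylor_rem 2 (s-1) n = M powr (1-s) - (N powr (1-s) - (s-1) * N powr (-s) + (s-1) * s * N powr (-s-1) / 2)"
    proof -
      have "-1 - s = -s - 1" by simp
      hence P: "N powr (-1-s) = N powr (-s-1)" by (rule arg_cong)
      have e: "-(s-1) - 2 = -s-1" "-(s-1) - 1 = -s" "-(s-1) = 1-s" by simp_all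
      show ?thesis unfolding taylor_rem_def N_def[symmetric] M_def[symmetric]
        by (simp add: ffz_def numeral_2_eq_2) (simp add: e algebra_simps, simp add: P field_simps)
    qed
    show ?thesis unfolding c_def t_def a b N_def[symmetric] M_def[symmetric]
      using that by (simp add: divide_simps) (simp add: algebra_simps)
  qed
  define D where "D = {s. Re s > -1} - {1::complex}"
  have cs: "summable (c s)" if "s \<in> D" for s
    unfolding c_def using that
    by (intro summable_add summable_divide holomorphic_suminf_taylor_rem(2)) (auto simp: D_def)
  have eq: "(\<Sum>n. c s n) = zeta s - 1/2 + 1/(1-s)" if sD: "s \<in> D" for s
  proof (rule analytic_continuation_open[of "{s. Re s > 1}" D "\<lambda>s. \<Sum>n. c s n" "\<lambda>s. zeta s - 1/2 + 1/(1-s)"])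
    show "open {s. Re s > 1}" "open D" by (auto simp: D_def open_halfspace_Re_gt)
    show "{s. Re s > 1} \<noteq> {}" by (auto intro: exI[of _ "2::complex"])
    show "{s. Re s > 1} \<subseteq> D" by (auto simp: D_def)
    show "connected D" unfolding D_def
      by (rule connected_open_delete) (auto intro!: open_halfspace_Re_gt convex_connected convex_halfspace_Re_gt)
    show "s \<in> D" by fact
    show "(\<lambda>s. zeta s - 1/2 + 1/(1-s)) holomorphic_on D"
      by (intro holomorphic_intros zeta_holomorphic_on) (auto simp: D_def)
    have "(\<lambda>s. \<Sum>n. taylor_rem 1 s n) holomorphic_on D"
      by (rule holomorphic_on_subset[OF holomorphic_suminf_taylor_rem(1)]) (auto simp: D_def)
    moreover have "((\<lambda>w. \<Sum>n. taylor_rem 2 w n) \<circ> (\<lambda>s. s - 1)) holomorphic_on D"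
      by (rule holomorphic_on_compose_gen[OF _ holomorphic_suminf_taylor_rem(1)[of 2]])
         (auto simp: D_def intro!: holomorphic_intros)
    ultimately have "(\<lambda>s. (\<Sum>n. taylor_rem 1 s n) / 2 + (\<Sum>n. taylor_rem 2 (s-1) n) / (s-1)) holomorphic_on D"
      unfolding o_def by (intro holomorphic_intros) (auto simp: D_def)
    thus "(\<lambda>s. \<Sum>n. c s n) holomorphic_on D"
    proof (rule holomorphic_transform)
      fix s assume "s \<in> D"
      hence "summable (taylor_rem 1 s)" "summable (taylor_rem 2 (s-1))"
        by (auto intro!: holomorphic_suminf_taylor_rem(2) simp: D_def)
      thus "(\<Sum>n. taylor_rem 1 s n) / 2 + (\<Sum>n. taylor_rem 2 (s-1) n) / (s-1) = (\<Sum>n. c s n)"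
        unfolding c_def by (subst suminf_add[symmetric]) (auto simp: suminf_divide summable_divide)
    qed
    fix s assume "s \<in> {s::complex. Re s > 1}"
    hence s: "Re s > 1" by simp
    have 1: "(\<lambda>n. of_nat (Suc n) powr (-s)) sums zeta s" by (rule zeta_sums[OF s])
    have 2: "(\<lambda>n. of_nat (Suc (Suc n)) powr (-s)) sums (zeta s - 1)"
      using sums_split_initial_segment[OF 1, of 1] by simp
    have lim: "(\<lambda>n. of_nat (Suc n) powr (1-s) :: complex) \<longlonglongrightarrow> 0"
    proof (rule tendsto_norm_zero_cancel)
      have "(\<lambda>n. real (Suc n) powr (1 - Re s)) \<longlonglongrightarrow> 0"
        by (rule filterlim_compose[OF tendsto_neg_powr[OF _ filterlim_ident]
              filterlim_compose[OF filterlim_real_sequentially filterlim_Suc]]) (use s in auto)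
      thus "(\<lambda>n. norm (of_nat (Suc n) powr (1-s) :: complex)) \<longlonglongrightarrow> 0"
        by (simp add: norm_powr_real_powr del: of_nat_Suc)
    qed
    have 3: "(\<lambda>n. of_nat (Suc (Suc n)) powr (1-s) - of_nat (Suc n) powr (1-s)) sums (0 - (1::complex))"
      using telescope_sums[OF lim] by simp
    have "t s sums ((zeta s + (zeta s - 1)) / 2 - (0 - 1) / (1-s))"
      unfolding t_def by (intro sums_diff sums_divide sums_add 1 2 3)
    moreover have "c s = t s" by (rule ext, rule ct) (use s in auto)
    ultimately have "c s sums ((zeta s + (zeta s - 1)) / 2 - (0 - 1) / (1-s))" by simp
    thus "(\<Sum>n. c s n) = zeta s - 1/2 + 1/(1-s)" by (simp add: sums_iff field_simps)
  qed
  have "c s sums (zeta s - 1/2 + 1/(1-s))"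
    using eq[of s] cs[of s] s by (simp add: sums_iff D_def)
  moreover have "c s = t s" by (rule ext, rule ct) (use s in auto)
  ultimately show ?thesis by (simp add: t_def)
qed

text \<open>The partial fraction expansion of the cotangent. The series for \<open>Digamma\<close>
  expresses \<open>Digamma (1 - z) - Digamma z\<close> as a sum, and the logarithmic derivative of
  the reflection formula of \<open>Gamma\<close> identifies it as pi cot(pi z).\<close>

lemma cot_sums:
  fixes z :: complex
  assumes z: "z \<notin> \<int>"
  shows "(\<lambda>n. 2 * z / (z\<^sup>2 - (of_nat (Suc n))\<^sup>2)) sums (pi * cos (pi * z) / sin (pi * z) - 1 / z)"
proof -
  have zk: "z + of_nat k \<noteq> 0" "z - of_nat k \<noteq> 0" "1 - z + of_nat k \<noteq> 0" for k
  proof -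
    show "z + of_nat k \<noteq> 0" using z by (metis Ints_minus Ints_of_nat add_eq_0_iff2)
    show "z - of_nat k \<noteq> 0" using z by auto
    show "1 - z + of_nat k \<noteq> 0"
    proof
      assume "1 - z + of_nat k = 0"
      hence "z = of_nat (Suc k)" by (simp add: algebra_simps)
      thus False using z by auto
    qed
  qed
  have z': "z \<notin> \<int>\<^sub>\<le>\<^sub>0" "1 - z \<notin> \<int>\<^sub>\<le>\<^sub>0"
    using z nonpos_Ints_subset_Ints by (auto dest!: subsetD)
  have sin0: "sin (of_real pi * z) \<noteq> 0"
  proof
    assume "sin (of_real pi * z) = 0"
    then obtain n :: int where "of_real pi * z = of_real pi * of_int n"
      by (auto simp: sin_eq_0 mult.commute)
    hence "z = of_int n" by simp
    thus False using z by simp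
  qed
  have psi: "(\<lambda>k. inverse (of_nat (Suc k)) - inverse (w + of_nat k)) sums (Digamma w + euler_mascheroni)"
    if "w \<noteq> 0" for w :: complex
    using summable_Digamma[OF that] by (simp add: Digamma_def sums_iff)
  have w0: "z \<noteq> 0" "1 - z \<noteq> 0" using z by auto
  have "(\<lambda>k. (inverse (of_nat (Suc k)) - inverse (1 - z + of_nat k)) -
             (inverse (of_nat (Suc k)) - inverse (z + of_nat k)))
        sums ((Digamma (1-z) + euler_mascheroni) - (Digamma z + euler_mascheroni))"
    by (intro sums_diff psi w0)
  hence 1: "(\<lambda>k. inverse (z + of_nat k) - inverse (1 - z + of_nat k)) sums (Digamma (1-z) - Digamma z)" by simp
  \<comment> \<open>Shifts z + k to z + k + 1, so that it pairs with k + 1 - z; the telescoped term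
    is the 1 / z of the statement.\<close>
  have "(\<lambda>k. inverse (z + of_nat (Suc k)) - inverse (z + of_nat k)) sums (0 - inverse (z + of_nat 0))"
    by (intro telescope_sums filterlim_compose[OF tendsto_inverse_0]
              tendsto_add_filterlim_at_infinity[OF tendsto_const] tendsto_of_nat)
  from sums_add[OF 1 this]
  have "(\<lambda>k. inverse (z + of_nat (Suc k)) - inverse (1 - z + of_nat k)) sums (Digamma (1-z) - Digamma z - 1/z)"
    by (simp add: field_simps)
  also have "(\<lambda>k. inverse (z + of_nat (Suc k)) - inverse (1 - z + of_nat k)) =
      (\<lambda>n. 2 * z / (z\<^sup>2 - (of_nat (Suc n))\<^sup>2))"
  proof
    fix k
    define N where "N = (of_nat (Suc k) :: complex)"
    have e: "1 - z + of_nat k = N - z" by (simp add: N_def)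
    have nz: "z + N \<noteq> 0" "z - N \<noteq> 0" unfolding N_def by (rule zk)+
    have "inverse (z + N) - inverse (N - z) = 1 / (z + N) + 1 / (z - N)"
      by (simp add: inverse_eq_divide minus_divide_right)
    also have "\<dots> = 2 * z / ((z + N) * (z - N))" using nz by (simp add: field_simps)
    also have "(z + N) * (z - N) = z\<^sup>2 - N\<^sup>2" by (simp add: power2_eq_square algebra_simps)
    finally show "inverse (z + of_nat (Suc k)) - inverse (1 - z + of_nat k) = 2 * z / (z\<^sup>2 - (of_nat (Suc k))\<^sup>2)"
      unfolding e N_def[symmetric] .
  qed
  also have "Digamma (1-z) - Digamma z = pi * cos (pi * z) / sin (pi * z)"
  proof -
    have "((\<lambda>z. Gamma z * Gamma (1-z)) has_field_derivative
        Gamma z * Gamma (1-z) * (Digamma z - Digamma (1-z))) (at z)"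
      using z' by (auto intro!: derivative_eq_intros simp: algebra_simps)
    moreover have "((\<lambda>z. of_real pi / sin (of_real pi * z)) has_field_derivative
        - (of_real pi / sin (of_real pi * z)) * (of_real pi * cos (of_real pi * z) / sin (of_real pi * z))) (at z)"
      using sin0 by (auto intro!: derivative_eq_intros simp: field_simps power2_eq_square)
    ultimately have "Gamma z * Gamma (1-z) * (Digamma z - Digamma (1-z)) =
        - (of_real pi / sin (of_real pi * z)) * (of_real pi * cos (of_real pi * z) / sin (of_real pi * z))"
      unfolding Gamma_reflection_complex by (rule DERIV_unique)
    moreover have "of_real pi / sin (of_real pi * z) \<noteq> 0" using sin0 by simp
    moreover have "b - a = d" if "c * (a - b) = - c * d" "c \<noteq> 0" for a b c d :: complex
    proof -
      have "c * (a - b) = c * (- d)" using that(1) by simp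
      hence "a - b = - d" using that(2) by (metis mult_left_cancel)
      thus ?thesis by (metis minus_diff_eq minus_minus)
    qed
    ultimately show ?thesis unfolding Gamma_reflection_complex by blast
  qed
  finally show ?thesis .
qed

text \<open>This is coth(x / 2) / 2 - 1 / x. Expanding it once in partial fractions and once in
  powers of exp(-x), and integrating both against x^(s - 1), produces \<open>zeta (1 - s)\<close>
  and \<open>zeta s\<close>.\<close>

definition hker :: "real \<Rightarrow> real" where
  "hker x = (1 + exp (-x)) / (2 * (1 - exp (-x))) - 1 / x"

text \<open>The cotangent expansion on the imaginary axis, at z = i x / (2 pi), where i cot turns
  into the hyperbolic cotangent.\<close>

lemma hker_sums_partial_fractions:
  assumes x: "x > 0"
  shows "(\<lambda>n. 2 * x / (x\<^sup>2 + (2 * pi * real (Suc n))\<^sup>2)) sums hker x"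
proof -
  define y where "y = x / (2 * pi)"
  define z where "z = \<i> * complex_of_real y"
  have y: "y > 0" using x by (simp add: y_def)
  have "z \<notin> \<int>"
  proof
    assume "z \<in> \<int>"
    hence "Im z = 0" by (auto elim!: Ints_cases)
    thus False using y by (simp add: z_def)
  qed
  from sums_mult[OF cot_sums[OF this], of "\<i> / (2 * of_real pi)"]
  have "(\<lambda>n. \<i> / (2 * of_real pi) * (2 * z / (z\<^sup>2 - (of_nat (Suc n))\<^sup>2)))
      sums (\<i> / (2 * of_real pi) * (of_real pi * cos (of_real pi * z) / sin (of_real pi * z) - 1 / z))" .
  also have "(\<lambda>n. \<i> / (2 * of_real pi) * (2 * z / (z\<^sup>2 - (of_nat (Suc n))\<^sup>2))) =
      (\<lambda>n. complex_of_real (2 * x / (x\<^sup>2 + (2 * pi * real (Suc n))\<^sup>2)))"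
  proof
    fix n
    define N where "N = real (Suc n)"
    define W where "W = complex_of_real (y\<^sup>2 + N\<^sup>2)"
    have "\<i> / (2 * of_real pi) * (2 * z / (z\<^sup>2 - (of_real N)\<^sup>2)) =
          (\<i> * \<i>) * of_real y / (of_real pi * (- W))"
      by (simp add: W_def z_def power_mult_distrib mult_ac)
    also have "\<dots> = of_real y / (of_real pi * W)" by simp
    also have "\<dots> = of_real (y / (pi * (y\<^sup>2 + N\<^sup>2)))" by (simp add: W_def)
    also have "y / (pi * (y\<^sup>2 + N\<^sup>2)) = 2 * x / (x\<^sup>2 + (2 * pi * N)\<^sup>2)"
    proof -
      have "x = 2 * pi * y" by (simp add: y_def)
      hence "2 * x / (x\<^sup>2 + (2 * pi * N)\<^sup>2) = (4 * pi * y) / ((4 * pi * pi) * (y\<^sup>2 + N\<^sup>2))"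
        by (simp add: power2_eq_square algebra_simps)
      also have "\<dots> = y / (pi * (y\<^sup>2 + N\<^sup>2))" by simp
      finally show ?thesis by simp
    qed
    finally show "\<i> / (2 * of_real pi) * (2 * z / (z\<^sup>2 - (of_nat (Suc n))\<^sup>2)) =
        complex_of_real (2 * x / (x\<^sup>2 + (2 * pi * real (Suc n))\<^sup>2))" by (simp add: N_def)
  qed
  also have "\<i> / (2 * of_real pi) * (of_real pi * cos (of_real pi * z) / sin (of_real pi * z) - 1 / z) = of_real (hker x)"
  proof -
    define q where "q = exp (x / 2)"
    have q: "q > 1" using x by (simp add: q_def)
    have e: "\<i> * (of_real pi * z) = of_real (- (x / 2))" "- (\<i> * (of_real pi * z)) = of_real (x / 2)"
      by (simp_all add: z_def y_def)
    have ex: "exp (- x) = 1 / (q * q)"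
      by (simp add: q_def exp_minus inverse_eq_divide flip: exp_add)
    have c: "cos (of_real pi * z) = of_real ((1 / q + q) / 2)"
      unfolding cos_exp_eq e by (simp add: q_def exp_minus inverse_eq_divide flip: exp_of_real)
    have s: "sin (of_real pi * z) = \<i> * of_real ((q - 1 / q) / 2)"
      unfolding sin_exp_eq' e by (simp add: q_def exp_minus inverse_eq_divide flip: exp_of_real)
    have q1: "q - 1 / q \<noteq> 0" using q by (simp add: field_simps) (metis less_1_mult less_irrefl)
    have "\<i> / (2 * of_real pi) * (of_real pi * cos (of_real pi * z) / sin (of_real pi * z) - 1 / z) =
        of_real (((1 / q + q) / 2) / (q - 1 / q) - 1 / (2 * pi * y))"
    proof -
      define P where "P = (1 / q + q) / 2"
      define Q where "Q = (q - 1 / q) / 2"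
      have Q: "Q \<noteq> 0" "q - 1 / q = 2 * Q" using q1 by (auto simp: Q_def)
      show ?thesis unfolding c s P_def[symmetric] Q_def[symmetric] Q(2) unfolding z_def
        using Q(1) y by (simp add: field_simps)
    qed
    also have "2 * pi * y = x" by (simp add: y_def)
    also have "((1 / q + q) / 2) / (q - 1 / q) - 1 / x = hker x"
    proof -
      have "q * q > 1" using q by (simp add: less_1_mult)
      hence "(1 + exp (-x)) / (2 * (1 - exp (-x))) = (q * q + 1) / (2 * (q * q - 1))"
        unfolding ex using q by (simp add: field_simps)
      also have "\<dots> = ((1 / q + q) / 2) / (q - 1 / q)"
        using q \<open>q * q > 1\<close> q1 by (simp add: field_simps)
      finally show ?thesis by (simp add: hker_def)
    qed
    finally show ?thesis .
  qed
  finally show ?thesis by (subst (asm) sums_of_real_iff)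
qed

text \<open>A geometric series in exp(-x). Its n-th term is the trapezoidal error of exp(- u x) on
  the interval from n to n + 1.\<close>

lemma hker_sums_trapezoid:
  assumes x: "x > 0"
  shows "(\<lambda>n. exp (- real n * x) * (exp (-x) * (1/2 + 1/x) + 1/2 - 1/x)) sums hker x"
proof -
  have q: "norm (exp (-x)) < 1" "1 - exp (-x) \<noteq> 0" using x by auto
  have "(\<lambda>n. exp (-x) ^ n * (exp (-x) * (1/2 + 1/x) + 1/2 - 1/x)) sums
      (1 / (1 - exp (-x)) * (exp (-x) * (1/2 + 1/x) + 1/2 - 1/x))"
    by (intro sums_mult2 geometric_sums q)
  also have "(\<lambda>n. exp (-x) ^ n) = (\<lambda>n. exp (- real n * x))"
    by (simp add: fun_eq_iff flip: exp_of_nat_mult)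
  also have "1 / (1 - exp (-x)) * (exp (-x) * (1/2 + 1/x) + 1/2 - 1/x) = hker x"
    using q(2) x unfolding hker_def by (simp add: field_simps)
  finally show ?thesis .
qed

text \<open>Peano's form of the trapezoidal error: two integrations by parts express it through the
  second derivative x^2 exp(- u x) and the non-negative kernel (u - n)(n + 1 - u) / 2.\<close>

lemma trapezoid_kernel_exp:
  assumes x: "x > 0"
  shows "((\<lambda>u. (u - real n) * (real n + 1 - u) / 2 * x\<^sup>2 * exp (- u * x)) has_integral
     exp (- real n * x) * (exp (-x) * (1/2 + 1/x) + 1/2 - 1/x)) {real n..real n + 1}"
proof -
  define T where "T = (\<lambda>u. exp (- u * x) * (- x * ((u - real n) * (real n + 1 - u)) / 2 - (2 * real n + 1 - 2 * u) / 2 + 1 / x))"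
  have "((\<lambda>u. (u - real n) * (real n + 1 - u) / 2 * x\<^sup>2 * exp (- u * x)) has_integral
      (T (real n + 1) - T (real n))) {real n..real n + 1}"
  proof (rule fundamental_theorem_of_calculus)
    fix u assume "u \<in> {real n..real n + 1}"
    show "(T has_vector_derivative (u - real n) * (real n + 1 - u) / 2 * x\<^sup>2 * exp (- u * x))
        (at u within {real n..real n + 1})"
      unfolding has_real_derivative_iff_has_vector_derivative[symmetric] T_def using x
      by (auto intro!: derivative_eq_intros simp: field_simps power2_eq_square)
  qed auto
  moreover have "exp (- (real n + 1) * x) = exp (- real n * x) * exp (- x)"
    by (simp add: algebra_simps flip: exp_add)
  hence "T (real n + 1) - T (real n) = exp (- real n * x) * (exp (-x) * (1/2 + 1/x) + 1/2 - 1/x)"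
    by (simp add: T_def algebra_simps diff_divide_distrib add_divide_distrib)
  ultimately show ?thesis by simp
qed

text \<open>The same error for u^(-s), whose second derivative is s (s + 1) u^(-s - 2). On the
  interval starting at 0 the integrand behaves like u^(-s - 1), which is integrable because s <
  0.\<close>

lemma trapezoid_kernel_powr:
  fixes s :: real
  assumes s: "-1 < s" "s < 0"
  shows "((\<lambda>u. (u - real n) * (real n + 1 - u) / 2 * u powr (-s-2)) has_integral
     ((real n powr (-s) + (real n + 1) powr (-s)) / 2 -
      ((real n + 1) powr (1-s) - real n powr (1-s)) / (1-s)) / (s * (s+1))) {real n..real n + 1}"
proof -
  define F where "F = (\<lambda>u. (- (u powr (1-s)) / (1-s) - (2 * real n + 1) * u powr (-s) / s
      + real n * (real n + 1) * u powr (-s-1) / (s+1)) / 2)"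
  have "((\<lambda>u. (u - real n) * (real n + 1 - u) / 2 * u powr (-s-2)) has_integral
      (F (real n + 1) - F (real n))) {real n..real n + 1}"
  \<comment> \<open>For n = 0 the antiderivative is not differentiable at 0. It is still continuous
    there, because its only negative power carries the factor n.\<close>
  proof (rule fundamental_theorem_of_calculus_interior)
    show "continuous_on {real n..real n + 1} F"
    proof (cases "n = 0")
      case True
      thus ?thesis unfolding F_def using s
        by (auto intro!: continuous_intros continuous_on_powr')
    next
      case False
      thus ?thesis unfolding F_def using s by (auto intro!: continuous_intros)
    qed
    fix u assume u: "u \<in> {real n<..<real n + 1}"
    hence u0: "u > 0" by (metis greaterThanLessThan_iff le_less_trans of_nat_0_le_iff)
    define v where "v = u powr (-s-2)"
    have p: "u powr (-s) = u * u * v" "u powr (-s-1) = u * v"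
    proof -
      have "u powr (-s) = u powr (2 + (-s-2))" "u powr (-s-1) = u powr (1 + (-s-2))" by (rule arg_cong; simp)+
      thus "u powr (-s) = u * u * v" "u powr (-s-1) = u * v"
        using u0 unfolding powr_add by (simp_all add: v_def power2_eq_square)
    qed
    have "(F has_real_derivative (- (u powr (-s)) + (2 * real n + 1) * u powr (-s-1) - real n * (real n + 1) * u powr (-s-2)) / 2) (at u)"
    proof -
      have d: "((\<lambda>u. u powr a) has_real_derivative a * u powr (a - 1)) (at u)" for a
        using has_real_derivative_powr[OF u0] by simp
      have "(F has_real_derivative (- ((1-s) * u powr (1-s-1)) / (1-s) - (2 * real n + 1) * (-s * u powr (-s-1)) / s
          + real n * (real n + 1) * ((-s-1) * u powr (-s-1-1)) / (s+1)) / 2) (at u)"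
        unfolding F_def by (intro DERIV_cdivide DERIV_add DERIV_diff DERIV_minus DERIV_cmult d)
      also have "- ((1-s) * u powr (1-s-1)) / (1-s) = - (u powr (-s))" using s by simp
      also have "(2 * real n + 1) * (-s * u powr (-s-1)) / s = - ((2 * real n + 1) * u powr (-s-1))" using s by simp
      also have "real n * (real n + 1) * ((-s-1) * u powr (-s-1-1)) / (s+1) = - (real n * (real n + 1) * u powr (-s-2))"
      proof -
        have "-s-1-1 = -s-2" by simp
        hence e: "u powr (-s-1-1) = u powr (-s-2)" by (rule arg_cong)
        have "a * ((-s-1) * b) / (s+1) = - (a * b)" for a b :: real
          using s by (simp add: field_simps)
        thus ?thesis unfolding e .
      qed
      finally show ?thesis by simp
    qed
    also have "(- (u powr (-s)) + (2 * real n + 1) * u powr (-s-1) - real n * (real n + 1) * u powr (-s-2)) / 2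
        = (u - real n) * (real n + 1 - u) / 2 * u powr (-s-2)"
      unfolding p v_def[symmetric] by (simp add: algebra_simps diff_divide_distrib add_divide_distrib)
    finally show "(F has_vector_derivative (u - real n) * (real n + 1 - u) / 2 * u powr (-s-2)) (at u)"
      by (simp add: has_real_derivative_iff_has_vector_derivative)
  qed auto
  also have "F (real n + 1) - F (real n) =
     ((real n powr (-s) + (real n + 1) powr (-s)) / 2 -
      ((real n + 1) powr (1-s) - real n powr (1-s)) / (1-s)) / (s * (s+1))"
  proof -
    define a where "a = real n"
    define A where "A = (a + 1) powr (-s)"
    define B where "B = a powr (-s)"
    have a: "a \<ge> 0" by (simp add: a_def)
    have 1: "(a + 1) powr (1-s) = (a + 1) * A" "(a + 1) * (a + 1) powr (-s-1) = A"
      using powr_add[of "a+1" 1 "-s"] powr_add[of "a+1" 1 "-s-1"] a by (simp_all add: A_def)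
    have 2: "a powr (1-s) = a * B" "a * a powr (-s-1) = B"
      using powr_add[of a 1 "-s"] powr_add[of a 1 "-s-1"] a by (simp_all add: B_def)
    have 3: "a * (a + 1) * (a + 1) powr (-s-1) = a * A" "a * (a + 1) * a powr (-s-1) = (a + 1) * B"
      using 1(2) 2(2) by (metis mult.assoc, metis mult.assoc mult.commute)
    have "F (a + 1) - F a = ((- ((a + 1) * A) / (1-s) - (2 * a + 1) * A / s + a * A / (s+1))
       - (- (a * B) / (1-s) - (2 * a + 1) * B / s + (a + 1) * B / (s+1))) / 2"
      by (simp add: F_def a_def[symmetric] 1(1) 2(1) 3 A_def[symmetric] B_def[symmetric] diff_divide_distrib)
    also have "\<dots> = ((B + A) / 2 - ((a + 1) * A - a * B) / (1-s)) / (s * (s+1))"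
      using s by (simp add: divide_simps) (simp add: algebra_simps)
    finally show ?thesis by (simp only: 1(1) 2(1) a_def[symmetric] A_def B_def)
  qed
  finally show ?thesis .
qed

section \<open>Mellin transforms of the kernel and the resulting functional equation\<close>

lemma has_integral_substitution_pos:
  fixes f g g' :: "real \<Rightarrow> real"
  assumes f: "(f has_integral I) {0<..}" "\<And>x. x > 0 \<Longrightarrow> f x \<ge> 0"
    and g: "\<And>x. x > 0 \<Longrightarrow> (g has_real_derivative g' x) (at x)" "inj_on g {0<..}" "g ` {0<..} = {0<..}"
    and g': "\<And>x. x > 0 \<Longrightarrow> g' x \<ge> 0"
  shows "((\<lambda>x. g' x * f (g x)) has_integral I) {0<..}"
proof -
  have "f absolutely_integrable_on g ` {0<..} \<and> integral (g ` {0<..}) f = I"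
    unfolding g(3) using f by (auto intro!: nonnegative_absolutely_integrable_1 simp: integral_unique has_integral_integrable)
  hence "(\<lambda>x. \<bar>g' x\<bar> * f (g x)) absolutely_integrable_on {0<..} \<and> integral {0<..} (\<lambda>x. \<bar>g' x\<bar> * f (g x)) = I"
    by (subst has_absolute_integral_change_of_variables_1')
       (use g in \<open>auto intro: has_field_derivative_at_within\<close>)
  hence "((\<lambda>x. \<bar>g' x\<bar> * f (g x)) has_integral I) {0<..}"
    using absolutely_integrable_on_def has_integral_iff by blast
  thus ?thesis by (rule has_integral_eq[rotated]) (use g' in auto)
qed

lemma has_integral_powr_exp:
  assumes p: "p > 0" and u: "u > 0"
  shows "((\<lambda>x. x powr (p - 1) * exp (- u * x)) has_integral Gamma p * u powr (-p)) {0::real<..}"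
proof -
  have "((\<lambda>t. t powr (p - 1) / exp t) has_integral Gamma p) {0<..}"
  proof (subst has_integral_restrict_UNIV[symmetric])
    have "(\<lambda>t. if t \<in> {0<..} then t powr (p - 1) / exp t else 0) = (\<lambda>t. if t \<in> {0..} then t powr (p - 1) / exp t else 0)"
      by (auto simp: fun_eq_iff)
    thus "((\<lambda>t. if t \<in> {0<..} then t powr (p - 1) / exp t else 0) has_integral Gamma p) UNIV"
      using Gamma_integral_real[OF p] by (simp only: has_integral_restrict_UNIV)
  qed
  hence "((\<lambda>x. u * ((u * x) powr (p - 1) / exp (u * x))) has_integral Gamma p) {0<..}"
  proof (rule has_integral_substitution_pos)
    show "(*) u ` {0<..} = {0<..}"
    proof safe
      fix x :: real assume "x > 0"
      thus "x \<in> (*) u ` {0<..}" using u by (intro image_eqI[of _ _ "x / u"]) auto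
    qed (use u in auto)
  qed (use u in \<open>auto intro!: derivative_eq_intros simp: inj_on_def\<close>)
  from has_integral_mult_left[OF this, of "u powr (-p)"]
  have "((\<lambda>x. u * ((u * x) powr (p - 1) / exp (u * x)) * u powr (-p)) has_integral Gamma p * u powr (-p)) {0<..}" .
  thus ?thesis
  proof (rule has_integral_eq[rotated])
    fix x :: real assume "x \<in> {0<..}"
    hence "u * ((u * x) powr (p - 1) / exp (u * x)) * u powr (-p) = (u powr 1 * u powr (p - 1) * u powr (-p)) * x powr (p - 1) * exp (- u * x)"
      using u by (simp add: powr_mult exp_minus field_simps)
    also have "u powr 1 * u powr (p - 1) * u powr (-p) = 1"
      using u by (simp only: powr_add[symmetric]) simp
    finally show "u * ((u * x) powr (p - 1) / exp (u * x)) * u powr (-p) = x powr (p - 1) * exp (- u * x)" by simp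
  qed
qed

lemma has_integral_gaussian_moment:
  assumes s: "s > -1" and v: "v > 0"
  shows "((\<lambda>x. 2 * x powr s * exp (- v * x\<^sup>2)) has_integral Gamma ((s + 1) / 2) * v powr (-((s + 1) / 2))) {0::real<..}"
proof -
  define p where "p = (s + 1) / 2"
  have p: "p > 0" using s by (simp add: p_def)
  have "((\<lambda>x. 2 * x * ((x\<^sup>2) powr (p - 1) * exp (- v * x\<^sup>2))) has_integral Gamma p * v powr (-p)) {0<..}"
    using has_integral_powr_exp[OF p v]
  proof (rule has_integral_substitution_pos)
    show "(\<lambda>x::real. x\<^sup>2) ` {0<..} = {0<..}"
    proof safe
      fix x :: real assume "x > 0"
      thus "x \<in> (\<lambda>x. x\<^sup>2) ` {0<..}" by (intro image_eqI[of _ _ "sqrt x"]) auto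
    qed auto
  qed (auto intro!: derivative_eq_intros simp: inj_on_def power2_eq_iff_nonneg)
  thus ?thesis unfolding p_def[symmetric]
  proof (rule has_integral_eq[rotated])
    fix x :: real assume x: "x \<in> {0<..}"
    have "x * (x\<^sup>2) powr (p - 1) = x powr (1 + 2 * (p - 1))"
    proof -
      have "(x\<^sup>2) powr (p - 1) = x powr (2 * (p - 1))"
        using x by (simp add: powr_powr flip: powr_numeral)
      thus ?thesis using x by (simp only: powr_add) simp
    qed
    also have "1 + 2 * (p - 1) = s" by (simp add: p_def field_simps)
    finally show "2 * x * ((x\<^sup>2) powr (p - 1) * exp (- v * x\<^sup>2)) = 2 * x powr s * exp (- v * x\<^sup>2)" by simp
  qed
qed

lemma nn_integral_powr_exp:
  assumes "p > 0" "u > 0"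
  shows "(\<integral>\<^sup>+x. ennreal (indicator {0<..} x * (x powr (p - 1) * exp (- u * x))) \<partial>lborel) = ennreal (Gamma p * u powr (-p))"
  using nn_integral_has_integral_lebesgue[OF _ has_integral_powr_exp[OF assms]] by simp

text \<open>Write 1 / (x^2 + c^2) as the integral of exp(- v (x^2 + c^2)) over v and exchange the
  integrals: the inner one is a Gaussian moment, the outer one a Gamma integral. With p = (s + 1) /
  2 this leaves Gamma(p) Gamma(1 - p), which the reflection formula evaluates.\<close>

lemma nn_integral_powr_over_square_plus:
  assumes s: "-1 < s" "s < 0" and c: "c > 0"
  shows "(\<integral>\<^sup>+x. ennreal (indicator {0<..} x * (2 * x / (x\<^sup>2 + c\<^sup>2) * x powr (s - 1))) \<partial>lborel) =
         ennreal (pi / cos (pi * s / 2) * c powr (s - 1))"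
proof -
  define p where "p = (s + 1) / 2"
  have p: "0 < p" "p < 1" using s by (simp_all add: p_def)
  define g where "g = (\<lambda>x v. ennreal (indicator {0<..} x * indicator {0<..} v * (2 * x powr s * exp (- v * (x\<^sup>2 + c\<^sup>2)))))"
  have [measurable]: "case_prod g \<in> borel_measurable (lborel \<Otimes>\<^sub>M lborel)"
    unfolding g_def by measurable
  have "(\<integral>\<^sup>+x. ennreal (indicator {0<..} x * (2 * x / (x\<^sup>2 + c\<^sup>2) * x powr (s - 1))) \<partial>lborel) =
        (\<integral>\<^sup>+x. \<integral>\<^sup>+v. g x v \<partial>lborel \<partial>lborel)"
  proof (rule nn_integral_cong)
    fix x :: real
    show "ennreal (indicator {0<..} x * (2 * x / (x\<^sup>2 + c\<^sup>2) * x powr (s - 1))) = (\<integral>\<^sup>+v. g x v \<partial>lborel)"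
    proof (cases "x > 0")
      case True
      have pos: "x\<^sup>2 + c\<^sup>2 > 0" using True by (intro add_pos_nonneg) auto
      have "(\<integral>\<^sup>+v. g x v \<partial>lborel) =
          (\<integral>\<^sup>+v. ennreal (2 * x powr s) * ennreal (indicator {0<..} v * (v powr (1 - 1) * exp (- (x\<^sup>2 + c\<^sup>2) * v))) \<partial>lborel)"
        using True by (intro nn_integral_cong) (auto simp: g_def indicator_def ennreal_mult[symmetric] algebra_simps)
      also have "\<dots> = ennreal (2 * x powr s) * ennreal (Gamma 1 * (x\<^sup>2 + c\<^sup>2) powr (-1))"
        by (subst nn_integral_cmult) (use nn_integral_powr_exp[OF _ pos, of 1] in auto)
      also have "\<dots> = ennreal (2 * x powr s / (x\<^sup>2 + c\<^sup>2))"
        using pos by (simp add: ennreal_mult[symmetric] powr_minus_divide)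
      also have "x powr s = x * x powr (s - 1)" using powr_add[of x 1 "s - 1"] True by simp
      finally show ?thesis using True by simp
    qed (simp add: g_def)
  qed
  also have "\<dots> = (\<integral>\<^sup>+v. \<integral>\<^sup>+x. g x v \<partial>lborel \<partial>lborel)"
    by (rule lborel_pair.Fubini'[symmetric]) measurable
  also have "\<dots> = (\<integral>\<^sup>+v. ennreal (Gamma p) * ennreal (indicator {0<..} v * (v powr ((1 - p) - 1) * exp (- c\<^sup>2 * v))) \<partial>lborel)"
  proof (rule nn_integral_cong)
    fix v :: real
    show "(\<integral>\<^sup>+x. g x v \<partial>lborel) = ennreal (Gamma p) * ennreal (indicator {0<..} v * (v powr ((1 - p) - 1) * exp (- c\<^sup>2 * v)))"
    proof (cases "v > 0")
      case True
      have "(\<integral>\<^sup>+x. g x v \<partial>lborel) =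
          (\<integral>\<^sup>+x. ennreal (exp (- c\<^sup>2 * v)) * ennreal (indicator {0<..} x * (2 * x powr s * exp (- v * x\<^sup>2))) \<partial>lborel)"
        using True by (intro nn_integral_cong)
          (auto simp: g_def indicator_def ennreal_mult[symmetric] mult_ac algebra_simps exp_add[symmetric] exp_diff)
      also have "\<dots> = ennreal (exp (- c\<^sup>2 * v)) * ennreal (Gamma p * v powr (-p))"
        by (subst nn_integral_cmult)
           (use nn_integral_has_integral_lebesgue[OF _ has_integral_gaussian_moment[OF s(1) True]] in \<open>auto simp: p_def\<close>)
      finally show ?thesis using True p by (simp add: ennreal_mult[symmetric] mult_ac)
    qed (simp add: g_def)
  qed
  also have "\<dots> = ennreal (Gamma p) * ennreal (Gamma (1 - p) * (c\<^sup>2) powr (-(1 - p)))"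
    by (subst nn_integral_cmult) (use nn_integral_powr_exp[of "1 - p" "c\<^sup>2"] p c in auto)
  also have "\<dots> = ennreal (Gamma p * Gamma (1 - p) * c powr (s - 1))"
  proof -
    have "(c\<^sup>2) powr (-(1 - p)) = c powr (2 * (-(1 - p)))"
      using c by (simp add: powr_powr flip: powr_numeral)
    also have "2 * (-(1 - p)) = s - 1" by (simp add: p_def)
    finally show ?thesis using p by (simp add: ennreal_mult[symmetric] mult_ac)
  qed
  also have "Gamma p * Gamma (1 - p) = pi / cos (pi * s / 2)"
  proof -
    have "complex_of_real (Gamma p * Gamma (1 - p)) = of_real (pi / sin (pi * p))"
      using Gamma_reflection_complex[of "of_real p"]
      by (simp add: Gamma_complex_of_real[symmetric] sin_of_real[symmetric])
    hence "Gamma p * Gamma (1 - p) = pi / sin (pi * p)" by (simp only: of_real_eq_iff)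
    also have "pi * p = pi * s / 2 + pi / 2" by (simp add: p_def field_simps)
    also have "sin (pi * s / 2 + pi / 2) = cos (pi * s / 2)" by (simp add: sin_add)
    finally show ?thesis .
  qed
  finally show ?thesis .
qed

lemma zeta_of_real: "zeta (of_real s) = of_real (Re (zeta (of_real s)))"
proof -
  have "cnj (zeta (of_real s)) = zeta (of_real s)" by (simp flip: zeta_cnj)
  hence "zeta (of_real s) \<in> \<real>" by (simp add: Reals_cnj_iff)
  thus ?thesis by simp
qed

text \<open>The partial fraction series has non-negative terms, so it may be integrated term by
  term; each term yields a power (2 pi n)^(s - 1), and these add up to
  \<open>zeta (1 - s)\<close>.\<close>

lemma nn_integral_hker_partial_fractions:
  assumes s: "-1 < s" "s < 0"
  shows "(\<integral>\<^sup>+x. ennreal (indicator {0<..} x * (hker x * x powr (s - 1))) \<partial>lborel) =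
         ennreal (pi / cos (pi * s / 2) * (2 * pi) powr (s - 1) * Re (zeta (of_real (1 - s))))"
proof -
  define C where "C = pi / cos (pi * s / 2)"
  have "cos (pi * s / 2) > 0"
  proof (rule cos_gt_zero_pi)
    have "pi * (-1) < pi * s" using s pi_gt_zero by (intro mult_strict_left_mono) auto
    thus "- (pi / 2) < pi * s / 2" by simp
    have "pi * s < pi * 1" using s pi_gt_zero by (intro mult_strict_left_mono) auto
    thus "pi * s / 2 < pi / 2" by simp
  qed
  hence C: "C > 0" by (simp add: C_def)
  define f where "f = (\<lambda>n x. indicator {0<..} x * (2 * x / (x\<^sup>2 + (2 * pi * real (Suc n))\<^sup>2) * x powr (s - 1)))"
  have f0: "f n x \<ge> 0" for n x by (auto simp: f_def indicator_def)
  have [measurable]: "(\<lambda>x. ennreal (f n x)) \<in> borel_measurable lborel" for n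
    unfolding f_def by measurable
  have "(\<integral>\<^sup>+x. ennreal (indicator {0<..} x * (hker x * x powr (s - 1))) \<partial>lborel) =
        (\<integral>\<^sup>+x. (\<Sum>n. ennreal (f n x)) \<partial>lborel)"
  proof (rule nn_integral_cong)
    fix x :: real
    have "(\<lambda>n. f n x) sums (indicator {0<..} x * (hker x * x powr (s - 1)))"
    proof (cases "x > 0")
      case True
      thus ?thesis unfolding f_def by (intro sums_mult sums_mult2 hker_sums_partial_fractions)
    qed (auto simp: f_def)
    thus "ennreal (indicator {0<..} x * (hker x * x powr (s - 1))) = (\<Sum>n. ennreal (f n x))"
      using f0 by (subst suminf_ennreal_eq) auto
  qed
  also have "\<dots> = (\<Sum>n. \<integral>\<^sup>+x. ennreal (f n x) \<partial>lborel)"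
    by (rule nn_integral_suminf) measurable
  also have "\<dots> = (\<Sum>n. ennreal (C * (2 * pi * real (Suc n)) powr (s - 1)))"
    unfolding f_def C_def using s by (subst nn_integral_powr_over_square_plus) auto
  also have "\<dots> = ennreal (C * (2 * pi) powr (s - 1) * Re (zeta (of_real (1 - s))))"
  proof (rule suminf_ennreal_eq)
    have "(\<lambda>n. of_nat (Suc n) powr (- of_real (1 - s))) sums zeta (of_real (1 - s))"
      by (rule zeta_sums) (use s in auto)
    hence "(\<lambda>n. Re (of_nat (Suc n) powr (- of_real (1 - s)))) sums Re (zeta (of_real (1 - s)))"
      by (rule sums_Re)
    also have "(\<lambda>n. Re (of_nat (Suc n) powr (- of_real (1 - s)))) = (\<lambda>n. real (Suc n) powr (s - 1))"
    proof
      fix n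
      have "of_nat (Suc n) powr (- of_real (1 - s)) = complex_of_real (real (Suc n) powr (s - 1))"
        using powr_of_real[of "real (Suc n)" "s - 1"] by (simp del: of_nat_Suc)
      thus "Re (of_nat (Suc n) powr (- of_real (1 - s))) = real (Suc n) powr (s - 1)" by simp
    qed
    finally have "(\<lambda>n. C * (2 * pi) powr (s - 1) * real (Suc n) powr (s - 1)) sums
        (C * (2 * pi) powr (s - 1) * Re (zeta (of_real (1 - s))))" by (rule sums_mult)
    thus "(\<lambda>n. C * (2 * pi * real (Suc n)) powr (s - 1)) sums
        (C * (2 * pi) powr (s - 1) * Re (zeta (of_real (1 - s))))"
      by (subst powr_mult) (auto simp: mult_ac)
  qed (use C in auto)
  finally show ?thesis by (simp add: C_def)
qed

text \<open>Each trapezoidal term is itself an integral over u. Exchanging it with the integral over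
  x produces \<open>Gamma (s + 2)\<close> and the trapezoidal error of u^(-s) divided by s (s + 1).
  Since all integrands are non-negative, the exchanges require only measurability.\<close>

lemma nn_integral_hker_trapezoid:
  assumes s: "-1 < s" "s < 0"
  shows "(\<integral>\<^sup>+x. ennreal (indicator {0<..} x * (hker x * x powr (s - 1))) \<partial>lborel) =
         ennreal (Gamma s * Re (zeta (of_real s)))"
proof -
  define G where "G = Gamma (s + 2)"
  have G: "G > 0" using s by (simp add: G_def)
  define b where "b = (\<lambda>n. ((real n powr (-s) + (real n + 1) powr (-s)) / 2 -
      ((real n + 1) powr (1-s) - real n powr (1-s)) / (1-s)) / (s * (s+1)))"
  define k where "k = (\<lambda>n x. exp (- real n * x) * (exp (-x) * (1/2 + 1/x) + 1/2 - 1/x))"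
  define f where "f = (\<lambda>n x u. ennreal (indicator {0<..} x * indicator {real n..real n + 1} u *
      ((u - real n) * (real n + 1 - u) / 2 * x powr (s+1) * exp (- u * x))))"
  have b0: "b n \<ge> 0" for n
    unfolding b_def by (rule has_integral_nonneg[OF trapezoid_kernel_powr[OF s]]) auto
  have k0: "k n x \<ge> 0" if "x > 0" for n x
    unfolding k_def by (rule has_integral_nonneg[OF trapezoid_kernel_exp[OF that]]) auto
  have [measurable]: "case_prod (f n) \<in> borel_measurable (lborel \<Otimes>\<^sub>M lborel)" for n
    unfolding f_def by measurable
  have inner: "(\<integral>\<^sup>+u. f n x u \<partial>lborel) = ennreal (indicator {0<..} x * (k n x * x powr (s - 1)))" for n x
  proof (cases "x > 0")
    case True
    have x2: "x powr (s+1) = x\<^sup>2 * x powr (s-1)"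
      using True powr_add[of x 2 "s-1"] by (simp add: add.commute)
    have "((\<lambda>u. (u - real n) * (real n + 1 - u) / 2 * x\<^sup>2 * exp (- u * x) * x powr (s-1)) has_integral
       k n x * x powr (s-1)) {real n..real n + 1}"
      unfolding k_def by (intro has_integral_mult_left trapezoid_kernel_exp True)
    from nn_integral_has_integral_lebesgue[OF _ this]
    have "(\<integral>\<^sup>+u. ennreal (indicator {real n..real n + 1} u * ((u - real n) * (real n + 1 - u) / 2 * x\<^sup>2 * exp (- u * x) * x powr (s-1))) \<partial>lborel)
      = ennreal (k n x * x powr (s-1))" by auto
    thus ?thesis using True by (simp add: f_def x2 mult_ac)
  qed (simp add: f_def)
  have inner': "(\<integral>\<^sup>+x. f n x u \<partial>lborel) =
      ennreal G * ennreal (indicator {real n..real n + 1} u * ((u - real n) * (real n + 1 - u) / 2 * u powr (-s-2)))" for n u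
  proof (cases "u \<in> {real n..real n + 1} \<and> u > 0")
    case True
    hence u: "u > 0" by simp
    have nn: "(u - real n) * (real n + 1 - u) / 2 \<ge> 0" using True by auto
    have e: "s + 2 - 1 = s + 1" by simp
    have "(\<integral>\<^sup>+x. f n x u \<partial>lborel) = (\<integral>\<^sup>+x. ennreal ((u - real n) * (real n + 1 - u) / 2) *
        ennreal (indicator {0<..} x * (x powr (s + 1) * exp (- u * x))) \<partial>lborel)"
      using True nn by (intro nn_integral_cong) (auto simp: f_def indicator_def ennreal_mult[symmetric] mult_ac)
    also have "\<dots> = ennreal ((u - real n) * (real n + 1 - u) / 2) * ennreal (G * u powr (-(s+2)))"
      unfolding G_def using s by (subst nn_integral_cmult) (use nn_integral_powr_exp[of "s+2" u, unfolded e] u in auto)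
    also have "-(s+2) = -s-2" by simp
    finally show ?thesis using True nn G by (simp add: ennreal_mult[symmetric] mult_ac)
  next
    case False
    hence "u \<notin> {real n..real n + 1} \<or> (u = 0 \<and> n = 0)" by auto
    thus ?thesis by (auto simp: f_def)
  qed
  have kint: "(\<integral>\<^sup>+x. ennreal (indicator {0<..} x * (k n x * x powr (s - 1))) \<partial>lborel) = ennreal (G * b n)" for n
  proof -
    have "(\<integral>\<^sup>+x. ennreal (indicator {0<..} x * (k n x * x powr (s - 1))) \<partial>lborel) = (\<integral>\<^sup>+x. \<integral>\<^sup>+u. f n x u \<partial>lborel \<partial>lborel)"
      by (simp only: inner)
    also have "\<dots> = (\<integral>\<^sup>+u. \<integral>\<^sup>+x. f n x u \<partial>lborel \<partial>lborel)"
      by (rule lborel_pair.Fubini'[symmetric]) measurable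
    also have "\<dots> = ennreal G * ennreal (b n)"
      unfolding inner'
      by (subst nn_integral_cmult)
         (use nn_integral_has_integral_lebesgue[OF _ trapezoid_kernel_powr[OF s, of n]] in \<open>auto simp: b_def\<close>)
    finally show ?thesis using G b0 by (simp add: ennreal_mult)
  qed
  have [measurable]: "(\<lambda>x. ennreal (indicator {0<..} x * (k n x * x powr (s - 1)))) \<in> borel_measurable lborel" for n
    unfolding k_def by measurable
  have "(\<integral>\<^sup>+x. ennreal (indicator {0<..} x * (hker x * x powr (s - 1))) \<partial>lborel) =
        (\<integral>\<^sup>+x. (\<Sum>n. ennreal (indicator {0<..} x * (k n x * x powr (s - 1)))) \<partial>lborel)"
  proof (rule nn_integral_cong)
    fix x :: real
    have "(\<lambda>n. indicator {0<..} x * (k n x * x powr (s - 1))) sums (indicator {0<..} x * (hker x * x powr (s - 1)))"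
    proof (cases "x > 0")
      case True
      thus ?thesis unfolding k_def by (intro sums_mult sums_mult2 hker_sums_trapezoid)
    qed auto
    moreover have "indicator {0<..} x * (k n x * x powr (s - 1)) \<ge> 0" for n
      using k0[of x n] by (auto simp: indicator_def)
    ultimately show "ennreal (indicator {0<..} x * (hker x * x powr (s - 1))) =
        (\<Sum>n. ennreal (indicator {0<..} x * (k n x * x powr (s - 1))))"
      by (subst suminf_ennreal_eq) auto
  qed
  also have "\<dots> = (\<Sum>n. ennreal (G * b n))"
    by (subst nn_integral_suminf) (auto simp: kint)
  also have "\<dots> = ennreal (G * (Re (zeta (of_real s)) / (s * (s + 1))))"
  proof (rule suminf_ennreal_eq)
    define a where "a = (\<lambda>n. ((real n powr (-s) + (real n + 1) powr (-s)) / 2 -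
      ((real n + 1) powr (1-s) - real n powr (1-s)) / (1-s)))"
    define t where "t = (\<lambda>n. (of_nat (Suc n) powr (- of_real s) + of_nat (Suc (Suc n)) powr (- of_real s)) / 2 -
           (of_nat (Suc (Suc n)) powr (1 - of_real s) - of_nat (Suc n) powr (1 - of_real s)) / (1 - of_real s) :: complex)"
    have "t sums (zeta (of_real s) - 1/2 + 1 / (1 - of_real s))"
      unfolding t_def by (rule zeta_trapezoid_sums) (use s in auto)
    also have "t = (\<lambda>n. complex_of_real (a (Suc n)))"
    proof
      fix n
      have p: "of_nat m powr (- of_real s) = complex_of_real (real m powr (-s))"
        "of_nat m powr (1 - of_real s) = complex_of_real (real m powr (1-s))" for m
        using powr_of_real[of "real m" "-s"] powr_of_real[of "real m" "1-s"] by simp_all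
      show "t n = complex_of_real (a (Suc n))"
        unfolding t_def a_def p by (simp add: add.commute)
    qed
    also have "zeta (of_real s) - 1/2 + 1 / (1 - of_real s) = of_real (Re (zeta (of_real s)) - 1/2 + 1 / (1 - s))"
      by (subst zeta_of_real) simp
    finally have "(\<lambda>n. a (Suc n)) sums (Re (zeta (of_real s)) - 1/2 + 1 / (1 - s))"
      by (subst (asm) sums_of_real_iff)
    \<comment> \<open>\<open>zeta_trapezoid_sums\<close> starts with the interval from 1 to 2; the
      interval from 0 to 1 adds exactly the missing 1/2 - 1 / (1 - s).\<close>
    hence "a sums (Re (zeta (of_real s)) - 1/2 + 1 / (1 - s) + a 0)" by (rule sums_Suc)
    also have "a 0 = 1/2 - 1 / (1 - s)" using s by (simp add: a_def)
    finally have "a sums Re (zeta (of_real s))" by simp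
    from sums_mult[OF sums_divide[OF this, of "s * (s+1)"], of G]
    show "(\<lambda>n. G * b n) sums (G * (Re (zeta (of_real s)) / (s * (s + 1))))"
      by (simp add: a_def b_def)
  qed (use G b0 in auto)
  also have "G = s * (s + 1) * Gamma s"
  proof -
    have "s \<notin> \<int>\<^sub>\<le>\<^sub>0" "s + 1 \<notin> \<int>\<^sub>\<le>\<^sub>0"
      using s by (auto elim!: nonpos_Ints_cases)
    hence "Gamma (s + 1 + 1) = (s + 1) * (s * Gamma s)"
      using Gamma_plus1[of "s + 1"] Gamma_plus1[of s] by simp
    thus ?thesis by (simp add: G_def mult_ac add.assoc)
  qed
  finally show ?thesis using s by simp
qed

lemma zeta_functional_equation_real:
  assumes s: "-1 < s" "s < 0"
  shows "Re (zeta (of_real (1 - s))) = 2 * (2 * pi) powr (-s) * cos (pi * s / 2) * Gamma s * Re (zeta (of_real s))"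
proof -
  define Z where "Z = Re (zeta (of_real (1 - s)))"
  define Y where "Y = Re (zeta (of_real s))"
  have cos: "cos (pi * s / 2) > 0"
  proof (rule cos_gt_zero_pi)
    have "pi * (-1) < pi * s" using s pi_gt_zero by (intro mult_strict_left_mono) auto
    thus "- (pi / 2) < pi * s / 2" by simp
    have "pi * s < pi * 1" using s pi_gt_zero by (intro mult_strict_left_mono) auto
    thus "pi * s / 2 < pi / 2" by simp
  qed
  have "Z \<ge> 0"
  proof -
    have "(\<lambda>n. of_nat (Suc n) powr (- of_real (1 - s))) sums zeta (of_real (1 - s))"
      by (rule zeta_sums) (use s in auto)
    hence sums: "(\<lambda>n. Re (of_nat (Suc n) powr (- of_real (1 - s)))) sums Z" unfolding Z_def by (rule sums_Re)
    have "Re (of_nat (Suc n) powr (- of_real (1 - s))) \<ge> 0" for n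
      using powr_of_real[of "real (Suc n)" "s - 1"] by (simp del: of_nat_Suc)
    from sums_le[OF this sums_zero sums] show ?thesis .
  qed
  moreover have "Z \<noteq> 0"
  proof
    assume "Z = 0"
    hence "zeta (of_real (1 - s)) = 0" unfolding Z_def by (subst zeta_of_real) (simp only: of_real_0)
    thus False using zeta_nonzero_Re_gt_1[of "of_real (1 - s)"] s by simp
  qed
  ultimately have Z: "Z > 0" by simp
  define R where "R = pi / cos (pi * s / 2) * (2 * pi) powr (s - 1) * Z"
  have R: "R > 0" using Z cos by (simp add: R_def)
  have "ennreal (Gamma s * Y) = ennreal R"
    using nn_integral_hker_trapezoid[OF s] nn_integral_hker_partial_fractions[OF s]
    by (simp add: R_def Y_def Z_def)
  \<comment> \<open>\<open>ennreal\<close> sends negative reals to 0. The equality returns to the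
    reals because \<open>R\<close> is strictly positive, for which \<open>Z > 0\<close> was needed;
    the sign of \<open>Gamma s * Y\<close> is not known in advance.\<close>
  hence "Gamma s * Y = R" using R by (cases "Gamma s * Y \<ge> 0") (auto simp: ennreal_neg)
  hence "2 * (2 * pi) powr (-s) * cos (pi * s / 2) * Gamma s * Y = (2 * pi) * (2 * pi) powr (-s) * (2 * pi) powr (s - 1) * Z"
    using cos by (simp add: R_def mult.assoc)
  also have "(2 * pi) * (2 * pi) powr (-s) * (2 * pi) powr (s - 1) = (2 * pi) powr (1 + (-s) + (s - 1))"
    unfolding powr_add by simp
  also have "\<dots> = 1" by simp
  finally show ?thesis by (simp add: Y_def Z_def)
qed

text \<open>Both sides are holomorphic off the integers, and removing a countable closed set leaves
  the plane connected, so the identity propagates from the real interval (-1, 0).\<close>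

lemma zeta_functional_equation:
  assumes w: "w \<notin> \<int>"
  shows "zeta (1 - w) = 2 * of_real (2 * pi) powr (-w) * cos (of_real pi * w / 2) * Gamma w * zeta w"
proof -
  define f where "f = (\<lambda>w. zeta (1 - w) - 2 * of_real (2 * pi) powr (-w) * cos (of_real pi * w / 2) * Gamma w * zeta w)"
  define D where "D = - (\<int> :: complex set)"
  have cl: "closed (\<int> :: complex set)" by (rule closed_Ints)
  have D1: "1 \<notin> D" by (simp add: D_def)
  have z1: "(zeta \<circ> (\<lambda>w. 1 - w)) holomorphic_on D"
  proof (rule holomorphic_on_compose_gen[OF _ zeta_holomorphic])
    show "(\<lambda>w. 1 - w) ` D \<subseteq> - {1}" by (auto simp: D_def)
  qed (intro holomorphic_intros)
  have "f w = 0"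
  proof (rule analytic_continuation[of f D "of_real ` {-1<..<0}" "of_real (-1/2)"])
    show "f holomorphic_on D"
      unfolding f_def using z1[unfolded o_def] zeta_holomorphic_on[OF D1] nonpos_Ints_subset_Ints
      by (intro holomorphic_intros) (auto simp: D_def dest!: subsetD)
    show "open D" using cl by (simp add: D_def open_Compl)
    have "connected (UNIV - (\<int> :: complex set))"
      by (rule connected_open_diff_countable) (auto simp: Ints_def)
    thus "connected D" by (simp add: D_def Compl_eq_Diff_UNIV)
    show "of_real ` {-1<..<0} \<subseteq> D"
    proof safe
      fix x :: real assume x: "x \<in> {-1<..<0}"
      have "x \<notin> \<int>" using x by (auto elim!: Ints_cases)
      thus "complex_of_real x \<in> D" by (simp add: D_def of_real_in_Ints_iff)
    qed
    have "(-1/2 :: real) \<notin> \<int>" by (auto elim!: Ints_cases simp: field_simps) presburger?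
    thus "complex_of_real (-1/2) \<in> D" unfolding D_def by (simp only: Compl_iff of_real_in_Ints_iff) simp
    show "complex_of_real (-1/2) islimpt of_real ` {-1<..<0}"
      unfolding islimpt_approachable
    proof (intro allI impI)
      fix e :: real assume e: "e > 0"
      define d where "d = min (e / 2) (1 / 4)"
      have d: "0 < d" "d < e" "d \<le> 1/4" using e by (auto simp: d_def)
      have "dist (complex_of_real (-1/2 + d)) (complex_of_real (-1/2)) = d"
        unfolding dist_of_real using d by (simp add: dist_real_def)
      moreover have "-1/2 + d \<in> {-1<..<0}" using d by auto
      moreover have "complex_of_real (-1/2 + d) \<noteq> complex_of_real (-1/2)" using d by (simp only: of_real_eq_iff)
      ultimately show "\<exists>x'\<in>complex_of_real ` {-1<..<0}. x' \<noteq> complex_of_real (-1/2) \<and> dist x' (complex_of_real (-1/2)) < e"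
        using d by (metis imageI)
    qed
    show "w \<in> D" using w by (simp add: D_def)
    fix z assume "z \<in> complex_of_real ` {-1<..<0}"
    then obtain s where s: "z = of_real s" "-1 < s" "s < 0" by auto
    have a: "of_real (2 * pi) powr (-z) = of_real ((2 * pi) powr (-s))"
      using powr_of_real[of "2*pi" "-s"] s by simp
    have b: "cos (of_real pi * z / 2) = of_real (cos (pi * s / 2))"
      by (simp add: s flip: cos_of_real)
    have c: "zeta (1 - z) = of_real (Re (zeta (of_real (1 - s))))"
    proof -
      have "1 - z = of_real (1 - s)" using s by simp
      thus ?thesis using zeta_of_real[of "1 - s"] by (rule ssubst)
    qed
    have d: "Gamma z = of_real (Gamma s)" by (simp add: s Gamma_complex_of_real)
    have e: "zeta z = of_real (Re (zeta (of_real s)))" unfolding s(1) by (rule zeta_of_real)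
    show "f z = 0" unfolding f_def a b c d e using zeta_functional_equation_real[OF s(2,3)] by simp
  qed
  thus ?thesis by (simp add: f_def)
qed

section \<open>Change of argument\<close>

text \<open>The map f / (2 A - f) carries the half-plane Re < A into the unit disc and fixes 0, so
  Schwarz's lemma applies to it on the rescaled disc; solving for \<open>f\<close> gives the
  bound.\<close>

lemma borel_caratheodory:
  assumes holo: "f holomorphic_on ball c R" and f0: "f c = 0"
    and R: "0 < R" and A: "\<And>z. z \<in> ball c R \<Longrightarrow> Re (f z) < A"
    and z: "dist c z \<le> r" "r < R"
  shows "norm (f z) \<le> 2 * A * r / (R - r)"
proof -
  have A0: "A > 0" using A[of c] f0 R by simp
  define \<phi> where "\<phi> = (\<lambda>\<xi>. f (c + of_real R * \<xi>) / (2 * of_real A - f (c + of_real R * \<xi>)))"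
  have in_ball: "c + of_real R * \<xi> \<in> ball c R" if "norm \<xi> < 1" for \<xi>
    using that R by (simp add: dist_norm norm_mult)
  have nz: "2 * of_real A - f w \<noteq> 0" and lt: "norm (f w) < norm (2 * of_real A - f w)" if "w \<in> ball c R" for w
  proof -
    have "(norm (2 * of_real A - f w))\<^sup>2 - (norm (f w))\<^sup>2 = 4 * A * (A - Re (f w))"
      unfolding cmod_power2 by (simp add: power2_eq_square algebra_simps)
    also have "\<dots> > 0" using A[OF that] A0 by simp
    finally have "(norm (f w))\<^sup>2 < (norm (2 * of_real A - f w))\<^sup>2" by simp
    thus "norm (f w) < norm (2 * of_real A - f w)" by (rule power2_less_imp_less) simp
    thus "2 * of_real A - f w \<noteq> 0" by auto
  qed
  have hol: "\<phi> holomorphic_on ball 0 1"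
  proof -
    have "(f \<circ> (\<lambda>\<xi>. c + of_real R * \<xi>)) holomorphic_on ball 0 1"
      by (rule holomorphic_on_compose_gen[OF _ holo]) (use in_ball in \<open>auto intro!: holomorphic_intros\<close>)
    thus ?thesis unfolding \<phi>_def o_def
      by (intro holomorphic_intros) (use nz in_ball in auto)
  qed
  define \<xi> where "\<xi> = (z - c) / of_real R"
  have z_eq: "z = c + of_real R * \<xi>" using R by (simp add: \<xi>_def)
  have \<xi>: "norm \<xi> \<le> r / R" using z R
    by (simp add: \<xi>_def norm_divide dist_norm norm_minus_commute divide_right_mono)
  have r0: "0 \<le> r" using z(1) zero_le_dist order_trans by blast
  have \<xi>1: "norm \<xi> < 1" using \<xi> z(2) R by (smt (verit) divide_less_eq_1_pos)
  have "norm (\<phi> \<xi>) \<le> norm \<xi>"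
  proof (rule Schwarz_Lemma(1)[OF hol _ _ \<xi>1])
    show "\<phi> 0 = 0" by (simp add: \<phi>_def f0)
    show "norm (\<phi> w) < 1" if "norm w < 1" for w
      using lt[OF in_ball[OF that]] nz[OF in_ball[OF that]] by (simp add: \<phi>_def norm_divide)
  qed
  hence "norm (\<phi> \<xi>) \<le> r / R" using \<xi> by linarith
  hence "norm (f z) \<le> r / R * norm (2 * of_real A - f z)"
    using nz[OF in_ball[OF \<xi>1]] by (simp add: \<phi>_def z_eq[symmetric] norm_divide pos_divide_le_eq)
  also have "\<dots> \<le> r / R * (2 * A + norm (f z))"
    using r0 R A0 norm_triangle_ineq4[of "2 * of_real A" "f z"]
    by (intro mult_left_mono) (auto simp: norm_mult)
  finally have "R * norm (f z) \<le> r * (2 * A + norm (f z))" using R by (simp add: field_simps)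
  hence "(R - r) * norm (f z) \<le> 2 * A * r" by (simp add: algebra_simps)
  thus ?thesis using z by (simp add: pos_le_divide_eq mult.commute)
qed

text \<open>Seen from a point off the segment, the direction turns by at most pi along it; this is
  the bound 1/2 for the winding number of a segment.\<close>

lemma Im_integral_inverse_linepath:
  assumes "w \<notin> closed_segment a b"
  shows "\<bar>Im (contour_integral (linepath a b) (\<lambda>z. 1 / (z - w)))\<bar> \<le> pi"
proof (cases "a = b")
  case False
  have "\<bar>Re (winding_number (linepath a b) w)\<bar> \<le> 1 / 2"
    using winding_number_lt_half_linepath[OF assms] by simp
  moreover have "contour_integral (linepath a b) (\<lambda>z. 1 / (z - w)) = 2 * pi * \<i> * winding_number (linepath a b) w"
    using assms by (subst winding_number_valid_path) auto
  hence "Im (contour_integral (linepath a b) (\<lambda>z. 1 / (z - w))) = 2 * pi * Re (winding_number (linepath a b) w)"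
    by simp
  ultimately show ?thesis by (simp add: abs_mult)
qed auto

text \<open>Without zeros there is a logarithm \<open>g\<close>, and Re g exceeds its value at the
  centre by at most ln(M / m). Borel-Caratheodory controls g - g(c) at each of the two endpoints,
  which doubles the constant 2.\<close>

lemma arg_change_zero_free:
  assumes holo: "f holomorphic_on ball c R" and nz: "\<And>z. z \<in> ball c R \<Longrightarrow> f z \<noteq> 0"
    and M: "\<And>z. z \<in> ball c R \<Longrightarrow> norm (f z) \<le> M"
    and m: "0 < m" "m \<le> norm (f c)"
    and r: "0 < r" "r < R" and ab: "dist c a \<le> r" "dist c b \<le> r"
  shows "norm (contour_integral (linepath a b) (\<lambda>z. deriv f z / f z)) \<le> 4 * (ln (M / m) + 1) * r / (R - r)"
proof -
  obtain g where g: "g holomorphic_on ball c R" "\<And>z. z \<in> ball c R \<Longrightarrow> exp (g z) = f z"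
    using holomorphic_logarithm_exists[OF convex_ball open_ball holo nz, of c] r by (metis centre_in_ball order.strict_trans)
  have c: "c \<in> ball c R" using r by auto
  have M0: "M > 0" using M[OF c] m by linarith
  \<comment> \<open>The summand 1 makes the bound on the real part strict, as
    \<open>borel_caratheodory\<close> demands.\<close>
  define A where "A = ln (M / m) + 1"
  have bound: "norm (g z - g c) \<le> 2 * A * r / (R - r)" if "dist c z \<le> r" for z
  proof (rule borel_caratheodory[where f = "\<lambda>z. g z - g c" and c = c])
    show "(\<lambda>z. g z - g c) holomorphic_on ball c R" by (intro holomorphic_intros g)
    fix w assume w: "w \<in> ball c R"
    have "Re (g w - g c) = ln (norm (f w)) - ln (norm (f c))"
      using g(2)[OF w] g(2)[OF c] by (metis ln_exp minus_complex.simps(1) norm_exp_eq_Re)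
    also have "\<dots> \<le> ln M - ln m"
      using M[OF w] m M0 nz[OF w] nz[OF c] by (intro diff_mono) (auto simp: ln_le_cancel_iff)
    also have "\<dots> < A" using M0 m by (simp add: A_def ln_div)
    finally show "Re (g w - g c) < A" .
  qed (use that r in auto)
  have seg: "closed_segment a b \<subseteq> ball c R"
    by (rule closed_segment_subset) (use ab r in auto)
  have der: "(g has_field_derivative deriv f z / f z) (at z within ball c R)" if z: "z \<in> ball c R" for z
  proof -
    have "((\<lambda>z. exp (g z)) has_field_derivative exp (g z) * deriv g z) (at z)"
      by (auto intro!: derivative_eq_intros holomorphic_derivI[OF g(1)] z)
    hence "(f has_field_derivative exp (g z) * deriv g z) (at z)"
      by (rule has_field_derivative_transform_within_open[OF _ open_ball z]) (use g in auto)
    hence "deriv g z = deriv f z / f z" using nz[OF z] g(2)[OF z]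
      by (auto dest!: DERIV_imp_deriv simp: field_simps)
    thus ?thesis using holomorphic_derivI[OF g(1) open_ball z] by simp
  qed
  have "((\<lambda>z. deriv f z / f z) has_contour_integral (g (pathfinish (linepath a b)) - g (pathstart (linepath a b)))) (linepath a b)"
    by (rule contour_integral_primitive[OF der]) (use seg in auto)
  hence "contour_integral (linepath a b) (\<lambda>z. deriv f z / f z) = (g b - g c) - (g a - g c)"
    by (simp add: contour_integral_unique)
  also have "norm \<dots> \<le> 2 * A * r / (R - r) + 2 * A * r / (R - r)"
    using bound[OF ab(1)] bound[OF ab(2)] norm_triangle_ineq4[of "g b - g c" "g a - g c"] by linarith
  also have "\<dots> = 4 * A * r / (R - r)" by (simp add: add_divide_distrib[symmetric])
  finally show ?thesis unfolding A_def .
qed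

text \<open>Zeros in the disc are divided out one at a time by Blaschke factors; each one contributes
  at most \<open>2 * pi\<close> and increases the value at the centre by the factor \<open>R / r1\<close>.\<close>
lemma arg_change_blaschke:
  assumes S: "open S" "cball c R \<subseteq> S"
    and r: "0 < r" "r < r1" "r1 < R" and ab: "dist c a \<le> r" "dist c b \<le> r" and m: "0 < m"
    and f: "f holomorphic_on S" "\<And>z. z \<in> cball c R \<Longrightarrow> norm (f z) \<le> M" "m \<le> norm (f c)"
      "\<And>z. z \<in> closed_segment a b \<Longrightarrow> f z \<noteq> 0" "M < norm (f c) * (R / r1) ^ n"
  shows "\<bar>Im (contour_integral (linepath a b) (\<lambda>z. deriv f z / f z))\<bar>
           \<le> 2 * pi * n + 4 * (ln (M / m) + 1) * r / (r1 - r)"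
  using f
proof (induction n arbitrary: f)
  case 0
  \<comment> \<open>For n = 0 the last assumption reads M < norm (f c), which contradicts the bound
    on the disc. This is how the number of zeros that can be removed is limited.\<close>
  have "c \<in> cball c R" using r by auto
  from 0(2)[OF this] 0(5) show ?case by simp
next
  case (Suc n)
  have cR: "c \<in> cball c R" using r by auto
  have "m \<le> M" using Suc.prems(2)[OF cR] Suc.prems(3) by linarith
  hence lnM: "ln (M / m) \<ge> 0" using m by simp
  have seg: "closed_segment a b \<subseteq> cball c r"
    by (rule closed_segment_subset) (use ab in auto)
  show ?case
  proof (cases "\<exists>\<rho>\<in>ball c r1. f \<rho> = 0")
    case False
    have sub: "ball c r1 \<subseteq> S" "ball c r1 \<subseteq> cball c R" using S r by (auto intro: order_trans)
    have "norm (contour_integral (linepath a b) (\<lambda>z. deriv f z / f z)) \<le> 4 * (ln (M / m) + 1) * r / (r1 - r)"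
      by (rule arg_change_zero_free[where c = c])
         (use False Suc.prems r ab m sub in \<open>auto intro: holomorphic_on_subset\<close>)
    moreover have "0 \<le> 2 * pi * real (Suc n)" by simp
    ultimately show ?thesis
      using abs_Im_le_cmod[of "contour_integral (linepath a b) (\<lambda>z. deriv f z / f z)"] by linarith
  next
    case True
    then obtain \<rho> where \<rho>: "dist c \<rho> < r1" "f \<rho> = 0" by auto
    define d where "d = cnj (\<rho> - c)"
    have nd: "norm d < r1" using \<rho>(1) by (simp add: d_def dist_norm norm_minus_commute complex_mod_cnj del: complex_cnj_diff)
    have \<rho>c: "\<rho> \<noteq> c" using \<rho>(2) Suc.prems(3) m by auto
    hence d0: "d \<noteq> 0" by (simp add: d_def)
    \<comment> \<open>The quotient f / (z - \<rho>) with its removable singularity filled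
      in.\<close>
    define h where "h = (\<lambda>z. if z = \<rho> then deriv f \<rho> else (f z - f \<rho>) / (z - \<rho>))"
    \<comment> \<open>\<open>B\<close> has the modulus of z - \<rho> on the circle and no zero
      inside, so multiplying by it restores the bound M that dividing by z - \<rho> may have
      spoiled.\<close>
    define B where "B = (\<lambda>z. (of_real (R\<^sup>2) - (z - c) * d) / of_real R)"
    define g where "g = (\<lambda>z. h z * B z)"
    have holh: "h holomorphic_on S" unfolding h_def by (rule pole_lemma_open[OF Suc.prems(1) S(1)])
    have holB: "B holomorphic_on S" unfolding B_def by (intro holomorphic_intros) (use r in auto)
    have holg: "g holomorphic_on S" unfolding g_def by (intro holomorphic_intros holh holB)
    have fh: "f z = (z - \<rho>) * h z" for z by (simp add: h_def \<rho>(2))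
    have B_sphere: "norm (B z) = norm (z - \<rho>)" if "dist c z = R" for z
    proof -
      have "of_real (R\<^sup>2) = (z - c) * cnj (z - c)"
        using that by (simp add: dist_norm norm_minus_commute complex_norm_square[symmetric] del: complex_cnj_diff)
      hence "of_real (R\<^sup>2) - (z - c) * d = (z - c) * cnj (z - \<rho>)" by (simp add: d_def algebra_simps)
      thus ?thesis using that r unfolding B_def
        by (simp add: norm_divide norm_mult dist_norm norm_minus_commute del: complex_cnj_diff)
    qed
    have g_le: "norm (g z) \<le> M" if "z \<in> cball c R" for z
    proof (rule maximum_modulus_frontier[of g "cball c R"])
      show "g holomorphic_on interior (cball c R)"
        by (rule holomorphic_on_subset[OF holg]) (use S in auto)
      show "continuous_on (closure (cball c R)) g"
        by (rule holomorphic_on_imp_continuous_on[OF holomorphic_on_subset[OF holg]]) (use S in auto)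
      fix w assume "w \<in> frontier (cball c R)"
      hence w: "dist c w = R" by (simp add: frontier_cball)
      have "norm (g w) = norm (f w)" by (simp add: g_def fh norm_mult B_sphere[OF w] mult.commute)
      thus "norm (g w) \<le> M" using Suc.prems(2)[of w] w by simp
    qed (use that in auto)
    have gc: "norm (f c) * (R / r1) \<le> norm (g c)"
    proof -
      have "g c = h c * of_real R" using r by (simp add: g_def B_def power2_eq_square)
      hence "norm (g c) = norm (h c) * R" using r by (simp add: norm_mult)
      moreover have "norm (f c) = norm d * norm (h c)" unfolding fh[of c]
        by (simp add: norm_mult d_def complex_mod_cnj norm_minus_commute del: complex_cnj_diff)
      moreover have "norm d * norm (h c) * (R / r1) \<le> r1 * norm (h c) * (R / r1)"
        using nd r by (intro mult_right_mono) auto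
      ultimately show ?thesis using r by simp
    qed
    have fc: "norm (f c) > 0" using Suc.prems(3) m by linarith
    have "norm (f c) * 1 \<le> norm (f c) * (R / r1)" using r fc by (intro mult_left_mono) auto
    hence mg: "m \<le> norm (g c)" using gc Suc.prems(3) by linarith
    have B0: "of_real (R\<^sup>2) - (z - c) * d \<noteq> 0" if "z \<in> cball c r" for z
    proof -
      have "norm ((z - c) * d) \<le> r * r1" unfolding norm_mult
        using that nd r by (intro mult_mono) (auto simp: dist_norm norm_minus_commute)
      also have "\<dots> < R * R" using r by (intro mult_strict_mono) auto
      also have "R * R = norm (of_real (R\<^sup>2) :: complex)"
        by (simp only: norm_of_real) (simp add: power2_eq_square)
      finally have "norm ((z - c) * d) < norm (of_real (R\<^sup>2) :: complex)" .
      thus ?thesis by auto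
    qed
    have g0: "g z \<noteq> 0" if "z \<in> closed_segment a b" for z
      using Suc.prems(4)[OF that] B0[of z] seg that r unfolding fh[of z] by (auto simp: g_def B_def)
    have "norm (f c) * (R / r1) * (R / r1) ^ n \<le> norm (g c) * (R / r1) ^ n"
      using gc r by (intro mult_right_mono) auto
    hence Mg: "M < norm (g c) * (R / r1) ^ n" using Suc.prems(5) by (simp add: mult_ac)
    note IH = Suc.IH[OF holg g_le mg g0 Mg]
    \<comment> \<open>The mirror image of \<rho> in the circle, where \<open>B\<close> vanishes. The
      logarithmic derivatives of \<open>f\<close> and \<open>g\<close> thus differ by 1 / (z -
      \<rho>) - 1 / (z - w), and each of the two terms turns the argument by at most pi.\<close>
    define w where "w = c + of_real (R\<^sup>2) / d"
    have \<rho>_seg: "\<rho> \<notin> closed_segment a b" using Suc.prems(4) \<rho>(2) by auto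
    have w_seg: "w \<notin> closed_segment a b"
    proof
      assume "w \<in> closed_segment a b"
      hence "of_real (R\<^sup>2) - (w - c) * d \<noteq> 0" using B0 seg by blast
      thus False using d0 by (simp add: w_def)
    qed
    have segS: "closed_segment a b \<subseteq> S" using seg S r by (auto intro!: order_trans[OF seg])
    have eq: "deriv f z / f z = deriv g z / g z + 1 / (z - \<rho>) - 1 / (z - w)" if z: "z \<in> closed_segment a b" for z
    proof -
      have zS: "z \<in> S" using z segS by auto
      have z\<rho>: "z \<noteq> \<rho>" and zw: "z \<noteq> w" using z \<rho>_seg w_seg by auto
      have h0: "h z \<noteq> 0" using Suc.prems(4)[OF z] unfolding fh[of z] by auto
      have "(z - w) * d = (z - c) * d - of_real (R\<^sup>2)" using d0 by (simp add: w_def algebra_simps)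
      hence Bw: "B z = - ((z - w) * d) / of_real R" by (simp add: B_def)
      have "((\<lambda>z. (z - \<rho>) * h z) has_field_derivative h z + (z - \<rho>) * deriv h z) (at z)"
        by (auto intro!: derivative_eq_intros holomorphic_derivI[OF holh S(1) zS])
      hence "deriv f z = h z + (z - \<rho>) * deriv h z" unfolding fh[symmetric] by (rule DERIV_imp_deriv)
      hence 1: "deriv f z / f z = 1 / (z - \<rho>) + deriv h z / h z"
        using h0 z\<rho> unfolding fh[of z] by (simp add: field_simps)
      have "(g has_field_derivative deriv h z * B z + h z * (- d / of_real R)) (at z)"
      proof -
        have "(B has_field_derivative - d / of_real R) (at z)"
          unfolding B_def using r by (auto intro!: derivative_eq_intros)
        thus ?thesis unfolding g_def
          by (auto intro!: derivative_eq_intros holomorphic_derivI[OF holh S(1) zS])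
      qed
      hence "deriv g z = deriv h z * B z + h z * (- d / of_real R)" by (rule DERIV_imp_deriv)
      hence "deriv g z / g z = deriv h z / h z + (- d / of_real R) / B z"
        using h0 g0[OF z] by (auto simp: g_def field_simps)
      also have "(- d / of_real R) / B z = 1 / (z - w)"
        unfolding Bw using d0 r zw by (simp add: field_simps)
      finally show ?thesis unfolding 1 by simp
    qed
    have int1: "(\<lambda>z. deriv g z / g z) contour_integrable_on linepath a b"
      by (intro contour_integrable_continuous_linepath holomorphic_on_imp_continuous_on
            holomorphic_on_divide holomorphic_on_subset[OF holomorphic_deriv[OF holg S(1)]]
            holomorphic_on_subset[OF holg]) (use segS g0 in auto)
    have int2: "(\<lambda>z. 1 / (z - \<rho>)) contour_integrable_on linepath a b"
               "(\<lambda>z. 1 / (z - w)) contour_integrable_on linepath a b"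
      by (intro contour_integrable_continuous_linepath continuous_intros; use \<rho>_seg w_seg in auto)+
    have "contour_integral (linepath a b) (\<lambda>z. deriv f z / f z) =
          contour_integral (linepath a b) (\<lambda>z. deriv g z / g z + 1 / (z - \<rho>) - 1 / (z - w))"
      by (rule contour_integral_cong) (use eq in auto)
    also have "\<dots> = contour_integral (linepath a b) (\<lambda>z. deriv g z / g z) +
        contour_integral (linepath a b) (\<lambda>z. 1 / (z - \<rho>)) - contour_integral (linepath a b) (\<lambda>z. 1 / (z - w))"
      by (simp add: contour_integral_add contour_integral_diff contour_integrable_add int1 int2)
    finally have "Im (contour_integral (linepath a b) (\<lambda>z. deriv f z / f z)) =
        Im (contour_integral (linepath a b) (\<lambda>z. deriv g z / g z)) +
        Im (contour_integral (linepath a b) (\<lambda>z. 1 / (z - \<rho>))) -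
        Im (contour_integral (linepath a b) (\<lambda>z. 1 / (z - w)))" by simp
    moreover have "2 * pi * real (Suc n) = 2 * pi * real n + 2 * pi" by (simp add: algebra_simps)
    ultimately show ?thesis
      using IH Im_integral_inverse_linepath[OF \<rho>_seg] Im_integral_inverse_linepath[OF w_seg]
      by linarith
  qed
qed

text \<open>Zeros are removed in the disc with radius \<open>r1\<close> halfway between
  \<open>r\<close> and \<open>R\<close>. Each removal raises the value at the centre by at least R /
  r1 while the bound M persists, so slightly more than ln(M / m) / ln(R / r1) removals exhaust them,
  and ln(R / r1) is at least (R - r) / (2 R).\<close>

lemma arg_change_bound:
  assumes S: "open S" "cball c R \<subseteq> S"
    and r: "0 < r" "r < R" and ab: "dist c a \<le> r" "dist c b \<le> r" and m: "0 < m"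
    and f: "f holomorphic_on S" "\<And>z. z \<in> cball c R \<Longrightarrow> norm (f z) \<le> M" "m \<le> norm (f c)"
      "\<And>z. z \<in> closed_segment a b \<Longrightarrow> f z \<noteq> 0"
  shows "\<bar>Im (contour_integral (linepath a b) (\<lambda>z. deriv f z / f z))\<bar> \<le> 24 * (ln (M / m) + 1) * R / (R - r)"
proof -
  define L where "L = ln (M / m)"
  define r1 where "r1 = (R + r) / 2"
  have r1: "r < r1" "r1 < R" "0 < r1" using r by (auto simp: r1_def)
  have cR: "c \<in> cball c R" using r by auto
  have mM: "m \<le> M" using f(2)[OF cR] f(3) by linarith
  hence L: "L \<ge> 0" using m by (simp add: L_def)
  define q where "q = ln (R / r1)"
  have "ln (r1 / R) \<le> r1 / R - 1" using r1 by (intro ln_le_minus_one) auto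
  hence q: "q \<ge> (R - r) / (2 * R)" using r r1 by (simp add: q_def ln_div r1_def field_simps)
  have q0: "q > 0" using r1 by (simp add: q_def)
  \<comment> \<open>The extra 1 makes n exceed L / q strictly, since M has to lie strictly below the
    enlarged value at the centre.\<close>
  define n where "n = nat \<lceil>L / q\<rceil> + 1"
  have n: "real n > L / q" "real n \<le> L / q + 2"
    using L q0 by (auto simp: n_def) linarith+
  have "M < norm (f c) * (R / r1) ^ n"
  proof -
    have "M / m = exp L" using mM m by (simp add: L_def)
    also have "L < n * q" using n(1) q0 by (simp add: pos_divide_less_eq)
    hence "exp L < exp (n * q)" by simp
    also have "exp (n * q) = (R / r1) ^ n" using r1 r by (simp add: q_def exp_of_nat_mult)
    finally have "M < m * (R / r1) ^ n" using m by (simp add: field_simps)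
    also have "\<dots> \<le> norm (f c) * (R / r1) ^ n" using f(3) r1 by (intro mult_right_mono) auto
    finally show ?thesis .
  qed
  from arg_change_blaschke[OF S r(1) r1(1,2) ab m f this]
  have "\<bar>Im (contour_integral (linepath a b) (\<lambda>z. deriv f z / f z))\<bar> \<le> 2 * pi * n + 4 * (L + 1) * r / (r1 - r)"
    by (simp add: L_def)
  also have "\<dots> \<le> 8 * real n + 8 * (L + 1) * (R / (R - r))"
  proof (intro add_mono)
    show "2 * pi * n \<le> 8 * real n" using pi_less_4 by (intro mult_right_mono) auto
    have "4 * (L + 1) * r / (r1 - r) = 8 * (L + 1) * (r / (R - r))"
      using r by (simp add: r1_def field_simps)
    also have "\<dots> \<le> 8 * (L + 1) * (R / (R - r))" using r L by (intro mult_left_mono divide_right_mono) auto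
    finally show "4 * (L + 1) * r / (r1 - r) \<le> 8 * (L + 1) * (R / (R - r))" .
  qed
  also have "real n \<le> 2 * L * (R / (R - r)) + 2 * (R / (R - r))"
  proof -
    have "L / q \<le> L / ((R - r) / (2 * R))" using q L r q0 by (intro divide_left_mono) auto
    also have "\<dots> = 2 * L * (R / (R - r))" by simp
    finally have "L / q \<le> 2 * L * (R / (R - r))" .
    moreover have "1 \<le> R / (R - r)" using r by simp
    ultimately show ?thesis using n(2) by linarith
  qed
  finally have "\<bar>Im (contour_integral (linepath a b) (\<lambda>z. deriv f z / f z))\<bar> \<le>
      8 * (2 * L * (R / (R - r)) + 2 * (R / (R - r))) + 8 * (L + 1) * (R / (R - r))" by simp
  also have "\<dots> = 24 * (L + 1) * R / (R - r)" by (simp add: algebra_simps add_divide_distrib)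
  finally show ?thesis by (simp add: L_def)
qed

section \<open>Logarithmic derivatives and reflection\<close>

definition zlog :: "complex \<Rightarrow> complex" where
  "zlog s = deriv zeta s / zeta s"

definition zquot :: "complex \<Rightarrow> complex" where
  "zquot s = zeta2 s / zeta s"

definition lam :: "complex \<Rightarrow> complex" where
  "lam w = Digamma w - of_real (ln (2 * pi)) - of_real (pi / 2) * tan (of_real pi * w / 2)"

lemma zlog_has_derivative:
  assumes "s \<noteq> 1" "zeta s \<noteq> 0"
  shows "(zlog has_field_derivative zquot s - (zlog s)\<^sup>2) (at s)"
proof -
  have "((\<lambda>s. deriv zeta s / zeta s) has_field_derivative
      (zeta2 s * zeta s - deriv zeta s * deriv zeta s) / (zeta s * zeta s)) (at s)"
    unfolding zeta2_altdef using assms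
    by (intro DERIV_divide holomorphic_derivI[OF zeta_holomorphic] holomorphic_derivI[OF zeta_deriv_holomorphic]) auto
  also have "(zeta2 s * zeta s - deriv zeta s * deriv zeta s) / (zeta s * zeta s) = zquot s - (zlog s)\<^sup>2"
    using assms by (simp add: zquot_def zlog_def power2_eq_square diff_divide_distrib)
  finally show ?thesis by (simp add: zlog_def [abs_def])
qed

lemma cos_half_nonzero:
  assumes "Im w \<noteq> 0"
  shows "cos (of_real pi * w / 2) \<noteq> 0"
proof
  assume "cos (of_real pi * w / 2) = 0"
  then obtain n :: int where "of_real pi * w / 2 = of_real (of_int n * pi) + of_real pi / 2"
    by (auto simp: cos_eq_0)
  hence "Im (of_real pi * w / 2) = 0" by simp
  thus False using assms by simp
qed

lemma not_Ints_if_Im: "Im w \<noteq> 0 \<Longrightarrow> w \<notin> \<int>" "Im w \<noteq> 0 \<Longrightarrow> w \<notin> \<int>\<^sub>\<le>\<^sub>0"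
  by (auto elim!: Ints_cases nonpos_Ints_cases)

lemma tan_has_derivative:
  assumes "Im w \<noteq> 0"
  shows "((\<lambda>w. tan (of_real pi * w / 2)) has_field_derivative
            of_real (pi / 2) * (1 + (tan (of_real pi * w / 2))\<^sup>2)) (at w)"
proof -
  define z where "z = of_real pi * w / 2"
  have c: "cos z \<noteq> 0" using cos_half_nonzero[OF assms] by (simp add: z_def)
  have "((\<lambda>w. tan (of_real pi * w / 2)) has_field_derivative inverse ((cos z)\<^sup>2) * (of_real pi / 2)) (at w)"
    unfolding z_def using c by (auto intro!: derivative_eq_intros simp: z_def)
  also have "inverse ((cos z)\<^sup>2) = 1 + (tan z)\<^sup>2"
    using tan_sec[OF c] by (simp add: power_inverse)
  finally show ?thesis by (simp add: z_def mult.commute)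
qed

lemma lam_has_derivative:
  assumes "Im w \<noteq> 0"
  shows "(lam has_field_derivative Polygamma 1 w -
      of_real (pi\<^sup>2 / 4) * (1 + (tan (of_real pi * w / 2))\<^sup>2)) (at w)"
proof -
  have "(lam has_field_derivative Polygamma 1 w - 0 - of_real (pi / 2) * (of_real (pi / 2) * (1 + (tan (of_real pi * w / 2))\<^sup>2))) (at w)"
    unfolding lam_def[abs_def] using not_Ints_if_Im(2)[OF assms]
    by (intro DERIV_diff DERIV_const DERIV_cmult tan_has_derivative assms)
       (auto intro!: derivative_eq_intros)
  thus ?thesis by (simp add: power2_eq_square mult.assoc)
qed

text \<open>Logarithmic differentiation of the functional equation: off the real axis its factor
  \<open>P\<close> has neither zeros nor poles, and \<open>lam\<close> is P' / P.\<close>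

lemma zlog_reflect:
  assumes w: "Im w \<noteq> 0" "zeta w \<noteq> 0"
  shows "zeta (1 - w) \<noteq> 0" "zlog (1 - w) = - (lam w + zlog w)"
proof -
  define P where "P = (\<lambda>w. 2 * of_real (2 * pi) powr (-w) * cos (of_real pi * w / 2) * Gamma w :: complex)"
  define S where "S = {w :: complex. Im w \<noteq> 0}"
  have "open S" unfolding S_def
    by (intro open_Collect_neq continuous_intros)
  have fe: "zeta (1 - w) = P w * zeta w" if "w \<in> S" for w
    using zeta_functional_equation[of w] that not_Ints_if_Im(1)[of w] by (auto simp: P_def S_def)
  have wS: "w \<in> S" using w by (simp add: S_def)
  have P0: "P w \<noteq> 0" unfolding P_def using cos_half_nonzero[OF w(1)] not_Ints_if_Im(2)[OF w(1)]
    by (auto simp: Gamma_eq_zero_iff)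
  show z1: "zeta (1 - w) \<noteq> 0" using fe[OF wS] P0 w by simp
  have w1: "w \<noteq> 1" "1 - w \<noteq> 1" using w by auto
  have dP: "(P has_field_derivative P w * lam w) (at w)"
  proof -
    have 1: "((\<lambda>w. of_real (2 * pi) powr (-w)) has_field_derivative
        - (of_real (ln (2 * pi)) * of_real (2 * pi) powr (-w))) (at w)" for w :: complex
    proof -
      have "of_real (2 * pi) powr w = exp (w * of_real (ln (2 * pi)))" for w :: complex
        using Ln_of_real[of "2 * pi"] by (simp add: powr_def)
      thus ?thesis by (auto intro!: derivative_eq_intros)
    qed
    define a where "a = complex_of_real (2 * pi) powr (-w)"
    define c where "c = cos (of_real pi * w / 2)"
    define t where "t = sin (of_real pi * w / 2)"
    have c0: "c \<noteq> 0" using cos_half_nonzero[OF w(1)] by (simp add: c_def)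
    have 2: "((\<lambda>w. cos (of_real pi * w / 2)) has_field_derivative (- t * (of_real pi / 2))) (at w)"
      unfolding t_def by (auto intro!: derivative_eq_intros)
    have 3: "(Gamma has_field_derivative Gamma w * Digamma w) (at w)"
      using not_Ints_if_Im(2)[OF w(1)] by (auto intro!: derivative_eq_intros)
    have "((\<lambda>w. of_real (2 * pi) powr (-w) * cos (of_real pi * w / 2) * Gamma w) has_field_derivative
        ((- (of_real (ln (2 * pi)) * a)) * c + (- t * (of_real pi / 2)) * a) * Gamma w + (Gamma w * Digamma w) * (a * c)) (at w)"
      unfolding a_def c_def by (intro DERIV_mult' DERIV_mult 1 2[unfolded c_def] 3)
    from DERIV_cmult[OF this, of 2]
    have "(P has_field_derivative 2 * (((- (of_real (ln (2 * pi)) * a)) * c + (- t * (of_real pi / 2)) * a) * Gamma w + (Gamma w * Digamma w) * (a * c))) (at w)"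
      by (simp add: P_def mult.assoc)
    also have "2 * (((- (of_real (ln (2 * pi)) * a)) * c + (- t * (of_real pi / 2)) * a) * Gamma w + (Gamma w * Digamma w) * (a * c)) = P w * lam w"
      unfolding P_def lam_def tan_def a_def[symmetric] c_def[symmetric] t_def[symmetric]
      using c0 by (simp add: field_simps)
    finally show ?thesis .
  qed
  have "((\<lambda>w. P w * zeta w) has_field_derivative P w * lam w * zeta w + deriv zeta w * P w) (at w)"
    by (intro DERIV_mult dP holomorphic_derivI[OF zeta_holomorphic]) (use w1 in auto)
  moreover have "((\<lambda>w. zeta (1 - w)) has_field_derivative - deriv zeta (1 - w)) (at w)"
  proof -
    have "(zeta has_field_derivative deriv zeta (1 - w)) (at (1 - w))"
      by (rule holomorphic_derivI[OF zeta_holomorphic]) (use w1 in auto)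
    moreover have "((\<lambda>w. 1 - w) has_field_derivative -1) (at w)" by (auto intro!: derivative_eq_intros)
    ultimately show ?thesis using DERIV_chain2 by fastforce
  qed
  hence "((\<lambda>w. P w * zeta w) has_field_derivative - deriv zeta (1 - w)) (at w)"
    by (rule has_field_derivative_transform_within_open[OF _ \<open>open S\<close> wS]) (use fe in auto)
  ultimately have "- deriv zeta (1 - w) = P w * lam w * zeta w + deriv zeta w * P w"
    by (metis DERIV_unique)
  hence "deriv zeta (1 - w) = - (P w * lam w * zeta w + deriv zeta w * P w)" by (metis minus_minus)
  thus "zlog (1 - w) = - (lam w + zlog w)"
    unfolding zlog_def fe[OF wS] using P0 w by (simp add: field_simps)
qed

text \<open>\<open>zlog\<close> satisfies the Riccati relation zlog' = zquot - zlog^2.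
  Differentiating \<open>zlog_reflect\<close> and inserting the relation on both sides gives the
  formula.\<close>

lemma zquot_reflect:
  assumes w: "Im w \<noteq> 0" "zeta w \<noteq> 0"
  shows "zquot (1 - w) = (lam w)\<^sup>2 + deriv lam w + 2 * lam w * zlog w + zquot w"
proof -
  define S where "S = {w :: complex. Im w \<noteq> 0} \<inter> {w. w \<noteq> 1 \<and> zeta w \<noteq> 0}"
  have "open ({w. w \<noteq> 1} \<inter> zeta -` (- {0}))"
    by (rule continuous_open_preimage[OF holomorphic_on_imp_continuous_on[OF zeta_holomorphic_on]])
       (auto simp: open_Compl Collect_neg_eq)
  hence "open {w. w \<noteq> 1 \<and> zeta w \<noteq> 0}" by (simp add: vimage_def Int_def)
  moreover have "open {w :: complex. Im w \<noteq> 0}" by (intro open_Collect_neq continuous_intros)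
  ultimately have S: "open S" unfolding S_def by (rule open_Int[rotated])
  have w1: "w \<noteq> 1" "1 - w \<noteq> 1" using w by auto
  have wS: "w \<in> S" using w w1 by (simp add: S_def)
  have "((\<lambda>w. zlog (1 - w)) has_field_derivative (zquot (1 - w) - (zlog (1 - w))\<^sup>2) * (-1)) (at w)"
    by (rule DERIV_chain2[OF zlog_has_derivative]) (use w1 zlog_reflect[OF w] in \<open>auto intro!: derivative_eq_intros\<close>)
  hence "((\<lambda>w. - (lam w + zlog w)) has_field_derivative (zquot (1 - w) - (zlog (1 - w))\<^sup>2) * (-1)) (at w)"
    by (rule has_field_derivative_transform_within_open[OF _ S wS]) (use zlog_reflect in \<open>auto simp: S_def\<close>)
  moreover have "(lam has_field_derivative deriv lam w) (at w)"
    using lam_has_derivative[OF w(1)] by (simp add: DERIV_imp_deriv)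
  hence "((\<lambda>w. - (lam w + zlog w)) has_field_derivative - (deriv lam w + (zquot w - (zlog w)\<^sup>2))) (at w)"
    by (intro DERIV_minus DERIV_add zlog_has_derivative w w1)
  ultimately have "(zquot (1 - w) - (zlog (1 - w))\<^sup>2) * (-1) = - (deriv lam w + (zquot w - (zlog w)\<^sup>2))"
    by (rule DERIV_unique)
  thus ?thesis unfolding zlog_reflect(2)[OF w] by (simp add: algebra_simps power2_eq_square)
qed

section \<open>Stirling-type estimates for \<open>lam\<close> and its derivative\<close>

lemma Ln_increment_bound:
  assumes "Re z > 0"
  shows "norm (Ln (z + 1) - Ln z - 1 / z) \<le> 1 / (norm z)\<^sup>2"
proof -
  define f where "f = (\<lambda>i::nat. if i = 0 then Ln else if i = 1 then (\<lambda>z. 1 / z) else (\<lambda>z. - (1 / z\<^sup>2)))"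
  define S where "S = closed_segment z (z + 1)"
  have S: "Re x > 0 \<and> norm x \<ge> norm z" if "x \<in> S" for x
  proof -
    have "\<exists>u\<ge>0. u \<le> 1 \<and> x = (1 - u) *\<^sub>R z + u *\<^sub>R (z + 1)"
      using that unfolding S_def in_segment by simp
    then obtain u where u: "0 \<le> u" "u \<le> 1" "x = (1 - u) *\<^sub>R z + u *\<^sub>R (z + 1)"
      by (elim exE conjE)
    have x: "x = z + of_real u" unfolding u(3) by (simp add: scaleR_conv_of_real algebra_simps)
    have "(Re z)\<^sup>2 \<le> (Re z + u)\<^sup>2" using assms u by (intro power_mono) auto
    hence "(norm z)\<^sup>2 \<le> (norm x)\<^sup>2" unfolding x cmod_power2 by simp
    hence "norm z \<le> norm x" by (rule power2_le_imp_le) simp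
    moreover have "Re x > 0" unfolding x using assms u(1) by simp
    ultimately show ?thesis by blast
  qed
  have z0: "norm z > 0" using assms by auto
  have "norm (f 0 (z + 1) - (\<Sum>i\<le>1. f i z * ((z + 1) - z) ^ i / fact i)) \<le> (1 / (norm z)\<^sup>2) * norm ((z + 1) - z) ^ Suc 1 / fact 1"
  proof (rule complex_Taylor[of S])
    show "convex S" by (simp add: S_def)
    fix x assume x: "x \<in> S"
    hence x': "x \<notin> \<real>\<^sub>\<le>\<^sub>0" "x \<noteq> 0" using S[OF x] by (auto simp: complex_nonpos_Reals_iff)
    show "(f i has_field_derivative f (Suc i) x) (at x within S)" if "i \<le> 1" for i
    proof (cases "i = 0")
      case True
      thus ?thesis using x' by (auto simp: f_def inverse_eq_divide intro!: derivative_eq_intros)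
    next
      case False
      hence "i = 1" using that by simp
      thus ?thesis using x' by (auto simp: f_def power2_eq_square intro!: derivative_eq_intros)
    qed
    have "1 / (norm x)\<^sup>2 \<le> 1 / (norm z)\<^sup>2"
      using S[OF x] z0 by (intro divide_left_mono power_mono mult_pos_pos) auto
    thus "norm (f (Suc 1) x) \<le> 1 / (norm z)\<^sup>2" by (simp add: f_def norm_divide norm_power)
  qed (auto simp: S_def)
  thus ?thesis by (simp add: f_def algebra_simps)
qed

lemma sum_inverse_square_shift:
  assumes a: "a > (0::real)"
  shows "(\<Sum>n<m. 1 / (a + real n)\<^sup>2) \<le> 1 / a\<^sup>2 + 1 / a"
proof (cases m)
  case (Suc k)
  have "(\<Sum>n<Suc k. 1 / (a + real n)\<^sup>2) \<le> 1 / a\<^sup>2 + 1 / a - 1 / (a + real k)"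
  proof (induction k)
    case (Suc k)
    define b where "b = a + real k"
    have b: "b > 0" using a by (simp add: b_def)
    have "1 / (b + 1)\<^sup>2 \<le> 1 / (b * (b + 1))"
      using b by (intro divide_left_mono) (auto simp: power2_eq_square)
    also have "\<dots> = 1 / b - 1 / (b + 1)" using b by (simp add: field_simps)
    finally show ?case using Suc.IH by (simp add: b_def algebra_simps)
  qed (simp)
  moreover have "1 / (a + real k) \<ge> 0" using a by simp
  ultimately show ?thesis unfolding Suc by linarith
qed (use a in auto)

text \<open>\<open>Digamma w\<close> is the limit of ln m minus the sum of 1 / (w + n), and
  \<open>Ln\<close> telescopes over the same steps. The difference is therefore a sum of terms
  bounded by 1 / |w + n|^2.\<close>

lemma Digamma_Ln_bound:
  assumes "Re w > 0" "norm w \<ge> 1/4"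
  shows "norm (Digamma w - Ln w) \<le> 10 / norm w"
proof -
  define a where "a = norm w"
  have a: "a \<ge> 1/4" "a > 0" using assms by (auto simp: a_def)
  have w0: "w \<noteq> 0" using assms by auto
  define S where "S = (\<lambda>m. \<Sum>n<m. Ln (w + of_nat n + 1) - Ln (w + of_nat n) - 1 / (w + of_nat n))"
  have bound: "norm (S m) \<le> 10 / a" for m
  proof -
    have "norm (S m) \<le> (\<Sum>n<m. 2 * (1 / (a + real n)\<^sup>2))" unfolding S_def
    proof (rule order_trans[OF norm_sum sum_mono])
      fix n
      have "(Re w)\<^sup>2 + (real n)\<^sup>2 \<le> (Re w + real n)\<^sup>2" using assms by (simp add: power2_sum)
      hence "a\<^sup>2 + (real n)\<^sup>2 \<le> (norm (w + of_nat n))\<^sup>2" unfolding a_def cmod_power2 by simp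
      hence n2: "2 * (a\<^sup>2 + (real n)\<^sup>2) \<le> 2 * (norm (w + of_nat n))\<^sup>2" by simp
      \<comment> \<open>As Re w > 0, |w + n| is comparable with |w| + n up to the factor sqrt 2,
        which reduces the sum to a real one.\<close>
      have "(a + real n)\<^sup>2 \<le> 2 * (a\<^sup>2 + (real n)\<^sup>2)"
        using zero_le_power2[of "a - real n"] by (simp add: power2_sum power2_diff)
      from order_trans[OF this n2] have *: "(a + real n)\<^sup>2 \<le> 2 * (norm (w + of_nat n))\<^sup>2" .
      have "norm (Ln (w + of_nat n + 1) - Ln (w + of_nat n) - 1 / (w + of_nat n)) \<le> 1 / (norm (w + of_nat n))\<^sup>2"
        by (rule Ln_increment_bound) (use assms in auto)
      also have "\<dots> = 2 / (2 * (norm (w + of_nat n))\<^sup>2)" by simp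
      also have "\<dots> \<le> 2 / (a + real n)\<^sup>2"
      proof (rule divide_left_mono[OF *])
        have "a + real n > 0" using a by simp
        thus "0 < 2 * (norm (w + of_nat n))\<^sup>2 * (a + real n)\<^sup>2"
          using * by (metis less_le_trans mult_pos_pos zero_less_power)
      qed auto
      finally show "norm (Ln (w + of_nat n + 1) - Ln (w + of_nat n) - 1 / (w + of_nat n)) \<le> 2 * (1 / (a + real n)\<^sup>2)"
        by simp
    qed
    also have "\<dots> \<le> 2 * (1 / a\<^sup>2 + 1 / a)"
      unfolding sum_distrib_left[symmetric] by (intro mult_left_mono sum_inverse_square_shift a) auto
    \<comment> \<open>Uses a \<ge> 1/4; the constant 10 of the statement is 2 (4 + 1).\<close>
    also have "1 / a\<^sup>2 \<le> 4 / a" using a by (simp add: power2_eq_square field_simps)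
    finally show ?thesis by simp
  qed
  have S_eq: "S m = Ln (w + of_nat m) - Ln w - (\<Sum>n<m. inverse (w + of_nat n))" for m
    by (induction m) (auto simp: S_def algebra_simps inverse_eq_divide)
  have "(\<lambda>m. of_real (ln (real m)) - (\<Sum>n<m. inverse (w + of_nat n))) \<longlonglongrightarrow> Digamma w"
    by (rule Digamma_LIMSEQ[OF w0])
  moreover have "(\<lambda>m. Ln (w + of_nat m) - of_real (ln (real m))) \<longlonglongrightarrow> 0"
  proof -
    have "(\<lambda>m. Ln (1 + w / of_nat m)) \<longlonglongrightarrow> Ln (1 + 0)"
      by (intro tendsto_intros tendsto_divide_0[OF tendsto_const] tendsto_of_nat) auto
    hence "(\<lambda>m. Ln (1 + w / of_nat m)) \<longlonglongrightarrow> 0" by simp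
    moreover have "\<forall>\<^sub>F m in sequentially. Ln (1 + w / of_nat m) = Ln (w + of_nat m) - of_real (ln (real m))"
      using eventually_gt_at_top[of 0]
    proof eventually_elim
      case (elim m)
      have "Ln (of_real (real m) * (1 + w / of_nat m)) = ln (real m) + Ln (1 + w / of_nat m)"
      proof -
        have "Re (1 + w / of_nat m) > 0" using assms elim by (simp add: add_pos_nonneg)
        hence "1 + w / of_nat m \<noteq> 0" by (metis order_less_irrefl zero_complex.sel(1))
        thus ?thesis using elim Ln_times_of_real[of "real m" "1 + w / of_nat m"] by simp
      qed
      moreover have "of_real (real m) * (1 + w / of_nat m) = w + of_nat m" using elim by (simp add: field_simps)
      ultimately show ?case by simp
    qed
    ultimately show ?thesis by (rule Lim_transform_eventually)
  qed
  ultimately have "(\<lambda>m. (of_real (ln (real m)) - (\<Sum>n<m. inverse (w + of_nat n))) +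
      (Ln (w + of_nat m) - of_real (ln (real m))) - Ln w) \<longlonglongrightarrow> Digamma w + 0 - Ln w"
    by (intro tendsto_intros)
  hence "S \<longlonglongrightarrow> Digamma w - Ln w" by (simp add: S_eq[abs_def] algebra_simps)
  hence "(\<lambda>m. norm (S m)) \<longlonglongrightarrow> norm (Digamma w - Ln w)" by (rule tendsto_norm)
  thus ?thesis using bound by (intro LIMSEQ_le_const2) (auto simp: a_def)
qed

text \<open>Deep in the lower half-plane the tangent tends to -i: the sum equals i exp(- i z) / cos
  z, with a numerator of modulus exp(Im z) and a denominator of modulus at least exp(- Im z) /
  4.\<close>

lemma tan_plus_ii_bound:
  assumes "Im z \<le> -1"
  shows "norm (tan z + \<i>) \<le> 4 * exp (2 * Im z)"
proof -
  define q where "q = exp (Im z)"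
  have q: "q > 0" by (simp add: q_def)
  have "q * exp 1 \<le> 1" using assms unfolding q_def exp_add[symmetric] by simp
  moreover have "exp 1 \<ge> (2::real)" using exp_ge_add_one_self[of 1] by simp
  hence "q * 2 \<le> q * exp 1" using q by (intro mult_left_mono) auto
  ultimately have "q * 2 \<le> 1" by linarith
  hence q2: "q \<le> 1/2" by simp
  have e1: "norm (exp (\<i> * z)) = 1 / q" by (simp add: q_def exp_minus inverse_eq_divide)
  have e2: "norm (exp (- (\<i> * z))) = q" by (simp add: q_def)
  have "q \<le> 1 / q / 4"
  proof -
    have "q * q \<le> 1/2 * (1/2)" using q2 q by (intro mult_mono) auto
    thus ?thesis using q by (simp add: field_simps)
  qed
  moreover have "1 / q \<le> norm (exp (\<i> * z) + exp (- (\<i> * z))) + q"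
    using norm_triangle_ineq4[of "exp (\<i> * z) + exp (- (\<i> * z))" "exp (- (\<i> * z))"]
    unfolding add_diff_cancel_right' e1 e2 .
  moreover have "norm (cos z) = norm (exp (\<i> * z) + exp (- (\<i> * z))) / 2"
    unfolding cos_exp_eq by (simp add: norm_divide)
  ultimately have c: "norm (cos z) \<ge> (1 / q) / 4" using q by linarith
  have q0: "1 / q / 4 > 0" using q by simp
  hence c0: "cos z \<noteq> 0" using c by auto
  have "tan z + \<i> = \<i> * exp (- (\<i> * z)) / cos z"
  proof -
    have "sin z + \<i> * cos z = \<i> * exp (- (\<i> * z))"
      unfolding sin_exp_eq' cos_exp_eq by (simp add: field_simps)
    thus ?thesis using c0 by (simp add: tan_def field_simps)
  qed
  hence "norm (tan z + \<i>) = q / norm (cos z)" by (simp add: norm_divide norm_mult q_def)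
  also have "\<dots> \<le> q / (1 / q / 4)" using c q0 q c0 by (intro divide_left_mono) auto
  also have "\<dots> = 4 * (q * q)" using q by simp
  also have "q * q = exp (2 * Im z)" by (simp add: q_def flip: exp_add)
  finally show ?thesis .
qed

text \<open>The subtracted main term is \<open>Ln w\<close> from Stirling's formula together with i
  pi / 2, which comes from the limit -i of the tangent. Near the negative imaginary axis this main
  term is close to the real number ln(|w| / (2 pi)).\<close>

definition lam_err :: "complex \<Rightarrow> complex" where
  "lam_err w = lam w - (Ln w - of_real (ln (2 * pi)) + \<i> * of_real (pi / 2))"

lemma lam_err_bound:
  assumes w: "Re w > 0" "Im w \<le> -1"
  shows "norm (lam_err w) \<le> 10 / norm w + 2 * pi * exp (pi * Im w)"
proof -
  have nw: "norm w \<ge> 1" using w abs_Im_le_cmod[of w] by linarith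
  define z where "z = of_real pi * w / 2"
  have "pi * Im w \<le> pi * (-1)" using w by (intro mult_left_mono) auto
  hence z: "Im z \<le> -1" using pi_gt3 by (simp add: z_def)
  have "lam_err w = (Digamma w - Ln w) - of_real (pi / 2) * (tan z + \<i>)"
    by (simp add: lam_err_def lam_def z_def algebra_simps)
  also have "norm \<dots> \<le> norm (Digamma w - Ln w) + norm (of_real (pi / 2) * (tan z + \<i>))"
    by (rule norm_triangle_ineq4)
  also have "norm (of_real (pi / 2) * (tan z + \<i>)) = pi / 2 * norm (tan z + \<i>)"
    by (simp add: norm_mult)
  also have "\<dots> \<le> pi / 2 * (4 * exp (2 * Im z))"
    by (intro mult_left_mono tan_plus_ii_bound z) auto
  also have "2 * Im z = pi * Im w" by (simp add: z_def)
  also have "norm (Digamma w - Ln w) \<le> 10 / norm w"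
    by (rule Digamma_Ln_bound) (use w nw in auto)
  finally show ?thesis by simp
qed

lemma lam_holomorphic: "lam holomorphic_on {w. Im w < 0}"
proof -
  have "lam field_differentiable at w" if "Im w < 0" for w
    using lam_has_derivative[of w] that by (auto simp: field_differentiable_def)
  thus ?thesis unfolding holomorphic_on_def
    by (auto intro: field_differentiable_at_within)
qed

lemma lam_err_holomorphic: "lam_err holomorphic_on {w. Im w < 0}"
  unfolding lam_err_def [abs_def]
  by (intro holomorphic_intros lam_holomorphic) (auto simp: complex_nonpos_Reals_iff)

text \<open>Cauchy's estimate for \<open>lam_err\<close> on circles of radius 1/4, which stay in Re
  > 0; the main term contributes 1 / w.\<close>

lemma lam_deriv_bound:
  "\<exists>C>0. \<forall>w. Re w \<ge> 1/2 \<and> Im w \<le> -2 \<longrightarrow> norm (deriv lam w) \<le> C * (1 / norm w + exp (pi * Im w))"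
proof -
  define C where "C = 4 * (20 + 2 * pi * exp pi) + 1"
  have C: "C > 0" unfolding C_def by (intro add_pos_pos mult_pos_pos) auto
  have "norm (deriv lam w) \<le> C * (1 / norm w + exp (pi * Im w))" if w: "Re w \<ge> 1/2" "Im w \<le> -2" for w
  proof -
    have nw: "norm w \<ge> 2" using w abs_Im_le_cmod[of w] by linarith
    define B where "B = 20 / norm w + 2 * pi * exp pi * exp (pi * Im w)"
    have "norm ((deriv ^^ 1) lam_err w) \<le> fact 1 * B / (1/4) ^ 1"
    proof (rule Cauchy_inequality)
      have sub: "cball w (1/4) \<subseteq> {w. Im w < 0}"
      proof
        fix x assume "x \<in> cball w (1/4)"
        thus "x \<in> {w. Im w < 0}" using abs_Im_le_cmod[of "w - x"] w by (simp add: dist_norm)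
      qed
      show "lam_err holomorphic_on ball w (1/4)"
        by (rule holomorphic_on_subset[OF lam_err_holomorphic]) (use sub ball_subset_cball in blast)
      show "continuous_on (cball w (1/4)) lam_err"
        by (rule holomorphic_on_imp_continuous_on[OF holomorphic_on_subset[OF lam_err_holomorphic sub]])
      fix x assume x: "norm (w - x) = 1/4"
      have re: "Re x > 0" and im: "Im x \<le> Im w + 1"
        using x abs_Re_le_cmod[of "w - x"] abs_Im_le_cmod[of "w - x"] w by auto
      have nx: "norm x \<ge> norm w / 2" using norm_triangle_ineq2[of w "w - x"] x nw by simp
      have "norm (lam_err x) \<le> 10 / norm x + 2 * pi * exp (pi * Im x)"
        by (rule lam_err_bound) (use re im w in auto)
      also have "10 / norm x \<le> 10 / (norm w / 2)"
        using nx nw by (intro divide_left_mono mult_pos_pos) auto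
      also have "pi * Im x \<le> pi + pi * Im w" using mult_left_mono[OF im, of pi] by (simp add: algebra_simps)
      hence "exp (pi * Im x) \<le> exp pi * exp (pi * Im w)" by (simp flip: exp_add)
      finally show "norm (lam_err x) \<le> B" by (simp add: B_def mult.assoc)
    qed auto
    hence d: "norm (deriv lam_err w) \<le> 4 * B" by simp
    have "deriv lam w = deriv lam_err w + 1 / w"
    proof -
      have "(lam_err has_field_derivative deriv lam_err w) (at w)"
        by (rule holomorphic_derivI[OF lam_err_holomorphic]) (use w in \<open>auto simp: open_halfspace_Im_lt\<close>)
      hence "((\<lambda>w. lam_err w + (Ln w - of_real (ln (2 * pi)) + \<i> * of_real (pi / 2))) has_field_derivative (deriv lam_err w + 1 / w)) (at w)"
        using w by (auto intro!: derivative_eq_intros simp: complex_nonpos_Reals_iff inverse_eq_divide)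
      moreover have "(\<lambda>w. lam_err w + (Ln w - of_real (ln (2 * pi)) + \<i> * of_real (pi / 2))) = lam"
        by (auto simp: lam_err_def)
      ultimately show ?thesis by (simp add: DERIV_imp_deriv)
    qed
    hence "norm (deriv lam w) \<le> norm (deriv lam_err w) + 1 / norm w"
      using norm_triangle_ineq[of "deriv lam_err w" "1 / w"] by (simp add: norm_divide)
    also have "\<dots> \<le> 4 * B + 1 / norm w" using d by simp
    also have "\<dots> \<le> C * (1 / norm w) + C * exp (pi * Im w)"
    proof -
      have "4 * B + 1 / norm w = 81 * (1 / norm w) + 8 * pi * exp pi * exp (pi * Im w)" by (simp add: B_def)
      also have "\<dots> \<le> C * (1 / norm w) + C * exp (pi * Im w)"
        unfolding C_def by (intro add_mono mult_right_mono) (auto simp: algebra_simps intro!: add_nonneg_nonneg)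
      finally show ?thesis .
    qed
    finally show ?thesis by (simp add: algebra_simps)
  qed
  thus ?thesis using C by blast
qed

section \<open>Bounds under the Riemann hypothesis\<close>

text \<open>The hypothesis speaks of the open critical strip only; from Re s = 1 on, non-vanishing
  is unconditional.\<close>

lemma zeta_nonzero_RH:
  assumes "riemann_hypothesis" "Re s > 1/2" "Im s \<noteq> 0"
  shows "zeta s \<noteq> 0"
  using assms zeta_nonzero_Re_ge_1[of s] unfolding riemann_hypothesis_def
  by (cases "Re s \<ge> 1") force+

text \<open>A zero left of the critical line would sit opposite a non-zero value on the right, and
  the functional equation transports non-vanishing across the line. Off the real axis this also
  covers the region left of the strip.\<close>

lemma zeta_zeros_RH:
  assumes RH: "riemann_hypothesis" and s: "zeta s = 0" "Im s \<noteq> 0"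
  shows "Re s = 1/2"
proof (rule ccontr)
  assume ne: "Re s \<noteq> 1/2"
  hence "Re s < 1/2" using zeta_nonzero_RH[OF RH, of s] s by fastforce
  hence "zeta (1 - s) \<noteq> 0" using s by (intro zeta_nonzero_RH[OF RH]) auto
  from zlog_reflect(1)[OF _ this] s show False by simp
qed

lemma zeta_lower_bound: "Re s \<ge> 2 \<Longrightarrow> norm (zeta s) \<ge> 2 - pi\<^sup>2 / 6"
  using zeta_right_tail(2)[of s] norm_triangle_ineq2[of 1 "1 - zeta s"] by (simp add: norm_minus_commute)

lemma two_minus_pi_sq_pos: "2 - pi\<^sup>2 / 6 > 0"
proof -
  have "pi\<^sup>2 < (3.2)\<^sup>2" using pi_approx by (intro power_strict_mono) auto
  thus ?thesis by (simp add: power2_eq_square)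
qed

text \<open>Borel--Caratheodory for a branch of \<open>log zeta\<close> on a disc of radius \<open>3/2 + \<eta>\<close> centred at \<open>s + 3/2\<close>,
  followed by Cauchy's estimates at \<open>s\<close>.\<close>
lemma zlog_zquot_bound_RH:
  assumes RH: "riemann_hypothesis"
  shows "\<exists>C>0. \<forall>s \<eta>. 0 < \<eta> \<and> \<eta> \<le> 1/8 \<and> Re s \<ge> 1/2 + 2 * \<eta> \<and> \<bar>Im s\<bar> \<ge> 4 \<longrightarrow>
    norm (zlog s) \<le> C * (ln \<bar>Im s\<bar>)\<^sup>2 / \<eta> ^ 4 \<and> norm (zquot s) \<le> C * (ln \<bar>Im s\<bar>)\<^sup>2 / \<eta> ^ 4"
proof -
  obtain C0 where C0: "C0 > 0" "\<And>s. Re s \<ge> 1/10 \<Longrightarrow> \<bar>Im s\<bar> \<ge> 1 \<Longrightarrow> norm (zeta s) \<le> C0 * \<bar>Im s\<bar>"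
    using zeta_growth by blast
  define m where "m = 2 - pi\<^sup>2 / 6"
  have m: "m > 0" using two_minus_pi_sq_pos by (simp add: m_def)
  define C1 where "C1 = \<bar>ln (C0 / m)\<bar> + ln 2 + 2"
  have C1: "C1 \<ge> 2" by (simp add: C1_def)
  \<comment> \<open>1152 = 1024 + 128: the square of 32 A / \<eta>^2, and 128 A / \<eta>^3 from the
    second derivative.\<close>
  define C where "C = 1152 * C1\<^sup>2"
  have main: "norm (zlog s) \<le> C * (ln \<bar>Im s\<bar>)\<^sup>2 / \<eta> ^ 4 \<and> norm (zquot s) \<le> C * (ln \<bar>Im s\<bar>)\<^sup>2 / \<eta> ^ 4"
    if s: "0 < \<eta>" "\<eta> \<le> 1/8" "Re s \<ge> 1/2 + 2 * \<eta>" "\<bar>Im s\<bar> \<ge> 4" for s \<eta>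
  proof -
    define t where "t = \<bar>Im s\<bar>"
    \<comment> \<open>This centre has real part above 2, where |zeta| is bounded below, and the disc
      of radius 3/2 + \<eta> around it ends at Re s - \<eta>, still right of the critical
      line.\<close>
    define c where "c = s + 3/2"
    define R where "R = 3/2 + \<eta>"
    define r where "r = 3/2 + \<eta> / 2"
    have R: "R > 0" "r < R" "r > 0" using s by (auto simp: R_def r_def)
    have ball: "Re z > 1/2" "\<bar>Im z\<bar> \<ge> 1" "\<bar>Im z\<bar> \<le> 2 * t" if "z \<in> ball c R" for z
    proof -
      have "norm (c - z) < R" using that by (simp add: dist_norm)
      hence "\<bar>Re (c - z)\<bar> < R" "\<bar>Im (c - z)\<bar> < R"
        using abs_Re_le_cmod[of "c - z"] abs_Im_le_cmod[of "c - z"] by linarith+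
      thus "Re z > 1/2" "\<bar>Im z\<bar> \<ge> 1" "\<bar>Im z\<bar> \<le> 2 * t" using s by (auto simp: c_def R_def t_def)
    qed
    have nz: "zeta z \<noteq> 0" if "z \<in> ball c R" for z
      using ball[OF that] by (intro zeta_nonzero_RH[OF RH]) auto
    have "1 \<notin> ball c R" using ball(2)[of 1] by auto
    hence hol: "zeta holomorphic_on ball c R" by (rule zeta_holomorphic_on)
    have cR: "c \<in> ball c R" using R by simp
    obtain g where g: "g holomorphic_on ball c R" "\<And>z. z \<in> ball c R \<Longrightarrow> exp (g z) = zeta z"
      using holomorphic_logarithm_exists[OF convex_ball open_ball hol nz cR] by metis
    define L where "L = ln t"
    have t4: "t \<ge> 4" using s by (simp add: t_def)
    have "exp 1 \<le> t" using exp_le t4 by linarith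
    hence L1: "L \<ge> 1" unfolding L_def using t4 by (simp add: ln_ge_iff)
    define A where "A = C1 * L"
    have A1: "A \<ge> 1" using C1 L1 mult_mono[of 1 C1 1 L] by (simp add: A_def)
    have cm: "norm (zeta c) \<ge> m" unfolding m_def by (rule zeta_lower_bound) (use s in \<open>simp add: c_def\<close>)
    have gb: "norm (g z - g c) \<le> 16 * A / \<eta>" if z: "dist c z \<le> r" for z
    proof -
      have "norm (g z - g c) \<le> 2 * A * r / (R - r)"
      proof (rule borel_caratheodory[where f = "\<lambda>z. g z - g c" and c = c])
        show "(\<lambda>z. g z - g c) holomorphic_on ball c R" by (intro holomorphic_intros g)
        fix w assume w: "w \<in> ball c R"
        have "Re (g w - g c) = ln (norm (zeta w)) - ln (norm (zeta c))"
          using g(2)[OF w] g(2)[OF cR] by (metis ln_exp minus_complex.simps(1) norm_exp_eq_Re)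
        also have "\<dots> \<le> ln (C0 * (2 * t)) - ln m"
        proof (rule diff_mono)
          have "norm (zeta w) \<le> C0 * \<bar>Im w\<bar>" using ball[OF w] by (intro C0) auto
          also have "\<dots> \<le> C0 * (2 * t)" using ball[OF w] C0 by (intro mult_left_mono) auto
          finally show "ln (norm (zeta w)) \<le> ln (C0 * (2 * t))" using nz[OF w] C0 t4
            by (subst ln_le_cancel_iff) auto
          have "0 < norm (zeta c)" using cm m by linarith
          thus "ln m \<le> ln (norm (zeta c))" using cm m by (subst ln_le_cancel_iff) auto
        qed
        also have "\<dots> = ln (C0 / m) + ln 2 + L" using C0 m t4 by (simp add: ln_mult ln_div L_def)
        also have "\<dots> < A"
        proof -
          have "\<bar>ln (C0 / m)\<bar> * 1 \<le> \<bar>ln (C0 / m)\<bar> * L" "ln 2 * 1 \<le> ln 2 * L" using L1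
            by (intro mult_left_mono; simp)+
          hence "ln (C0 / m) + ln 2 + L < \<bar>ln (C0 / m)\<bar> * L + ln 2 * L + 2 * L" using L1 by linarith
          thus ?thesis by (simp add: A_def C1_def algebra_simps)
        qed
        finally show "Re (g w - g c) < A" .
      qed (use z R in auto)
      also have "R - r = \<eta> / 2" by (simp add: R_def r_def)
      also have "2 * A * r / (\<eta> / 2) = 4 * A * r / \<eta>" by simp
      also have "\<dots> \<le> 4 * A * 4 / \<eta>" using A1 s by (intro divide_right_mono mult_left_mono) (auto simp: r_def)
      finally show ?thesis by simp
    qed
    have sub: "cball s (\<eta> / 2) \<subseteq> ball c R"
    proof
      fix z assume "z \<in> cball s (\<eta> / 2)"
      hence "dist c z \<le> 3/2 + \<eta> / 2"
        using dist_triangle[of c z s] by (simp add: c_def dist_norm)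
      thus "z \<in> ball c R" using s by (simp add: R_def)
    qed
    have cb: "norm ((deriv ^^ n) (\<lambda>z. g z - g c) s) \<le> fact n * (16 * A / \<eta>) / (\<eta> / 2) ^ n" for n
    proof (rule Cauchy_inequality)
      have h: "(\<lambda>z. g z - g c) holomorphic_on cball s (\<eta> / 2)"
        by (intro holomorphic_intros holomorphic_on_subset[OF g(1) sub])
      thus "(\<lambda>z. g z - g c) holomorphic_on ball s (\<eta> / 2)" by (rule holomorphic_on_subset) auto
      show "continuous_on (cball s (\<eta> / 2)) (\<lambda>z. g z - g c)" using h by (rule holomorphic_on_imp_continuous_on)
      fix z assume z: "norm (s - z) = \<eta> / 2"
      have "dist c z \<le> r" using dist_triangle[of c z s] z by (simp add: c_def r_def dist_norm)
      thus "norm (g z - g c) \<le> 16 * A / \<eta>" by (rule gb)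
    qed (use s in auto)
    have "s \<in> cball s (\<eta> / 2)" using s by simp
    hence sR: "s \<in> ball c R" using sub by blast
    have d1: "deriv (\<lambda>z. g z - g c) z = zlog z" if z: "z \<in> ball c R" for z
    proof -
      have "((\<lambda>z. exp (g z)) has_field_derivative exp (g z) * deriv g z) (at z)"
        by (auto intro!: derivative_eq_intros holomorphic_derivI[OF g(1)] z)
      hence "(zeta has_field_derivative exp (g z) * deriv g z) (at z)"
        by (rule has_field_derivative_transform_within_open[OF _ open_ball z]) (use g in auto)
      hence "deriv g z = zlog z" using nz[OF z] g(2)[OF z]
        by (auto dest!: DERIV_imp_deriv simp: zlog_def field_simps)
      moreover have "((\<lambda>z. g z - g c) has_field_derivative deriv g z - 0) (at z)"
        by (intro DERIV_diff DERIV_const holomorphic_derivI[OF g(1) open_ball z])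
      ultimately show ?thesis by (simp add: DERIV_imp_deriv)
    qed
    have s1: "s \<noteq> 1" using s by auto
    have z1: "norm (zlog s) \<le> 32 * A / \<eta>\<^sup>2"
      using cb[of 1] d1[OF sR] by (simp add: power2_eq_square)
    have dd: "deriv (deriv (\<lambda>z. g z - g c)) s = zquot s - (zlog s)\<^sup>2"
    proof -
      have "(deriv (\<lambda>z. g z - g c) has_field_derivative zquot s - (zlog s)\<^sup>2) (at s)"
        by (rule has_field_derivative_transform_within_open[OF zlog_has_derivative[OF s1 nz[OF sR]] open_ball sR])
           (use d1 in auto)
      thus ?thesis by (rule DERIV_imp_deriv)
    qed
    have "norm (deriv (deriv (\<lambda>z. g z - g c)) s) \<le> 128 * A / \<eta> ^ 3"
      using cb[of 2] by (simp add: numeral_2_eq_2 field_simps eval_nat_numeral)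
    hence z2: "norm (zquot s - (zlog s)\<^sup>2) \<le> 128 * A / \<eta> ^ 3" unfolding dd .
    have A2: "A \<le> A\<^sup>2" using A1 by (simp add: power2_eq_square)
    have e: "\<eta> ^ 4 \<le> \<eta>\<^sup>2" "\<eta> ^ 4 \<le> \<eta> ^ 3" using s by (intro power_decreasing; simp)+
    have "norm (zlog s) \<le> 32 * A\<^sup>2 / \<eta> ^ 4"
      by (rule order_trans[OF z1]) (use A2 e s A1 in \<open>intro frac_le; auto\<close>)
    hence f1: "norm (zlog s) \<le> 1152 * A\<^sup>2 / \<eta> ^ 4"
      by (rule order_trans) (use s in \<open>intro divide_right_mono; auto\<close>)
    have "norm (zquot s) \<le> norm (zquot s - (zlog s)\<^sup>2) + (norm (zlog s))\<^sup>2"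
      using norm_triangle_ineq[of "zquot s - (zlog s)\<^sup>2" "(zlog s)\<^sup>2"] by (simp add: norm_power)
    also have "\<dots> \<le> 128 * A / \<eta> ^ 3 + (32 * A / \<eta>\<^sup>2)\<^sup>2"
      using z1 z2 by (intro add_mono power_mono) auto
    also have "128 * A / \<eta> ^ 3 \<le> 128 * A\<^sup>2 / \<eta> ^ 4" using A2 e s A1 by (intro frac_le) auto
    also have "(32 * A / \<eta>\<^sup>2)\<^sup>2 = 1024 * A\<^sup>2 / \<eta> ^ 4" by (simp add: power_divide power_mult_distrib)
    finally have f2: "norm (zquot s) \<le> 1152 * A\<^sup>2 / \<eta> ^ 4" by (simp add: add_divide_distrib[symmetric])
    have "1152 * A\<^sup>2 = C * (ln \<bar>Im s\<bar>)\<^sup>2" by (simp add: A_def C_def L_def t_def power_mult_distrib)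
    thus ?thesis using f1 f2 by simp
  qed
  have "C > 0" using C1 by (simp add: C_def)
  thus ?thesis using main by blast
qed

section \<open>No zeros of \<open>zeta2\<close> far to the left at bounded height\<close>

lemma abs_le_abs_sinh: "\<bar>x\<bar> \<le> \<bar>sinh (x::real)\<bar>"
proof -
  have ge: "x \<le> sinh x" if "x \<ge> 0" for x :: real
  proof -
    have "(\<lambda>x. sinh x - x) 0 \<le> (\<lambda>x. sinh x - x) x"
    proof (rule DERIV_nonneg_imp_nondecreasing[OF that])
      fix y :: real
      have "((\<lambda>x. sinh x - x) has_real_derivative cosh y - 1) (at y)"
        by (auto intro!: derivative_eq_intros)
      thus "\<exists>z. ((\<lambda>x. sinh x - x) has_real_derivative z) (at y) \<and> 0 \<le> z"
        using cosh_real_ge_1[of y] by (intro exI[of _ "cosh y - 1"]) auto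
    qed
    thus ?thesis by simp
  qed
  show ?thesis using ge[of x] ge[of "-x"] by (cases "x \<ge> 0") auto
qed

text \<open>With y = Im z the imaginary part is sinh y cosh y / |cos z|^2, and |cos z|^2 is at most
  (cosh y)^2; what is left is |sinh y| / cosh y, and |sinh y| is at least |y|.\<close>

lemma Im_tan_lower_bound:
  assumes c: "cos z \<noteq> (0::complex)"
  shows "\<bar>Im (tan z)\<bar> \<ge> \<bar>Im z\<bar> / cosh (Im z)"
proof -
  define a where "a = Re z"
  define S where "S = sinh (Im z)"
  define K where "K = cosh (Im z)"
  have K: "K \<ge> 1" "K\<^sup>2 = S\<^sup>2 + 1" by (simp_all add: K_def S_def cosh_real_ge_1 cosh_square_eq)
  have sn: "Re (sin z) = sin a * K" "Im (sin z) = cos a * S"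
    by (simp_all add: Re_sin Im_sin a_def S_def K_def sinh_def cosh_def)
  have cs: "Re (cos z) = cos a * K" "Im (cos z) = - (sin a * S)"
    by (simp_all add: Re_cos Im_cos a_def S_def K_def sinh_def cosh_def field_simps)
  define d where "d = (cos a * K)\<^sup>2 + (sin a * S)\<^sup>2"
  have "d = (norm (cos z))\<^sup>2" unfolding cmod_power2 cs d_def by simp
  hence d0: "d > 0" using c by simp
  have "Im (tan z) = (cos a * S * (cos a * K) + sin a * K * (sin a * S)) / d"
    unfolding tan_def Im_divide sn cs d_def by simp
  also have "cos a * S * (cos a * K) + sin a * K * (sin a * S) = S * K * ((sin a)\<^sup>2 + (cos a)\<^sup>2)"
    by algebra
  finally have im: "\<bar>Im (tan z)\<bar> = \<bar>S\<bar> * K / d" using d0 K by (simp add: abs_mult)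
  have "d \<le> (cos a)\<^sup>2 * K\<^sup>2 + (sin a)\<^sup>2 * K\<^sup>2"
    unfolding d_def power_mult_distrib K(2) by (intro add_mono mult_left_mono) auto
  also have "\<dots> = K\<^sup>2 * ((sin a)\<^sup>2 + (cos a)\<^sup>2)" by algebra
  also have "\<dots> = K * K" by (simp add: power2_eq_square[of K])
  finally have dK: "d \<le> K * K" .
  have "\<bar>Im z\<bar> \<le> \<bar>S\<bar>" unfolding S_def by (rule abs_le_abs_sinh)
  hence "\<bar>Im z\<bar> / K \<le> \<bar>S\<bar> / K" using K by (intro divide_right_mono) auto
  also have "\<dots> = \<bar>S\<bar> * K / (K * K)" using K by simp
  also have "\<dots> \<le> \<bar>S\<bar> * K / d" using dK d0 K by (intro divide_left_mono mult_nonneg_nonneg mult_pos_pos) auto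
  finally show ?thesis using im by (simp add: K_def)
qed

lemma zlog_real: "x \<noteq> 1 \<Longrightarrow> zlog (of_real x) \<in> \<real>"
  unfolding zlog_def using zeta_deriv_cnj[of "of_real x"] zeta_cnj[of "of_real x"]
  by (intro Reals_divide) (auto simp: Reals_cnj_iff)

lemma zquot_real: "x \<noteq> 1 \<Longrightarrow> zquot (of_real x) \<in> \<real>"
  unfolding zquot_def using zeta2_cnj[of "of_real x"] zeta_cnj[of "of_real x"]
  by (intro Reals_divide) (auto simp: Reals_cnj_iff)

text \<open>For \<open>w\<close> far to the right, \<open>zeta2 (1 - w) = 0\<close> forces \<open>pi * tan (pi * w / 2) = b w + (b' w - pi\<^sup>2 / 4) / b w\<close>
  with \<open>b w = Digamma w - ln (2 * pi) + zlog w\<close>. The right-hand side is real on the real axis and has a small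
  derivative, so its imaginary part is smaller than that of the left-hand side.\<close>
lemma zeta2_low_zero_free:
  assumes V: "V > 0"
  shows "\<exists>K>1. \<forall>w. Re w \<ge> K \<and> -V \<le> Im w \<and> Im w < 0 \<longrightarrow> zeta2 (1 - w) \<noteq> 0"
proof -
  obtain Cr where Cr: "Cr > 0" "\<And>s. Re s \<ge> 3 \<Longrightarrow> norm (zlog s) \<le> Cr * 2 powr (- Re s)"
    using zeta_right_asymptotics unfolding zlog_def by blast
  define b where "b = (\<lambda>w. Digamma w - of_real (ln (2 * pi)) + zlog w)"
  define b' where "b' = (\<lambda>w. Polygamma 1 w + (zquot w - (zlog w)\<^sup>2))"
  define H where "H = {w::complex. Re w > 2}"
  have H: "open H" by (simp add: H_def open_halfspace_Re_gt)
  have w_facts: "w \<notin> \<int>\<^sub>\<le>\<^sub>0" "w \<noteq> 1" "zeta w \<noteq> 0" "w \<notin> \<real>\<^sub>\<le>\<^sub>0" if "w \<in> H" for w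
    using that zeta_nonzero_Re_gt_1[of w]
    by (auto simp: H_def complex_nonpos_Reals_iff elim!: nonpos_Ints_cases)
  have db: "(b has_field_derivative b' w) (at w)" if w: "w \<in> H" for w
  proof -
    have "(b has_field_derivative (Polygamma 1 w - 0) + (zquot w - (zlog w)\<^sup>2)) (at w)"
      unfolding b_def using w_facts[OF w]
      by (intro DERIV_add DERIV_diff DERIV_const zlog_has_derivative) (auto intro!: derivative_eq_intros)
    thus ?thesis by (simp add: b'_def)
  qed
  have bh: "b holomorphic_on H"
    unfolding holomorphic_on_def using db field_differentiable_at_within field_differentiable_def by blast
  have b'h: "b' holomorphic_on H"
  proof (rule holomorphic_transform[OF holomorphic_deriv[OF bh H]])
    show "deriv b w = b' w" if "w \<in> H" for w using db[OF that] by (rule DERIV_imp_deriv)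
  qed
  have Lnh: "Ln holomorphic_on H" by (intro holomorphic_intros) (use w_facts in auto)
  define C0 where "C0 = 10 + ln (2 * pi) + Cr"
  have ln2pi: "ln (2 * pi) > 0" using pi_gt3 by (intro ln_gt_zero) auto
  have C0: "C0 > 0" unfolding C0_def using ln2pi Cr(1) by linarith
  have bLn: "norm (b w - Ln w) \<le> C0" if w: "Re w \<ge> 3" for w
  proof -
    have nw: "norm w \<ge> 3" using w complex_Re_le_cmod[of w] by linarith
    have "b w - Ln w = (Digamma w - Ln w) + (zlog w - of_real (ln (2 * pi)))" by (simp add: b_def)
    also have "norm \<dots> \<le> norm (Digamma w - Ln w) + (norm (zlog w) + norm (complex_of_real (ln (2 * pi))))"
      by (intro order_trans[OF norm_triangle_ineq] add_left_mono norm_triangle_ineq4)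
    also have "norm (Digamma w - Ln w) \<le> 10 / norm w" by (rule Digamma_Ln_bound) (use w nw in auto)
    also have "\<dots> \<le> 10 / 1" using nw by (intro divide_left_mono) auto
    also have "norm (zlog w) \<le> Cr * 2 powr (- Re w)" by (rule Cr(2)) (use w in auto)
    also have "\<dots> \<le> Cr * 2 powr 0" using Cr w by (intro mult_left_mono powr_mono) auto
    also have "norm (complex_of_real (ln (2 * pi))) = ln (2 * pi)" using ln2pi by simp
    finally show ?thesis by (simp add: C0_def)
  qed
  have cauchy: "norm (deriv f w) \<le> B / r"
    if f: "f holomorphic_on H" and B: "\<And>z. norm (w - z) = r \<Longrightarrow> norm (f z) \<le> B" and r: "r > 0" "Re w > 2 + r" for f w B r
  proof -
    have sub: "cball w r \<subseteq> H"
    proof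
      fix z assume "z \<in> cball w r"
      thus "z \<in> H" using abs_Re_le_cmod[of "w - z"] r by (simp add: dist_norm H_def)
    qed
    have "norm ((deriv ^^ 1) f w) \<le> fact 1 * B / r ^ 1"
    proof (rule Cauchy_inequality)
      show "f holomorphic_on ball w r" using f sub ball_subset_cball by (metis holomorphic_on_subset)
      show "continuous_on (cball w r) f" using f sub by (metis holomorphic_on_subset holomorphic_on_imp_continuous_on)
    qed (use B r in auto)
    thus ?thesis by simp
  qed
  have dLn: "deriv Ln w = 1 / w" if "w \<in> H" for w
    using w_facts[OF that] by (intro DERIV_imp_deriv) (auto intro!: derivative_eq_intros simp: inverse_eq_divide)
  have ddiff: "deriv (\<lambda>w. f w - Ln w) w = deriv f w - 1 / w" if "f holomorphic_on H" "w \<in> H" for f w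
    using that dLn[of w] holomorphic_on_imp_differentiable_at[OF that(1) H that(2)]
      holomorphic_on_imp_differentiable_at[OF Lnh H that(2)] by simp
  have b'b: "norm (b' w) \<le> C0 + 1" if w: "Re w \<ge> 5" for w
  proof -
    have wH: "w \<in> H" using w by (simp add: H_def)
    have "norm (deriv (\<lambda>w. b w - Ln w) w) \<le> C0 / 1"
    proof (rule cauchy)
      fix z assume "norm (w - z) = 1"
      thus "norm (b z - Ln z) \<le> C0" using abs_Re_le_cmod[of "w - z"] w by (intro bLn) auto
    qed (use w bh Lnh in \<open>auto intro!: holomorphic_intros\<close>)
    moreover have "deriv b w = b' w" using db[OF wH] by (rule DERIV_imp_deriv)
    ultimately have "norm (b' w - 1 / w) \<le> C0" using ddiff[OF bh wH] by simp
    moreover have "1 \<le> norm w" using w complex_Re_le_cmod[of w] by linarith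
    hence "1 / norm w \<le> 1 / 1" by (intro divide_left_mono) auto
    hence "norm (1 / w) \<le> 1" by (simp add: norm_divide)
    ultimately show ?thesis using norm_triangle_ineq2[of "b' w" "1 / w"] by linarith
  qed
  \<comment> \<open>From here on Re (Ln w) is at least C0 + 1, so \<open>b w\<close>, which lies
    within C0 of \<open>Ln w\<close>, has modulus at least 1.\<close>
  define K1 where "K1 = 5 + exp (C0 + 1)"
  have b1: "norm (b w) \<ge> 1" if w: "Re w \<ge> K1" for w
  proof -
    have w5: "Re w \<ge> 5" using w exp_gt_zero[of "C0 + 1"] unfolding K1_def by linarith
    have "exp (C0 + 1) \<le> norm w" using w complex_Re_le_cmod[of w] by (simp add: K1_def)
    hence "C0 + 1 \<le> ln (norm w)" using w5 by (subst ln_ge_iff) auto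
    also have "ln (norm w) = Re (Ln w)"
    proof -
      have "w \<noteq> 0" using w5 by auto
      thus ?thesis by simp
    qed
    also have "\<dots> \<le> norm (Ln w)" by (rule complex_Re_le_cmod)
    finally show ?thesis using bLn[of w] w5 norm_triangle_ineq2[of "Ln w" "Ln w - b w"]
      by (simp add: norm_minus_commute)
  qed
  define G where "G = (\<lambda>w. b w + (b' w - of_real (pi\<^sup>2 / 4)) / b w)"
  define C2 where "C2 = C0 + (C0 + 1 + pi\<^sup>2 / 4)"
  have C2: "C2 > 0" using C0 by (simp add: C2_def add_pos_nonneg)
  have GLn: "norm (G w - Ln w) \<le> C2" if w: "Re w \<ge> K1" for w
  proof -
    have w5: "Re w \<ge> 5" using w exp_gt_zero[of "C0 + 1"] unfolding K1_def by linarith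
    have n4: "norm (complex_of_real (pi\<^sup>2 / 4)) = pi\<^sup>2 / 4" by (simp only: norm_of_real) simp
    have "norm (b' w - of_real (pi\<^sup>2 / 4)) \<le> norm (b' w) + pi\<^sup>2 / 4"
      using norm_triangle_ineq4[of "b' w" "of_real (pi\<^sup>2 / 4)"] unfolding n4 .
    hence "norm ((b' w - of_real (pi\<^sup>2 / 4)) / b w) \<le> (norm (b' w) + pi\<^sup>2 / 4) / 1"
      unfolding norm_divide using b1[OF w] by (intro frac_le) auto
    also have "\<dots> \<le> C0 + 1 + pi\<^sup>2 / 4" using b'b[OF w5] by simp
    finally have "norm ((b' w - of_real (pi\<^sup>2 / 4)) / b w) \<le> C0 + 1 + pi\<^sup>2 / 4" .
    moreover have "norm (b w - Ln w) \<le> C0" using w5 by (intro bLn) simp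
    moreover have "G w - Ln w = (b w - Ln w) + (b' w - of_real (pi\<^sup>2 / 4)) / b w" by (simp add: G_def)
    ultimately show ?thesis unfolding C2_def by (metis norm_triangle_mono)
  qed
  \<comment> \<open>Radius of the Cauchy discs, chosen so that the derivative of \<open>G\<close> is
    at most 1 / cosh(pi V / 2), a quantity comparable with the lower bound for the tangent.\<close>
  define R where "R = (1 + C2) * cosh (pi * V / 2)"
  have R: "R \<ge> 1 + C2" using C2 cosh_real_ge_1[of "pi * V / 2"] mult_left_mono[of 1 "cosh (pi * V / 2)" "1 + C2"]
    by (simp add: R_def)
  define K where "K = K1 + R + 1"
  have K1: "K1 > 5" by (simp add: K1_def)
  have K: "K > 7" using K1 R C2 by (simp add: K_def)
  have "zeta2 (1 - w) \<noteq> 0" if w: "Re w \<ge> K" "-V \<le> Im w" "Im w < 0" for w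
  proof
    assume zero: "zeta2 (1 - w) = 0"
    define v where "v = - Im w"
    have v: "0 < v" "v \<le> V" using w by (auto simp: v_def)
    define x where "x = complex_of_real (Re w)"
    have wH: "w \<in> H" using w K by (simp add: H_def)
    define HK where "HK = {w::complex. Re w > K1}"
    have HK: "open HK" "HK \<subseteq> H" using K1 by (auto simp: HK_def H_def open_halfspace_Re_gt)
    have b0: "b z \<noteq> 0" if "z \<in> HK" for z using b1[of z] that by (auto simp: HK_def)
    have Gh: "G holomorphic_on HK"
      unfolding G_def using b0
      by (intro holomorphic_intros holomorphic_on_subset[OF bh HK(2)] holomorphic_on_subset[OF b'h HK(2)]) auto
    have dG: "norm (deriv G z) \<le> (1 + C2) / R" if z: "Re z \<ge> K" for z
    proof -
      have zH: "z \<in> HK" using z K1 R C2 by (simp add: HK_def K_def)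
      have sub: "cball z R \<subseteq> HK"
      proof
        fix y assume "y \<in> cball z R"
        thus "y \<in> HK" using abs_Re_le_cmod[of "z - y"] z by (simp add: dist_norm HK_def K_def)
      qed
      have hd: "(\<lambda>w. G w - Ln w) holomorphic_on HK"
        by (intro holomorphic_on_diff Gh holomorphic_on_subset[OF Lnh HK(2)])
      have "norm ((deriv ^^ 1) (\<lambda>w. G w - Ln w) z) \<le> fact 1 * C2 / R ^ 1"
      proof (rule Cauchy_inequality)
        show "(\<lambda>w. G w - Ln w) holomorphic_on ball z R"
          by (rule holomorphic_on_subset[OF hd]) (use sub ball_subset_cball in blast)
        show "continuous_on (cball z R) (\<lambda>w. G w - Ln w)"
          by (rule holomorphic_on_imp_continuous_on[OF holomorphic_on_subset[OF hd sub]])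
        fix y assume "norm (z - y) = R"
        hence "y \<in> HK" using sub by (auto simp: dist_norm)
        thus "norm (G y - Ln y) \<le> C2" by (intro GLn) (auto simp: HK_def)
      qed (use R C2 in auto)
      moreover have "deriv (\<lambda>w. G w - Ln w) z = deriv G z - 1 / z"
        using holomorphic_on_imp_differentiable_at[OF Gh HK(1) zH] dLn[of z] zH HK
          holomorphic_on_imp_differentiable_at[OF Lnh H, of z] by auto
      ultimately have "norm (deriv G z - 1 / z) \<le> C2 / R" by simp
      moreover have "norm (1 / z) \<le> 1 / R"
        unfolding norm_divide using z complex_Re_le_cmod[of z] K1 R C2 by (intro frac_le) (auto simp: K_def)
      ultimately show ?thesis
        using norm_triangle_ineq2[of "deriv G z" "1 / z"] by (simp add: add_divide_distrib)
    qed
    have seg: "closed_segment x w \<subseteq> {z. Re z \<ge> K}"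
    proof (rule closed_segment_subset)
      show "convex {z. Re z \<ge> K}" by (rule convex_halfspace_Re_ge)
    qed (use w in \<open>auto simp: x_def\<close>)
    have "norm (G w - G x) \<le> (1 + C2) / R * norm (w - x)"
    proof (rule field_differentiable_bound[where S = "closed_segment x w"])
      fix z assume z: "z \<in> closed_segment x w"
      have "z \<in> HK" using z seg K1 R C2 by (auto simp: HK_def K_def)
      thus "(G has_field_derivative deriv G z) (at z within closed_segment x w)"
        using holomorphic_derivI[OF Gh HK(1)] by blast
      show "norm (deriv G z) \<le> (1 + C2) / R" using z seg by (intro dG) auto
    qed auto
    also have "norm (w - x) = v"
    proof -
      have "w - x = \<i> * of_real (Im w)" by (simp add: x_def complex_eq_iff)
      thus ?thesis using v by (simp add: norm_mult v_def)
    qed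
    finally have 1: "norm (G w - G x) \<le> (1 + C2) / R * v" .
    have "Re w \<noteq> 1" "Re w \<noteq> 0" using w K by auto
    hence "G x \<in> \<real>" unfolding G_def b_def b'_def x_def
      by (intro Reals_add Reals_diff Reals_divide Reals_power zlog_real zquot_real Reals_of_real Polygamma_Real) auto
    hence "Im (G x) = 0" by (simp add: complex_is_Real_iff)
    hence 2: "\<bar>Im (G w)\<bar> \<le> (1 + C2) / R * v"
      using 1 abs_Im_le_cmod[of "G w - G x"] by simp
    define \<tau> where "\<tau> = of_real (pi / 2) * tan (of_real pi * w / 2)"
    have imw: "Im w \<noteq> 0" using w by simp
    have bw: "b w \<noteq> 0" using b1[of w] w K1 R C2 by (auto simp: K_def)
    have "0 = zquot (1 - w)" using zero by (simp add: zquot_def)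
    also have "\<dots> = (lam w)\<^sup>2 + deriv lam w + 2 * lam w * zlog w + zquot w"
      by (rule zquot_reflect[OF imw w_facts(3)[OF wH]])
    also have "lam w = b w - zlog w - \<tau>" by (simp add: lam_def b_def \<tau>_def)
    also have "deriv lam w = Polygamma 1 w - of_real (pi\<^sup>2 / 4) - \<tau>\<^sup>2"
      using DERIV_imp_deriv[OF lam_has_derivative[OF imw]]
      by (simp add: \<tau>_def power_mult_distrib power_divide algebra_simps)
    finally have "2 * b w * \<tau> = b w * b w + (b' w - of_real (pi\<^sup>2 / 4))"
      by (simp add: b'_def power2_eq_square algebra_simps)
    hence "2 * \<tau> = G w" using bw unfolding G_def by (simp add: field_simps)
    hence Gw: "G w = of_real pi * tan (of_real pi * w / 2)" by (simp add: \<tau>_def)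
    have "\<bar>Im (G w)\<bar> = pi * \<bar>Im (tan (of_real pi * w / 2))\<bar>" unfolding Gw by (simp add: abs_mult)
    also have "\<dots> \<ge> pi * (\<bar>Im (of_real pi * w / 2)\<bar> / cosh (Im (of_real pi * w / 2)))"
      by (intro mult_left_mono Im_tan_lower_bound cos_half_nonzero imw) auto
    also have "Im (of_real pi * w / 2) = - (pi * v / 2)" by (simp add: v_def)
    finally have 3: "\<bar>Im (G w)\<bar> \<ge> pi * (pi * v / 2 / cosh (pi * v / 2))" using v by simp
    have "cosh (pi * v / 2) \<le> cosh (pi * V / 2)" using v by (subst cosh_real_nonneg_le_iff) auto
    hence "pi * (pi * v / 2 / cosh (pi * V / 2)) \<le> pi * (pi * v / 2 / cosh (pi * v / 2))"
      using v by (intro mult_left_mono divide_left_mono) (auto simp: cosh_real_pos)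
    also have "\<dots> \<le> (1 + C2) / R * v" using 2 3 by linarith
    also have "\<dots> = v / cosh (pi * V / 2)" using C2 by (simp add: R_def)
    \<comment> \<open>The same cosh stands on both sides; what remains would say pi^2 / 2 \<le>
      1.\<close>
    finally have "pi * (pi * v / 2) / cosh (pi * V / 2) \<le> v / cosh (pi * V / 2)" by simp
    hence "pi * (pi * v / 2) \<le> v" using cosh_real_pos[of "pi * V / 2"] unfolding divide_le_cancel by blast
    moreover have "3 * (3 * v / 2) \<le> pi * (pi * v / 2)" using pi_gt3 v by (intro mult_mono divide_right_mono) auto
    ultimately show False using v by simp
  qed
  thus ?thesis using K by (intro exI[of _ K]) auto
qed

section \<open>Weighted integrals\<close>

lemma contour_integral_linepath_same_Im:
  assumes "p < q"
  shows "contour_integral (linepath (Complex p T) (Complex q T)) f = integral {p..q} (\<lambda>x. f (Complex x T))"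
proof -
  define z z' where "z = Complex p T" and "z' = Complex q T"
  have "contour_integral (linepath z z') f = (z' - z) * integral {0..1} (\<lambda>x. f (linepath z z' x))"
    by (simp add: contour_integral_integral)
  also have "z' - z = of_real (q - p)" by (simp add: z_def z'_def complex_eq_iff)
  also have "integral {0..1} (\<lambda>x. f (linepath z z' x)) = integral {0..(q - p) / (q - p)} (\<lambda>x. f (Complex (p + (q - p) * x) T))"
  proof -
    have "linepath z z' x = Complex (p + (q - p) * x) T" for x
      by (simp add: linepath_def z_def z'_def complex_eq_iff algebra_simps)
    thus ?thesis using assms by simp
  qed
  also have "{0..(q - p) / (q - p)} = (\<lambda>x. x / (q - p)) ` {0..q - p}" using assms by simp
  also have "integral \<dots> (\<lambda>x. f (Complex (p + (q - p) * x) T)) =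
             integral {p-p..q-p} (\<lambda>x. f (Complex (x + p) T)) / of_real (q - p)"
    using assms by (subst integral_stretch_real) (auto simp: scaleR_conv_of_real add_ac)
  also have "\<dots> = integral {p..q} (\<lambda>x. f (Complex x T)) / of_real (q - p)"
    by (subst integral_shift_real_ivl) (rule refl)
  finally show ?thesis using assms by (simp add: z_def z'_def)
qed

text \<open>Integration by parts with A(x) the integral of \<omega> from x to q: the weighted
  integral equals (p - h) A(p) plus the integral of A. This turns bounds for changes of argument
  into bounds for the weighted integral.\<close>

lemma weighted_integral_bound_right:
  fixes \<omega> g :: "real \<Rightarrow> real"
  assumes pq: "p \<le> q" and cont: "continuous_on {p..q} \<omega>" and g: "g integrable_on {p..q}"
    and bd: "\<And>x. x \<in> {p..q} \<Longrightarrow> \<bar>integral {x..q} \<omega>\<bar> \<le> g x"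
  shows "\<bar>integral {p..q} (\<lambda>x. (x - h) * \<omega> x)\<bar> \<le> \<bar>p - h\<bar> * g p + integral {p..q} g"
proof -
  define A where "A = (\<lambda>x. integral {x..q} \<omega>)"
  have dA: "(A has_vector_derivative - \<omega> x) (at x within {p..q})" if "x \<in> {p..q}" for x
    unfolding A_def by (rule integral_has_vector_derivative'[OF cont that])
  have Ac: "continuous_on {p..q} A"
    using dA by (rule continuous_on_vector_derivative)
  have "((\<lambda>x. A x - (x - h) * \<omega> x) has_integral (q - h) * A q - (p - h) * A p) {p..q}"
  proof (rule fundamental_theorem_of_calculus[OF pq])
    fix x assume "x \<in> {p..q}"
    hence "(A has_real_derivative - \<omega> x) (at x within {p..q})"
      using dA by (simp add: has_real_derivative_iff_has_vector_derivative)
    hence "((\<lambda>x. (x - h) * A x) has_real_derivative A x - (x - h) * \<omega> x) (at x within {p..q})"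
      by (auto intro!: derivative_eq_intros)
    thus "((\<lambda>x. (x - h) * A x) has_vector_derivative A x - (x - h) * \<omega> x) (at x within {p..q})"
      by (simp add: has_real_derivative_iff_has_vector_derivative)
  qed
  moreover have "A q = 0" by (simp add: A_def)
  ultimately have 1: "integral {p..q} (\<lambda>x. A x - (x - h) * \<omega> x) = - ((p - h) * A p)"
    by (simp add: integral_unique)
  have i1: "A integrable_on {p..q}" "(\<lambda>x. (x - h) * \<omega> x) integrable_on {p..q}"
    by (intro integrable_continuous_real continuous_intros Ac cont)+
  have 2: "integral {p..q} (\<lambda>x. (x - h) * \<omega> x) = (p - h) * A p + integral {p..q} A"
    using 1 integral_diff[OF i1] by simp
  have "\<bar>integral {p..q} A\<bar> \<le> integral {p..q} g"
    using integral_norm_bound_integral[OF i1(1) g] bd by (simp add: A_def)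
  moreover have "\<bar>(p - h) * A p\<bar> \<le> \<bar>p - h\<bar> * g p"
    unfolding abs_mult using bd[of p] pq by (intro mult_left_mono) (auto simp: A_def)
  ultimately show ?thesis unfolding 2 by linarith
qed

lemma has_vector_derivative_vertical:
  assumes "(f has_field_derivative D) (at (Complex c t))"
  shows "((\<lambda>t. f (Complex c t)) has_vector_derivative \<i> * D) (at t within A)"
proof -
  have "((\<lambda>t. Complex c t) has_vector_derivative \<i>) (at t within A)"
    unfolding Complex_eq by (auto intro!: derivative_eq_intros)
  from field_vector_diff_chain_within[OF this, of f D] assms show ?thesis
    by (simp add: o_def has_field_derivative_at_within)
qed

lemma has_vector_derivative_horizontal:
  assumes "(f has_field_derivative D) (at (Complex x T))"
  shows "((\<lambda>x. f (Complex x T)) has_vector_derivative D) (at x within A)"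
proof -
  have "((\<lambda>x. Complex x T) has_vector_derivative 1) (at x within A)"
    unfolding Complex_eq by (auto intro!: derivative_eq_intros)
  from field_vector_diff_chain_within[OF this, of f D] assms show ?thesis
    by (simp add: o_def has_field_derivative_at_within)
qed

lemma continuous_on_vertical:
  "continuous_on {Complex c t |t. t \<in> A} f \<Longrightarrow> continuous_on A (\<lambda>t. f (Complex c t))"
  by (rule continuous_on_compose2[where g = f]) (auto simp: Complex_eq intro!: continuous_intros)

text \<open>Integration by parts in the manner of Littlewood: the weight is differentiated away, and
  for a logarithm \<Lambda> of \<open>zquot\<close> what is left to integrate is ln |zquot|.\<close>

lemma vertical_weighted_integral:
  assumes T: "T0 < T"
    and der: "\<And>t. t \<in> {T0..T} \<Longrightarrow> (\<Lambda> has_field_derivative W (Complex c t)) (at (Complex c t))"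
    and W: "continuous_on {T0..T} (\<lambda>t. W (Complex c t))"
  shows "Im (contour_integral (linepath (Complex c T0) (Complex c T)) (\<lambda>s. (s - h) * W s)) =
      (c - Re h) * (Im (\<Lambda> (Complex c T)) - Im (\<Lambda> (Complex c T0)))
      + (T - Im h) * Re (\<Lambda> (Complex c T)) - (T0 - Im h) * Re (\<Lambda> (Complex c T0))
      - integral {T0..T} (\<lambda>t. Re (\<Lambda> (Complex c t)))"
proof -
  have Lc: "continuous_on {T0..T} (\<lambda>t. \<Lambda> (Complex c t))"
    by (rule continuous_on_vector_derivative[OF has_vector_derivative_vertical[OF der]])
  have sc: "continuous_on {T0..T} (\<lambda>t. Complex c t)" unfolding Complex_eq by (intro continuous_intros)
  define F where "F = (\<lambda>t. (Complex c t - h) * \<Lambda> (Complex c t))"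
  have "((\<lambda>t. \<i> * \<Lambda> (Complex c t) + \<i> * ((Complex c t - h) * W (Complex c t))) has_integral (F T - F T0)) {T0..T}"
  proof (rule fundamental_theorem_of_calculus)
    fix t assume t: "t \<in> {T0..T}"
    have "((\<lambda>s. (s - h) * \<Lambda> s) has_field_derivative 1 * \<Lambda> (Complex c t) + W (Complex c t) * (Complex c t - h)) (at (Complex c t))"
      by (intro DERIV_mult der[OF t]) (auto intro!: derivative_eq_intros)
    from has_vector_derivative_vertical[OF this, of "{T0..T}"]
    show "(F has_vector_derivative \<i> * \<Lambda> (Complex c t) + \<i> * ((Complex c t - h) * W (Complex c t))) (at t within {T0..T})"
      by (simp add: F_def algebra_simps)
  qed (use T in auto)
  moreover have i1: "(\<lambda>t. \<i> * \<Lambda> (Complex c t)) integrable_on {T0..T}"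
    and i2: "(\<lambda>t. \<i> * ((Complex c t - h) * W (Complex c t))) integrable_on {T0..T}"
    and i3: "(\<lambda>t. \<Lambda> (Complex c t)) integrable_on {T0..T}"
    by (intro integrable_continuous_real continuous_intros Lc W sc)+
  ultimately have "integral {T0..T} (\<lambda>t. \<i> * ((Complex c t - h) * W (Complex c t))) =
      F T - F T0 - integral {T0..T} (\<lambda>t. \<i> * \<Lambda> (Complex c t))"
    using integral_add[OF i1 i2] by (simp add: integral_unique algebra_simps)
  also have "integral {T0..T} (\<lambda>t. \<i> * ((Complex c t - h) * W (Complex c t))) =
      contour_integral (linepath (Complex c T0) (Complex c T)) (\<lambda>s. (s - h) * W s)"
    using T by (subst contour_integral_linepath_same_Re[of _ c _ T0 T]) auto
  finally have "Im (contour_integral (linepath (Complex c T0) (Complex c T)) (\<lambda>s. (s - h) * W s)) =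
      Im (F T) - Im (F T0) - Im (\<i> * integral {T0..T} (\<lambda>t. \<Lambda> (Complex c t)))"
    by simp
  also have "Im (\<i> * integral {T0..T} (\<lambda>t. \<Lambda> (Complex c t))) = integral {T0..T} (\<lambda>t. Re (\<Lambda> (Complex c t)))"
    using integral_linear[OF i3 bounded_linear_Re] by (simp add: o_def)
  finally show ?thesis by (simp add: F_def algebra_simps)
qed

text \<open>Moving the segment to the right, the integrals over the horizontal sides stay bounded and the one over
  the shifted segment tends to zero.\<close>
lemma vertical_integral_decay_bound:
  assumes S: "open S" "convex S" "f holomorphic_on S"
    and strip: "\<And>x y. x \<ge> a \<Longrightarrow> y \<in> {y0..y1} \<Longrightarrow> Complex x y \<in> S"
    and q: "0 < q" "q < 1" and C: "C \<ge> 0"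
    and bd: "\<And>x y. x \<ge> a \<Longrightarrow> y \<in> {y0..y1} \<Longrightarrow> norm (f (Complex x y)) \<le> C * q powr x"
    and y: "y0 \<le> y1"
  shows "norm (integral {y0..y1} (\<lambda>y. f (Complex a y))) \<le> 2 * C * q powr a / (- ln q)"
proof -
  obtain P where P: "\<And>s. s \<in> S \<Longrightarrow> (P has_field_derivative f s) (at s within S)"
    using holomorphic_convex_primitive'[OF S(2,1,3)] by blast
  have P': "(P has_field_derivative f s) (at s)" if "s \<in> S" for s
    using P[OF that] unfolding at_within_open[OF that S(1)] .
  have lq: "ln q < 0" using q by simp
  define B where "B = C * q powr a / (- ln q)"
  have horiz: "norm (P (Complex X y) - P (Complex a y)) \<le> B" if X: "X > a" and y: "y \<in> {y0..y1}" for X y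
  proof -
    define \<phi> where "\<phi> = (\<lambda>x. C * (q powr x / ln q))"
    have "norm (P (Complex X y) - P (Complex a y)) \<le> \<phi> X - \<phi> a"
    proof (rule differentiable_bound_general[OF X, where f = "\<lambda>x. P (Complex x y)"])
      show "continuous_on {a..X} (\<lambda>x. P (Complex x y))"
        by (rule continuous_on_vector_derivative[OF has_vector_derivative_horizontal[OF P']])
           (use strip y in auto)
      have d: "(\<phi> has_real_derivative C * q powr x) (at x)" for x
        unfolding \<phi>_def using q lq by (auto intro!: derivative_eq_intros)
      thus d': "(\<phi> has_vector_derivative C * q powr x) (at x)" for x
        by (simp add: has_real_derivative_iff_has_vector_derivative)
      show "continuous_on {a..X} \<phi>"
        using d by (intro continuous_at_imp_continuous_on ballI) (metis DERIV_isCont)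
      fix x assume x: "a < x" "x < X"
      show "((\<lambda>x. P (Complex x y)) has_vector_derivative f (Complex x y)) (at x)"
        by (rule has_vector_derivative_horizontal[OF P']) (use strip x y in auto)
      show "norm (f (Complex x y)) \<le> C * q powr x" using bd x y by auto
    qed
    also have "\<dots> \<le> B" using C q lq by (simp add: \<phi>_def B_def divide_nonneg_neg mult_nonneg_nonpos)
    finally show ?thesis .
  qed
  have vert: "norm (P (Complex X y1) - P (Complex X y0)) \<le> C * q powr X * (y1 - y0)" if X: "X > a" for X
  proof -
    have "norm (P (Complex X y1) - P (Complex X y0)) \<le> C * q powr X * norm (Complex X y1 - Complex X y0)"
    proof (rule field_differentiable_bound[where S = "closed_segment (Complex X y0) (Complex X y1)" and f' = f])
      fix z assume "z \<in> closed_segment (Complex X y0) (Complex X y1)"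
      hence z: "z = Complex X (Im z)" "Im z \<in> {y0..y1}"
        using y by (auto simp: closed_segment_same_Re closed_segment_eq_real_ivl complex_eq_iff)
      have "Complex X (Im z) \<in> S" using z X by (intro strip) auto
      hence "z \<in> S" using z(1) by simp
      thus "(P has_field_derivative f z) (at z within closed_segment (Complex X y0) (Complex X y1))"
        using P' has_field_derivative_at_within by blast
      have "norm (f (Complex X (Im z))) \<le> C * q powr X" using z X by (intro bd) auto
      thus "norm (f z) \<le> C * q powr X" using z(1) by simp
    qed auto
    also have "norm (Complex X y1 - Complex X y0) = y1 - y0" using y by (simp add: cmod_def)
    finally show ?thesis .
  qed
  have main: "norm (P (Complex a y1) - P (Complex a y0)) \<le> 2 * B + C * q powr X * (y1 - y0)" if "X > a" for X
  proof -
    have "P (Complex a y1) - P (Complex a y0) = (P (Complex X y1) - P (Complex X y0))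
        - (P (Complex X y1) - P (Complex a y1)) + (P (Complex X y0) - P (Complex a y0))" by simp
    also have "norm \<dots> \<le> norm (P (Complex X y1) - P (Complex X y0))
        + norm (P (Complex X y1) - P (Complex a y1)) + norm (P (Complex X y0) - P (Complex a y0))"
      by (rule order_trans[OF norm_triangle_ineq add_right_mono[OF norm_triangle_ineq4]])
    finally show ?thesis using vert[OF that] horiz[OF that, of y1] horiz[OF that, of y0] y by simp
  qed
  have "((\<lambda>X. 2 * B + C * q powr X * (y1 - y0)) \<longlongrightarrow> 2 * B + C * 0 * (y1 - y0)) at_top"
  proof (intro tendsto_intros)
    have "((\<lambda>X. exp (X * ln q)) \<longlongrightarrow> 0) at_top" using lq by real_asymp
    thus "((\<lambda>X. q powr X) \<longlongrightarrow> 0) at_top" using q by (simp add: powr_def)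
  qed
  hence "norm (P (Complex a y1) - P (Complex a y0)) \<le> 2 * B + C * 0 * (y1 - y0)"
    by (rule tendsto_lowerbound)
       (use main in \<open>auto intro: eventually_mono[OF eventually_gt_at_top[of a]]\<close>)
  moreover have "norm (integral {y0..y1} (\<lambda>y. f (Complex a y))) = norm (P (Complex a y1) - P (Complex a y0))"
  proof -
    have "((\<lambda>y. \<i> * f (Complex a y)) has_integral (P (Complex a y1) - P (Complex a y0))) {y0..y1}"
      by (rule fundamental_theorem_of_calculus[OF y])
         (use strip in \<open>auto intro!: has_vector_derivative_vertical P'\<close>)
    hence "integral {y0..y1} (\<lambda>y. \<i> * f (Complex a y)) = P (Complex a y1) - P (Complex a y0)"
      by (rule integral_unique)
    thus ?thesis by (metis integral_mult_right norm_ii norm_mult mult_1)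
  qed
  ultimately show ?thesis by (simp add: B_def)
qed

section \<open>The vertical sides\<close>

text \<open>Where neither function vanishes, this is the logarithmic derivative of
  \<open>zquot\<close>. Written as a difference it lets the argument principle act on
  \<open>zeta2\<close> and \<open>zeta\<close> separately.\<close>

definition zw :: "complex \<Rightarrow> complex" where
  "zw s = deriv zeta2 s / zeta2 s - zlog s"

text \<open>Differentiate the product zeta2 = zeta exp(\<Lambda>); any holomorphic logarithm of
  \<open>zquot\<close> thus serves as a primitive of \<open>zw\<close>.\<close>

lemma log_branch_derivative:
  assumes U: "open U" "s \<in> U" "1 \<notin> U" and hol: "\<Lambda> holomorphic_on U"
    and nz: "\<And>z. z \<in> U \<Longrightarrow> zeta z \<noteq> 0" and ex: "\<And>z. z \<in> U \<Longrightarrow> zquot z = exp (\<Lambda> z)"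
  shows "(\<Lambda> has_field_derivative zw s) (at s)"
proof -
  have s1: "s \<noteq> 1" using U by auto
  have "((\<lambda>z. zeta z * exp (\<Lambda> z)) has_field_derivative
      zeta s * (exp (\<Lambda> s) * deriv \<Lambda> s) + deriv zeta s * exp (\<Lambda> s)) (at s)"
    using s1 by (auto intro!: derivative_eq_intros holomorphic_derivI[OF zeta_holomorphic] holomorphic_derivI[OF hol] U)
  hence "(zeta2 has_field_derivative zeta s * (exp (\<Lambda> s) * deriv \<Lambda> s) + deriv zeta s * exp (\<Lambda> s)) (at s)"
    by (rule has_field_derivative_transform_within_open[OF _ U(1,2)]) (use ex nz in \<open>auto simp: zquot_def field_simps\<close>)
  hence "deriv zeta2 s = zeta s * (exp (\<Lambda> s) * deriv \<Lambda> s) + deriv zeta s * exp (\<Lambda> s)" by (rule DERIV_imp_deriv)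
  moreover have "zeta2 s = zeta s * exp (\<Lambda> s)" using ex[OF U(2)] nz[OF U(2)] by (simp add: zquot_def field_simps)
  ultimately have "zw s = deriv \<Lambda> s" using nz[OF U(2)] by (simp add: zw_def zlog_def field_simps)
  thus ?thesis using holomorphic_derivI[OF hol U(1,2)] by simp
qed

lemma norm_Ln_1_plus_le: "norm z \<le> 1/3 \<Longrightarrow> norm (Ln (1 + z)) \<le> 2 * norm z" for z :: complex
  by (rule norm_Ln_le) simp

lemma one_plus_not_nonpos_Real: "norm z < 1 \<Longrightarrow> 1 + z \<notin> \<real>\<^sub>\<le>\<^sub>0" for z :: complex
  using abs_Re_le_cmod[of z] by (auto simp: complex_nonpos_Reals_iff)

text \<open>Dividing by the exponential main term \<open>u\<close> leaves 1 + E with E of size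
  3^(-x) / 2^(-x) = (2/3)^x. Right of a - 1 it is at most 1/3 in modulus, so the principal logarithm
  of 1 + E is holomorphic there and serves as \<epsilon>.\<close>

lemma zquot_right_branch:
  "\<exists>a\<ge>4. \<exists>C>0. \<exists>\<epsilon>. \<epsilon> holomorphic_on {s. Re s > a - 1} \<and>
     (\<forall>s. Re s > a - 1 \<longrightarrow> zeta s \<noteq> 0 \<and>
        zquot s = exp (- s * of_real (ln 2) + of_real (2 * ln (ln 2)) + \<epsilon> s) \<and>
        norm (\<epsilon> s) \<le> C * (2/3) powr (Re s) \<and> norm (\<epsilon> s) \<le> 1)"
proof -
  obtain C where C: "C > 0" "\<And>s. Re s \<ge> 3 \<Longrightarrow> zeta s \<noteq> 0"
    "\<And>s. Re s \<ge> 3 \<Longrightarrow> norm (zquot s - of_real ((ln 2)\<^sup>2) * 2 powr (-s)) \<le> C * 3 powr (- Re s)"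
    using zeta_right_asymptotics unfolding zquot_def by blast
  define u where "u = (\<lambda>s. complex_of_real ((ln 2)\<^sup>2) * 2 powr (-s))"
  define E where "E = (\<lambda>s. zquot s / u s - 1)"
  have l2: "ln (2::real) > 0" by simp
  have u_exp: "u s = exp (- s * of_real (ln 2) + of_real (2 * ln (ln 2)))" for s
  proof -
    have "(2::complex) powr (-s) = exp (- s * of_real (ln 2))"
      using Ln_of_real[of 2] by (simp add: powr_def)
    moreover have "exp (complex_of_real (2 * ln (ln 2))) = of_real ((ln 2)\<^sup>2)"
    proof -
      have "exp (2 * ln (ln 2 :: real)) = (ln 2)\<^sup>2" using l2 by (simp add: exp_double)
      thus ?thesis by (metis exp_of_real)
    qed
    ultimately show ?thesis unfolding u_def exp_add by simp
  qed
  have u0: "u s \<noteq> 0" for s by (simp add: u_exp)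
  have nu: "norm (u s) = (ln 2)\<^sup>2 * 2 powr (- Re s)" for s
    unfolding u_def norm_mult norm_of_real by (subst norm_powr_real_powr) auto
  define C2 where "C2 = C / (ln 2)\<^sup>2"
  have C2: "C2 > 0" using C l2 by (simp add: C2_def)
  have Eb: "norm (E s) \<le> C2 * (2/3) powr (Re s)" if s: "Re s \<ge> 3" for s
  proof -
    have "E s = (zquot s - u s) / u s" using u0[of s] by (simp add: E_def diff_divide_distrib)
    hence "norm (E s) = norm (zquot s - u s) / norm (u s)" by (simp add: norm_divide)
    also have "\<dots> \<le> C * 3 powr (- Re s) / norm (u s)"
      using C(3)[OF s] by (intro divide_right_mono) (auto simp: u_def)
    also have "\<dots> = C2 * (3 powr (- Re s) / 2 powr (- Re s))" unfolding nu by (simp add: C2_def)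
    also have "3 powr (- Re s) / 2 powr (- Re s) = (2/3) powr (Re s)"
      by (simp add: powr_divide powr_minus field_simps)
    finally show ?thesis .
  qed
  have "((\<lambda>x::real. C2 * exp (x * ln (2/3))) \<longlongrightarrow> 0) at_top"
    by real_asymp
  hence "\<forall>\<^sub>F x in at_top. C2 * exp (x * ln (2/3)) < 1/3"
    by (rule order_tendstoD) simp
  hence "\<forall>\<^sub>F x in at_top. C2 * (2/3) powr x < 1/3" by (simp add: powr_def)
  then obtain x0 where x0: "\<And>x. x \<ge> x0 \<Longrightarrow> C2 * (2/3) powr x < 1/3" by (auto simp: eventually_at_top_linorder)
  define a where "a = max 4 (x0 + 1)"
  have small: "norm (E s) \<le> 1/3" if s: "Re s > a - 1" for s
  proof -
    have "Re s \<ge> 3" "Re s \<ge> x0" using s unfolding a_def by linarith+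
    thus ?thesis using Eb[of s] x0[of "Re s"] by linarith
  qed
  define \<epsilon> where "\<epsilon> = (\<lambda>s. Ln (1 + E s))"
  have "\<epsilon> holomorphic_on {s. Re s > a - 1}"
  proof -
    have "1 \<notin> {s. Re s > a - 1}" by (auto simp: a_def)
    hence "zquot holomorphic_on {s. Re s > a - 1}" unfolding zquot_def[abs_def]
      by (intro holomorphic_intros zeta_holomorphic_on holomorphic_on_subset[OF zeta2_holomorphic])
         (auto simp: a_def intro!: C(2))
    moreover have "u holomorphic_on {s. Re s > a - 1}" unfolding u_exp by (intro holomorphic_intros)
    ultimately have "E holomorphic_on {s. Re s > a - 1}" unfolding E_def
      by (intro holomorphic_intros) (auto simp: u0)
    moreover have "1 + E s \<notin> \<real>\<^sub>\<le>\<^sub>0" if "Re s > a - 1" for s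
      using small[OF that] by (intro one_plus_not_nonpos_Real) simp
    ultimately show ?thesis unfolding \<epsilon>_def by (intro holomorphic_intros) auto
  qed
  moreover have "zeta s \<noteq> 0 \<and> zquot s = exp (- s * of_real (ln 2) + of_real (2 * ln (ln 2)) + \<epsilon> s) \<and>
        norm (\<epsilon> s) \<le> 2 * C2 * (2/3) powr (Re s) \<and> norm (\<epsilon> s) \<le> 1" if s: "Re s > a - 1" for s
  proof -
    have s3: "Re s \<ge> 3" using s by (auto simp: a_def)
    have e: "norm (\<epsilon> s) \<le> 2 * norm (E s)" unfolding \<epsilon>_def by (rule norm_Ln_1_plus_le[OF small[OF s]])
    have "1 + E s \<noteq> 0" using small[OF s] by (metis add.inverse_unique norm_minus_cancel norm_one not_le divide_less_eq_1_pos zero_less_numeral one_less_numeral_iff semiring_norm(77))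
    hence "exp (\<epsilon> s) = 1 + E s" by (simp add: \<epsilon>_def)
    hence "zquot s = u s * exp (\<epsilon> s)" using u0[of s] by (simp add: E_def)
    hence "zquot s = exp (- s * of_real (ln 2) + of_real (2 * ln (ln 2)) + \<epsilon> s)"
      unfolding u_exp by (simp add: exp_add mult_ac)
    thus ?thesis using e Eb[OF s3] small[OF s] C(2)[OF s3] by auto
  qed
  ultimately show ?thesis using C2 by (intro exI[of _ a] conjI exI[of _ "2 * C2"] exI[of _ \<epsilon>]) (auto simp: a_def)
qed

lemma lam_Re_large: "\<exists>T1\<ge>4. \<forall>w. Re w \<ge> 1/2 \<and> Im w \<le> - T1 \<longrightarrow> Re (lam w) \<ge> M"
\<comment> \<open>The 30 absorbs ln(2 pi) \<le> 2 pi - 1 and the error 10 + 2 pi of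
  \<open>lam_err\<close>, as pi < 4.\<close>
proof (intro exI[of _ "max 4 (exp (M + 30))"] conjI allI impI)
  fix w assume w: "1/2 \<le> Re w \<and> Im w \<le> - max 4 (exp (M + 30))"
  have v: "exp (M + 30) \<le> norm w" "4 \<le> norm w" using w abs_Im_le_cmod[of w] by linarith+
  have "M + 30 \<le> ln (norm w)" using v by (subst ln_ge_iff) auto
  moreover have "norm (lam_err w) \<le> 10 / norm w + 2 * pi * exp (pi * Im w)"
    by (rule lam_err_bound) (use w in auto)
  moreover have "10 / norm w \<le> 10 / 1" using v by (intro divide_left_mono) auto
  moreover have "2 * pi * exp (pi * Im w) \<le> 2 * pi * 1"
    using w by (intro mult_left_mono) (auto intro!: mult_nonneg_nonpos)
  moreover have "Re (lam w) = ln (norm w) - ln (2 * pi) + Re (lam_err w)"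
  proof -
    have "w \<noteq> 0" using v by auto
    thus ?thesis by (simp add: lam_err_def)
  qed
  moreover have "- Re (lam_err w) \<le> norm (lam_err w)" using abs_Re_le_cmod[of "lam_err w"] by linarith
  moreover have "ln (2 * pi) \<le> 2 * pi - 1" using pi_gt_zero by (intro ln_le_minus_one) auto
  ultimately show "Re (lam w) \<ge> M" using pi_less_4 by linarith
qed auto

lemma lam_vertical_asymptotics:
  assumes a: "a > 0"
  shows "\<exists>K>0. \<exists>T1\<ge>4. \<forall>t\<ge>T1. norm (lam (Complex a (-t)) - of_real (ln (t / (2 * pi)))) \<le> K / t"
proof (rule exI[of _ "2 * a + 10 + 2 * pi"], rule conjI, goal_cases)
  case 2
  show ?case
  proof (rule exI[of _ "max 4 (3 * a)"], intro conjI allI impI)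
  fix t assume t: "t \<ge> max 4 (3 * a)"
  define w where "w = Complex a (-t)"
  have w0: "w \<noteq> 0" using a by (auto simp: w_def complex_eq_iff)
  have t0: "t > 0" using t by simp
  have na: "norm (\<i> * complex_of_real (a / t)) = a / t"
    unfolding norm_mult norm_of_real using a t0 by simp
  \<comment> \<open>Since i w = t (1 + i a / t) lies near the positive real axis, Ln(i w) is ln t up
    to O(1 / t); this is why \<open>lam\<close> is nearly real on the line.\<close>
  have "Ln (\<i> * w) = Ln w + \<i> * of_real (pi / 2)"
    using w0 a by (subst Ln_times_ii) (auto simp: w_def)
  moreover have "\<i> * w = of_real t * (1 + \<i> * of_real (a / t))"
    using t0 by (simp add: w_def complex_eq_iff)
  moreover have "Ln (of_real t * (1 + \<i> * of_real (a / t))) = of_real (ln t) + Ln (1 + \<i> * of_real (a / t))"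
  proof -
    have "1 + \<i> * of_real (a / t) \<noteq> 0" by (simp add: complex_eq_iff)
    thus ?thesis using t0 Ln_times_of_real[of t] Ln_of_real[of t] by simp
  qed
  ultimately have key: "Ln w + \<i> * of_real (pi / 2) = of_real (ln t) + Ln (1 + \<i> * of_real (a / t))"
    by (simp only:)
  have "ln (t / (2 * pi)) = ln t - ln (2 * pi)" using t0 by (simp add: ln_div)
  hence "lam w - of_real (ln (t / (2 * pi))) = (Ln w + \<i> * of_real (pi / 2)) - of_real (ln t) + lam_err w"
    by (simp add: lam_err_def)
  also have "\<dots> = Ln (1 + \<i> * of_real (a / t)) + lam_err w" unfolding key by simp
  finally have "norm (lam w - of_real (ln (t / (2 * pi)))) = norm (Ln (1 + \<i> * of_real (a / t)) + lam_err w)"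
    by (rule arg_cong)
  also have "\<dots> \<le> norm (Ln (1 + \<i> * of_real (a / t))) + norm (lam_err w)" by (rule norm_triangle_ineq)
  also have "norm (Ln (1 + \<i> * of_real (a / t))) \<le> 2 * norm (\<i> * complex_of_real (a / t))"
  proof (rule norm_Ln_1_plus_le)
    have "a / t \<le> 1 / 3" using t a t0 by (simp add: field_simps)
    thus "norm (\<i> * complex_of_real (a / t)) \<le> 1 / 3" unfolding na .
  qed
  also note na
  also have "norm (lam_err w) \<le> 10 / norm w + 2 * pi * exp (pi * Im w)"
    by (rule lam_err_bound) (use a t in \<open>auto simp: w_def\<close>)
  also have "10 / norm w \<le> 10 / t"
    using t0 abs_Im_le_cmod[of w] by (intro divide_left_mono mult_pos_pos) (auto simp: w_def)
  also have "2 * pi * exp (pi * Im w) \<le> 2 * pi * (1 / t)"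
  proof (intro mult_left_mono)
    have "t \<le> pi * t" using t0 pi_gt3 mult_right_mono[of 1 pi t] by simp
    also have "\<dots> \<le> exp (pi * t)" using exp_ge_add_one_self[of "pi * t"] by linarith
    finally have "1 / exp (pi * t) \<le> 1 / t" using t0 by (intro divide_left_mono) auto
    thus "exp (pi * Im w) \<le> 1 / t" by (simp add: w_def exp_minus inverse_eq_divide)
  qed auto
  finally show "norm (lam (Complex a (-t)) - of_real (ln (t / (2 * pi)))) \<le> (2 * a + 10 + 2 * pi) / t"
    by (simp add: w_def add_divide_distrib)
  qed auto
qed (use a in \<open>auto intro!: add_pos_pos\<close>)

text \<open>A primitive of ln(ln x): integrating by parts leaves the integral of 1 / ln x, the
  origin of \<open>Li\<close> in the theorem.\<close>

definition main_prim :: "real \<Rightarrow> real" where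
  "main_prim x = x * ln (ln x) - Li x"

lemma Li_has_derivative:
  assumes "x > 1"
  shows "(Li has_real_derivative 1 / ln x) (at x)"
proof -
  \<comment> \<open>An interval inside x > 1 that has both \<open>x\<close> and the base point 2 in
    its interior, on whichever side of 2 \<open>x\<close> lies.\<close>
  define a b where "a = (1 + min x 2) / 2" and "b = max x 2 + 1"
  have ab: "1 < a" "a < x" "a < 2" "x < b" "2 < b" using assms by (auto simp: a_def b_def)
  have "continuous_on {a..b} (\<lambda>t. 1 / ln t)"
    using ab by (intro continuous_intros) auto
  hence "((\<lambda>u. LBINT y=ereal 2..u. 1 / ln y) has_vector_derivative (1 / ln x)) (at x within {a..b})"
    using ab by (intro interval_integral_FTC2) auto
  hence "((\<lambda>u. LBINT y=2..u. 1 / ln y) has_vector_derivative (1 / ln x)) (at x within {a..b})" by simp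
  moreover have "at x within {a..b} = at x" using ab by (intro at_within_interior) (auto simp: interior_atLeastAtMost_real)
  ultimately show ?thesis
    by (simp add: Li_def [abs_def] has_real_derivative_iff_has_vector_derivative)
qed

lemma main_prim_has_derivative:
  assumes "x > 1"
  shows "(main_prim has_real_derivative ln (ln x)) (at x)"
proof -
  have "ln x > 0" using assms by simp
  hence "((\<lambda>x. ln (ln x)) has_real_derivative (1 / x) / ln x) (at x)"
    using assms by (auto intro!: derivative_eq_intros)
  hence "(main_prim has_real_derivative (1 * ln (ln x) + (1 / x) / ln x * x) - 1 / ln x) (at x)"
    unfolding main_prim_def[abs_def] by (intro DERIV_diff DERIV_mult DERIV_ident Li_has_derivative assms)
  thus ?thesis using assms by simp
qed

lemma zw_holomorphic:
  assumes "open U" "1 \<notin> U" "\<And>z. z \<in> U \<Longrightarrow> zeta z \<noteq> 0" "\<And>z. z \<in> U \<Longrightarrow> zeta2 z \<noteq> 0"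
  shows "zw holomorphic_on U"
proof -
  have sub: "U \<subseteq> - {1}" using assms(2) by auto
  have "deriv zeta2 holomorphic_on - {1}" by (intro holomorphic_deriv zeta2_holomorphic) auto
  thus ?thesis unfolding zw_def [abs_def] zlog_def using assms
    by (intro holomorphic_intros zeta_holomorphic_on holomorphic_on_subset[OF zeta2_holomorphic sub]
          holomorphic_on_subset[OF zeta_deriv_holomorphic sub] holomorphic_on_subset[of _ "- {1}"]) (use sub in auto)
qed

text \<open>The logarithm of \<open>zquot\<close> is explicit. Its imaginary part, weighted by a -
  1/2, gives -(a - 1/2) T ln 2, and the integral of its real part subtracts (2 ln(ln 2) - a ln 2) T,
  so that \<open>a\<close> cancels. The integral of \<epsilon> is bounded by its decay to the right.
  The corner term T ln |zquot| is kept in order to cancel against the upper side.\<close>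

lemma right_vertical:
  assumes hol: "\<epsilon> holomorphic_on {s. Re s > b}" and b: "b \<ge> 1" "a > b" and C: "C > 0"
    and eps: "\<And>s. Re s > b \<Longrightarrow> zeta s \<noteq> 0 \<and>
        zquot s = exp (- s * of_real (ln 2) + of_real (2 * ln (ln 2)) + \<epsilon> s) \<and>
        norm (\<epsilon> s) \<le> C * (2/3) powr (Re s) \<and> norm (\<epsilon> s) \<le> 1"
  shows "\<exists>K. \<forall>T>T0. \<bar>Im (contour_integral (linepath (Complex a T0) (Complex a T)) (\<lambda>s. (s - 1/2) * zw s))
     - (T * ln (norm (zquot (Complex a T))) + T * (ln 2 / 2 - 2 * ln (ln 2)))\<bar> \<le> K"
proof -
  define S where "S = {s::complex. Re s > b}"
  have S: "open S" "convex S" "1 \<notin> S"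
    using b by (auto simp: S_def open_halfspace_Re_gt convex_halfspace_Re_gt)
  define c where "c = 2 * ln (ln (2::real))"
  define \<Lambda> where "\<Lambda> = (\<lambda>s. - s * of_real (ln 2) + of_real c + \<epsilon> s)"
  have Lh: "\<Lambda> holomorphic_on S" unfolding \<Lambda>_def by (intro holomorphic_intros) (use hol in \<open>simp add: S_def\<close>)
  have ex: "zquot s = exp (\<Lambda> s)" "zeta s \<noteq> 0" if "s \<in> S" for s
    using eps[of s] that by (auto simp: S_def \<Lambda>_def c_def)
  have z2: "zeta2 s \<noteq> 0" if "s \<in> S" for s using ex[OF that] by (auto simp: zquot_def)
  have der: "(\<Lambda> has_field_derivative zw s) (at s)" if "s \<in> S" for s
    by (rule log_branch_derivative[OF S(1) that S(3) Lh]) (use ex in auto)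
  have zwh: "zw holomorphic_on S" by (rule zw_holomorphic) (use S ex z2 in auto)
  have inS: "Complex a t \<in> S" for t using b by (simp add: S_def)
  define K1 where "K1 = 2 * C * (2/3) powr a / (- ln (2/3))"
  define L0 where "L0 = Re (\<Lambda> (Complex a T0))"
  define K where "K = a * (\<bar>T0\<bar> * ln 2 + 2) + \<bar>T0 * L0\<bar> + \<bar>T0 * (c - a * ln 2)\<bar> + K1"
  have "\<bar>Im (contour_integral (linepath (Complex a T0) (Complex a T)) (\<lambda>s. (s - 1/2) * zw s))
     - (T * ln (norm (zquot (Complex a T))) + T * (ln 2 / 2 - 2 * ln (ln 2)))\<bar> \<le> K" if T: "T > T0" for T
  proof -
    define I where "I = integral {T0..T} (\<lambda>t. \<epsilon> (Complex a t))"
    have I: "norm I \<le> K1" unfolding I_def K1_def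
    proof (rule vertical_integral_decay_bound[OF S(1,2)])
      fix x y assume "x \<ge> a"
      hence "Re (Complex x y) > b" using b by simp
      thus "Complex x y \<in> S" "norm (\<epsilon> (Complex x y)) \<le> C * (2/3) powr x"
        using eps[of "Complex x y"] by (auto simp: S_def)
    qed (use hol C T in \<open>auto simp: S_def\<close>)
    have ec: "continuous_on {T0..T} (\<lambda>t. \<epsilon> (Complex a t))"
      by (intro continuous_on_vertical holomorphic_on_imp_continuous_on holomorphic_on_subset[OF hol]) (use b in auto)
    have "Im (contour_integral (linepath (Complex a T0) (Complex a T)) (\<lambda>s. (s - 1/2) * zw s)) =
        (a - Re (1/2)) * (Im (\<Lambda> (Complex a T)) - Im (\<Lambda> (Complex a T0)))
      + (T - Im (1/2)) * Re (\<Lambda> (Complex a T)) - (T0 - Im (1/2)) * Re (\<Lambda> (Complex a T0))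
      - integral {T0..T} (\<lambda>t. Re (\<Lambda> (Complex a t)))"
    proof (rule vertical_weighted_integral[OF T])
      show "continuous_on {T0..T} (\<lambda>t. zw (Complex a t))"
        by (intro continuous_on_vertical holomorphic_on_imp_continuous_on holomorphic_on_subset[OF zwh]) (use inS in auto)
    qed (use der inS in auto)
    also have "integral {T0..T} (\<lambda>t. Re (\<Lambda> (Complex a t))) = (T - T0) * (c - a * ln 2) + Re I"
    proof -
      have "integral {T0..T} (\<lambda>t. Re (\<Lambda> (Complex a t))) = integral {T0..T} (\<lambda>t. (c - a * ln 2) + Re (\<epsilon> (Complex a t)))"
        by (simp add: \<Lambda>_def algebra_simps)
      also have "\<dots> = integral {T0..T} (\<lambda>t. c - a * ln 2) + integral {T0..T} (\<lambda>t. Re (\<epsilon> (Complex a t)))"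
        by (rule integral_add) (intro integrable_continuous_real continuous_intros ec)+
      also have "integral {T0..T} (\<lambda>t. Re (\<epsilon> (Complex a t))) = Re I"
        using integral_linear[OF integrable_continuous_real[OF ec] bounded_linear_Re] by (simp add: o_def I_def)
      finally show ?thesis using T by simp
    qed
    also have "Re (\<Lambda> (Complex a T)) = ln (norm (zquot (Complex a T)))" using ex(1)[OF inS] by simp
    also have "Im (\<Lambda> (Complex a T)) = - T * ln 2 + Im (\<epsilon> (Complex a T))" by (simp add: \<Lambda>_def)
    also have "Im (\<Lambda> (Complex a T0)) = - T0 * ln 2 + Im (\<epsilon> (Complex a T0))" by (simp add: \<Lambda>_def)
    finally have eq: "Im (contour_integral (linepath (Complex a T0) (Complex a T)) (\<lambda>s. (s - 1/2) * zw s))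
       - (T * ln (norm (zquot (Complex a T))) + T * (ln 2 / 2 - 2 * ln (ln 2))) =
       (a - 1/2) * (T0 * ln 2 + (Im (\<epsilon> (Complex a T)) - Im (\<epsilon> (Complex a T0)))) - T0 * L0 + T0 * (c - a * ln 2) - Re I"
      by (simp add: L0_def c_def algebra_simps)
    have e1: "\<bar>Im (\<epsilon> (Complex a t))\<bar> \<le> 1" for t
      using abs_Im_le_cmod[of "\<epsilon> (Complex a t)"] eps[of "Complex a t"] b by auto
    have "\<bar>(a - 1/2) * (T0 * ln 2 + (Im (\<epsilon> (Complex a T)) - Im (\<epsilon> (Complex a T0))))\<bar> \<le> a * (\<bar>T0\<bar> * ln 2 + 2)"
      unfolding abs_mult
    proof (rule mult_mono)
      have "\<bar>T0 * ln 2\<bar> = \<bar>T0\<bar> * ln 2" by (simp add: abs_mult)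
      thus "\<bar>T0 * ln 2 + (Im (\<epsilon> (Complex a T)) - Im (\<epsilon> (Complex a T0)))\<bar> \<le> \<bar>T0\<bar> * ln 2 + 2"
        using e1[of T] e1[of T0] by linarith
    qed (use b in auto)
    moreover have "\<bar>Re I\<bar> \<le> K1" using I abs_Re_le_cmod[of I] by linarith
    ultimately show ?thesis unfolding eq K_def by linarith
  qed
  thus ?thesis by blast
qed

text \<open>The factor \<open>1 + deriv lam w / (lam w)\<^sup>2\<close> of \<open>zquot (1 - w) / (lam w)\<^sup>2\<close> is split off, because the remaining
  factor tends to 1 exponentially fast to the right.\<close>
lemma zquot_left_branch:
  "\<exists>a\<ge>4. \<exists>T1\<ge>4. \<exists>C>0. \<exists>e1 e2.
     e1 holomorphic_on {w. Re w > a - 1 \<and> Im w < - T1} \<and> e2 holomorphic_on {w. Re w > a - 1 \<and> Im w < - T1} \<and>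
     (\<forall>w. Re w > a - 1 \<and> Im w < - T1 \<longrightarrow> zeta w \<noteq> 0 \<and> Re (lam w) \<ge> 1 \<and>
        zquot (1 - w) = exp (2 * Ln (lam w) + e1 w + e2 w) \<and> norm (e1 w) \<le> 1 \<and> norm (e2 w) \<le> 1 \<and>
        norm (e1 w) \<le> 2 * norm (deriv lam w) / (norm (lam w))\<^sup>2 \<and> norm (e2 w) \<le> C * (1/2) powr (Re w))"
proof -
  obtain Cr where Cr: "Cr > 0" "\<And>s. Re s \<ge> 3 \<Longrightarrow> zeta s \<noteq> 0"
    "\<And>s. Re s \<ge> 3 \<Longrightarrow> norm (zlog s) \<le> Cr * 2 powr (- Re s)"
    "\<And>s. Re s \<ge> 3 \<Longrightarrow> norm (zquot s - of_real ((ln 2)\<^sup>2) * 2 powr (-s)) \<le> Cr * 3 powr (- Re s)"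
    using zeta_right_asymptotics unfolding zlog_def zquot_def by blast
  obtain Cl where Cl: "Cl > 0" "\<And>w. Re w \<ge> 1/2 \<Longrightarrow> Im w \<le> -2 \<Longrightarrow> norm (deriv lam w) \<le> Cl * (1 / norm w + exp (pi * Im w))"
    using lam_deriv_bound by blast
  \<comment> \<open>As |deriv lam| is at most 2 Cl in this region, |lam| \<ge> 6 Cl + 2 makes
    \<open>E1\<close> at most 1/3 in modulus.\<close>
  obtain T1 where T1: "T1 \<ge> 4" "\<And>w. Re w \<ge> 1/2 \<Longrightarrow> Im w \<le> - T1 \<Longrightarrow> Re (lam w) \<ge> 6 * Cl + 2"
    using lam_Re_large[of "6 * Cl + 2"] by blast
  define C1 where "C1 = 4 * Cr + 1"
  define E1 where "E1 = (\<lambda>w. deriv lam w / (lam w)\<^sup>2)"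
  define E2 where "E2 = (\<lambda>w. ((2 * lam w * zlog w + zquot w) / (lam w)\<^sup>2) / (1 + E1 w))"
  have p12: "(1/2) powr x = 2 powr (-x)" for x :: real by (simp add: powr_minus powr_divide divide_simps)
  have lamb: "norm (lam w) \<ge> 6 * Cl + 2" if "Re w \<ge> 3" "Im w < - T1" for w
    using T1(2)[of w] that complex_Re_le_cmod[of "lam w"] by linarith
  have E1b: "norm (E1 w) \<le> 1/3" if w: "Re w \<ge> 3" "Im w < - T1" for w
  proof -
    have nl: "norm (lam w) \<ge> 6 * Cl + 2" using lamb[OF w] .
    have nw: "norm w \<ge> 1" using complex_Re_le_cmod[of w] w by linarith
    have "1 / norm w \<le> 1 / 1" using nw by (intro divide_left_mono) auto
    moreover have "exp (pi * Im w) \<le> 1" using w T1 by (auto intro!: mult_nonneg_nonpos)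
    ultimately have "1 / norm w + exp (pi * Im w) \<le> 2" by linarith
    hence "norm (deriv lam w) \<le> Cl * 2"
      using Cl(2)[of w] w T1 mult_left_mono[of "1 / norm w + exp (pi * Im w)" 2 Cl] Cl(1) by linarith
    moreover have "(6 * Cl) * 1 \<le> norm (lam w) * norm (lam w)"
      using nl Cl by (intro mult_mono) auto
    ultimately have "norm (deriv lam w) \<le> 1/3 * (norm (lam w))\<^sup>2" by (simp add: power2_eq_square)
    moreover have "norm (lam w) > 0" using nl Cl by linarith
    ultimately show ?thesis by (simp add: E1_def norm_divide norm_power pos_divide_le_eq)
  qed
  have one_E1: "norm (1 + E1 w) \<ge> 2/3" if w: "Re w \<ge> 3" "Im w < - T1" for w
    using norm_triangle_ineq4[of "1 + E1 w" "E1 w"] E1b[OF w] by simp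
  have E2b: "norm (E2 w) \<le> C1 * (3/2) * (1/2) powr (Re w)" if w: "Re w \<ge> 3" "Im w < - T1" for w
  proof -
    have nl: "norm (lam w) \<ge> 2" using lamb[OF w] Cl by linarith
    define p where "p = 2 powr (- Re w)"
    have zl: "norm (zlog w) \<le> Cr * p" unfolding p_def by (rule Cr(3)[OF w(1)])
    have l2: "0 \<le> ln (2::real)" "ln (2::real) \<le> 1" using ln_2_less_1 by auto
    have "norm (zquot w) \<le> norm (zquot w - of_real ((ln 2)\<^sup>2) * 2 powr (-w)) + norm (complex_of_real ((ln 2)\<^sup>2) * 2 powr (-w))"
      using norm_triangle_ineq[of "zquot w - of_real ((ln 2)\<^sup>2) * 2 powr (-w)" "of_real ((ln 2)\<^sup>2) * 2 powr (-w)"] by simp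
    also have "norm (complex_of_real ((ln 2)\<^sup>2) * 2 powr (-w)) = (ln 2)\<^sup>2 * p"
      unfolding norm_mult norm_of_real p_def by (subst norm_powr_real_powr) auto
    also have "(ln 2)\<^sup>2 * p \<le> 1 * p" using l2 by (intro mult_right_mono power_le_one) (auto simp: p_def)
    also have "norm (zquot w - of_real ((ln 2)\<^sup>2) * 2 powr (-w)) \<le> Cr * 3 powr (- Re w)" by (rule Cr(4)[OF w(1)])
    also have "Cr * 3 powr (- Re w) \<le> Cr * p" unfolding p_def using Cr(1) w by (intro mult_left_mono powr_mono2') auto
    finally have zq: "norm (zquot w) \<le> (Cr + 1) * p" by (simp add: algebra_simps)
    have l0: "norm (lam w) > 0" using nl by linarith
    have "norm ((2 * lam w * zlog w + zquot w) / (lam w)\<^sup>2) \<le> (2 * norm (lam w) * norm (zlog w) + norm (zquot w)) / (norm (lam w))\<^sup>2"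
      unfolding norm_divide norm_power
      using norm_triangle_ineq[of "2 * lam w * zlog w" "zquot w"] by (intro divide_right_mono) (auto simp: norm_mult)
    also have "\<dots> = 2 * norm (zlog w) / norm (lam w) + norm (zquot w) / (norm (lam w))\<^sup>2"
      using l0 by (simp add: add_divide_distrib power2_eq_square)
    also have "\<dots> \<le> 2 * norm (zlog w) / 1 + norm (zquot w) / 1"
    proof (intro add_mono divide_left_mono)
      have "1 * 1 \<le> norm (lam w) * norm (lam w)" using nl by (intro mult_mono) auto
      thus "1 \<le> (norm (lam w))\<^sup>2" by (simp add: power2_eq_square)
    qed (use nl l0 in auto)
    also have "\<dots> \<le> C1 * p"
    proof -
      have "0 \<le> Cr * p" using Cr(1) by (simp add: p_def)
      moreover have "C1 * p = 4 * (Cr * p) + p" "(Cr + 1) * p = Cr * p + p" by (simp_all add: C1_def algebra_simps)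
      ultimately show ?thesis using zl zq by simp
    qed
    finally have n: "norm ((2 * lam w * zlog w + zquot w) / (lam w)\<^sup>2) \<le> C1 * p" .
    have "norm (E2 w) \<le> C1 * p / (2/3)"
      unfolding E2_def norm_divide[of _ "1 + E1 w"] using n one_E1[OF w] Cr(1)
      by (intro frac_le) (auto simp: C1_def p_def)
    thus ?thesis by (simp add: p_def p12)
  qed
  define C2 where "C2 = C1 * (3/2)"
  have C2: "C2 > 0" using Cr by (simp add: C2_def C1_def)
  have "((\<lambda>x::real. C2 * exp (x * ln (1/2))) \<longlongrightarrow> 0) at_top"
    by real_asymp
  hence "\<forall>\<^sub>F x in at_top. C2 * exp (x * ln (1/2)) < 1/3" by (rule order_tendstoD) simp
  hence "\<forall>\<^sub>F x in at_top. C2 * (1/2) powr x < 1/3" by (simp add: powr_def)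
  then obtain x0 where x0: "\<And>x. x \<ge> x0 \<Longrightarrow> C2 * (1/2) powr x < 1/3" by (auto simp: eventually_at_top_linorder)
  define a where "a = max 4 (x0 + 1)"
  define \<Omega> where "\<Omega> = {w. Re w > a - 1 \<and> Im w < - T1}"
  have \<Omega>: "Re w \<ge> 3" "Re w \<ge> x0" "Im w < - T1" if "w \<in> \<Omega>" for w using that by (auto simp: \<Omega>_def a_def)
  have E2s: "norm (E2 w) \<le> 1/3" if w: "w \<in> \<Omega>" for w
    using E2b[of w] x0[of "Re w"] \<Omega>[OF w] by (simp add: C2_def)
  have lam0: "lam w \<noteq> 0" if "w \<in> \<Omega>" for w using lamb[of w] \<Omega>[OF that] Cl by auto
  have oe: "1 + E1 w \<noteq> 0" if "w \<in> \<Omega>" for w using one_E1[of w] \<Omega>[OF that] by auto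
  have sub: "\<Omega> \<subseteq> {w. Im w < 0}" "1 \<notin> \<Omega>" using T1 by (auto simp: \<Omega>_def)
  have lh: "lam holomorphic_on \<Omega>" "deriv lam holomorphic_on \<Omega>"
    using lam_holomorphic holomorphic_deriv[OF lam_holomorphic open_halfspace_Im_lt] sub(1)
    by (auto intro: holomorphic_on_subset)
  have E1h: "E1 holomorphic_on \<Omega>" unfolding E1_def by (intro holomorphic_intros lh) (use lam0 in auto)
  have O1: "\<Omega> \<subseteq> - {1}" using sub(2) by auto
  have zh: "zlog holomorphic_on \<Omega>" "zquot holomorphic_on \<Omega>"
    unfolding zlog_def[abs_def] zquot_def[abs_def] using \<Omega> Cr(2)
    by (intro holomorphic_intros zeta_holomorphic_on[OF sub(2)] holomorphic_on_subset[OF zeta2_holomorphic O1]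
        holomorphic_on_subset[OF zeta_deriv_holomorphic O1]; auto)+
  have E2h: "E2 holomorphic_on \<Omega>" unfolding E2_def
    by (intro holomorphic_intros lh E1h zh) (use lam0 oe in auto)
  have "(\<lambda>w. Ln (1 + E1 w)) holomorphic_on \<Omega>"
    by (intro holomorphic_intros E1h one_plus_not_nonpos_Real) (use E1b \<Omega> in force)
  moreover have "(\<lambda>w. Ln (1 + E2 w)) holomorphic_on \<Omega>"
    by (intro holomorphic_intros E2h one_plus_not_nonpos_Real) (use E2s in force)
  moreover have "zeta w \<noteq> 0 \<and> Re (lam w) \<ge> 1 \<and>
        zquot (1 - w) = exp (2 * Ln (lam w) + Ln (1 + E1 w) + Ln (1 + E2 w)) \<and>
        norm (Ln (1 + E1 w)) \<le> 1 \<and> norm (Ln (1 + E2 w)) \<le> 1 \<and>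
        norm (Ln (1 + E1 w)) \<le> 2 * norm (deriv lam w) / (norm (lam w))\<^sup>2 \<and>
        norm (Ln (1 + E2 w)) \<le> (2 * C2) * (1/2) powr (Re w)" if w: "w \<in> \<Omega>" for w
  proof -
    note w' = \<Omega>[OF w]
    have z0: "zeta w \<noteq> 0" using Cr(2) w' by auto
    have l1: "norm (Ln (1 + E1 w)) \<le> 2 * norm (E1 w)" by (rule norm_Ln_1_plus_le[OF E1b[OF w'(1,3)]])
    have l2: "norm (Ln (1 + E2 w)) \<le> 2 * norm (E2 w)" by (rule norm_Ln_1_plus_le[OF E2s[OF w]])
    have e2: "1 + E2 w \<noteq> 0" using one_plus_not_nonpos_Real[of "E2 w"] E2s[OF w] by auto
    have "zquot (1 - w) = (lam w)\<^sup>2 + deriv lam w + 2 * lam w * zlog w + zquot w"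
      by (rule zquot_reflect[OF _ z0]) (use w' T1 in auto)
    also have "\<dots> = (lam w)\<^sup>2 * ((1 + E1 w) + (2 * lam w * zlog w + zquot w) / (lam w)\<^sup>2)"
      using lam0[OF w] by (simp add: E1_def field_simps)
    also have "(2 * lam w * zlog w + zquot w) / (lam w)\<^sup>2 = (1 + E1 w) * E2 w"
      using oe[OF w] by (simp add: E2_def)
    also have "(1 + E1 w) + (1 + E1 w) * E2 w = (1 + E1 w) * (1 + E2 w)" by (simp add: algebra_simps)
    also have "(lam w)\<^sup>2 * ((1 + E1 w) * (1 + E2 w)) = exp (2 * Ln (lam w) + Ln (1 + E1 w) + Ln (1 + E2 w))"
      using lam0[OF w] oe[OF w] e2 by (simp add: exp_add exp_double)
    finally have "zquot (1 - w) = exp (2 * Ln (lam w) + Ln (1 + E1 w) + Ln (1 + E2 w))" .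
    moreover have "Re (lam w) \<ge> 1" using T1(2)[of w] w' Cl by auto
    moreover have "norm (Ln (1 + E1 w)) \<le> 1" "norm (Ln (1 + E2 w)) \<le> 1"
      using l1 l2 E1b[OF w'(1,3)] E2s[OF w] by linarith+
    moreover have "norm (Ln (1 + E1 w)) \<le> 2 * norm (deriv lam w) / (norm (lam w))\<^sup>2"
      using l1 by (simp add: E1_def norm_divide norm_power)
    moreover have "norm (Ln (1 + E2 w)) \<le> (2 * C2) * (1/2) powr (Re w)"
      using l2 E2b[OF w'(1,3)] by (simp add: C2_def)
    ultimately show ?thesis using z0 by blast
  qed
  ultimately show ?thesis using C2 T1(1) unfolding \<Omega>_def
    by (intro exI[of _ a] conjI exI[of _ T1] exI[of _ "2 * C2"] exI[of _ "\<lambda>w. Ln (1 + E1 w)"] exI[of _ "\<lambda>w. Ln (1 + E2 w)"])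
       (auto simp: a_def)
qed

text \<open>Along the line \<open>lam\<close> is ln(t / (2 pi)) + O(1 / t), and its derivative is
  O(1 / t). The common bound has the primitive ln(ln(t / (2 pi))), so both errors together integrate
  to O(ln(ln T)).\<close>

lemma left_real_part_asymptotics:
  assumes a: "a \<ge> 1/2"
  shows "\<exists>T2\<ge>18. \<exists>K>0. \<forall>t\<ge>T2. \<bar>2 * ln (norm (lam (Complex a (-t)))) - 2 * ln (ln (t / (2 * pi)))\<bar>
             + 2 * norm (deriv lam (Complex a (-t))) / (norm (lam (Complex a (-t))))\<^sup>2 \<le> K * (1 / (t * ln (t / (2 * pi))))"
proof -
  have a0: "a > 0" using a by simp
  obtain K1 T1 where K1: "K1 > 0" "T1 \<ge> 4"
      "\<And>t. t \<ge> T1 \<Longrightarrow> norm (lam (Complex a (-t)) - of_real (ln (t / (2 * pi)))) \<le> K1 / t"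
    using lam_vertical_asymptotics[OF a0] by blast
  obtain Cl where Cl: "Cl > 0" "\<And>w. Re w \<ge> 1/2 \<Longrightarrow> Im w \<le> -2 \<Longrightarrow> norm (deriv lam w) \<le> Cl * (1 / norm w + exp (pi * Im w))"
    using lam_deriv_bound by blast
  \<comment> \<open>18 exceeds 2 pi e, which makes ln(t / (2 pi)) at least 1; 3 K1 makes the
    relative error of \<open>lam\<close> at most 1/3.\<close>
  define T2 where "T2 = max (max 18 T1) (3 * K1)"
  define K where "K = 4 * K1 + 16 * Cl"
  have "\<bar>2 * ln (norm (lam (Complex a (-t)))) - 2 * ln (ln (t / (2 * pi)))\<bar>
             + 2 * norm (deriv lam (Complex a (-t))) / (norm (lam (Complex a (-t))))\<^sup>2 \<le> K * (1 / (t * ln (t / (2 * pi))))"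
    if t: "t \<ge> T2" for t
  proof -
    define w where "w = Complex a (-t)"
    define l where "l = ln (t / (2 * pi))"
    have t18: "t \<ge> 18" "t \<ge> T1" "t \<ge> 3 * K1" using t by (auto simp: T2_def)
    have l1: "l \<ge> 1"
    proof -
      have "exp 1 * (2 * pi) \<le> (2.8::real) * (2 * 3.2)"
        using e_less_272 pi_approx by (intro mult_mono) auto
      also have "\<dots> \<le> t" using t18 by simp
      finally have "exp 1 \<le> t / (2 * pi)" by (subst pos_le_divide_eq) auto
      thus ?thesis unfolding l_def using t18 by (subst ln_ge_iff) auto
    qed
    define z where "z = (lam w - of_real l) / of_real l"
    have nz: "norm z \<le> K1 / (t * l)"
    proof -
      have "norm z = norm (lam w - of_real l) / l" using l1 by (simp add: z_def norm_divide)
      also have "\<dots> \<le> (K1 / t) / l" using K1(3)[OF t18(2)] l1 unfolding w_def l_def[symmetric] by (intro divide_right_mono) auto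
      finally show ?thesis by simp
    qed
    have "K1 / (t * l) \<le> 1 / 3"
    proof -
      have "3 * K1 * 1 \<le> t * l" using t18 l1 K1 by (intro mult_mono) auto
      moreover have "t * l > 0" using t18 l1 by simp
      ultimately show ?thesis by (simp add: pos_divide_le_eq)
    qed
    hence z3: "norm z \<le> 1/3" using nz by linarith
    have z0: "1 + z \<noteq> 0" using one_plus_not_nonpos_Real[of z] z3 by auto
    have lw: "lam w = of_real l * (1 + z)" using l1 by (simp add: z_def field_simps)
    have "ln (norm (lam w)) = ln l + ln (norm (1 + z))"
      unfolding lw norm_mult using l1 z0 by (subst ln_mult) auto
    also have "ln (norm (1 + z)) = Re (Ln (1 + z))" using z0 by simp
    finally have "ln (norm (lam w)) - ln l = Re (Ln (1 + z))" by simp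
    moreover have "\<bar>Re (Ln (1 + z))\<bar> \<le> 2 * norm z"
      using norm_Ln_1_plus_le[OF z3] abs_Re_le_cmod[of "Ln (1 + z)"] by linarith
    ultimately have 1: "\<bar>2 * ln (norm (lam w)) - 2 * ln l\<bar> \<le> 4 * (K1 / (t * l))" using nz by linarith
    have nl: "norm (lam w) \<ge> l / 2"
    proof -
      have "norm (1 + z) \<ge> 1/2" using norm_triangle_ineq4[of "1 + z" z] z3 by simp
      hence "l * norm (1 + z) \<ge> l * (1/2)" using l1 by (intro mult_left_mono) auto
      thus ?thesis unfolding lw norm_mult using l1 by simp
    qed
    have nw: "norm w \<ge> t" using abs_Im_le_cmod[of w] t18 by (simp add: w_def)
    have "norm (deriv lam w) \<le> Cl * (1 / norm w + exp (pi * Im w))"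
      by (rule Cl(2)) (use a t18 in \<open>auto simp: w_def\<close>)
    also have "\<dots> \<le> Cl * (1 / t + 1 / t)"
    proof (intro mult_left_mono add_mono)
      show "1 / norm w \<le> 1 / t" using nw t18 by (intro divide_left_mono mult_pos_pos) auto
      have "t \<le> pi * t" using t18 pi_gt3 mult_right_mono[of 1 pi t] by simp
      also have "\<dots> \<le> exp (pi * t)" using exp_ge_add_one_self[of "pi * t"] by linarith
      finally have "1 / exp (pi * t) \<le> 1 / t" using t18 by (intro divide_left_mono) auto
      thus "exp (pi * Im w) \<le> 1 / t" by (simp add: w_def exp_minus inverse_eq_divide)
    qed (use Cl in auto)
    also have "\<dots> = 2 * Cl / t" by simp
    finally have d: "norm (deriv lam w) \<le> 2 * Cl / t" .
    have "2 * norm (deriv lam w) / (norm (lam w))\<^sup>2 \<le> 2 * (2 * Cl / t) / (l / 2 * (l / 2))"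
    proof (intro frac_le)
      show "l / 2 * (l / 2) \<le> (norm (lam w))\<^sup>2" unfolding power2_eq_square using nl l1 by (intro mult_mono) auto
    qed (use d l1 Cl t18 in auto)
    also have "\<dots> = 16 * Cl / (t * (l * l))" using l1 by (simp add: field_simps)
    also have "\<dots> \<le> 16 * Cl / (t * l)"
    proof (intro divide_left_mono mult_left_mono)
      show "l \<le> l * l" using l1 mult_left_mono[of 1 l l] by simp
    qed (use l1 t18 Cl in auto)
    finally have 2: "2 * norm (deriv lam w) / (norm (lam w))\<^sup>2 \<le> 16 * Cl / (t * l)" .
    have "4 * (K1 / (t * l)) + 16 * Cl / (t * l) = K * (1 / (t * l))" by (simp add: K_def add_divide_distrib)
    thus ?thesis using 1 2 unfolding w_def[symmetric] l_def[symmetric] by linarith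
  qed
  moreover have "K > 0" using K1 Cl by (simp add: K_def)
  moreover have "T2 \<ge> 18" by (simp add: T2_def)
  ultimately show ?thesis by blast
qed

text \<open>The three parts of the logarithm are treated differently. The integral of 2 ln |lam| is
  compared with that of 2 ln(ln(t / (2 pi))), which is 4 pi times \<open>main_prim\<close>;
  \<open>e1\<close> is small enough in modulus to be integrated directly; \<open>e2\<close> does not
  decay along the line, but its integral is bounded by moving the line to the right.\<close>

lemma left_vertical:
  assumes hol: "e1 holomorphic_on {w. Re w > b \<and> Im w < - T1}" "e2 holomorphic_on {w. Re w > b \<and> Im w < - T1}"
    and b: "b \<ge> 3" "a > b" "T1 \<ge> 4" and C: "C > 0"
    and e: "\<And>w. Re w > b \<Longrightarrow> Im w < - T1 \<Longrightarrow> zeta w \<noteq> 0 \<and> Re (lam w) \<ge> 1 \<and>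
        zquot (1 - w) = exp (2 * Ln (lam w) + e1 w + e2 w) \<and> norm (e1 w) \<le> 1 \<and> norm (e2 w) \<le> 1 \<and>
        norm (e1 w) \<le> 2 * norm (deriv lam w) / (norm (lam w))\<^sup>2 \<and> norm (e2 w) \<le> C * (1/2) powr (Re w)"
  shows "\<exists>T2\<ge>18. \<forall>T0>T2. \<exists>K>0. \<forall>T>T0.
     \<bar>Im (contour_integral (linepath (Complex (1-a) T0) (Complex (1-a) T)) (\<lambda>s. (s - 1/2) * zw s))
       - (T * ln (norm (zquot (Complex (1-a) T))) - 4 * pi * main_prim (T / (2 * pi)))\<bar> \<le> K * (1 + ln (ln T))"
proof -
  have "a \<ge> 1/2" using b by simp
  from left_real_part_asymptotics[OF this] obtain T3 K3 where T3: "T3 \<ge> 18" "K3 > 0"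
    "\<And>t. t \<ge> T3 \<Longrightarrow> \<bar>2 * ln (norm (lam (Complex a (-t)))) - 2 * ln (ln (t / (2 * pi)))\<bar>
             + 2 * norm (deriv lam (Complex a (-t))) / (norm (lam (Complex a (-t))))\<^sup>2 \<le> K3 * (1 / (t * ln (t / (2 * pi))))"
    by blast
  define T2 where "T2 = max T1 T3"
  define \<Omega> where "\<Omega> = {w. Re w > b \<and> Im w < - T1}"
  define U where "U = {s::complex. Re s < 1 - b \<and> Im s > T1}"
  have UO: "s \<in> U \<longleftrightarrow> 1 - s \<in> \<Omega>" for s by (auto simp: U_def \<Omega>_def)
  have openO: "open \<Omega>" "convex \<Omega>" unfolding \<Omega>_def Collect_conj_eq
    by (intro open_Int convex_Int open_halfspace_Re_gt open_halfspace_Im_lt convex_halfspace_Re_gt convex_halfspace_Im_lt)+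
  have openU: "open U" unfolding U_def Collect_conj_eq
    by (intro open_Int open_halfspace_Re_lt open_halfspace_Im_gt)
  have U1: "1 \<notin> U" using b by (auto simp: U_def)
  define \<Lambda> where "\<Lambda> = (\<lambda>s. 2 * Ln (lam (1 - s)) + e1 (1 - s) + e2 (1 - s))"
  have lamh: "lam holomorphic_on \<Omega>"
    by (rule holomorphic_on_subset[OF lam_holomorphic]) (use b in \<open>auto simp: \<Omega>_def\<close>)
  have comp: "(\<lambda>s. f (1 - s)) holomorphic_on U" if "f holomorphic_on \<Omega>" for f
  proof -
    have "(f \<circ> (\<lambda>s. 1 - s)) holomorphic_on U"
      by (rule holomorphic_on_compose_gen[OF _ that]) (use UO in \<open>auto intro!: holomorphic_intros\<close>)
    thus ?thesis by (simp add: o_def)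
  qed
  have Lh: "\<Lambda> holomorphic_on U" unfolding \<Lambda>_def
  proof (intro holomorphic_intros comp lamh)
    fix s assume "s \<in> U"
    hence "Re (lam (1 - s)) \<ge> 1" using e[of "1 - s"] UO[of s] by (auto simp: \<Omega>_def)
    thus "lam (1 - s) \<notin> \<real>\<^sub>\<le>\<^sub>0" by (auto simp: complex_nonpos_Reals_iff)
  qed (use hol in \<open>simp_all add: \<Omega>_def\<close>)
  have ex: "zquot s = exp (\<Lambda> s)" "zeta s \<noteq> 0" if "s \<in> U" for s
  proof -
    have w: "Re (1 - s) > b" "Im (1 - s) < - T1" using UO[of s] that by (auto simp: \<Omega>_def)
    show "zquot s = exp (\<Lambda> s)" using e[OF w] by (simp add: \<Lambda>_def)
    have "zeta (1 - (1 - s)) \<noteq> 0" by (rule zlog_reflect(1)) (use e[OF w] w b in auto)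
    thus "zeta s \<noteq> 0" by simp
  qed
  have z2: "zeta2 s \<noteq> 0" if "s \<in> U" for s using ex[OF that] by (auto simp: zquot_def)
  have der: "(\<Lambda> has_field_derivative zw s) (at s)" if "s \<in> U" for s
    by (rule log_branch_derivative[OF openU that U1 Lh]) (use ex in auto)
  have zwh: "zw holomorphic_on U" by (rule zw_holomorphic[OF openU U1]) (use ex z2 in auto)
  have inU: "Complex (1-a) t \<in> U" if "t > T1" for t using b that by (simp add: U_def)
  have w_eq: "1 - Complex (1-a) t = Complex a (-t)" for t by (simp add: complex_eq_iff)
  have inO: "Complex a (-t) \<in> \<Omega>" if "t > T1" for t using b that by (simp add: \<Omega>_def)
  \<comment> \<open>Twice |Im Ln| \<le> pi, plus 1 for each of \<open>e1\<close> and
    \<open>e2\<close>, is at most 10.\<close>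
  have ImL: "\<bar>Im (\<Lambda> (Complex (1-a) t))\<bar> \<le> 10" if "t > T1" for t
  proof -
    define w where "w = Complex a (-t)"
    have w: "Re w > b" "Im w < - T1" using inO[OF that] by (auto simp: w_def \<Omega>_def)
    have "lam w \<noteq> 0" using e[OF w] by auto
    hence "\<bar>Im (Ln (lam w))\<bar> \<le> pi" using mpi_less_Im_Ln[of "lam w"] Im_Ln_le_pi[of "lam w"] by linarith
    moreover have "\<bar>Im (e1 w)\<bar> \<le> 1" "\<bar>Im (e2 w)\<bar> \<le> 1"
      using e[OF w] abs_Im_le_cmod[of "e1 w"] abs_Im_le_cmod[of "e2 w"] by linarith+
    moreover have "Im (\<Lambda> (Complex (1-a) t)) = 2 * Im (Ln (lam w)) + Im (e1 w) + Im (e2 w)"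
      by (simp add: \<Lambda>_def w_eq w_def)
    ultimately show ?thesis using pi_less_4 by linarith
  qed
  have ReL: "Re (\<Lambda> (Complex (1-a) t)) = 2 * ln (norm (lam (Complex a (-t)))) + Re (e1 (Complex a (-t))) + Re (e2 (Complex a (-t)))"
    if "t > T1" for t
  proof -
    have "lam (Complex a (-t)) \<noteq> 0" using e[of "Complex a (-t)"] inO[OF that] by (auto simp: \<Omega>_def)
    thus ?thesis by (simp add: \<Lambda>_def w_eq)
  qed
  define K1 where "K1 = 2 * C * (1/2) powr a / (- ln (1/2))"
  have "\<exists>K>0. \<forall>T>T0.
     \<bar>Im (contour_integral (linepath (Complex (1-a) T0) (Complex (1-a) T)) (\<lambda>s. (s - 1/2) * zw s))
       - (T * ln (norm (zquot (Complex (1-a) T))) - 4 * pi * main_prim (T / (2 * pi)))\<bar> \<le> K * (1 + ln (ln T))"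
    if T0: "T0 > T2" for T0
  proof -
    have T0': "T0 > T1" "T0 > T3" "T0 > 18" using T0 T3 by (auto simp: T2_def)
    define L0 where "L0 = Re (\<Lambda> (Complex (1-a) T0))"
    define M0 where "M0 = 4 * pi * main_prim (T0 / (2 * pi))"
    define K where "K = 20 * a + \<bar>T0 * L0\<bar> + K1 + \<bar>M0\<bar> + K3 + K3 * \<bar>ln (ln (T0 / (2 * pi)))\<bar>"
    have K1p: "K1 > 0" unfolding K1_def using C by (intro divide_pos_pos mult_pos_pos) (auto simp: ln_div)
    have Kp: "K > 0" unfolding K_def using b K1p T3 by (intro add_pos_nonneg) auto
    have "\<bar>Im (contour_integral (linepath (Complex (1-a) T0) (Complex (1-a) T)) (\<lambda>s. (s - 1/2) * zw s))
       - (T * ln (norm (zquot (Complex (1-a) T))) - 4 * pi * main_prim (T / (2 * pi)))\<bar> \<le> K * (1 + ln (ln T))"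
      if T: "T > T0" for T
    proof -
      have tt: "t > T1" "t \<ge> T3" "t > 18" if "t \<in> {T0..T}" for t using that T0' by auto
      have t2pi: "t / (2 * pi) > 1" "ln (t / (2 * pi)) > 0" if "t \<in> {T0..T}" for t
      proof -
        show "t / (2 * pi) > 1" using tt[OF that] pi_less_4 by (simp add: pos_less_divide_eq)
        thus "ln (t / (2 * pi)) > 0" by (rule ln_gt_zero)
      qed
      have vc: "continuous_on {T0..T} (\<lambda>t. f (Complex a (-t)))" if "f holomorphic_on \<Omega>" for f
      proof (rule continuous_on_compose2[where g = f and t = \<Omega>])
        show "continuous_on \<Omega> f" using that by (rule holomorphic_on_imp_continuous_on)
        show "continuous_on {T0..T} (\<lambda>t. Complex a (-t))" unfolding Complex_eq by (intro continuous_intros)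
      qed (use inO tt in auto)
      have c1: "continuous_on {T0..T} (\<lambda>t. e1 (Complex a (-t)))" "continuous_on {T0..T} (\<lambda>t. e2 (Complex a (-t)))"
        using hol vc by (auto simp: \<Omega>_def)
      have c3: "continuous_on {T0..T} (\<lambda>t. lam (Complex a (-t)))" by (rule vc[OF lamh])
      have l0: "lam (Complex a (-t)) \<noteq> 0" if "t \<in> {T0..T}" for t
        using e[of "Complex a (-t)"] inO[OF tt(1)[OF that]] by (auto simp: \<Omega>_def)
      define \<phi> where "\<phi> = (\<lambda>t. 2 * ln (norm (lam (Complex a (-t)))) + Re (e1 (Complex a (-t))))"
      have c\<phi>: "continuous_on {T0..T} \<phi>" unfolding \<phi>_def
        by (intro continuous_intros c1 c3) (use l0 in auto)
      define \<psi> where "\<psi> = (\<lambda>t. 2 * ln (ln (t / (2 * pi))))"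
      have dpsi: "((\<lambda>t. 4 * pi * main_prim (t / (2 * pi))) has_real_derivative \<psi> t) (at t)" if "t \<in> {T0..T}" for t
      proof -
        have "((\<lambda>t. t / (2 * pi)) has_real_derivative 1 / (2 * pi)) (at t)" by (auto intro!: derivative_eq_intros)
        from DERIV_chain2[OF main_prim_has_derivative[OF t2pi(1)[OF that]] this]
        have "((\<lambda>t. main_prim (t / (2 * pi))) has_real_derivative ln (ln (t / (2 * pi))) * (1 / (2 * pi))) (at t)" .
        from DERIV_cmult[OF this, of "4 * pi"] show ?thesis by (simp add: \<psi>_def)
      qed
      have ipsi: "(\<psi> has_integral 4 * pi * main_prim (T / (2 * pi)) - M0) {T0..T}"
        unfolding M0_def by (rule fundamental_theorem_of_calculus)
          (use T dpsi in \<open>auto simp: has_real_derivative_iff_has_vector_derivative[symmetric] intro: has_field_derivative_at_within\<close>)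
      have ig: "((\<lambda>t. K3 * (1 / (t * ln (t / (2 * pi))))) has_integral
          K3 * ln (ln (T / (2 * pi))) - K3 * ln (ln (T0 / (2 * pi)))) {T0..T}"
      proof (rule fundamental_theorem_of_calculus)
        fix t assume t: "t \<in> {T0..T}"
        have "((\<lambda>t. K3 * ln (ln (t / (2 * pi)))) has_real_derivative K3 * (1 / (t * ln (t / (2 * pi))))) (at t)"
          using t2pi[OF t] tt[OF t] by (auto intro!: derivative_eq_intros simp: field_simps)
        thus "((\<lambda>t. K3 * ln (ln (t / (2 * pi)))) has_vector_derivative K3 * (1 / (t * ln (t / (2 * pi))))) (at t within {T0..T})"
          by (simp add: has_real_derivative_iff_has_vector_derivative[symmetric] has_field_derivative_at_within)
      qed (use T in auto)
      define I2 where "I2 = integral {T0..T} (\<lambda>t. e2 (Complex a (-t)))"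
      have I2: "norm I2 \<le> K1"
      proof -
        \<comment> \<open>In the variable w = 1 - s the height is -t, so the integral is reflected
          to fit \<open>vertical_integral_decay_bound\<close>.\<close>
        have "I2 = integral {-T..-T0} (\<lambda>y. e2 (Complex a y))"
          unfolding I2_def using Henstock_Kurzweil_Integration.integral_reflect_real[of "-T0" "-T" "\<lambda>y. e2 (Complex a y)"] by simp
        also have "norm \<dots> \<le> K1" unfolding K1_def
        proof (rule vertical_integral_decay_bound[OF openO])
          show "e2 holomorphic_on \<Omega>" using hol by (simp add: \<Omega>_def)
          fix x y assume "x \<ge> a" "y \<in> {-T..-T0}"
          hence "Re (Complex x y) > b" "Im (Complex x y) < - T1" using b T0' by auto
          thus "Complex x y \<in> \<Omega>" "norm (e2 (Complex x y)) \<le> C * (1/2) powr x"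
            using e[of "Complex x y"] by (auto simp: \<Omega>_def)
        qed (use C T in auto)
        finally show ?thesis .
      qed
      have Int: "integral {T0..T} (\<lambda>t. Re (\<Lambda> (Complex (1-a) t))) = integral {T0..T} \<phi> + Re I2"
      proof -
        have "integral {T0..T} (\<lambda>t. Re (\<Lambda> (Complex (1-a) t))) = integral {T0..T} (\<lambda>t. \<phi> t + Re (e2 (Complex a (-t))))"
          by (rule integral_cong) (use ReL tt in \<open>auto simp: \<phi>_def\<close>)
        also have "\<dots> = integral {T0..T} \<phi> + integral {T0..T} (\<lambda>t. Re (e2 (Complex a (-t))))"
          by (rule integral_add) (intro integrable_continuous_real continuous_intros c\<phi> c1)+
        also have "integral {T0..T} (\<lambda>t. Re (e2 (Complex a (-t)))) = Re I2"
          using integral_linear[OF integrable_continuous_real[OF c1(2)] bounded_linear_Re] by (simp add: o_def I2_def)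
        finally show ?thesis .
      qed
      have diff: "\<bar>integral {T0..T} \<phi> - (4 * pi * main_prim (T / (2 * pi)) - M0)\<bar> \<le>
          K3 * ln (ln (T / (2 * pi))) - K3 * ln (ln (T0 / (2 * pi)))"
      proof -
        have i\<phi>: "\<phi> integrable_on {T0..T}" by (rule integrable_continuous_real[OF c\<phi>])
        have i\<psi>: "\<psi> integrable_on {T0..T}" using ipsi by auto
        have "integral {T0..T} \<phi> - (4 * pi * main_prim (T / (2 * pi)) - M0) = integral {T0..T} (\<lambda>t. \<phi> t - \<psi> t)"
          using integral_diff[OF i\<phi> i\<psi>] integral_unique[OF ipsi] by simp
        also have "\<bar>\<dots>\<bar> \<le> integral {T0..T} (\<lambda>t. K3 * (1 / (t * ln (t / (2 * pi)))))"
          unfolding real_norm_def[symmetric]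
        proof (rule integral_norm_bound_integral)
          show "(\<lambda>t. \<phi> t - \<psi> t) integrable_on {T0..T}" by (intro integrable_diff i\<phi> i\<psi>)
          show "(\<lambda>t. K3 * (1 / (t * ln (t / (2 * pi))))) integrable_on {T0..T}" using ig by auto
          fix t assume t: "t \<in> {T0..T}"
          define w where "w = Complex a (-t)"
          have w: "Re w > b" "Im w < - T1" using inO[OF tt(1)[OF t]] by (auto simp: w_def \<Omega>_def)
          have "\<bar>Re (e1 w)\<bar> \<le> 2 * norm (deriv lam w) / (norm (lam w))\<^sup>2"
            using e[OF w] abs_Re_le_cmod[of "e1 w"] by linarith
          thus "norm (\<phi> t - \<psi> t) \<le> K3 * (1 / (t * ln (t / (2 * pi))))"
            using T3(3)[OF tt(2)[OF t]] unfolding \<phi>_def \<psi>_def w_def[symmetric] real_norm_def by linarith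
        qed
        also have "\<dots> = K3 * ln (ln (T / (2 * pi))) - K3 * ln (ln (T0 / (2 * pi)))" by (rule integral_unique[OF ig])
        finally show ?thesis .
      qed
      have "Im (contour_integral (linepath (Complex (1-a) T0) (Complex (1-a) T)) (\<lambda>s. (s - 1/2) * zw s)) =
        ((1-a) - Re (1/2)) * (Im (\<Lambda> (Complex (1-a) T)) - Im (\<Lambda> (Complex (1-a) T0)))
        + (T - Im (1/2)) * Re (\<Lambda> (Complex (1-a) T)) - (T0 - Im (1/2)) * Re (\<Lambda> (Complex (1-a) T0))
        - integral {T0..T} (\<lambda>t. Re (\<Lambda> (Complex (1-a) t)))"
      proof (rule vertical_weighted_integral[OF T])
        show "continuous_on {T0..T} (\<lambda>t. zw (Complex (1-a) t))"
          by (intro continuous_on_vertical holomorphic_on_imp_continuous_on holomorphic_on_subset[OF zwh]) (use inU tt in auto)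
      qed (use der inU tt in auto)
      also have "Re (\<Lambda> (Complex (1-a) T)) = ln (norm (zquot (Complex (1-a) T)))"
        using ex(1)[OF inU, of T] tt[of T] T by simp
      finally have eq: "Im (contour_integral (linepath (Complex (1-a) T0) (Complex (1-a) T)) (\<lambda>s. (s - 1/2) * zw s))
       - (T * ln (norm (zquot (Complex (1-a) T))) - 4 * pi * main_prim (T / (2 * pi))) =
        (1/2 - a) * (Im (\<Lambda> (Complex (1-a) T)) - Im (\<Lambda> (Complex (1-a) T0))) - T0 * L0
        - (integral {T0..T} \<phi> - (4 * pi * main_prim (T / (2 * pi)) - M0)) - Re I2 + M0"
        unfolding Int by (simp add: L0_def)
      have "\<bar>(1/2 - a) * (Im (\<Lambda> (Complex (1-a) T)) - Im (\<Lambda> (Complex (1-a) T0)))\<bar> \<le> a * 20"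
        unfolding abs_mult
      proof (rule mult_mono)
        show "\<bar>Im (\<Lambda> (Complex (1-a) T)) - Im (\<Lambda> (Complex (1-a) T0))\<bar> \<le> 20"
          using ImL[of T] ImL[of T0] T T0' by linarith
      qed (use b in auto)
      moreover have "\<bar>Re I2\<bar> \<le> K1" using I2 abs_Re_le_cmod[of I2] by linarith
      moreover have "\<bar>- K3 * ln (ln (T0 / (2 * pi)))\<bar> = K3 * \<bar>ln (ln (T0 / (2 * pi)))\<bar>"
        using T3 by (simp add: abs_mult)
      moreover have "K3 * ln (ln (T / (2 * pi))) \<le> K3 * ln (ln T)"
      proof (intro mult_left_mono)
        have p: "T / (2 * pi) > 1" "ln (T / (2 * pi)) > 0" using t2pi[of T] T by auto
        have "T / (2 * pi) \<le> T / 1" using T T0' pi_gt3 by (intro divide_left_mono) auto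
        hence "ln (T / (2 * pi)) \<le> ln T" using p T T0' by (subst ln_le_cancel_iff) auto
        thus "ln (ln (T / (2 * pi))) \<le> ln (ln T)" using p by (subst ln_le_cancel_iff) auto
      qed (use T3 in auto)
      ultimately have "\<bar>Im (contour_integral (linepath (Complex (1-a) T0) (Complex (1-a) T)) (\<lambda>s. (s - 1/2) * zw s))
       - (T * ln (norm (zquot (Complex (1-a) T))) - 4 * pi * main_prim (T / (2 * pi)))\<bar>
       \<le> (20 * a + \<bar>T0 * L0\<bar> + K1 + \<bar>M0\<bar> + K3 * \<bar>ln (ln (T0 / (2 * pi)))\<bar>) + K3 * ln (ln T)"
        unfolding eq using diff by linarith
      also have "\<dots> \<le> K + K * ln (ln T)"
      proof (rule add_mono)
        have "exp 1 \<le> T" using exp_le T T0' by linarith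
        hence "1 \<le> ln T" using T T0' by (subst ln_ge_iff) auto
        hence "0 \<le> ln (ln T)" by simp
        moreover have "K3 \<le> K" unfolding K_def using b K1p T3 by (simp add: add_nonneg_nonneg)
        ultimately show "K3 * ln (ln T) \<le> K * ln (ln T)" by (intro mult_right_mono)
      qed (use T3 in \<open>simp add: K_def\<close>)
      finally show ?thesis by (simp add: algebra_simps)
    qed
    thus ?thesis using Kp by blast
  qed
  moreover have "T2 \<ge> 18" using T3 by (simp add: T2_def)
  ultimately show ?thesis by blast
qed

section \<open>The horizontal side\<close>

text \<open>For the argument between x and a, use a disc centred at a + it whose left edge stays at
  half the distance y = x - 1/2 from the critical line. The change of argument is then O(Q / y), and
  integrating by parts against the weight costs only the integral of 1 / y, a logarithm of 1 /
  \<delta>.\<close>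

lemma weighted_log_derivative_bound:
  assumes a: "a \<ge> 1" and \<delta>: "0 < \<delta>" "1/2 + \<delta> \<le> a" and A: "A > 0" and m: "m > 0"
    and S: "open S" "\<And>s. Re s > 1/2 \<Longrightarrow> \<bar>Im s - t\<bar> \<le> a \<Longrightarrow> s \<in> S"
    and f: "f holomorphic_on S" "m \<le> norm (f (Complex a t))"
      "\<And>s. 1/2 < Re s \<Longrightarrow> Re s \<le> 2 * a \<Longrightarrow> \<bar>Im s - t\<bar> \<le> a \<Longrightarrow> norm (f s) \<le> A / (Re s - 1/2) ^ 4"
      "\<And>x. x \<in> {1/2+\<delta>..a} \<Longrightarrow> f (Complex x t) \<noteq> 0"
  shows "\<bar>integral {1/2+\<delta>..a} (\<lambda>x. (x - 1/2) * Im (deriv f (Complex x t) / f (Complex x t)))\<bar>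
    \<le> 96 * a * (ln (16 * A / \<delta> ^ 4 / m) + 1) * (1 + ln ((a - 1/2) / \<delta>))"
proof -
  define Q where "Q = ln (16 * A / \<delta> ^ 4 / m) + 1"
  define G where "G = 96 * a * Q"
  define \<omega> where "\<omega> = (\<lambda>x. Im (deriv f (Complex x t) / f (Complex x t)))"
  have inS: "Complex x t \<in> S" if "x \<in> {1/2+\<delta>..a}" for x
    by (rule S(2)) (use that \<delta> a in auto)
  have cC: "continuous_on X (\<lambda>x. Complex x t)" for X
    unfolding Complex_eq by (intro continuous_intros)
  have cfx: "continuous_on {1/2+\<delta>..a} (\<lambda>x. F (Complex x t))" if "F holomorphic_on S" for F
    by (rule continuous_on_compose2[OF holomorphic_on_imp_continuous_on[OF that] cC]) (use inS in auto)
  have cq: "continuous_on {1/2+\<delta>..a} (\<lambda>x. deriv f (Complex x t) / f (Complex x t))"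
    by (intro continuous_intros cfx f holomorphic_deriv S) (use f(4) in auto)
  have c\<omega>: "continuous_on {1/2+\<delta>..a} \<omega>" unfolding \<omega>_def by (intro continuous_on_Im cq)
  have bd: "\<bar>integral {x..a} \<omega>\<bar> \<le> G / (x - 1/2)" if x: "x \<in> {1/2+\<delta>..a}" for x
  proof -
    define y where "y = x - 1/2"
    have y: "y \<ge> \<delta>" "y > 0" "y \<le> a" using x \<delta> a by (auto simp: y_def)
    define c where "c = Complex a t"
    \<comment> \<open>Now R - r = y / 4, which explains the denominator y and the factor 96 = 24 *
      4.\<close>
    define r where "r = a - x + y / 4"
    define R where "R = a - x + y / 2"
    have cb: "Re s \<ge> 1/2 + y / 2" "Re s \<le> 2 * a" "\<bar>Im s - t\<bar> \<le> a" if "s \<in> cball c R" for s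
    proof -
      have 1: "\<bar>Re (s - c)\<bar> \<le> R" "\<bar>Im (s - c)\<bar> \<le> R"
        using that abs_Re_le_cmod[of "s - c"] abs_Im_le_cmod[of "s - c"] by (auto simp: dist_norm norm_minus_commute)
      have 2: "\<bar>Re s - a\<bar> \<le> R" "\<bar>Im s - t\<bar> \<le> R" using 1 by (simp_all add: c_def)
      have R: "R \<le> a" using x \<delta> y a by (simp add: R_def y_def)
      show "Re s \<ge> 1/2 + y / 2" using abs_le_D2[OF 2(1)] by (simp add: R_def y_def field_simps)
      show "Re s \<le> 2 * a" "\<bar>Im s - t\<bar> \<le> a" using 2 R by auto
    qed
    have seg: "\<exists>u\<in>{x..a}. z = Complex u t" if "z \<in> closed_segment (Complex x t) (Complex a t)" for z
    proof -
      have "Im z = t \<and> Re z \<in> closed_segment x a"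
        using that by (auto simp: closed_segment_same_Im)
      thus ?thesis using x by (intro bexI[of _ "Re z"]) (auto simp: complex_eq_iff closed_segment_eq_real_ivl)
    qed
    have ac: "\<bar>Im (contour_integral (linepath (Complex x t) (Complex a t)) (\<lambda>z. deriv f z / f z))\<bar>
        \<le> 24 * (ln ((16 * A / \<delta> ^ 4) / m) + 1) * R / (R - r)"
    proof (rule arg_change_bound[OF S(1)])
      show "cball c R \<subseteq> S" using cb y by (intro subsetI S(2)) fastforce+
      show "0 < r" "r < R" using x y by (auto simp: r_def R_def)
      have "c - Complex x t = of_real (a - x)" by (simp add: c_def complex_eq_iff)
      hence "dist c (Complex x t) = a - x" using x by (simp add: dist_norm del: of_real_diff)
      thus "dist c (Complex x t) \<le> r" using y by (simp add: r_def)
      show "dist c (Complex a t) \<le> r" using x y by (simp add: c_def r_def)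
      show "m \<le> norm (f c)" using f(2) by (simp add: c_def)
      fix z assume "z \<in> closed_segment (Complex x t) (Complex a t)"
      from seg[OF this] show "f z \<noteq> 0" using f(4) x by auto
    next
      fix z assume z: "z \<in> cball c R"
      have 1: "Re z - 1/2 \<ge> \<delta> / 2" using cb(1)[OF z] y by simp
      have "norm (f z) \<le> A / (Re z - 1/2) ^ 4"
        by (rule f(3)) (use cb[OF z] y in auto)
      also have "\<dots> \<le> A / (\<delta> / 2) ^ 4"
        using 1 \<delta> A by (intro divide_left_mono power_mono mult_pos_pos zero_less_power) auto
      also have "\<dots> = 16 * A / \<delta> ^ 4" by (simp add: power_divide)
      finally show "norm (f z) \<le> 16 * A / \<delta> ^ 4" .
    qed (use m f in auto)
    have e: "R - r = y / 4" by (simp add: R_def r_def)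
    have ac': "\<bar>Im (contour_integral (linepath (Complex x t) (Complex a t)) (\<lambda>z. deriv f z / f z))\<bar>
        \<le> 24 * Q * R / (y / 4)" using ac unfolding e Q_def[symmetric] .
    have "0 \<le> 24 * Q * R / (y / 4)" using ac' by linarith
    have R0: "R > 0" using x y by (simp add: R_def)
    have Q0: "Q \<ge> 0" using \<open>0 \<le> 24 * Q * R / (y / 4)\<close> R0 y by (simp add: zero_le_divide_iff zero_le_mult_iff)
    have "24 * Q * R / (y / 4) \<le> 24 * Q * a / (y / 4)"
      using x \<delta> y a Q0 by (intro divide_right_mono mult_left_mono) (auto simp: R_def y_def)
    also have "\<dots> = G / y" using y by (simp add: G_def field_simps)
    finally have B: "\<bar>Im (contour_integral (linepath (Complex x t) (Complex a t)) (\<lambda>z. deriv f z / f z))\<bar> \<le> G / y"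
      using ac' by linarith
    show ?thesis
    proof (cases "x = a")
      case True
      thus ?thesis using B y by (simp add: y_def)
    next
      case False
      hence xa: "x < a" using x by simp
      have "integral {x..a} \<omega> = Im (integral {x..a} (\<lambda>x. deriv f (Complex x t) / f (Complex x t)))"
        unfolding \<omega>_def
        using integral_linear[OF integrable_continuous_real[OF continuous_on_subset[OF cq]] bounded_linear_Im, of x a] x
        by (simp add: o_def)
      also have "\<dots> = Im (contour_integral (linepath (Complex x t) (Complex a t)) (\<lambda>z. deriv f z / f z))"
        using contour_integral_linepath_same_Im[OF xa, of t "\<lambda>z. deriv f z / f z"] by simp
      finally show ?thesis using B by (simp add: y_def)
    qed
  qed
  have ig: "((\<lambda>x. G / (x - 1/2)) has_integral G * ln (a - 1/2) - G * ln (1/2 + \<delta> - 1/2)) {1/2+\<delta>..a}"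
  proof (rule fundamental_theorem_of_calculus)
    fix x assume x: "x \<in> {1/2+\<delta>..a}"
    have "((\<lambda>x. G * ln (x - 1/2)) has_real_derivative G / (x - 1/2)) (at x)"
      using x \<delta> by (auto intro!: derivative_eq_intros)
    thus "((\<lambda>x. G * ln (x - 1/2)) has_vector_derivative G / (x - 1/2)) (at x within {1/2+\<delta>..a})"
      by (simp add: has_real_derivative_iff_has_vector_derivative[symmetric] has_field_derivative_at_within)
  qed (use \<delta> in auto)
  have "\<bar>integral {1/2+\<delta>..a} (\<lambda>x. (x - 1/2) * \<omega> x)\<bar> \<le> \<bar>1/2 + \<delta> - 1/2\<bar> * (G / (1/2 + \<delta> - 1/2)) + integral {1/2+\<delta>..a} (\<lambda>x. G / (x - 1/2))"
    by (rule weighted_integral_bound_right[OF \<delta>(2) c\<omega> _ bd]) (use ig in auto)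
  also have "\<dots> = G + (G * ln (a - 1/2) - G * ln \<delta>)"
    using \<delta> integral_unique[OF ig] by simp
  also have "\<dots> = G * (1 + ln ((a - 1/2) / \<delta>))" using \<delta> by (simp add: ln_div algebra_simps)
  finally show ?thesis unfolding \<omega>_def G_def Q_def .
qed

text \<open>Locally ln |f| is, up to a constant, the real part of a holomorphic logarithm; dividing
  by the value at the point moves \<open>f / f z0\<close> to 1, away from the branch cut.\<close>

lemma ln_norm_horizontal_derivative:
  assumes f: "f field_differentiable at (Complex x t)" "f (Complex x t) \<noteq> 0"
  shows "((\<lambda>x. ln (norm (f (Complex x t)))) has_vector_derivative Re (deriv f (Complex x t) / f (Complex x t))) (at x)"
proof -
  define z0 where "z0 = Complex x t"
  define h where "h = (\<lambda>z. Ln (f z / f z0))"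
  have df: "(f has_field_derivative deriv f z0) (at z0)"
    using f(1) by (simp add: z0_def DERIV_deriv_iff_field_differentiable)
  have "(h has_field_derivative deriv f z0 / f z0) (at z0)"
    unfolding h_def using f(2) by (auto intro!: derivative_eq_intros df simp: z0_def[symmetric])
  hence "((\<lambda>u. h (Complex u t)) has_vector_derivative deriv f z0 / f z0) (at x)"
    unfolding z0_def by (rule has_vector_derivative_horizontal)
  hence "((\<lambda>u. Re (h (Complex u t))) has_vector_derivative Re (deriv f z0 / f z0)) (at x)"
    by (rule bounded_linear.has_vector_derivative[OF bounded_linear_Re])
  hence d: "((\<lambda>u. ln (norm (f z0)) + Re (h (Complex u t))) has_vector_derivative Re (deriv f z0 / f z0)) (at x)"
    by (auto intro!: derivative_eq_intros)
  have "isCont f z0" using df by (rule DERIV_isCont)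
  moreover have "isCont (\<lambda>u. Complex u t) x" unfolding Complex_eq by (intro continuous_intros)
  ultimately have "isCont (\<lambda>u. f (Complex u t)) x" unfolding z0_def by (rule isCont_o2[rotated])
  hence "eventually (\<lambda>u. f (Complex u t) \<noteq> 0) (at x)"
    using f(2) by (auto simp: isCont_def intro: tendsto_imp_eventually_ne)
  hence "eventually (\<lambda>u. f (Complex u t) \<noteq> 0) (nhds x)"
    using f(2) by (simp add: eventually_nhds_conv_at)
  then obtain U where U: "open U" "x \<in> U" "\<And>u. u \<in> U \<Longrightarrow> f (Complex u t) \<noteq> 0"
    unfolding eventually_nhds by blast
  show ?thesis unfolding z0_def[symmetric]
  proof (rule has_vector_derivative_transform_within_open[OF d U(1,2)])
    fix u assume "u \<in> U"
    thus "ln (norm (f z0)) + Re (h (Complex u t)) = ln (norm (f (Complex u t)))"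
      using U(3)[of u] f(2) by (simp add: h_def z0_def norm_divide ln_div)
  qed
qed

lemma zquot_holomorphic:
  assumes "1 \<notin> S" "\<And>s. s \<in> S \<Longrightarrow> zeta s \<noteq> 0"
  shows "zquot holomorphic_on S"
proof -
  have "S \<subseteq> - {1}" using assms(1) by auto
  thus ?thesis unfolding zquot_def [abs_def] using assms
    by (intro holomorphic_intros zeta_holomorphic_on holomorphic_on_subset[OF zeta2_holomorphic])
qed

lemma zquot_log_deriv:
  assumes s: "s \<noteq> 1" "zeta s \<noteq> 0" "zeta2 s \<noteq> 0"
  shows "(zquot has_field_derivative zquot s * zw s) (at s)" "deriv zquot s / zquot s = zw s"
proof -
  have dz: "(zeta has_field_derivative deriv zeta s) (at s)"
    by (rule holomorphic_derivI[OF zeta_holomorphic]) (use s in auto)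
  have d2: "(zeta2 has_field_derivative deriv zeta2 s) (at s)"
    by (rule holomorphic_derivI[OF zeta2_holomorphic]) (use s in auto)
  have "(zquot has_field_derivative (deriv zeta2 s * zeta s - zeta2 s * deriv zeta s) / (zeta s * zeta s)) (at s)"
    unfolding zquot_def[abs_def] by (rule DERIV_divide[OF d2 dz s(2)])
  also have "(deriv zeta2 s * zeta s - zeta2 s * deriv zeta s) / (zeta s * zeta s) = zquot s * zw s"
    using s by (simp add: zquot_def zw_def zlog_def field_simps)
  finally show 1: "(zquot has_field_derivative zquot s * zw s) (at s)" .
  show "deriv zquot s / zquot s = zw s"
    using DERIV_imp_deriv[OF 1] s by (simp add: zquot_def)
qed

lemma zlog_zquot_strip_bound_RH:
  assumes RH: "riemann_hypothesis" and a: "a \<ge> 1"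
  shows "\<exists>C>0. \<forall>t s. t \<ge> a + 4 \<and> 1/2 < Re s \<and> Re s \<le> 2 * a \<and> \<bar>\<bar>Im s\<bar> - t\<bar> \<le> a \<longrightarrow>
    norm (zlog s) \<le> C * (ln t)\<^sup>2 / (Re s - 1/2) ^ 4 \<and> norm (zquot s) \<le> C * (ln t)\<^sup>2 / (Re s - 1/2) ^ 4"
proof -
  obtain C where C: "C > 0" "\<And>s \<eta>. 0 < \<eta> \<Longrightarrow> \<eta> \<le> 1/8 \<Longrightarrow> Re s \<ge> 1/2 + 2 * \<eta> \<Longrightarrow> \<bar>Im s\<bar> \<ge> 4 \<Longrightarrow>
      norm (zlog s) \<le> C * (ln \<bar>Im s\<bar>)\<^sup>2 / \<eta> ^ 4 \<and> norm (zquot s) \<le> C * (ln \<bar>Im s\<bar>)\<^sup>2 / \<eta> ^ 4"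
    using zlog_zquot_bound_RH[OF RH] by blast
  define D where "D = 4 * C * (16 * a) ^ 4"
  have "norm (zlog s) \<le> D * (ln t)\<^sup>2 / (Re s - 1/2) ^ 4 \<and> norm (zquot s) \<le> D * (ln t)\<^sup>2 / (Re s - 1/2) ^ 4"
    if s: "t \<ge> a + 4" "1/2 < Re s" "Re s \<le> 2 * a" "\<bar>\<bar>Im s\<bar> - t\<bar> \<le> a" for t s
  proof -
    define y where "y = Re s - 1/2"
    \<comment> \<open>Proportional to the distance from the critical line, scaled so that y \<le> 2
      a gives \<eta> \<le> 1/8.\<close>
    define \<eta> where "\<eta> = y / (16 * a)"
    have y: "0 < y" "y \<le> 2 * a" using s by (auto simp: y_def)
    have I: "\<bar>Im s\<bar> \<ge> 4" "\<bar>Im s\<bar> \<le> 2 * t" using s by auto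
    have \<eta>: "0 < \<eta>" "\<eta> \<le> 1/8" "2 * \<eta> \<le> y"
      using y a by (auto simp: \<eta>_def field_simps)
    have l: "ln \<bar>Im s\<bar> \<le> 2 * ln t"
    proof -
      have "2 * t \<le> t * t" using s a by (intro mult_right_mono) auto
      hence "ln \<bar>Im s\<bar> \<le> ln (t * t)" using I by (intro ln_mono) linarith+
      also have "\<dots> = 2 * ln t" using s a by (subst ln_mult) auto
      finally show ?thesis .
    qed
    have "C * (ln \<bar>Im s\<bar>)\<^sup>2 / \<eta> ^ 4 \<le> C * (2 * ln t)\<^sup>2 / \<eta> ^ 4"
      using l C I \<eta> by (intro divide_right_mono mult_left_mono power_mono) auto
    also have "\<dots> = D * (ln t)\<^sup>2 / y ^ 4"
      using y a by (simp add: D_def \<eta>_def power_divide power_mult_distrib)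
    finally have "C * (ln \<bar>Im s\<bar>)\<^sup>2 / \<eta> ^ 4 \<le> D * (ln t)\<^sup>2 / y ^ 4" .
    thus ?thesis using C(2)[of \<eta> s] \<eta> I unfolding y_def[symmetric] by (auto simp: y_def)
  qed
  moreover have "D > 0" using C a by (simp add: D_def)
  ultimately show ?thesis by blast
qed

text \<open>The threshold keeps 1 / ln T at most 1/20, so that the window around the critical line
  lies in [9/20, 11/20], and makes ln(ln T) at least 1, so that constants can be absorbed into
  it.\<close>

lemma exp_20_facts:
  fixes T :: real
  assumes "T \<ge> exp 20"
  shows "ln T \<ge> 20" "ln (ln T) \<ge> 1" "T \<ge> 21"
proof -
  have T: "T > 0" using assms exp_gt_zero[of 20] by linarith
  thus l: "ln T \<ge> 20" using assms by (simp add: ln_ge_iff)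
  show "T \<ge> 21" using assms exp_ge_add_one_self[of 20] by simp
  have "exp 1 \<le> ln T" using l e_less_272 by linarith
  thus "ln (ln T) \<ge> 1" using l by (subst ln_ge_iff) auto
qed

text \<open>With the cut at \<delta> = 1 / ln T the quantity (ln T)^2 / \<delta>^4 is (ln T)^6, so
  each of the two logarithmic factors is O(ln(ln T)).\<close>

lemma weighted_bound_loglog:
  fixes a c m :: real
  assumes "a \<ge> 1" "c > 0" "m > 0"
  shows "\<exists>K>0. \<forall>T\<ge>exp 20. 96 * a * (ln (16 * (c * (ln T)\<^sup>2) / (1 / ln T) ^ 4 / m) + 1) * (1 + ln ((a - 1/2) / (1 / ln T)))
    \<le> K * (ln (ln T))\<^sup>2"
proof -
  define K1 where "K1 = \<bar>ln (16 * c / m)\<bar> + 7"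
  define K2 where "K2 = 2 + \<bar>ln (a - 1/2)\<bar>"
  have "96 * a * (ln (16 * (c * (ln T)\<^sup>2) / (1 / ln T) ^ 4 / m) + 1) * (1 + ln ((a - 1/2) / (1 / ln T)))
      \<le> 96 * a * K1 * K2 * (ln (ln T))\<^sup>2" if T: "T \<ge> exp 20" for T
  proof -
    note T' = exp_20_facts[OF T]
    define l where "l = ln T"
    define k where "k = ln l"
    have l: "l \<ge> 20" "k \<ge> 1" using T' by (auto simp: l_def k_def)
    have "16 * (c * l\<^sup>2) / (1 / l) ^ 4 / m = (16 * c / m) * l ^ 6"
      using l by (simp add: power_divide power_add[symmetric])
    hence "ln (16 * (c * l\<^sup>2) / (1 / l) ^ 4 / m) = ln ((16 * c / m) * l ^ 6)" by simp
    also have "\<dots> = ln (16 * c / m) + 6 * k"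
      using l assms by (subst ln_mult) (auto simp: ln_realpow k_def)
    finally have 1: "ln (16 * (c * l\<^sup>2) / (1 / l) ^ 4 / m) = ln (16 * c / m) + 6 * k" .
    have "(a - 1/2) / (1 / l) = (a - 1/2) * l" by simp
    hence "ln ((a - 1/2) / (1 / l)) = ln ((a - 1/2) * l)" by simp
    also have "\<dots> = ln (a - 1/2) + k" unfolding k_def using l assms by (subst ln_mult) auto
    finally have 2: "ln ((a - 1/2) / (1 / l)) = ln (a - 1/2) + k" .
    have e1: "\<bar>ln (16 * c / m)\<bar> \<le> \<bar>ln (16 * c / m)\<bar> * k" "\<bar>ln (a - 1/2)\<bar> \<le> \<bar>ln (a - 1/2)\<bar> * k"
      using l by (auto intro: mult_left_mono[of 1 k, simplified])
    have 3: "ln (16 * c / m) + 6 * k + 1 \<le> K1 * k"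
      using e1(1) l abs_ge_self[of "ln (16 * c / m)"] unfolding K1_def distrib_right by linarith
    have 4: "1 + (ln (a - 1/2) + k) \<le> K2 * k"
      using e1(2) l abs_ge_self[of "ln (a - 1/2)"] unfolding K2_def distrib_right by linarith
    have K: "K1 \<ge> 0" "K2 \<ge> 0" by (auto simp: K1_def K2_def)
    have a5: "ln (a - 1/2) \<ge> - 1"
    proof -
      have "ln (a - 1/2) \<ge> ln (1/2)" using assms by (subst ln_le_cancel_iff) auto
      thus ?thesis using ln_le_minus_one[of 2] by (simp add: ln_div)
    qed
    have "96 * a * (ln (16 * c / m) + 6 * k + 1) * (1 + (ln (a - 1/2) + k)) \<le> 96 * a * (K1 * k) * (K2 * k)"
      by (rule mult_mono[OF mult_left_mono[OF 3] 4]) (use l K assms a5 in auto)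
    also have "\<dots> = 96 * a * K1 * K2 * k\<^sup>2" by (simp add: power2_eq_square)
    finally show ?thesis unfolding l_def[symmetric] k_def[symmetric] 1 2 .
  qed
  moreover have "96 * a * K1 * K2 > 0" using assms by (simp add: K1_def K2_def)
  ultimately show ?thesis by blast
qed

text \<open>The weighted bound applied to \<open>zquot\<close> itself: right of the critical line
  the hypothesis removes its poles and bounds it by (ln T)^2 over the fourth power of the
  distance.\<close>

lemma right_horizontal:
  assumes RH: "riemann_hypothesis" and a: "a \<ge> 1" and m: "m > 0" "\<And>t. t \<ge> 4 \<Longrightarrow> m \<le> norm (zquot (Complex a t))"
  shows "\<exists>K>0. \<exists>T2. \<forall>T\<ge>T2. (\<forall>x. zeta2 (Complex x T) \<noteq> 0) \<longrightarrow>
    \<bar>integral {1/2 + 1 / ln T..a} (\<lambda>x. (x - 1/2) * Im (zw (Complex x T)))\<bar> \<le> K * (ln (ln T))\<^sup>2"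
proof -
  obtain C where C: "C > 0" "\<And>t s. t \<ge> a + 4 \<Longrightarrow> 1/2 < Re s \<Longrightarrow> Re s \<le> 2 * a \<Longrightarrow> \<bar>\<bar>Im s\<bar> - t\<bar> \<le> a \<Longrightarrow>
      norm (zquot s) \<le> C * (ln t)\<^sup>2 / (Re s - 1/2) ^ 4"
    using zlog_zquot_strip_bound_RH[OF RH a] by blast
  obtain K where K: "K > 0" "\<And>T. T \<ge> exp 20 \<Longrightarrow> 96 * a * (ln (16 * (C * (ln T)\<^sup>2) / (1 / ln T) ^ 4 / m) + 1) * (1 + ln ((a - 1/2) / (1 / ln T)))
    \<le> K * (ln (ln T))\<^sup>2" using weighted_bound_loglog[OF a C(1) m(1)] by blast
  have "\<bar>integral {1/2 + 1 / ln T..a} (\<lambda>x. (x - 1/2) * Im (zw (Complex x T)))\<bar> \<le> K * (ln (ln T))\<^sup>2"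
    if T: "T \<ge> max (exp 20) (a + 4)" and nz: "\<forall>x. zeta2 (Complex x T) \<noteq> 0" for T
  proof -
    have T20: "T \<ge> exp 20" "T \<ge> a + 4" using T by auto
    note T' = exp_20_facts[OF T20(1)]
    define S where "S = {s::complex. Re s > 1/2} \<inter> {s. Im s > 1}"
    have "1 / ln T \<le> 1 / 20" using T' by (intro divide_left_mono) auto
    hence \<delta>: "0 < 1 / ln T" "1/2 + 1 / ln T \<le> a" using T' a by (simp, linarith)
    have eq: "zw (Complex x T) = deriv zquot (Complex x T) / zquot (Complex x T)" if "x > 1/2" for x
      using zquot_log_deriv(2)[of "Complex x T"] zeta_nonzero_RH[OF RH, of "Complex x T"] nz that T' by (auto simp: complex_eq_iff)
    have "\<bar>integral {1/2+1/ln T..a} (\<lambda>x. (x - 1/2) * Im (deriv zquot (Complex x T) / zquot (Complex x T)))\<bar>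
        \<le> 96 * a * (ln (16 * (C * (ln T)\<^sup>2) / (1 / ln T) ^ 4 / m) + 1) * (1 + ln ((a - 1/2) / (1 / ln T)))"
    proof (rule weighted_log_derivative_bound[where S = S])
      show "open S" unfolding S_def by (intro open_Int open_halfspace_Re_gt open_halfspace_Im_gt)
      show "s \<in> S" if "Re s > 1/2" "\<bar>Im s - T\<bar> \<le> a" for s using that T20 by (auto simp: S_def)
      show "zquot holomorphic_on S"
        by (rule zquot_holomorphic) (use zeta_nonzero_RH[OF RH] in \<open>force simp: S_def\<close>)+
      show "C * (ln T)\<^sup>2 > 0" using C T' by simp
      show "m \<le> norm (zquot (Complex a T))" by (rule m(2)) (use T' in simp)
      show "norm (zquot s) \<le> C * (ln T)\<^sup>2 / (Re s - 1/2) ^ 4"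
        if "1/2 < Re s" "Re s \<le> 2 * a" "\<bar>Im s - T\<bar> \<le> a" for s
        by (rule C(2)) (use that T20 in auto)
      show "zquot (Complex x T) \<noteq> 0" if "x \<in> {1/2+1/ln T..a}" for x
      proof -
        have "x > 1/2" using that \<delta>(1) unfolding atLeastAtMost_iff by linarith
        hence "zeta (Complex x T) \<noteq> 0" using zeta_nonzero_RH[OF RH, of "Complex x T"] T' by simp
        thus ?thesis using nz by (simp add: zquot_def)
      qed
    qed (use a \<delta> m in auto)
    also have "\<dots> \<le> K * (ln (ln T))\<^sup>2" by (rule K(2)[OF T20(1)])
    also have "integral {1/2+1/ln T..a} (\<lambda>x. (x - 1/2) * Im (deriv zquot (Complex x T) / zquot (Complex x T)))
        = integral {1/2+1/ln T..a} (\<lambda>x. (x - 1/2) * Im (zw (Complex x T)))"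
    proof (rule integral_cong)
      fix x assume "x \<in> {1/2+1/ln T..a}"
      hence "x > 1/2" using \<delta>(1) unfolding atLeastAtMost_iff by linarith
      thus "(x - 1/2) * Im (deriv zquot (Complex x T) / zquot (Complex x T)) = (x - 1/2) * Im (zw (Complex x T))"
        using eq[of x] by simp
    qed
    finally show ?thesis .
  qed
  thus ?thesis using K(1) by blast
qed

text \<open>The left half is carried to the right by s = 1 - w. Dividing
  \<open>zquot (1 - w)\<close> by the square of \<open>lam w\<close> gives a function bounded below
  at the centre by the constant \<open>m\<close>, and the reflection formula bounds it above. The
  factor split off has the logarithmic derivative 2 deriv lam / lam, which is bounded.\<close>

lemma left_horizontal:
  assumes RH: "riemann_hypothesis" and a: "a \<ge> 1" and m: "m > 0"
      "\<And>t. t \<ge> t1 \<Longrightarrow> m * (norm (lam (Complex a (-t))))\<^sup>2 \<le> norm (zquot (Complex (1-a) t))"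
  shows "\<exists>K>0. \<exists>T2. \<forall>T\<ge>T2. (\<forall>x. zeta2 (Complex x T) \<noteq> 0) \<longrightarrow>
    \<bar>integral {1-a..1/2 - 1 / ln T} (\<lambda>x. (x - 1/2) * Im (zw (Complex x T)))\<bar> \<le> K * (ln (ln T))\<^sup>2"
proof -
  obtain C where C: "C > 0" "\<And>t s. t \<ge> a + 4 \<Longrightarrow> 1/2 < Re s \<Longrightarrow> Re s \<le> 2 * a \<Longrightarrow> \<bar>\<bar>Im s\<bar> - t\<bar> \<le> a \<Longrightarrow>
      norm (zlog s) \<le> C * (ln t)\<^sup>2 / (Re s - 1/2) ^ 4 \<and> norm (zquot s) \<le> C * (ln t)\<^sup>2 / (Re s - 1/2) ^ 4"
    using zlog_zquot_strip_bound_RH[OF RH a] by blast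
  obtain T1 where T1: "T1 \<ge> 4" "\<And>w. Re w \<ge> 1/2 \<Longrightarrow> Im w \<le> - T1 \<Longrightarrow> Re (lam w) \<ge> 1"
    using lam_Re_large[of 1] by blast
  obtain Cl where Cl: "Cl > 0" "\<And>w. Re w \<ge> 1/2 \<Longrightarrow> Im w \<le> -2 \<Longrightarrow> norm (deriv lam w) \<le> Cl * (1 / norm w + exp (pi * Im w))"
    using lam_deriv_bound by blast
  \<comment> \<open>The factor (2 a)^4 turns the bounded part 1 + 2 Cl into a multiple of 1 / (Re w
    - 1/2)^4, since Re w \<le> 2 a; 3 C collects the \<open>zlog\<close> and \<open>zquot\<close>
    terms.\<close>
  define c where "c = (1 + 2 * Cl) * (2 * a) ^ 4 + 3 * C"
  have c: "c > 0" using Cl C by (simp add: c_def add_nonneg_pos)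
  obtain K where K: "K > 0" "\<And>T. T \<ge> exp 20 \<Longrightarrow> 96 * a * (ln (16 * (c * (ln T)\<^sup>2) / (1 / ln T) ^ 4 / m) + 1) * (1 + ln ((a - 1/2) / (1 / ln T)))
    \<le> K * (ln (ln T))\<^sup>2" using weighted_bound_loglog[OF a c m(1)] by blast
  define S where "S = {w::complex. Re w > 1/2} \<inter> {w. Im w < - T1}"
  have openS: "open S" unfolding S_def by (intro open_Int open_halfspace_Re_gt open_halfspace_Im_lt)
  define f where "f = (\<lambda>w. zquot (1 - w) / (lam w)\<^sup>2)"
  have lam1: "norm (lam w) \<ge> 1" if "w \<in> S" for w
    using T1(2)[of w] that complex_Re_le_cmod[of "lam w"] by (auto simp: S_def)
  have lam0: "lam w \<noteq> 0" if "w \<in> S" for w using lam1[OF that] by auto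
  have dl: "norm (deriv lam w) \<le> 2 * Cl" if "w \<in> S" for w
  proof -
    have w: "Re w \<ge> 1/2" "Im w \<le> -4" using that T1 by (auto simp: S_def)
    have "norm (deriv lam w) \<le> Cl * (1 / norm w + exp (pi * Im w))" by (rule Cl(2)) (use w in auto)
    also have "\<dots> \<le> Cl * (1 + 1)"
    proof (intro mult_left_mono add_mono)
      show "1 / norm w \<le> 1" using abs_Im_le_cmod[of w] w by (simp add: divide_le_eq)
      show "exp (pi * Im w) \<le> 1" using w by (simp add: mult_nonneg_nonpos)
    qed (use Cl in auto)
    finally show ?thesis by simp
  qed
  have dlam: "(lam has_field_derivative deriv lam w) (at w)" if "w \<in> S" for w
    using lam_holomorphic by (rule holomorphic_derivI) (use that T1 in \<open>auto simp: S_def open_halfspace_Im_lt\<close>)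
  have zS: "zeta w \<noteq> 0" "zeta (1 - w) \<noteq> 0" "Im w \<noteq> 0" "1 - w \<noteq> 1" if "w \<in> S" for w
  proof -
    show 1: "Im w \<noteq> 0" using that T1 by (auto simp: S_def)
    show 2: "zeta w \<noteq> 0" by (rule zeta_nonzero_RH[OF RH]) (use that 1 in \<open>auto simp: S_def\<close>)
    show "zeta (1 - w) \<noteq> 0" using zlog_reflect(1)[OF 1 2] .
    show "1 - w \<noteq> 1" using 1 by auto
  qed
  have holf: "f holomorphic_on S"
  proof -
    have "(zquot \<circ> (\<lambda>w. 1 - w)) holomorphic_on S"
      by (rule holomorphic_on_compose_gen[where t = "(\<lambda>w. 1 - w) ` S"], intro holomorphic_intros, rule zquot_holomorphic)
         (use zS in force)+
    moreover have "lam holomorphic_on S"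
      by (rule holomorphic_on_subset[OF lam_holomorphic]) (use T1 in \<open>auto simp: S_def\<close>)
    ultimately show ?thesis unfolding f_def o_def by (intro holomorphic_intros) (use lam0 in auto)
  qed
  have zwf: "zw (1 - w) = - (deriv f w / f w) - 2 * (deriv lam w / lam w)" "f w \<noteq> 0" if w: "w \<in> S" "zeta2 (1 - w) \<noteq> 0" for w
  proof -
    have q0: "zquot (1 - w) \<noteq> 0" using w zS[OF w(1)] by (simp add: zquot_def)
    thus f0: "f w \<noteq> 0" using lam0[OF w(1)] by (simp add: f_def)
    have 1: "((\<lambda>w. zquot (1 - w)) has_field_derivative (zquot (1 - w) * zw (1 - w)) * (- 1)) (at w)"
      by (rule DERIV_chain2[OF zquot_log_deriv(1)]) (use zS[OF w(1)] w in \<open>auto intro!: derivative_eq_intros\<close>)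
    have "(f has_field_derivative ((zquot (1 - w) * zw (1 - w)) * (- 1) * (lam w)\<^sup>2 - zquot (1 - w) * (2 * lam w * deriv lam w)) / ((lam w)\<^sup>2 * (lam w)\<^sup>2)) (at w)"
      unfolding f_def by (rule DERIV_divide[OF 1]) (use lam0[OF w(1)] in \<open>auto intro!: derivative_eq_intros dlam[OF w(1)]\<close>)
    hence "deriv f w = ((zquot (1 - w) * zw (1 - w)) * (- 1) * (lam w)\<^sup>2 - zquot (1 - w) * (2 * lam w * deriv lam w)) / ((lam w)\<^sup>2 * (lam w)\<^sup>2)"
      by (rule DERIV_imp_deriv)
    also have "\<dots> = f w * (- zw (1 - w) - 2 * (deriv lam w / lam w))"
      using lam0[OF w(1)] by (simp add: f_def field_simps power2_eq_square)
    finally have "deriv f w / f w = - zw (1 - w) - 2 * (deriv lam w / lam w)" using f0 by simp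
    thus "zw (1 - w) = - (deriv f w / f w) - 2 * (deriv lam w / lam w)" by simp
  qed
  have bdf: "norm (f w) \<le> c * (ln T)\<^sup>2 / (Re w - 1/2) ^ 4"
    if T: "T \<ge> exp 20" "T \<ge> a + 4" and w: "w \<in> S" "1/2 < Re w" "Re w \<le> 2 * a" "\<bar>\<bar>Im w\<bar> - T\<bar> \<le> a" for T w
  proof -
    note T' = exp_20_facts[OF T(1)]
    define B where "B = C * (ln T)\<^sup>2 / (Re w - 1/2) ^ 4"
    have zb: "norm (zlog w) \<le> B" "norm (zquot w) \<le> B" using C(2)[OF T(2) w(2-4)] by (auto simp: B_def)
    have "f w = 1 + deriv lam w / (lam w)\<^sup>2 + 2 * zlog w / lam w + zquot w / (lam w)\<^sup>2"
      using zquot_reflect[of w] zS[OF w(1)] lam0[OF w(1)] by (simp add: f_def field_simps power2_eq_square)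
    also have "norm \<dots> \<le> norm (1::complex) + norm (deriv lam w / (lam w)\<^sup>2) + norm (2 * zlog w / lam w) + norm (zquot w / (lam w)\<^sup>2)"
      by (intro norm_triangle_le add_mono) auto
    also have "\<dots> \<le> 1 + 2 * Cl + 2 * B + B"
    proof (intro add_mono)
      have l2: "1 \<le> (norm (lam w))\<^sup>2" using lam1[OF w(1)] by simp
      have D: "x / d \<le> x" if "x \<ge> 0" "d \<ge> 1" for x d :: real
        using divide_left_mono[of 1 d x] that by simp
      show "norm (deriv lam w / (lam w)\<^sup>2) \<le> 2 * Cl"
        using order_trans[OF D dl[OF w(1)]] l2 by (simp add: norm_divide norm_power)
      show "norm (2 * zlog w / lam w) \<le> 2 * B"
        using order_trans[OF D[of "2 * norm (zlog w)" "norm (lam w)"], of "2 * B"] zb lam1[OF w(1)]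
        by (simp add: norm_divide norm_mult)
      show "norm (zquot w / (lam w)\<^sup>2) \<le> B"
        using order_trans[OF D zb(2)] l2 by (simp add: norm_divide norm_power)
    qed simp
    also have "\<dots> = (1 + 2 * Cl) + 3 * B" by simp
    also have "1 + 2 * Cl \<le> ((1 + 2 * Cl) * (2 * a) ^ 4) * (ln T)\<^sup>2 / (Re w - 1/2) ^ 4"
    proof -
      have "(Re w - 1/2) ^ 4 * 1 \<le> (2 * a) ^ 4 * (ln T)\<^sup>2"
        using w T' a by (intro mult_mono power_mono one_le_power) auto
      hence "(1 + 2 * Cl) * (Re w - 1/2) ^ 4 \<le> (1 + 2 * Cl) * ((2 * a) ^ 4 * (ln T)\<^sup>2)"
        using Cl by (intro mult_left_mono) auto
      moreover have "(Re w - 1/2) ^ 4 > 0" using w by simp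
      ultimately show ?thesis by (simp only: pos_le_divide_eq mult.assoc)
    qed
    also have "((1 + 2 * Cl) * (2 * a) ^ 4) * (ln T)\<^sup>2 / (Re w - 1/2) ^ 4 + 3 * B = c * (ln T)\<^sup>2 / (Re w - 1/2) ^ 4"
      by (simp only: B_def c_def add_divide_distrib distrib_right times_divide_eq_right mult.assoc)
    finally show ?thesis by simp
  qed
  define K' where "K' = K + 4 * Cl * a\<^sup>2"
  have "\<bar>integral {1-a..1/2 - 1 / ln T} (\<lambda>x. (x - 1/2) * Im (zw (Complex x T)))\<bar> \<le> K' * (ln (ln T))\<^sup>2"
    if T: "T \<ge> Max {exp 20, a + 4, t1, T1 + a + 1}" and nz: "\<forall>x. zeta2 (Complex x T) \<noteq> 0" for T
  proof -
    have T20: "T \<ge> exp 20" "T \<ge> a + 4" "T \<ge> t1" "T > T1 + a" using T by auto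
    note T' = exp_20_facts[OF T20(1)]
    have "1 / ln T \<le> 1 / 20" using T' by (intro divide_left_mono) auto
    hence \<delta>: "0 < 1 / ln T" "1/2 + 1 / ln T \<le> a" using T' a by (simp, linarith)
    define \<delta>' where "\<delta>' = 1 / ln T"
    define P where "P = (\<lambda>x. deriv f (Complex x (-T)) / f (Complex x (-T)))"
    define R where "R = (\<lambda>x. deriv lam (Complex x (-T)) / lam (Complex x (-T)))"
    have inS: "Complex x (-T) \<in> S" if "x \<in> {1/2+\<delta>'..a}" for x
    proof -
      have "x > 1/2" using that \<delta>(1) unfolding atLeastAtMost_iff \<delta>'_def by linarith
      thus ?thesis using T20 a by (simp add: S_def)
    qed
    have one: "1 - Complex x (-T) = Complex (1 - x) T" for x by (simp add: complex_eq_iff)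
    have nz': "zeta2 (1 - Complex x (-T)) \<noteq> 0" for x unfolding one using nz by simp
    have cC: "continuous_on X (\<lambda>x. Complex x (-T))" for X
      unfolding Complex_eq by (intro continuous_intros)
    have cfx: "continuous_on {1/2+\<delta>'..a} (\<lambda>x. F (Complex x (-T)))" if "F holomorphic_on S" for F
      by (rule continuous_on_compose2[OF holomorphic_on_imp_continuous_on[OF that] cC]) (use inS in auto)
    have lamS: "lam holomorphic_on S"
      by (rule holomorphic_on_subset[OF lam_holomorphic]) (use T1 in \<open>auto simp: S_def\<close>)
    have cP: "continuous_on {1/2+\<delta>'..a} P" unfolding P_def
      by (intro continuous_intros cfx holf holomorphic_deriv openS) (use zwf(2)[OF inS nz'] in auto)
    have cR: "continuous_on {1/2+\<delta>'..a} R" unfolding R_def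
      by (intro continuous_intros cfx lamS holomorphic_deriv openS) (use lam0[OF inS] in auto)
    have "integral {1-a..1/2 - 1 / ln T} (\<lambda>x. (x - 1/2) * Im (zw (Complex x T)))
        = integral {\<delta>' - 1/2..a - 1} (\<lambda>y. (-y - 1/2) * Im (zw (Complex (-y) T)))"
      using Henstock_Kurzweil_Integration.integral_reflect_real[of "a - 1" "\<delta>' - 1/2" "\<lambda>y. (-y - 1/2) * Im (zw (Complex (-y) T))"]
      by (simp add: \<delta>'_def)
    also have "\<dots> = integral {1/2+\<delta>'..a} (\<lambda>v. (-(v-1) - 1/2) * Im (zw (Complex (-(v-1)) T)))"
      using integral_shift_Icc_real[of "1/2+\<delta>'" a "\<lambda>y. (-y - 1/2) * Im (zw (Complex (-y) T))" "-1"]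
      by (simp add: algebra_simps o_def)
    also have "\<dots> = integral {1/2+\<delta>'..a} (\<lambda>v. (v - 1/2) * Im (P v) + (v - 1/2) * Im (2 * R v))"
    proof (rule integral_cong)
      fix v assume v: "v \<in> {1/2+\<delta>'..a}"
      have "zw (Complex (-(v-1)) T) = - P v - 2 * R v"
        using zwf(1)[OF inS[OF v] nz'] unfolding one by (simp add: P_def R_def)
      hence e: "Im (zw (Complex (-(v-1)) T)) = - Im (P v) - Im (2 * R v)" by simp
      show "(-(v-1) - 1/2) * Im (zw (Complex (-(v-1)) T)) = (v - 1/2) * Im (P v) + (v - 1/2) * Im (2 * R v)"
        unfolding e by (simp add: algebra_simps)
    qed
    also have "\<dots> = integral {1/2+\<delta>'..a} (\<lambda>v. (v - 1/2) * Im (P v)) + integral {1/2+\<delta>'..a} (\<lambda>v. (v - 1/2) * Im (2 * R v))"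
      by (rule integral_add) (intro integrable_continuous_real continuous_intros cP cR)+
    finally have split: "integral {1-a..1/2 - 1 / ln T} (\<lambda>x. (x - 1/2) * Im (zw (Complex x T))) =
        integral {1/2+\<delta>'..a} (\<lambda>v. (v - 1/2) * Im (P v)) + integral {1/2+\<delta>'..a} (\<lambda>v. (v - 1/2) * Im (2 * R v))" .
    have "\<bar>integral {1/2+\<delta>'..a} (\<lambda>v. (v - 1/2) * Im (P v))\<bar>
        \<le> 96 * a * (ln (16 * (c * (ln T)\<^sup>2) / \<delta>' ^ 4 / m) + 1) * (1 + ln ((a - 1/2) / \<delta>'))"
      unfolding P_def
    proof (rule weighted_log_derivative_bound[OF a _ _ _ m(1) openS])
      show "s \<in> S" if "Re s > 1/2" "\<bar>Im s - - T\<bar> \<le> a" for s using that T20 by (auto simp: S_def)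
      show "c * (ln T)\<^sup>2 > 0" using c T' by simp
      show "m \<le> norm (f (Complex a (-T)))"
      proof -
        have "a \<in> {1/2+\<delta>'..a}" using \<delta> by (simp add: \<delta>'_def)
        hence "norm (lam (Complex a (-T))) > 0" using lam0[OF inS] by simp
        thus ?thesis using m(2)[OF T20(3)] unfolding f_def one norm_divide norm_power by (simp add: pos_le_divide_eq)
      qed
      show "norm (f s) \<le> c * (ln T)\<^sup>2 / (Re s - 1/2) ^ 4"
        if "1/2 < Re s" "Re s \<le> 2 * a" "\<bar>Im s - - T\<bar> \<le> a" for s
        by (rule bdf) (use that T20 a T1 in \<open>auto simp: S_def\<close>)
      show "f (Complex x (-T)) \<noteq> 0" if "x \<in> {1/2+\<delta>'..a}" for x
        by (rule zwf(2)[OF inS[OF that] nz'])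
    qed (use \<delta> holf in \<open>auto simp: \<delta>'_def\<close>)
    also have "\<dots> \<le> K * (ln (ln T))\<^sup>2" unfolding \<delta>'_def by (rule K(2)[OF T20(1)])
    finally have 1: "\<bar>integral {1/2+\<delta>'..a} (\<lambda>v. (v - 1/2) * Im (P v))\<bar> \<le> K * (ln (ln T))\<^sup>2" .
    have "norm (integral {1/2+\<delta>'..a} (\<lambda>v. (v - 1/2) * Im (2 * R v))) \<le> (a * (4 * Cl)) * (a - (1/2+\<delta>'))"
    proof (rule integral_bound)
      fix v assume v: "v \<in> {1/2+\<delta>'..a}"
      have "norm (R v) \<le> 2 * Cl"
      proof -
        have "norm (R v) = norm (deriv lam (Complex v (-T))) / norm (lam (Complex v (-T)))" by (simp add: R_def norm_divide)
        also have "\<dots> \<le> 2 * Cl / 1" using lam1[OF inS[OF v]] dl[OF inS[OF v]] Cl by (intro frac_le) auto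
        finally show ?thesis by simp
      qed
      hence r: "\<bar>Im (2 * R v)\<bar> \<le> 4 * Cl" using abs_Im_le_cmod[of "2 * R v"] by (simp add: norm_mult)
      have "v > 1/2" "v \<le> a" using inS[OF v] v by (auto simp: S_def)
      thus "norm ((v - 1/2) * Im (2 * R v)) \<le> a * (4 * Cl)"
        unfolding real_norm_def abs_mult using r by (intro mult_mono) auto
    qed (use \<delta> in \<open>auto simp: \<delta>'_def intro!: continuous_intros cR[unfolded \<delta>'_def]\<close>)
    also have "\<dots> \<le> (a * (4 * Cl)) * a"
    proof (rule mult_left_mono)
      show "a - (1/2+\<delta>') \<le> a" using \<delta>(1) unfolding \<delta>'_def by linarith
    qed (use a Cl in auto)
    also have "\<dots> = 4 * Cl * a\<^sup>2 * 1" by (simp add: power2_eq_square)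
    also have "\<dots> \<le> 4 * Cl * a\<^sup>2 * (ln (ln T))\<^sup>2" using T' Cl by (intro mult_left_mono) auto
    finally have 2: "\<bar>integral {1/2+\<delta>'..a} (\<lambda>v. (v - 1/2) * Im (2 * R v))\<bar> \<le> 4 * Cl * a\<^sup>2 * (ln (ln T))\<^sup>2" by simp
    show ?thesis unfolding split K'_def distrib_right using 1 2 by linarith
  qed
  moreover have "K' > 0" using K Cl by (simp add: K'_def add_pos_nonneg)
  ultimately show ?thesis by blast
qed

text \<open>Close to the critical line discs of fixed size are used; growth linear in the height
  then gives a change of argument of O(ln T).\<close>

lemma near_half_arg_bound:
  assumes a: "a \<ge> 1" and B: "B > 0" "\<mu> > 0"
    and f: "f holomorphic_on {s. Im s > 1}" "\<And>s. Re s \<ge> 1/4 \<Longrightarrow> Im s \<ge> 2 \<Longrightarrow> norm (f s) \<le> B * Im s"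
  shows "\<exists>D>0. \<forall>T x q. T \<ge> exp 20 \<and> T \<ge> a + 2 \<and> (\<forall>x. f (Complex x T) \<noteq> 0) \<and> \<mu> \<le> norm (f (Complex a T))
     \<and> 9/20 \<le> x \<and> x \<le> q \<and> q \<le> 11/20 \<longrightarrow>
     \<bar>integral {x..q} (\<lambda>u. Im (deriv f (Complex u T) / f (Complex u T)))\<bar> \<le> D * ln T"
proof -
  define D where "D = 120 * a * (\<bar>ln (2 * B / \<mu>)\<bar> + 2)"
  have "\<bar>integral {x..q} (\<lambda>u. Im (deriv f (Complex u T) / f (Complex u T)))\<bar> \<le> D * ln T"
    if T: "T \<ge> exp 20" "T \<ge> a + 2" and nz: "\<forall>x. f (Complex x T) \<noteq> 0" and \<mu>: "\<mu> \<le> norm (f (Complex a T))"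
      and xq: "9/20 \<le> x" "x \<le> q" "q \<le> 11/20" for T x q
  proof (cases "x = q")
    case True
    thus ?thesis using exp_20_facts[OF T(1)] a by (simp add: D_def)
  next
    case False
    hence xq': "x < q" using xq by simp
    note T' = exp_20_facts[OF T(1)]
    define S where "S = {s::complex. Im s > 1}"
    have openS: "open S" unfolding S_def by (rule open_halfspace_Im_gt)
    define c where "c = Complex a T"
    define M where "M = B * (T + a)"
    have dc: "dist c (Complex u T) = a - u" if "u \<le> a" for u
    proof -
      have "c - Complex u T = of_real (a - u)" by (simp add: c_def complex_eq_iff)
      thus ?thesis using that by (simp add: dist_norm del: of_real_diff)
    qed
    have cb: "Re s \<ge> 1/4" "Im s \<ge> 2" "Im s \<le> T + a" if "s \<in> cball c (a - 1/4)" for s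
    proof -
      have 1: "\<bar>Re (s - c)\<bar> \<le> a - 1/4" "\<bar>Im (s - c)\<bar> \<le> a - 1/4"
        using that abs_Re_le_cmod[of "s - c"] abs_Im_le_cmod[of "s - c"] by (auto simp: dist_norm norm_minus_commute)
      show "Re s \<ge> 1/4" "Im s \<ge> 2" "Im s \<le> T + a" using 1 T by (auto simp: c_def)
    qed
    define Q where "Q = ln (M / \<mu>) + 1"
    \<comment> \<open>The inner disc reaches back to 9/20 and the outer one to 1/4; the radii differ
      by 1/5, whence 120 = 24 * 5.\<close>
    have "\<bar>Im (contour_integral (linepath (Complex x T) (Complex q T)) (\<lambda>z. deriv f z / f z))\<bar>
        \<le> 24 * (ln (M / \<mu>) + 1) * (a - 1/4) / ((a - 1/4) - (a - 9/20))"
    proof (rule arg_change_bound[OF openS])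
      show "cball c (a - 1/4) \<subseteq> S" using cb(2) by (force simp: S_def)
      show "dist c (Complex x T) \<le> a - 9/20" using dc[of x] xq a by simp
      show "dist c (Complex q T) \<le> a - 9/20" using dc[of q] xq a by simp
      show "f holomorphic_on S" using f by (simp add: S_def)
      show "norm (f z) \<le> M" if "z \<in> cball c (a - 1/4)" for z
      proof -
        have "norm (f z) \<le> B * Im z" by (rule f(2)) (use cb[OF that] in auto)
        also have "\<dots> \<le> M" unfolding M_def using cb[OF that] B by (intro mult_left_mono) auto
        finally show ?thesis .
      qed
      show "f z \<noteq> 0" if "z \<in> closed_segment (Complex x T) (Complex q T)" for z
      proof -
        have "z = Complex (Re z) T" using that by (auto simp: closed_segment_same_Im complex_eq_iff)
        thus ?thesis using nz by metis
      qed
    qed (use a B \<mu> in \<open>auto simp: c_def\<close>)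
    moreover have "24 * Q * (a - 1/4) / ((a - 1/4) - (a - 9/20)) = 120 * (Q * (a - 1/4))" by simp
    ultimately have 1: "\<bar>Im (contour_integral (linepath (Complex x T) (Complex q T)) (\<lambda>z. deriv f z / f z))\<bar> \<le> 120 * (Q * (a - 1/4))"
      unfolding Q_def by linarith
    hence "0 \<le> 120 * (Q * (a - 1/4))" by linarith
    hence Q0: "Q \<ge> 0" using a by (simp add: zero_le_mult_iff)
    have "Q * (a - 1/4) \<le> Q * a" using Q0 by (intro mult_left_mono) auto
    moreover have "Q \<le> (\<bar>ln (2 * B / \<mu>)\<bar> + 2) * ln T"
    proof -
      have "M / \<mu> \<le> (2 * B / \<mu>) * T"
      proof -
        have "M / \<mu> \<le> (B * (2 * T)) / \<mu>" unfolding M_def using T B by (intro divide_right_mono mult_left_mono) auto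
        thus ?thesis by (simp add: mult_ac)
      qed
      moreover have "M / \<mu> > 0" using B T' a by (simp add: M_def)
      ultimately have "ln (M / \<mu>) \<le> ln ((2 * B / \<mu>) * T)" by (intro ln_mono) auto
      also have "\<dots> = ln (2 * B / \<mu>) + ln T" using B T' by (subst ln_mult) auto
      finally have "Q \<le> \<bar>ln (2 * B / \<mu>)\<bar> + ln T + 1" unfolding Q_def by linarith
      moreover have "\<bar>ln (2 * B / \<mu>)\<bar> * 1 \<le> \<bar>ln (2 * B / \<mu>)\<bar> * ln T" using T' by (intro mult_left_mono) auto
      ultimately show ?thesis using T' unfolding distrib_right by linarith
    qed
    hence "Q * a \<le> (\<bar>ln (2 * B / \<mu>)\<bar> + 2) * ln T * a" using a by (intro mult_right_mono) auto
    ultimately have "120 * (Q * (a - 1/4)) \<le> 120 * ((\<bar>ln (2 * B / \<mu>)\<bar> + 2) * ln T * a)" by linarith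
    also have "\<dots> = D * ln T" by (simp add: D_def)
    finally have 2: "\<bar>Im (contour_integral (linepath (Complex x T) (Complex q T)) (\<lambda>z. deriv f z / f z))\<bar> \<le> D * ln T"
      using 1 by linarith
    have cC: "continuous_on X (\<lambda>x. Complex x T)" for X
      unfolding Complex_eq by (intro continuous_intros)
    have cfx: "continuous_on {x..q} (\<lambda>x. F (Complex x T))" if "F holomorphic_on S" for F
      by (rule continuous_on_compose2[OF holomorphic_on_imp_continuous_on[OF that] cC]) (use T' in \<open>auto simp: S_def\<close>)
    have "continuous_on {x..q} (\<lambda>x. deriv f (Complex x T) / f (Complex x T))"
      by (intro continuous_intros cfx f(1)[folded S_def] holomorphic_deriv openS) (use nz in auto)
    hence "integral {x..q} (\<lambda>u. Im (deriv f (Complex u T) / f (Complex u T)))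
        = Im (integral {x..q} (\<lambda>x. deriv f (Complex x T) / f (Complex x T)))"
      using integral_linear[OF integrable_continuous_real bounded_linear_Im] by (simp add: o_def)
    also have "\<dots> = Im (contour_integral (linepath (Complex x T) (Complex q T)) (\<lambda>z. deriv f z / f z))"
      using contour_integral_linepath_same_Im[OF xq', of T "\<lambda>z. deriv f z / f z"] by simp
    finally show ?thesis using 2 by simp
  qed
  moreover have "D > 0" using a by (simp add: D_def add_nonneg_pos)
  ultimately show ?thesis by blast
qed

text \<open>Cauchy's estimate on circles of radius 1/10, which stay in the range of
  \<open>zeta_growth\<close>; the factor 400 is 2! * 2 * 10^2.\<close>

lemma zeta2_growth: "\<exists>C>0. \<forall>s. Re s \<ge> 1/4 \<and> Im s \<ge> 2 \<longrightarrow> norm (zeta2 s) \<le> C * Im s"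
proof -
  obtain C where C: "C > 0" "\<And>s. Re s \<ge> 1/10 \<Longrightarrow> \<bar>Im s\<bar> \<ge> 1 \<Longrightarrow> norm (zeta s) \<le> C * \<bar>Im s\<bar>"
    using zeta_growth by blast
  have "norm (zeta2 s) \<le> 400 * C * Im s" if s: "Re s \<ge> 1/4" "Im s \<ge> 2" for s
  proof -
    have b: "Re z \<ge> 3/20" "Im z \<ge> 1" "Im z \<le> 2 * Im s" if "z \<in> cball s (1/10)" for z
    proof -
      have *: "\<bar>Re (z - s)\<bar> \<le> 1/10" "\<bar>Im (z - s)\<bar> \<le> 1/10"
        using that abs_Re_le_cmod[of "z - s"] abs_Im_le_cmod[of "z - s"] by (auto simp: dist_norm norm_minus_commute)
      show "Re z \<ge> 3/20" using abs_le_D2[OF *(1)] s by simp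
      show "Im z \<ge> 1" "Im z \<le> 2 * Im s" using abs_le_D1[OF *(2)] abs_le_D2[OF *(2)] s by simp_all
    qed
    have n1: "1 \<notin> cball s (1/10)" using b(2)[of 1] by force
    have "norm ((deriv ^^ 2) zeta s) \<le> fact 2 * (C * (2 * Im s)) / (1/10) ^ 2"
    proof (rule Cauchy_inequality)
      have h: "zeta holomorphic_on cball s (1/10)" by (rule zeta_holomorphic_on[OF n1])
      show "zeta holomorphic_on ball s (1/10)" by (rule holomorphic_on_subset[OF h]) auto
      show "continuous_on (cball s (1/10)) zeta" by (rule holomorphic_on_imp_continuous_on[OF h])
      fix z assume "norm (s - z) = 1/10"
      hence z: "z \<in> cball s (1/10)" by (simp add: dist_norm)
      have "norm (zeta z) \<le> C * \<bar>Im z\<bar>" by (rule C(2)) (use b[OF z] in auto)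
      also have "\<dots> \<le> C * (2 * Im s)" using b[OF z] C by (intro mult_left_mono) auto
      finally show "norm (zeta z) \<le> C * (2 * Im s)" .
    qed auto
    thus ?thesis unfolding zeta2_def[symmetric] by (simp add: fact_numeral power2_eq_square)
  qed
  moreover have "400 * C > 0" using C by simp
  ultimately show ?thesis by blast
qed

text \<open>\<open>zquot\<close> may have poles close to the segment, so \<open>zeta2\<close> and
  \<open>zeta\<close> are handled separately. Their changes of argument are O(ln T), while weight
  and length are O(1 / ln T).\<close>

lemma near_horizontal:
  assumes a: "a \<ge> 2" and m: "m > 0" "\<And>t. t \<ge> 4 \<Longrightarrow> m \<le> norm (zquot (Complex a t))"
  shows "\<exists>K>0. \<exists>T2. \<forall>T\<ge>T2. (\<forall>x. zeta (Complex x T) \<noteq> 0) \<and> (\<forall>x. zeta2 (Complex x T) \<noteq> 0) \<longrightarrow>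
    \<bar>integral {1/2 - 1 / ln T..1/2 + 1 / ln T} (\<lambda>x. (x - 1/2) * Im (zw (Complex x T)))\<bar> \<le> K"
proof -
  obtain C1 where C1: "C1 > 0" "\<And>s. Re s \<ge> 1/10 \<Longrightarrow> \<bar>Im s\<bar> \<ge> 1 \<Longrightarrow> norm (zeta s) \<le> C1 * \<bar>Im s\<bar>"
    using zeta_growth by blast
  obtain C2 where C2: "C2 > 0" "\<And>s. Re s \<ge> 1/4 \<Longrightarrow> Im s \<ge> 2 \<Longrightarrow> norm (zeta2 s) \<le> C2 * Im s"
    using zeta2_growth by blast
  define m0 where "m0 = 2 - pi\<^sup>2 / 6"
  have m0: "m0 > 0" using two_minus_pi_sq_pos by (simp add: m0_def)
  have za: "norm (zeta (Complex a t)) \<ge> m0" for t unfolding m0_def by (rule zeta_lower_bound) (use a in simp)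
  have z2a: "norm (zeta2 (Complex a t)) \<ge> m * m0" if "t \<ge> 4" for t
  proof -
    have "zeta (Complex a t) \<noteq> 0" using za[of t] m0 by auto
    hence "zeta2 (Complex a t) = zquot (Complex a t) * zeta (Complex a t)" by (simp add: zquot_def)
    thus ?thesis using mult_mono[OF m(2)[OF that] za[of t]] m0 by (simp add: norm_mult)
  qed
  have a1: "a \<ge> 1" using a by simp
  have h1: "zeta holomorphic_on {s. Im s > 1}" by (rule zeta_holomorphic_on) auto
  have h2: "zeta2 holomorphic_on {s. Im s > 1}" by (rule holomorphic_on_subset[OF zeta2_holomorphic]) auto
  have C1': "norm (zeta s) \<le> C1 * Im s" if "Re s \<ge> 1/4" "Im s \<ge> 2" for s
    using C1(2)[of s] that by simp
  obtain D1 where D1: "D1 > 0" "\<And>T x q. T \<ge> exp 20 \<Longrightarrow> T \<ge> a + 2 \<Longrightarrow> (\<forall>x. zeta (Complex x T) \<noteq> 0) \<Longrightarrow>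
     m0 \<le> norm (zeta (Complex a T)) \<Longrightarrow> 9/20 \<le> x \<Longrightarrow> x \<le> q \<Longrightarrow> q \<le> 11/20 \<Longrightarrow>
     \<bar>integral {x..q} (\<lambda>u. Im (deriv zeta (Complex u T) / zeta (Complex u T)))\<bar> \<le> D1 * ln T"
    using near_half_arg_bound[OF a1 C1(1) m0 h1 C1'] by blast
  have mm: "m * m0 > 0" using m m0 by simp
  obtain D2 where D2: "D2 > 0" "\<And>T x q. T \<ge> exp 20 \<Longrightarrow> T \<ge> a + 2 \<Longrightarrow> (\<forall>x. zeta2 (Complex x T) \<noteq> 0) \<Longrightarrow>
     m * m0 \<le> norm (zeta2 (Complex a T)) \<Longrightarrow> 9/20 \<le> x \<Longrightarrow> x \<le> q \<Longrightarrow> q \<le> 11/20 \<Longrightarrow>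
     \<bar>integral {x..q} (\<lambda>u. Im (deriv zeta2 (Complex u T) / zeta2 (Complex u T)))\<bar> \<le> D2 * ln T"
    using near_half_arg_bound[OF a1 C2(1) mm h2 C2(2)] by blast
  define K where "K = 3 * (D1 + D2)"
  have "\<bar>integral {1/2 - 1 / ln T..1/2 + 1 / ln T} (\<lambda>x. (x - 1/2) * Im (zw (Complex x T)))\<bar> \<le> K"
    if T: "T \<ge> max (exp 20) (a + 2)" and nz: "\<forall>x. zeta (Complex x T) \<noteq> 0" "\<forall>x. zeta2 (Complex x T) \<noteq> 0" for T
  proof -
    have T20: "T \<ge> exp 20" "T \<ge> a + 2" using T by auto
    note T' = exp_20_facts[OF T20(1)]
    define \<delta> where "\<delta> = 1 / ln T"
    have \<delta>: "0 < \<delta>" "\<delta> \<le> 1/20" "\<delta> * ln T = 1" using T' by (auto simp: \<delta>_def field_simps)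
    define p q where "p = 1/2 - \<delta>" and "q = 1/2 + \<delta>"
    have pq: "9/20 \<le> p" "p \<le> q" "q \<le> 11/20" "p < q" using \<delta> by (auto simp: p_def q_def)
    have cC: "continuous_on X (\<lambda>x. Complex x T)" for X
      unfolding Complex_eq by (intro continuous_intros)
    have cfx: "continuous_on X (\<lambda>x. F (Complex x T))" if "F holomorphic_on {s. Im s > 1}" for F X
      by (rule continuous_on_compose2[OF holomorphic_on_imp_continuous_on[OF that] cC]) (use T' in auto)
    define P1 P2 where "P1 = (\<lambda>u. Im (deriv zeta (Complex u T) / zeta (Complex u T)))"
      and "P2 = (\<lambda>u. Im (deriv zeta2 (Complex u T) / zeta2 (Complex u T)))"
    have c1: "continuous_on X P1" for X unfolding P1_def
      by (intro continuous_on_Im continuous_intros cfx h1 holomorphic_deriv open_halfspace_Im_gt) (use nz in auto)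
    have c2: "continuous_on X P2" for X unfolding P2_def
      by (intro continuous_on_Im continuous_intros cfx h2 holomorphic_deriv open_halfspace_Im_gt) (use nz in auto)
    have e: "Im (zw (Complex x T)) = P2 x - P1 x" for x by (simp add: zw_def zlog_def P1_def P2_def)
    have "\<bar>integral {p..q} (\<lambda>x. (x - 1/2) * (P2 x - P1 x))\<bar> \<le> \<bar>p - 1/2\<bar> * ((D1 + D2) * ln T) + integral {p..q} (\<lambda>_. (D1 + D2) * ln T)"
    proof (rule weighted_integral_bound_right[OF pq(2)])
      show "continuous_on {p..q} (\<lambda>x. P2 x - P1 x)" by (intro continuous_intros c1 c2)
      fix x assume x: "x \<in> {p..q}"
      have "integral {x..q} (\<lambda>x. P2 x - P1 x) = integral {x..q} P2 - integral {x..q} P1"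
        by (intro integral_diff integrable_continuous_real c1 c2)
      moreover have "\<bar>integral {x..q} P2\<bar> \<le> D2 * ln T" unfolding P2_def
        by (rule D2(2)) (use T20 nz z2a[of T] T' x pq in auto)
      moreover have "\<bar>integral {x..q} P1\<bar> \<le> D1 * ln T" unfolding P1_def
        by (rule D1(2)) (use T20 nz za[of T] T' x pq in auto)
      ultimately show "\<bar>integral {x..q} (\<lambda>x. P2 x - P1 x)\<bar> \<le> (D1 + D2) * ln T" by (simp add: distrib_right)
    qed (rule integrable_const_ivl)
    also have "\<dots> = \<delta> * ((D1 + D2) * ln T) + 2 * \<delta> * ((D1 + D2) * ln T)"
      using pq \<delta> by (simp add: p_def q_def)
    also have "\<dots> = K * (\<delta> * ln T)" by (simp add: K_def algebra_simps)
    also have "\<dots> = K" using \<delta> by simp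
    finally show ?thesis unfolding e p_def q_def \<delta>_def .
  qed
  moreover have "K > 0" using D1 D2 by (simp add: K_def)
  ultimately show ?thesis by blast
qed

text \<open>With s - 1/2 = (x - 1/2) + i T, the part T Re \<open>zw\<close> integrates exactly to
  the difference of the corner values. The part (x - 1/2) Im \<open>zw\<close> is cut at distance 1
  / ln T on either side of the critical line.\<close>

lemma top_horizontal:
  assumes RH: "riemann_hypothesis" and a: "a \<ge> 2"
    and m: "m > 0" "\<And>t. t \<ge> 4 \<Longrightarrow> m \<le> norm (zquot (Complex a t))"
    and m': "m' > 0" "\<And>t. t \<ge> t1 \<Longrightarrow> m' * (norm (lam (Complex a (-t))))\<^sup>2 \<le> norm (zquot (Complex (1-a) t))"
  shows "\<exists>K>0. \<exists>T2. \<forall>T\<ge>T2. (\<forall>x. zeta (Complex x T) \<noteq> 0) \<and> (\<forall>x. zeta2 (Complex x T) \<noteq> 0) \<longrightarrow>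
    \<bar>Im (contour_integral (linepath (Complex (1-a) T) (Complex a T)) (\<lambda>s. (s - 1/2) * zw s))
      - T * (ln (norm (zquot (Complex a T))) - ln (norm (zquot (Complex (1-a) T))))\<bar> \<le> K * (ln (ln T))\<^sup>2"
proof -
  have a1: "a \<ge> 1" using a by simp
  obtain K1 T1 where 1: "K1 > 0" "\<And>T. T \<ge> T1 \<Longrightarrow> (\<forall>x. zeta2 (Complex x T) \<noteq> 0) \<Longrightarrow>
    \<bar>integral {1/2 + 1 / ln T..a} (\<lambda>x. (x - 1/2) * Im (zw (Complex x T)))\<bar> \<le> K1 * (ln (ln T))\<^sup>2"
    using right_horizontal[OF RH a1 m] by blast
  obtain K2 T2 where 2: "K2 > 0" "\<And>T. T \<ge> T2 \<Longrightarrow> (\<forall>x. zeta2 (Complex x T) \<noteq> 0) \<Longrightarrow>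
    \<bar>integral {1-a..1/2 - 1 / ln T} (\<lambda>x. (x - 1/2) * Im (zw (Complex x T)))\<bar> \<le> K2 * (ln (ln T))\<^sup>2"
    using left_horizontal[OF RH a1 m'] by blast
  obtain K3 T3 where 3: "K3 > 0" "\<And>T. T \<ge> T3 \<Longrightarrow> (\<forall>x. zeta (Complex x T) \<noteq> 0) \<and> (\<forall>x. zeta2 (Complex x T) \<noteq> 0) \<Longrightarrow>
    \<bar>integral {1/2 - 1 / ln T..1/2 + 1 / ln T} (\<lambda>x. (x - 1/2) * Im (zw (Complex x T)))\<bar> \<le> K3"
    using near_horizontal[OF a m] by blast
  define K where "K = K1 + K2 + K3"
  have "\<bar>Im (contour_integral (linepath (Complex (1-a) T) (Complex a T)) (\<lambda>s. (s - 1/2) * zw s))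
      - T * (ln (norm (zquot (Complex a T))) - ln (norm (zquot (Complex (1-a) T))))\<bar> \<le> K * (ln (ln T))\<^sup>2"
    if T: "T \<ge> Max {exp 20, T1, T2, T3}" and nz: "\<forall>x. zeta (Complex x T) \<noteq> 0" "\<forall>x. zeta2 (Complex x T) \<noteq> 0" for T
  proof -
    have T20: "T \<ge> exp 20" "T \<ge> T1" "T \<ge> T2" "T \<ge> T3" using T by auto
    note T' = exp_20_facts[OF T20(1)]
    define \<delta> where "\<delta> = 1 / ln T"
    have \<delta>: "0 < \<delta>" "\<delta> \<le> 1/20" using T' by (auto simp: \<delta>_def field_simps)
    define W where "W = (\<lambda>x. zw (Complex x T))"
    have cC: "continuous_on X (\<lambda>x. Complex x T)" for X
      unfolding Complex_eq by (intro continuous_intros)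
    have cfx: "continuous_on X (\<lambda>x. F (Complex x T))" if "F holomorphic_on {s. Im s > 1}" for F X
      by (rule continuous_on_compose2[OF holomorphic_on_imp_continuous_on[OF that] cC]) (use T' in auto)
    have h1: "zeta holomorphic_on {s. Im s > 1}" by (rule zeta_holomorphic_on) auto
    have h2: "zeta2 holomorphic_on {s. Im s > 1}" by (rule holomorphic_on_subset[OF zeta2_holomorphic]) auto
    have cW: "continuous_on X W" for X unfolding W_def zw_def zlog_def
      by (intro continuous_intros cfx h1 h2 holomorphic_deriv open_halfspace_Im_gt) (use nz in auto)
    have n1: "Complex x T \<noteq> 1" for x using T' by (auto simp: complex_eq_iff)
    have i: "(\<lambda>x. (x - 1/2) * Im (W x)) integrable_on {u..v}" for u v
      by (intro integrable_continuous_real continuous_intros cW)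
    have "((\<lambda>x. Re (W x)) has_integral
        ln (norm (zquot (Complex a T))) - ln (norm (zquot (Complex (1-a) T)))) {1-a..a}"
    proof (rule fundamental_theorem_of_calculus)
      fix x
      have "((\<lambda>x. ln (norm (zquot (Complex x T)))) has_vector_derivative
          Re (deriv zquot (Complex x T) / zquot (Complex x T))) (at x)"
      proof (rule ln_norm_horizontal_derivative)
        show "zquot field_differentiable at (Complex x T)"
          using zquot_log_deriv(1)[OF n1] nz unfolding field_differentiable_def by blast
        show "zquot (Complex x T) \<noteq> 0" using nz by (simp add: zquot_def)
      qed
      hence "((\<lambda>x. ln (norm (zquot (Complex x T)))) has_vector_derivative Re (W x)) (at x)"
        using zquot_log_deriv(2)[OF n1] nz by (simp add: W_def)
      thus "((\<lambda>x. ln (norm (zquot (Complex x T)))) has_vector_derivative Re (W x)) (at x within {1-a..a})"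
        by (rule has_vector_derivative_at_within)
    qed (use a in simp)
    hence iRe: "integral {1-a..a} (\<lambda>x. Re (W x)) = ln (norm (zquot (Complex a T))) - ln (norm (zquot (Complex (1-a) T)))"
      by (rule integral_unique)
    have "contour_integral (linepath (Complex (1-a) T) (Complex a T)) (\<lambda>s. (s - 1/2) * zw s)
        = integral {1-a..a} (\<lambda>x. (Complex x T - 1/2) * W x)"
      unfolding W_def by (rule contour_integral_linepath_same_Im) (use a in simp)
    hence "Im (contour_integral (linepath (Complex (1-a) T) (Complex a T)) (\<lambda>s. (s - 1/2) * zw s))
        = Im (integral {1-a..a} (\<lambda>x. (Complex x T - 1/2) * W x))" by simp
    also have "\<dots> = integral {1-a..a} (\<lambda>x. Im ((Complex x T - 1/2) * W x))"
    proof -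
      have "(\<lambda>x. (Complex x T - 1/2) * W x) integrable_on {1-a..a}"
        by (intro integrable_continuous_real continuous_intros cC cW)
      from integral_linear[OF this bounded_linear_Im] show ?thesis by (simp only: o_def)
    qed
    also have "\<dots> = integral {1-a..a} (\<lambda>x. (x - 1/2) * Im (W x) + T * Re (W x))"
      by (rule integral_cong) simp
    also have "\<dots> = integral {1-a..a} (\<lambda>x. (x - 1/2) * Im (W x)) + integral {1-a..a} (\<lambda>x. T * Re (W x))"
      by (rule integral_add) (intro integrable_continuous_real continuous_intros cW)+
    also have "integral {1-a..a} (\<lambda>x. T * Re (W x)) = T * (ln (norm (zquot (Complex a T))) - ln (norm (zquot (Complex (1-a) T))))"
      unfolding iRe[symmetric] by (rule integral_mult_right)
    finally have e1: "Im (contour_integral (linepath (Complex (1-a) T) (Complex a T)) (\<lambda>s. (s - 1/2) * zw s))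
      - T * (ln (norm (zquot (Complex a T))) - ln (norm (zquot (Complex (1-a) T)))) = integral {1-a..a} (\<lambda>x. (x - 1/2) * Im (W x))"
      by simp
    have e2: "integral {1-a..1/2-\<delta>} (\<lambda>x. (x - 1/2) * Im (W x)) + integral {1/2-\<delta>..a} (\<lambda>x. (x - 1/2) * Im (W x))
        = integral {1-a..a} (\<lambda>x. (x - 1/2) * Im (W x))"
      by (rule Henstock_Kurzweil_Integration.integral_combine[OF _ _ i]) (use a \<delta> in auto)
    have e3: "integral {1/2-\<delta>..1/2+\<delta>} (\<lambda>x. (x - 1/2) * Im (W x)) + integral {1/2+\<delta>..a} (\<lambda>x. (x - 1/2) * Im (W x))
        = integral {1/2-\<delta>..a} (\<lambda>x. (x - 1/2) * Im (W x))"
      by (rule Henstock_Kurzweil_Integration.integral_combine[OF _ _ i]) (use a \<delta> in auto)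
    have b1: "\<bar>integral {1/2+\<delta>..a} (\<lambda>x. (x - 1/2) * Im (W x))\<bar> \<le> K1 * (ln (ln T))\<^sup>2"
      unfolding W_def \<delta>_def by (rule 1(2)[OF T20(2) nz(2)])
    have b2: "\<bar>integral {1-a..1/2-\<delta>} (\<lambda>x. (x - 1/2) * Im (W x))\<bar> \<le> K2 * (ln (ln T))\<^sup>2"
      unfolding W_def \<delta>_def by (rule 2(2)[OF T20(3) nz(2)])
    have "\<bar>integral {1/2-\<delta>..1/2+\<delta>} (\<lambda>x. (x - 1/2) * Im (W x))\<bar> \<le> K3 * 1"
      unfolding W_def \<delta>_def using 3(2)[OF T20(4)] nz by simp
    also have "\<dots> \<le> K3 * (ln (ln T))\<^sup>2" using T' 3 by (intro mult_left_mono one_le_power) auto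
    finally have b3: "\<bar>integral {1/2-\<delta>..1/2+\<delta>} (\<lambda>x. (x - 1/2) * Im (W x))\<bar> \<le> K3 * (ln (ln T))\<^sup>2" .
    show ?thesis unfolding e1 K_def distrib_right using b1 b2 b3 e2 e3 by linarith
  qed
  moreover have "K > 0" using 1 2 3 by (simp add: K_def)
  ultimately show ?thesis by blast
qed

section \<open>Zeros and contours\<close>

lemma finite_zeros_compact:
  assumes "f holomorphic_on S" "open S" "connected S" "compact K" "K \<subseteq> S" "z0 \<in> S" "f z0 \<noteq> 0"
  shows "finite {z\<in>K. f z = 0}"
proof (cases "f constant_on S")
  case True
  then obtain c where "\<And>z. z \<in> S \<Longrightarrow> f z = c" unfolding constant_on_def by blast
  hence "{z\<in>K. f z = 0} = {}" using assms(5,6,7) by (metis (mono_tags, lifting) Collect_empty_eq subsetD)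
  thus ?thesis by (simp only: finite.emptyI)
next
  case False
  thus ?thesis using holomorphic_compact_finite_zeros[of f S K] assms by blast
qed

lemma zeta2_nonzero_right: "\<exists>a\<ge>4. \<forall>s. Re s > a - 1 \<longrightarrow> zeta2 s \<noteq> 0"
proof -
  obtain a C \<epsilon> where a: "a \<ge> 4" and
    e: "\<forall>s. Re s > a - 1 \<longrightarrow> zeta s \<noteq> 0 \<and> zquot s = exp (- s * of_real (ln 2) + of_real (2 * ln (ln 2)) + \<epsilon> s) \<and>
        norm (\<epsilon> s) \<le> C * (2/3) powr (Re s) \<and> norm (\<epsilon> s) \<le> 1"
    using zquot_right_branch by blast
  have "zeta2 s \<noteq> 0" if "Re s > a - 1" for s
  proof
    assume "zeta2 s = 0"
    hence "zquot s = 0" by (simp add: zquot_def)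
    thus False using e that by simp
  qed
  thus ?thesis using a by blast
qed

text \<open>\<open>zeta\<close> has no essential singularity at 1, hence neither has
  \<open>zeta2\<close>. Zeros accumulating at 1 would then force \<open>zeta2\<close> to vanish near
  1 and, by the identity theorem, everywhere.\<close>

lemma zeta2_nonzero_near_1: "\<exists>r>0. \<forall>s\<in>ball 1 r - {1}. zeta2 s \<noteq> 0"
proof -
  define g where "g = (\<lambda>w. 1 + (\<Sum>n. taylor_rem 1 w n))"
  have g: "g holomorphic_on {w. Re w > - real 1}"
    unfolding g_def by (intro holomorphic_on_add holomorphic_on_const holomorphic_suminf_taylor_rem)
  define U where "U = {s::complex. Re s > 0}"
  have U: "open U" "1 \<in> U" by (auto simp: U_def open_halfspace_Re_gt)
  have "(g \<circ> (\<lambda>s. s - 1)) holomorphic_on U"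
    by (rule holomorphic_on_compose_gen[OF _ g]) (auto simp: U_def intro!: holomorphic_intros)
  hence g1: "(\<lambda>s. g (s - 1)) holomorphic_on U" by (simp add: o_def)
  have hid: "(\<lambda>s. s - 1) holomorphic_on U" by (intro holomorphic_intros)
  have iso: "isolated_singularity_at F 1" if "F holomorphic_on U" for F
    by (rule isolated_singularity_at_holomorphic[OF holomorphic_on_subset[OF that] U]) auto
  have ne: "not_essential (\<lambda>s. g (s - 1) / (s - 1)) 1"
    by (intro not_essential_divide not_essential_holomorphic[OF _ U(2,1)] iso g1 hid)
  have "\<forall>\<^sub>F s in at 1. g (s - 1) / (s - 1) = zeta s"
  proof (rule eventually_at_in_open[OF U, THEN eventually_mono])
    fix s assume s: "s \<in> U - {1}"
    have "(s - 1) * zeta (s - 1 + 1) = g (s - 1)"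
      unfolding g_def by (rule zeta_continuation_at_minus_1) (use s in \<open>auto simp: U_def\<close>)
    thus "g (s - 1) / (s - 1) = zeta s" using s by (simp add: field_simps)
  qed
  hence nez: "not_essential zeta 1" by (rule not_essential_transform[OF ne])
  have isoz: "isolated_singularity_at F 1" if "F holomorphic_on - {1}" for F
    by (rule isolated_singularity_at_holomorphic[of F UNIV]) (use that in \<open>auto simp: Compl_eq_Diff_UNIV\<close>)
  have "not_essential (deriv zeta) 1"
    by (rule not_essential_deriv[OF nez isoz[OF zeta_holomorphic]])
  hence "not_essential (deriv (deriv zeta)) 1"
    by (rule not_essential_deriv) (rule isoz[OF zeta_deriv_holomorphic])
  hence ne2: "not_essential zeta2 1" by (simp add: zeta2_altdef)
  have "\<not> (\<exists>\<^sub>F s in at 1. zeta2 s = 0)"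
  proof
    assume "\<exists>\<^sub>F s in at 1. zeta2 s = 0"
    hence "\<forall>\<^sub>F s in at 1. zeta2 s = 0"
      by (rule not_essential_frequently_0_imp_eventually_0[OF isoz[OF zeta2_holomorphic] ne2])
    then obtain d where d: "d > 0" "\<And>s. s \<noteq> 1 \<Longrightarrow> dist s 1 < d \<Longrightarrow> zeta2 s = 0"
      unfolding eventually_at by blast
    obtain a where a: "a \<ge> 4" "\<And>s. Re s > a - 1 \<Longrightarrow> zeta2 s \<noteq> 0" using zeta2_nonzero_right by blast
    have "zeta2 (of_real a) = 0"
    proof (rule analytic_continuation_open[of "ball 1 d - {1}" "- {1}" zeta2 "\<lambda>_. 0"])
      show "open (ball (1::complex) d - {1})" by auto
      have "1 + of_real (d/2) \<in> ball (1::complex) d - {1}" using d by (simp add: dist_norm)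
      thus "ball (1::complex) d - {1} \<noteq> {}" by blast
      show "connected (- {1::complex})" by (rule connected_punctured_universe) simp
      show "of_real a \<in> - {1::complex}" using a by simp
    qed (use d zeta2_holomorphic in \<open>auto simp: dist_commute\<close>)
    moreover have "zeta2 (of_real a) \<noteq> 0" by (rule a(2)) simp
    ultimately show False by simp
  qed
  hence "\<forall>\<^sub>F s in at 1. zeta2 s \<noteq> 0" by (simp add: not_frequently)
  then obtain d where "d > 0" "\<And>s. s \<noteq> 1 \<Longrightarrow> dist s 1 < d \<Longrightarrow> zeta2 s \<noteq> 0"
    unfolding eventually_at by blast
  thus ?thesis by (intro exI[of _ d]) (auto simp: dist_commute)
qed

text \<open>The zeros have to be confined on the right, on the left even for arbitrarily small
  positive imaginary part, and away from the pole; then they lie in a compact subset of the domain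
  of holomorphy.\<close>

lemma finite_zeta2_zeros: "finite (zeta2_zeros T)"
proof -
  obtain r where r: "r > 0" "\<And>s. s \<in> ball 1 r - {1} \<Longrightarrow> zeta2 s \<noteq> 0" using zeta2_nonzero_near_1 by blast
  obtain a where a: "a \<ge> 4" "\<And>s. Re s > a - 1 \<Longrightarrow> zeta2 s \<noteq> 0" using zeta2_nonzero_right by blast
  \<comment> \<open>The zero-free region asks for a positive height, while \<open>T\<close> is
    arbitrary.\<close>
  have "max T 1 > 0" by simp
  from zeta2_low_zero_free[OF this] obtain K where K: "K > 1"
    "\<And>w. Re w \<ge> K \<Longrightarrow> - max T 1 \<le> Im w \<Longrightarrow> Im w < 0 \<Longrightarrow> zeta2 (1 - w) \<noteq> 0" by blast
  define B where "B = cbox (Complex (1 - K) 0) (Complex (a - 1) T) - ball 1 r"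
  have "finite {z\<in>B. zeta2 z = 0}"
  proof (rule finite_zeros_compact[OF zeta2_holomorphic])
    show "compact B" unfolding B_def by (intro compact_diff compact_cbox) auto
    show "B \<subseteq> - {1}" using r by (auto simp: B_def)
    show "of_real a \<in> - {1::complex}" using a by simp
    show "zeta2 (of_real a) \<noteq> 0" by (rule a(2)) simp
    show "connected (- {1::complex})" by (rule connected_punctured_universe) simp
  qed auto
  moreover have "zeta2_zeros T \<subseteq> {z\<in>B. zeta2 z = 0}"
  proof
    fix s assume "s \<in> zeta2_zeros T"
    hence s: "zeta2 s = 0" "0 < Im s" "Im s \<le> T" by (auto simp: zeta2_zeros_def)
    have "Re s \<le> a - 1" using a(2)[of s] s by force
    moreover have "Re s \<ge> 1 - K" using K(2)[of "1 - s"] s by force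
    moreover have "s \<notin> ball 1 r" using r(2)[of s] s by fastforce
    ultimately show "s \<in> {z\<in>B. zeta2 z = 0}" using s by (auto simp: B_def in_cbox_complex_iff)
  qed
  ultimately show ?thesis by (rule finite_subset[rotated])
qed

lemma rectangle_argument_principle:
  assumes pq: "Re p < Re q" "Im p < Im q" "Im p > 0"
    and f: "f holomorphic_on {s. Im s > 0}" and h: "h holomorphic_on UNIV"
    and nz: "\<And>s. s \<in> path_image (rectpath p q) \<Longrightarrow> f s \<noteq> 0"
  shows "finite {s\<in>box p q. f s = 0}"
    "contour_integral (rectpath p q) (\<lambda>s. h s * (deriv f s / f s)) =
      2 * pi * \<i> * (\<Sum>s | s \<in> box p q \<and> f s = 0. h s * of_int (zorder f s))"
proof -
  \<comment> \<open>A slightly larger box, still above the real axis: its closure holds only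
    finitely many zeros, and its interior contains the contour.\<close>
  define p' where "p' = Complex (Re p - 1) (Im p / 2)"
  define q' where "q' = Complex (Re q + 1) (Im q + 1)"
  define S where "S = box p' q'"
  define Z where "Z = {w\<in>S. f w = 0 \<or> w \<in> {}}"
  have SH: "cbox p' q' \<subseteq> {s. Im s > 0}" using pq by (auto simp: p'_def in_cbox_complex_iff)
  have SS: "S \<subseteq> cbox p' q'" unfolding S_def by (rule box_subset_cbox)
  have cS: "cbox p q \<subseteq> S" using pq by (auto simp: S_def p'_def q'_def in_cbox_complex_iff in_box_complex_iff)
  have pi: "path_image (rectpath p q) = cbox p q - box p q"
    by (rule path_image_rectpath_cbox_minus_box) (use pq in auto)
  have p0: "f p \<noteq> 0" by (rule nz) (use pq in \<open>auto simp: pi in_box_complex_iff in_cbox_complex_iff\<close>)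
  have finZ': "finite {z\<in>cbox p' q'. f z = 0}"
  proof (rule finite_zeros_compact[OF f])
    show "connected {s. 0 < Im s}" by (intro convex_connected convex_halfspace_Im_gt)
  qed (use SH p0 pq in \<open>auto simp: open_halfspace_Im_gt\<close>)
  have finZ: "finite Z" by (rule finite_subset[OF _ finZ']) (use SS in \<open>auto simp: Z_def\<close>)
  show "finite {s\<in>box p q. f s = 0}"
    by (rule finite_subset[OF _ finZ]) (use cS box_subset_cbox in \<open>auto simp: Z_def\<close>)
  have "contour_integral (rectpath p q) (\<lambda>s. deriv f s * h s / f s) =
      2 * pi * \<i> * (\<Sum>w\<in>Z. winding_number (rectpath p q) w * h w * zorder f w)"
    unfolding Z_def
  proof (rule argument_principle)
    show "open S" "connected S" by (auto simp: S_def intro: convex_connected)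
    show "f holomorphic_on S - {}" by (rule holomorphic_on_subset[OF f]) (use SS SH in auto)
    show "h holomorphic_on S" by (rule holomorphic_on_subset[OF h]) auto
    show "path_image (rectpath p q) \<subseteq> S - {w \<in> S. f w = 0 \<or> w \<in> {}}"
      using nz cS pi by auto
    show "\<forall>z. z \<notin> S \<longrightarrow> winding_number (rectpath p q) z = 0"
      using cS pq by (auto intro!: winding_number_rectpath_outside)
    show "finite {w \<in> S. f w = 0 \<or> w \<in> {}}" using finZ by (simp add: Z_def)
  qed auto
  also have "(\<Sum>w\<in>Z. winding_number (rectpath p q) w * h w * zorder f w) =
      (\<Sum>s | s \<in> box p q \<and> f s = 0. h s * of_int (zorder f s))"
  proof (rule sum.mono_neutral_cong_right[OF finZ])
    show "{s. s \<in> box p q \<and> f s = 0} \<subseteq> Z" using cS box_subset_cbox[of p q] by (auto simp: Z_def)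
    show "\<forall>w\<in>Z - {s. s \<in> box p q \<and> f s = 0}. winding_number (rectpath p q) w * h w * zorder f w = 0"
    proof
      fix w assume w: "w \<in> Z - {s. s \<in> box p q \<and> f s = 0}"
      hence "w \<notin> box p q" "w \<notin> path_image (rectpath p q)" using nz by (auto simp: Z_def)
      hence "w \<notin> cbox p q" using pi by auto
      hence "winding_number (rectpath p q) w = 0" using pq by (intro winding_number_rectpath_outside) auto
      thus "winding_number (rectpath p q) w * h w * zorder f w = 0" by simp
    qed
  qed (simp add: winding_number_rectpath)
  finally show "contour_integral (rectpath p q) (\<lambda>s. h s * (deriv f s / f s)) =
      2 * pi * \<i> * (\<Sum>s | s \<in> box p q \<and> f s = 0. h s * of_int (zorder f s))"
    by (simp add: mult.commute)
qed

lemma contour_integral_rectpath: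
  assumes "continuous_on (path_image (rectpath p q)) F" "Re p \<le> Re q" "Im p \<le> Im q"
  shows "F contour_integrable_on rectpath p q"
    "contour_integral (rectpath p q) F =
      contour_integral (linepath p (Complex (Re q) (Im p))) F + contour_integral (linepath (Complex (Re q) (Im p)) q) F
      - contour_integral (linepath (Complex (Re p) (Im q)) q) F - contour_integral (linepath p (Complex (Re p) (Im q))) F"
proof -
  define a2 a4 where "a2 = Complex (Re q) (Im p)" and "a4 = Complex (Re p) (Im q)"
  have img: "path_image (rectpath p q) = closed_segment p a2 \<union> (closed_segment a2 q \<union> (closed_segment q a4 \<union> closed_segment a4 p))"
    by (simp add: rectpath_def Let_def path_image_join a2_def a4_def)
  have c: "F contour_integrable_on linepath p a2" "F contour_integrable_on linepath a2 q"
      "F contour_integrable_on linepath q a4" "F contour_integrable_on linepath a4 p"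
    by (rule contour_integrable_continuous_linepath, rule continuous_on_subset[OF assms(1)], use img in blast)+
  show "F contour_integrable_on rectpath p q"
    unfolding rectpath_def Let_def a2_def[symmetric] a4_def[symmetric]
    using c by (simp add: contour_integrable_join valid_path_join)
  have "contour_integral (rectpath p q) F = contour_integral (linepath p a2) F + (contour_integral (linepath a2 q) F
      + (contour_integral (linepath q a4) F + contour_integral (linepath a4 p) F))"
    unfolding rectpath_def Let_def a2_def[symmetric] a4_def[symmetric]
    using c by (simp add: contour_integrable_join valid_path_join)
  also have "contour_integral (linepath q a4) F = - contour_integral (linepath a4 q) F"
    by (rule contour_integral_reverse_linepath) (rule continuous_on_subset[OF assms(1)], use img in blast)
  also have "contour_integral (linepath a4 p) F = - contour_integral (linepath p a4) F"
    by (rule contour_integral_reverse_linepath) (rule continuous_on_subset[OF assms(1)], use img in blast)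
  finally show "contour_integral (rectpath p q) F =
      contour_integral (linepath p (Complex (Re q) (Im p))) F + contour_integral (linepath (Complex (Re q) (Im p)) q) F
      - contour_integral (linepath (Complex (Re p) (Im q)) q) F - contour_integral (linepath p (Complex (Re p) (Im q))) F"
    by (simp add: a2_def a4_def)
qed

text \<open>The zeros of \<open>zeta\<close> lie on the critical line and those of
  \<open>zeta2\<close> are confined by \<open>strip\<close>, so only finitely many of them have
  heights in a given unit interval; any other height in it will do.\<close>

lemma good_height_exists:
  assumes RH: "riemann_hypothesis" and X: "X > 0"
    and strip: "\<And>s. zeta2 s = 0 \<Longrightarrow> Im s > X \<Longrightarrow> 1 - a \<le> Re s \<and> Re s \<le> a" and a: "a \<ge> 1"
  shows "\<exists>T0>X. (\<forall>x. zeta (Complex x T0) \<noteq> 0) \<and> (\<forall>x. zeta2 (Complex x T0) \<noteq> 0)"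
proof -
  define B where "B = cbox (Complex (1-a) (X+1)) (Complex a (X+2))"
  obtain b where b: "b \<ge> 4" "\<And>s. Re s > b - 1 \<Longrightarrow> zeta2 s \<noteq> 0" using zeta2_nonzero_right by blast
  have conn: "connected {s. 0 < Im s}" by (intro convex_connected convex_halfspace_Im_gt)
  have op: "open {s. 0 < Im s}" by (rule open_halfspace_Im_gt)
  have cB: "compact B" unfolding B_def by (rule compact_cbox)
  have BS: "B \<subseteq> {s. 0 < Im s}" using X by (auto simp: B_def in_cbox_complex_iff)
  have h1: "zeta holomorphic_on {s. Im s > 0}" by (rule zeta_holomorphic_on) auto
  have h2: "zeta2 holomorphic_on {s. Im s > 0}" by (rule holomorphic_on_subset[OF zeta2_holomorphic]) auto
  have f1: "finite {s\<in>B. zeta s = 0}"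
    by (rule finite_zeros_compact[OF h1 op conn cB BS, of "Complex 2 1"])
       (use zeta_nonzero_Re_ge_1[of "Complex 2 1"] in auto)
  have f2: "finite {s\<in>B. zeta2 s = 0}"
    by (rule finite_zeros_compact[OF h2 op conn cB BS, of "Complex b 1"])
       (use b(2)[of "Complex b 1"] in auto)
  have "infinite {X+1..X+2}" by (rule infinite_Icc) simp
  moreover have "finite (Im ` {s\<in>B. zeta s = 0} \<union> Im ` {s\<in>B. zeta2 s = 0})" using f1 f2 by blast
  ultimately have "{X+1..X+2} - (Im ` {s\<in>B. zeta s = 0} \<union> Im ` {s\<in>B. zeta2 s = 0}) \<noteq> {}"
    by (metis Diff_infinite_finite finite.emptyI)
  then obtain T0 where T0: "T0 \<in> {X+1..X+2}" "T0 \<notin> Im ` {s\<in>B. zeta s = 0}" "T0 \<notin> Im ` {s\<in>B. zeta2 s = 0}" by blast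
  have "zeta (Complex x T0) \<noteq> 0" for x
  proof
    assume z: "zeta (Complex x T0) = 0"
    have "x = 1/2" using zeta_zeros_RH[OF RH z] T0 X by simp
    hence "Complex x T0 \<in> B" using T0 a by (simp add: B_def in_cbox_complex_iff)
    thus False using T0(2) z by (metis (mono_tags, lifting) complex.sel(2) image_eqI mem_Collect_eq)
  qed
  moreover have "zeta2 (Complex x T0) \<noteq> 0" for x
  proof
    assume z: "zeta2 (Complex x T0) = 0"
    hence "Complex x T0 \<in> B" using strip[OF z] T0 by (simp add: B_def in_cbox_complex_iff)
    thus False using T0(3) z by (metis (mono_tags, lifting) complex.sel(2) image_eqI mem_Collect_eq)
  qed
  moreover have "T0 > X" using T0 by simp
  ultimately show ?thesis by blast
qed

text \<open>The rectangle starts at a height \<open>T0\<close>, because on the left side a logarithm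
  of \<open>zquot\<close> is available only far up; the zeros below are subtracted as a sum
  independent of \<open>T\<close>.\<close>

lemma zero_sum_contour:
  assumes RH: "riemann_hypothesis" and T: "0 < T0" "T0 < T" and a: "a \<ge> 1"
    and strip: "\<And>s. zeta2 s = 0 \<Longrightarrow> Im s \<ge> T0 \<Longrightarrow> 1 - a < Re s \<and> Re s < a"
    and nz: "\<And>x. zeta (Complex x T0) \<noteq> 0" "\<And>x. zeta2 (Complex x T0) \<noteq> 0"
      "\<And>x. zeta (Complex x T) \<noteq> 0" "\<And>x. zeta2 (Complex x T) \<noteq> 0"
  shows "2 * pi * ((\<Sum>\<rho>\<in>zeta2_zeros T. of_int (zorder zeta2 \<rho>) * (Re \<rho> - 1/2))
        - (\<Sum>\<rho>\<in>zeta2_zeros T0. of_int (zorder zeta2 \<rho>) * (Re \<rho> - 1/2))) =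
      Im (contour_integral (linepath (Complex (1-a) T0) (Complex a T0)) (\<lambda>s. (s - 1/2) * zw s))
    + Im (contour_integral (linepath (Complex a T0) (Complex a T)) (\<lambda>s. (s - 1/2) * zw s))
    - Im (contour_integral (linepath (Complex (1-a) T) (Complex a T)) (\<lambda>s. (s - 1/2) * zw s))
    - Im (contour_integral (linepath (Complex (1-a) T0) (Complex (1-a) T)) (\<lambda>s. (s - 1/2) * zw s))"
proof -
  define p q where "p = Complex (1-a) T0" and "q = Complex a T"
  have pq: "Re p < Re q" "Im p < Im q" "Im p > 0" using T a by (auto simp: p_def q_def)
  have img: "path_image (rectpath p q) =
           {z. Re z \<in> {Re p, Re q} \<and> Im z \<in> {Im p..Im q}} \<union> {z. Im z \<in> {Im p, Im q} \<and> Re z \<in> {Re p..Re q}}"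
    by (rule path_image_rectpath) (use pq in auto)
  have z2: "zeta2 s \<noteq> 0" if s: "s \<in> path_image (rectpath p q)" for s
  proof
    assume z: "zeta2 s = 0"
    have "Im s \<ge> T0" using s T unfolding img by (auto simp: p_def q_def)
    hence "1 - a < Re s" "Re s < a" using strip[OF z] by auto
    hence "s = Complex (Re s) T0 \<or> s = Complex (Re s) T" using s unfolding img by (auto simp: p_def q_def complex_eq_iff)
    thus False using nz z by metis
  qed
  have z1: "zeta s \<noteq> 0" if s: "s \<in> path_image (rectpath p q)" for s
  proof
    assume z: "zeta s = 0"
    have "Im s \<ge> T0" using s T unfolding img by (auto simp: p_def q_def)
    hence "Re s = 1/2" using zeta_zeros_RH[OF RH z] T by simp
    hence "s = Complex (Re s) T0 \<or> s = Complex (Re s) T" using s a unfolding img by (auto simp: p_def q_def complex_eq_iff)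
    thus False using nz z by metis
  qed
  have h1: "zeta holomorphic_on {s. Im s > 0}" by (rule zeta_holomorphic_on) auto
  have h2: "zeta2 holomorphic_on {s. Im s > 0}" by (rule holomorphic_on_subset[OF zeta2_holomorphic]) auto
  have sub: "path_image (rectpath p q) \<subseteq> {s. Im s > 0}" using pq unfolding img by auto
  have cont: "continuous_on (path_image (rectpath p q)) G" if "G holomorphic_on {s. Im s > 0}" for G
    by (rule continuous_on_subset[OF holomorphic_on_imp_continuous_on[OF that] sub])
  have c1: "continuous_on (path_image (rectpath p q)) (\<lambda>s. (s - 1/2) * (deriv zeta s / zeta s))"
    by (intro continuous_intros cont h1 holomorphic_deriv open_halfspace_Im_gt) (use z1 in auto)
  have c2: "continuous_on (path_image (rectpath p q)) (\<lambda>s. (s - 1/2) * (deriv zeta2 s / zeta2 s))"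
    by (intro continuous_intros cont h2 holomorphic_deriv open_halfspace_Im_gt) (use z2 in auto)
  have i1: "(\<lambda>s. (s - 1/2) * (deriv zeta s / zeta s)) contour_integrable_on rectpath p q"
    by (rule contour_integral_rectpath(1)[OF c1]) (use pq in auto)
  have i2: "(\<lambda>s. (s - 1/2) * (deriv zeta2 s / zeta2 s)) contour_integrable_on rectpath p q"
    by (rule contour_integral_rectpath(1)[OF c2]) (use pq in auto)
  have F: "(\<lambda>s. (s - 1/2) * zw s) = (\<lambda>s. (s - 1/2) * (deriv zeta2 s / zeta2 s) - (s - 1/2) * (deriv zeta s / zeta s))"
    by (simp add: zw_def zlog_def right_diff_distrib)
  have hh: "(\<lambda>s. s - 1/2) holomorphic_on UNIV" by (intro holomorphic_intros)
  have cF: "continuous_on (path_image (rectpath p q)) (\<lambda>s. (s - 1/2) * zw s)"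
    unfolding F by (intro continuous_on_diff c1 c2)
  define S1 where "S1 = (\<Sum>s | s \<in> box p q \<and> zeta s = 0. (s - 1/2) * of_int (zorder zeta s))"
  define S2 where "S2 = (\<Sum>s | s \<in> box p q \<and> zeta2 s = 0. (s - 1/2) * of_int (zorder zeta2 s))"
  have ci: "contour_integral (rectpath p q) (\<lambda>s. (s - 1/2) * zw s) = 2 * pi * \<i> * S2 - 2 * pi * \<i> * S1"
    unfolding F S1_def S2_def
    using contour_integral_diff[OF i2 i1] rectangle_argument_principle(2)[OF pq h2 hh z2]
      rectangle_argument_principle(2)[OF pq h1 hh z1] by simp
  have "Im (contour_integral (rectpath p q) (\<lambda>s. (s - 1/2) * zw s)) = 2 * pi * (Re S2 - Re S1)"
    unfolding ci by (simp add: algebra_simps)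
  moreover have "Re S1 = 0" unfolding S1_def Re_sum
  proof (rule sum.neutral, rule ballI)
    fix s assume "s \<in> {s. s \<in> box p q \<and> zeta s = 0}"
    hence "zeta s = 0" "Im s \<noteq> 0" using pq by (auto simp: in_box_complex_iff)
    hence "Re s = 1/2" by (rule zeta_zeros_RH[OF RH])
    thus "Re ((s - 1/2) * of_int (zorder zeta s)) = 0" by simp
  qed
  moreover have "Re S2 = (\<Sum>\<rho>\<in>zeta2_zeros T - zeta2_zeros T0. of_int (zorder zeta2 \<rho>) * (Re \<rho> - 1/2))"
    unfolding S2_def Re_sum
  proof (rule sum.cong)
    show "{s. s \<in> box p q \<and> zeta2 s = 0} = zeta2_zeros T - zeta2_zeros T0"
    proof (intro equalityI subsetI)
      fix s assume "s \<in> {s. s \<in> box p q \<and> zeta2 s = 0}"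
      thus "s \<in> zeta2_zeros T - zeta2_zeros T0"
        using T by (auto simp: p_def q_def in_box_complex_iff zeta2_zeros_def)
    next
      fix s assume "s \<in> zeta2_zeros T - zeta2_zeros T0"
      hence s: "zeta2 s = 0" "Im s > T0" "Im s \<le> T" by (auto simp: zeta2_zeros_def)
      \<comment> \<open>\<open>zeta2_zeros T\<close> includes the height T, the open box does not;
        the choice of T excludes zeros there.\<close>
      have "Im s \<noteq> T" using nz(4)[of "Re s"] s(1) by auto
      thus "s \<in> {s. s \<in> box p q \<and> zeta2 s = 0}"
        using s strip[OF s(1)] by (auto simp: p_def q_def in_box_complex_iff)
    qed
  qed simp
  moreover have "(\<Sum>\<rho>\<in>zeta2_zeros T - zeta2_zeros T0. of_int (zorder zeta2 \<rho>) * (Re \<rho> - 1/2)) =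
      (\<Sum>\<rho>\<in>zeta2_zeros T. of_int (zorder zeta2 \<rho>) * (Re \<rho> - 1/2)) - (\<Sum>\<rho>\<in>zeta2_zeros T0. of_int (zorder zeta2 \<rho>) * (Re \<rho> - 1/2))"
    by (rule sum_diff[OF finite_zeta2_zeros]) (use T in \<open>auto simp: zeta2_zeros_def\<close>)
  ultimately have 1: "Im (contour_integral (rectpath p q) (\<lambda>s. (s - 1/2) * zw s)) =
      2 * pi * ((\<Sum>\<rho>\<in>zeta2_zeros T. of_int (zorder zeta2 \<rho>) * (Re \<rho> - 1/2)) - (\<Sum>\<rho>\<in>zeta2_zeros T0. of_int (zorder zeta2 \<rho>) * (Re \<rho> - 1/2)))"
    by simp
  have "contour_integral (rectpath p q) (\<lambda>s. (s - 1/2) * zw s) =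
      contour_integral (linepath p (Complex (Re q) (Im p))) (\<lambda>s. (s - 1/2) * zw s)
      + contour_integral (linepath (Complex (Re q) (Im p)) q) (\<lambda>s. (s - 1/2) * zw s)
      - contour_integral (linepath (Complex (Re p) (Im q)) q) (\<lambda>s. (s - 1/2) * zw s)
      - contour_integral (linepath p (Complex (Re p) (Im q))) (\<lambda>s. (s - 1/2) * zw s)"
    by (rule contour_integral_rectpath(2)[OF cF]) (use pq in auto)
  thus ?thesis using 1 by (simp add: p_def q_def)
qed

text \<open>The corner terms T ln |zquot| of the two vertical sides cancel against those of the
  upper side. The lower side and the zeros up to \<open>T0\<close> contribute constants, which 1
  \<le> (ln(ln T))^2 absorbs.\<close>

lemma zeta2_zero_sum_good_height:
  assumes RH: "riemann_hypothesis"
  shows "\<exists>K>0. \<exists>T2\<ge>exp 20. \<forall>T\<ge>T2. (\<forall>x. zeta (Complex x T) \<noteq> 0) \<and> (\<forall>x. zeta2 (Complex x T) \<noteq> 0) \<longrightarrow>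
    \<bar>2 * pi * (\<Sum>\<rho>\<in>zeta2_zeros T. of_int (zorder zeta2 \<rho>) * (Re \<rho> - 1/2))
      - (T * (ln 2 / 2 - 2 * ln (ln 2)) + 4 * pi * main_prim (T / (2 * pi)))\<bar> \<le> K * (ln (ln T))\<^sup>2"
proof -
  obtain ar Cr \<epsilon> where ar: "ar \<ge> 4" "Cr > 0" "\<epsilon> holomorphic_on {s. Re s > ar - 1}"
    "\<And>s. Re s > ar - 1 \<Longrightarrow> zeta s \<noteq> 0 \<and>
        zquot s = exp (- s * of_real (ln 2) + of_real (2 * ln (ln 2)) + \<epsilon> s) \<and>
        norm (\<epsilon> s) \<le> Cr * (2/3) powr (Re s) \<and> norm (\<epsilon> s) \<le> 1"
    using zquot_right_branch by blast
  obtain al T1 Cl e1 e2 where al: "al \<ge> 4" "T1 \<ge> 4" "Cl > 0"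
     "e1 holomorphic_on {w. Re w > al - 1 \<and> Im w < - T1}" "e2 holomorphic_on {w. Re w > al - 1 \<and> Im w < - T1}"
     "\<And>w. Re w > al - 1 \<Longrightarrow> Im w < - T1 \<Longrightarrow> zeta w \<noteq> 0 \<and> Re (lam w) \<ge> 1 \<and>
        zquot (1 - w) = exp (2 * Ln (lam w) + e1 w + e2 w) \<and> norm (e1 w) \<le> 1 \<and> norm (e2 w) \<le> 1 \<and>
        norm (e1 w) \<le> 2 * norm (deriv lam w) / (norm (lam w))\<^sup>2 \<and> norm (e2 w) \<le> Cl * (1/2) powr (Re w)"
    using zquot_left_branch by blast
  define a where "a = max ar al"
  have a: "a \<ge> 4" "a > ar - 1" "a > al - 1" using ar al by (auto simp: a_def)
  \<comment> \<open>Lower bound for |zquot| on Re s = a, read off its exponential form with Re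
    \<epsilon> \<ge> -1.\<close>
  define m where "m = exp (- a * ln 2 + 2 * ln (ln 2) - 1)"
  have m0: "m > 0" by (simp add: m_def)
  have m: "m \<le> norm (zquot (Complex a t))" for t
  proof -
    have e: "zquot (Complex a t) = exp (- Complex a t * of_real (ln 2) + of_real (2 * ln (ln 2)) + \<epsilon> (Complex a t))"
      "norm (\<epsilon> (Complex a t)) \<le> 1" using ar(4)[of "Complex a t"] a by auto
    have "Re (\<epsilon> (Complex a t)) \<ge> -1" using e(2) abs_Re_le_cmod[of "\<epsilon> (Complex a t)"] by linarith
    thus ?thesis unfolding e(1) m_def by simp
  qed
  \<comment> \<open>The exponent is -2 because \<open>e1\<close> and \<open>e2\<close> are each at
    most 1 in modulus.\<close>
  define m' where "m' = exp (- 2 :: real)"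
  have m'0: "m' > 0" by (simp add: m'_def)
  have m': "m' * (norm (lam (Complex a (-t))))\<^sup>2 \<le> norm (zquot (Complex (1-a) t))" if "t \<ge> T1 + 1" for t
  proof -
    define w where "w = Complex a (-t)"
    have w: "1 - w = Complex (1-a) t" by (simp add: w_def complex_eq_iff)
    have e: "Re (lam w) \<ge> 1" "zquot (1 - w) = exp (2 * Ln (lam w) + e1 w + e2 w)" "norm (e1 w) \<le> 1" "norm (e2 w) \<le> 1"
      using al(6)[of w] a that by (auto simp: w_def)
    have "lam w \<noteq> 0" using e(1) by auto
    hence "exp (2 * Ln (lam w)) = (lam w)\<^sup>2" by (simp add: exp_double)
    hence "zquot (1 - w) = (lam w)\<^sup>2 * exp (e1 w + e2 w)" unfolding e(2) by (simp add: exp_add)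
    hence "norm (zquot (1 - w)) = (norm (lam w))\<^sup>2 * exp (Re (e1 w) + Re (e2 w))" by (simp add: norm_mult norm_power)
    moreover have "-2 \<le> Re (e1 w) + Re (e2 w)"
      using e(3,4) abs_Re_le_cmod[of "e1 w"] abs_Re_le_cmod[of "e2 w"] by linarith
    hence "m' \<le> exp (Re (e1 w) + Re (e2 w))" by (simp add: m'_def)
    ultimately show ?thesis unfolding w_def[symmetric] w[symmetric]
      using mult_right_mono[of m' "exp (Re (e1 w) + Re (e2 w))" "(norm (lam w))\<^sup>2"] by (simp add: mult.commute)
  qed
  have zr: "zeta2 s \<noteq> 0" if "Re s \<ge> a" for s
  proof
    assume "zeta2 s = 0"
    hence "zquot s = 0" by (simp add: zquot_def)
    thus False using ar(4)[of s] a that by simp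
  qed
  have zl: "zeta2 s \<noteq> 0" if "Re s \<le> 1 - a" "Im s > T1" for s
  proof
    assume "zeta2 s = 0"
    hence "zquot (1 - (1 - s)) = 0" by (simp add: zquot_def)
    thus False using al(6)[of "1 - s"] a that by simp
  qed
  have b3: "al - 1 \<ge> 3" using al by simp
  obtain TL where TL: "TL \<ge> 18" "\<And>T0. T0 > TL \<Longrightarrow> \<exists>K>0. \<forall>T>T0.
     \<bar>Im (contour_integral (linepath (Complex (1-a) T0) (Complex (1-a) T)) (\<lambda>s. (s - 1/2) * zw s))
       - (T * ln (norm (zquot (Complex (1-a) T))) - 4 * pi * main_prim (T / (2 * pi)))\<bar> \<le> K * (1 + ln (ln T))"
    using left_vertical[OF al(4,5) b3 a(3) al(2,3,6)] by blast
  obtain KT TT where KT: "KT > 0" "\<And>T. T \<ge> TT \<Longrightarrow> (\<forall>x. zeta (Complex x T) \<noteq> 0) \<and> (\<forall>x. zeta2 (Complex x T) \<noteq> 0) \<Longrightarrow>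
    \<bar>Im (contour_integral (linepath (Complex (1-a) T) (Complex a T)) (\<lambda>s. (s - 1/2) * zw s))
      - T * (ln (norm (zquot (Complex a T))) - ln (norm (zquot (Complex (1-a) T))))\<bar> \<le> KT * (ln (ln T))\<^sup>2"
    using top_horizontal[OF RH _ m0 m m'0 m', of "T1 + 1"] a by auto
  define X where "X = max TL T1"
  have strip: "1 - a < Re s \<and> Re s < a" if "zeta2 s = 0" "Im s > X" for s
    using zr[of s] zl[of s] that by (force simp: X_def)
  have "X > 0" "a \<ge> 1" using TL a by (auto simp: X_def)
  then obtain T0 where T0: "T0 > X" "\<And>x. zeta (Complex x T0) \<noteq> 0" "\<And>x. zeta2 (Complex x T0) \<noteq> 0"
    using good_height_exists[OF RH, of X a] strip by (metis less_imp_le)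
  have T0': "T0 > TL" "T0 > 0" using T0 TL by (auto simp: X_def)
  obtain KL where KL: "KL > 0" "\<And>T. T > T0 \<Longrightarrow>
     \<bar>Im (contour_integral (linepath (Complex (1-a) T0) (Complex (1-a) T)) (\<lambda>s. (s - 1/2) * zw s))
       - (T * ln (norm (zquot (Complex (1-a) T))) - 4 * pi * main_prim (T / (2 * pi)))\<bar> \<le> KL * (1 + ln (ln T))"
    using TL(2)[OF T0'(1)] by blast
  have b1: "ar - 1 \<ge> 1" using ar by simp
  obtain KR where KR: "\<And>T. T > T0 \<Longrightarrow> \<bar>Im (contour_integral (linepath (Complex a T0) (Complex a T)) (\<lambda>s. (s - 1/2) * zw s))
     - (T * ln (norm (zquot (Complex a T))) + T * (ln 2 / 2 - 2 * ln (ln 2)))\<bar> \<le> KR"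
    using right_vertical[OF ar(3) b1 a(2) ar(2,4), of T0] by blast
  define A0 where "A0 = 2 * pi * (\<Sum>\<rho>\<in>zeta2_zeros T0. of_int (zorder zeta2 \<rho>) * (Re \<rho> - 1/2))"
  define B0 where "B0 = Im (contour_integral (linepath (Complex (1-a) T0) (Complex a T0)) (\<lambda>s. (s - 1/2) * zw s))"
  define K where "K = \<bar>A0\<bar> + \<bar>B0\<bar> + \<bar>KR\<bar> + KT + 2 * KL"
  define T2 where "T2 = max (exp 20) (max TT (T0 + 1))"
  have "\<bar>2 * pi * (\<Sum>\<rho>\<in>zeta2_zeros T. of_int (zorder zeta2 \<rho>) * (Re \<rho> - 1/2))
      - (T * (ln 2 / 2 - 2 * ln (ln 2)) + 4 * pi * main_prim (T / (2 * pi)))\<bar> \<le> K * (ln (ln T))\<^sup>2"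
    if T: "T \<ge> T2" and nz: "\<forall>x. zeta (Complex x T) \<noteq> 0" "\<forall>x. zeta2 (Complex x T) \<noteq> 0" for T
  proof -
    have T20: "T \<ge> exp 20" "T \<ge> TT" "T > T0" using T by (auto simp: T2_def)
    define k where "k = (ln (ln T))\<^sup>2"
    have "ln (ln T) * 1 \<le> ln (ln T) * ln (ln T)"
      using exp_20_facts[OF T20(1)] by (intro mult_left_mono) auto
    hence k: "1 \<le> k" "ln (ln T) \<le> k"
      using exp_20_facts[OF T20(1)] unfolding k_def power2_eq_square by linarith+
    have "2 * pi * ((\<Sum>\<rho>\<in>zeta2_zeros T. of_int (zorder zeta2 \<rho>) * (Re \<rho> - 1/2))
        - (\<Sum>\<rho>\<in>zeta2_zeros T0. of_int (zorder zeta2 \<rho>) * (Re \<rho> - 1/2))) =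
      B0
    + Im (contour_integral (linepath (Complex a T0) (Complex a T)) (\<lambda>s. (s - 1/2) * zw s))
    - Im (contour_integral (linepath (Complex (1-a) T) (Complex a T)) (\<lambda>s. (s - 1/2) * zw s))
    - Im (contour_integral (linepath (Complex (1-a) T0) (Complex (1-a) T)) (\<lambda>s. (s - 1/2) * zw s))"
      unfolding B0_def by (rule zero_sum_contour[OF RH T0'(2) T20(3)]) (use strip T0 nz a in auto)
    hence main: "2 * pi * (\<Sum>\<rho>\<in>zeta2_zeros T. of_int (zorder zeta2 \<rho>) * (Re \<rho> - 1/2)) = A0 + B0
    + Im (contour_integral (linepath (Complex a T0) (Complex a T)) (\<lambda>s. (s - 1/2) * zw s))
    - Im (contour_integral (linepath (Complex (1-a) T) (Complex a T)) (\<lambda>s. (s - 1/2) * zw s))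
    - Im (contour_integral (linepath (Complex (1-a) T0) (Complex (1-a) T)) (\<lambda>s. (s - 1/2) * zw s))"
      unfolding A0_def right_diff_distrib by linarith
    have "KL * (1 + ln (ln T)) \<le> KL * (2 * k)" using k KL by (intro mult_left_mono) auto
    hence 1: "KL * (1 + ln (ln T)) \<le> (2 * KL) * k" by simp
    have 2: "\<bar>A0\<bar> + \<bar>B0\<bar> + \<bar>KR\<bar> \<le> (\<bar>A0\<bar> + \<bar>B0\<bar> + \<bar>KR\<bar>) * k"
      using k mult_left_mono[of 1 k "\<bar>A0\<bar> + \<bar>B0\<bar> + \<bar>KR\<bar>"] by simp
    have 3: "K * k = (\<bar>A0\<bar> + \<bar>B0\<bar> + \<bar>KR\<bar>) * k + KT * k + (2 * KL) * k"
      by (simp add: K_def algebra_simps)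
    show ?thesis unfolding main k_def[symmetric] 3
      using KR[OF T20(3)] KL(2)[OF T20(3)] KT(2)[OF T20(2) conjI[OF nz]] 1 2
      unfolding k_def[symmetric] right_diff_distrib[of T] by linarith
  qed
  moreover have "K > 0" using KT KL by (simp add: K_def add_nonneg_pos)
  moreover have "T2 \<ge> exp 20" by (simp add: T2_def)
  ultimately show ?thesis by blast
qed

text \<open>T / (2 pi) may be arbitrarily close to 1, where ln(ln x) is unbounded. On (1, 2] the
  inequality ln x \<ge> 1 - 1 / x \<ge> (x - 1) / 2 allows a comparison with \<open>C\<close>, a
  primitive of ln((x - 1) / 2) that stays bounded near 1.\<close>

lemma main_prim_bounded: "\<exists>B. \<forall>x. 1 < x \<and> x \<le> X \<longrightarrow> \<bar>main_prim x\<bar> \<le> B"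
proof -
  define C where "C = (\<lambda>x::real. (x - 1) * ln ((x - 1) / 2) - (x - 1))"
  have low: "main_prim 2 \<le> main_prim x \<and> main_prim x \<le> main_prim 2 - C 2" if x: "1 < x" "x \<le> 2" for x
  proof
    show "main_prim 2 \<le> main_prim x"
    proof (rule DERIV_nonpos_imp_nonincreasing[OF x(2)])
      fix y assume y: "x \<le> y" "y \<le> 2"
      hence y1: "y > 1" using x by simp
      have "ln y \<le> 1" using y ln_le_minus_one[of y] x by simp
      moreover have "ln y > 0" using y x by simp
      ultimately have "ln (ln y) \<le> 0" by simp
      thus "\<exists>d. (main_prim has_real_derivative d) (at y) \<and> d \<le> 0"
        using main_prim_has_derivative[OF y1] by blast
    qed
    have "main_prim x - C x \<le> main_prim 2 - C 2"
    proof (rule DERIV_nonneg_imp_nondecreasing[OF x(2)])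
      fix y assume y: "x \<le> y" "y \<le> 2"
      hence y1: "y > 1" using x by simp
      have dC: "(C has_real_derivative ln ((y - 1) / 2)) (at y)"
        unfolding C_def using y1 by (auto intro!: derivative_eq_intros)
      have "(y - 1) / 2 \<le> (y - 1) / y" using y y1 by (intro divide_left_mono) auto
      also have "\<dots> = 1 - inverse y" using y1 by (simp add: field_simps)
      also have "\<dots> \<le> ln y" using ln_le_minus_one[of "inverse y"] y1 by (simp add: ln_inverse)
      finally have "ln ((y - 1) / 2) \<le> ln (ln y)" using y1 by (intro ln_mono) auto
      moreover have "((\<lambda>x. main_prim x - C x) has_real_derivative ln (ln y) - ln ((y - 1) / 2)) (at y)"
        by (intro derivative_intros main_prim_has_derivative[OF y1] dC)
      ultimately show "\<exists>d. ((\<lambda>x. main_prim x - C x) has_real_derivative d) (at y) \<and> 0 \<le> d"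
        by (intro exI[of _ "ln (ln y) - ln ((y - 1) / 2)"]) auto
    qed
    moreover have "C x \<le> 0"
    proof -
      have "ln ((x - 1) / 2) \<le> 0" using x by (subst ln_le_zero_iff) auto
      hence "(x - 1) * ln ((x - 1) / 2) \<le> 0" using x by (intro mult_nonneg_nonpos) auto
      thus ?thesis using x unfolding C_def by linarith
    qed
    ultimately show "main_prim x \<le> main_prim 2 - C 2" by linarith
  qed
  have "continuous_on {2..X} main_prim"
  proof (intro continuous_at_imp_continuous_on ballI)
    fix x assume "x \<in> {2..X}"
    hence "x > 1" by simp
    from DERIV_isCont[OF main_prim_has_derivative[OF this]] show "isCont main_prim x" .
  qed
  hence "bounded (main_prim ` {2..X})"
    by (intro compact_imp_bounded compact_continuous_image) auto
  then obtain B where "\<forall>y\<in>main_prim ` {2..X}. norm y \<le> B" unfolding bounded_iff ..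
  hence B: "\<bar>main_prim x\<bar> \<le> B" if "x \<in> {2..X}" for x using that by force
  have "\<bar>main_prim x\<bar> \<le> max B (\<bar>main_prim 2\<bar> + \<bar>C 2\<bar>)" if "1 < x" "x \<le> X" for x
  proof (cases "x \<le> 2")
    case True
    thus ?thesis using low[of x] that by linarith
  next
    case False
    thus ?thesis using B[of x] that by simp
  qed
  thus ?thesis by blast
qed

text \<open>Every height slightly above T is free of zeros, and the sum is the same there as at T,
  since zeros at height T are already counted. The main term and the error bound are continuous, so
  t may decrease to T.\<close>

lemma zeta2_zero_sum_large:
  assumes RH: "riemann_hypothesis"
  shows "\<exists>K>0. \<exists>T2\<ge>exp 20. \<forall>T\<ge>T2.
    \<bar>2 * pi * (\<Sum>\<rho>\<in>zeta2_zeros T. of_int (zorder zeta2 \<rho>) * (Re \<rho> - 1/2))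
      - (T * (ln 2 / 2 - 2 * ln (ln 2)) + 4 * pi * main_prim (T / (2 * pi)))\<bar> \<le> K * (ln (ln T))\<^sup>2"
proof -
  define M where "M = (\<lambda>T. T * (ln 2 / 2 - 2 * ln (ln 2)) + 4 * pi * main_prim (T / (2 * pi)))"
  define \<Sigma> where "\<Sigma> = (\<lambda>T. 2 * pi * (\<Sum>\<rho>\<in>zeta2_zeros T. of_int (zorder zeta2 \<rho>) * (Re \<rho> - 1/2)))"
  obtain K T2 where K: "K > 0" "T2 \<ge> exp 20"
    "\<And>T. T \<ge> T2 \<Longrightarrow> (\<forall>x. zeta (Complex x T) \<noteq> 0) \<and> (\<forall>x. zeta2 (Complex x T) \<noteq> 0) \<Longrightarrow> \<bar>\<Sigma> T - M T\<bar> \<le> K * (ln (ln T))\<^sup>2"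
    using zeta2_zero_sum_good_height[OF RH] unfolding M_def \<Sigma>_def by blast
  have "\<bar>\<Sigma> T - M T\<bar> \<le> K * (ln (ln T))\<^sup>2" if T: "T \<ge> T2" for T
  proof -
    have T20: "T \<ge> exp 20" using T K by simp
    note T' = exp_20_facts[OF T20]
    define B where "B = cbox (Complex (1/2) T) (Complex (1/2) (T+1))"
    have "finite {s\<in>B. zeta s = 0}"
    proof (rule finite_zeros_compact[of zeta "{s. Im s > 0}" B "Complex 2 1"])
      show "zeta holomorphic_on {s. Im s > 0}" by (rule zeta_holomorphic_on) auto
      show "connected {s. 0 < Im s}" by (intro convex_connected convex_halfspace_Im_gt)
      show "zeta (Complex 2 1) \<noteq> 0" by (rule zeta_nonzero_Re_ge_1) auto
      show "B \<subseteq> {s. Im s > 0}" using T' by (auto simp: B_def in_cbox_complex_iff)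
    qed (auto simp: B_def open_halfspace_Im_gt)
    \<comment> \<open>Heights of nearby zeros with T itself removed: what happens at height T does
      not disturb an approach from above.\<close>
    define F where "F = (Im ` {s\<in>B. zeta s = 0} \<union> Im ` zeta2_zeros (T + 1)) - {T}"
    have "finite F" unfolding F_def using \<open>finite {s\<in>B. zeta s = 0}\<close> finite_zeta2_zeros[of "T + 1"] by blast
    hence "open (- F)" by (simp add: finite_imp_closed open_Compl)
    moreover have "T \<in> - F" by (simp add: F_def)
    ultimately obtain e where e: "e > 0" "ball T e \<subseteq> - F" unfolding open_contains_ball by blast
    define d where "d = min e 1"
    have d: "d > 0" "d \<le> e" "d \<le> 1" using e by (auto simp: d_def)
    have notF: "t \<notin> F" if "T < t" "t < T + d" for t
    proof -
      have "t \<in> ball T e" using that d by (simp add: dist_real_def)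
      thus ?thesis using e(2) by blast
    qed
    have g2: "zeta2 s \<noteq> 0" if s: "T < Im s" "Im s < T + d" for s
    proof
      assume "zeta2 s = 0"
      hence "s \<in> zeta2_zeros (T + 1)" using s d T' by (auto simp: zeta2_zeros_def)
      hence "Im s \<in> F" using s by (auto simp: F_def)
      thus False using notF s by blast
    qed
    have g1: "zeta s \<noteq> 0" if s: "T < Im s" "Im s < T + d" for s
    proof
      assume z: "zeta s = 0"
      hence "Re s = 1/2" using zeta_zeros_RH[OF RH z] s T' by simp
      hence "s \<in> B" using s d by (simp add: B_def in_cbox_complex_iff)
      hence "Im s \<in> F" using s z by (auto simp: F_def)
      thus False using notF s by blast
    qed
    have step: "\<bar>\<Sigma> T - M t\<bar> \<le> K * (ln (ln t))\<^sup>2" if t: "T < t" "t < T + d" for t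
    proof -
      have "zeta2_zeros t = zeta2_zeros T"
      proof (intro equalityI subsetI)
        fix s assume "s \<in> zeta2_zeros t"
        hence s: "zeta2 s = 0" "0 < Im s" "Im s \<le> t" by (auto simp: zeta2_zeros_def)
        hence "Im s \<le> T" using g2[of s] t by force
        thus "s \<in> zeta2_zeros T" using s by (simp add: zeta2_zeros_def)
      next
        fix s assume "s \<in> zeta2_zeros T"
        thus "s \<in> zeta2_zeros t" using t by (auto simp: zeta2_zeros_def)
      qed
      hence "\<Sigma> t = \<Sigma> T" by (simp add: \<Sigma>_def)
      moreover have "\<bar>\<Sigma> t - M t\<bar> \<le> K * (ln (ln t))\<^sup>2"
        by (rule K(3)) (use t T g1 g2 in auto)
      ultimately show ?thesis by simp
    qed
    have ev: "\<forall>\<^sub>F t in at_right T. \<bar>\<Sigma> T - M t\<bar> \<le> K * (ln (ln t))\<^sup>2"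
      unfolding eventually_at_right_field using step d by (intro exI[of _ "T + d"]) auto
    have Tpi: "T / (2 * pi) > 1" using T' pi_less_4 by (simp add: pos_less_divide_eq)
    have cm: "isCont (\<lambda>t. main_prim (t / (2 * pi))) T"
      by (rule isCont_o2[where g = main_prim and f = "\<lambda>t. t / (2 * pi)"])
         (intro continuous_intros, simp, rule DERIV_isCont[OF main_prim_has_derivative[OF Tpi]])
    have "isCont M T" unfolding M_def by (intro continuous_intros cm)
    hence "(M \<longlongrightarrow> M T) (at_right T)" by (simp add: isCont_def filterlim_at_split)
    hence 1: "((\<lambda>t. \<bar>\<Sigma> T - M t\<bar>) \<longlongrightarrow> \<bar>\<Sigma> T - M T\<bar>) (at_right T)" by (intro tendsto_intros)
    have "isCont (\<lambda>t. K * (ln (ln t))\<^sup>2) T" using T' by (intro continuous_intros) auto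
    hence 2: "((\<lambda>t. K * (ln (ln t))\<^sup>2) \<longlongrightarrow> K * (ln (ln T))\<^sup>2) (at_right T)" by (simp add: isCont_def filterlim_at_split)
    show ?thesis by (rule tendsto_le[OF _ 2 1 ev]) simp
  qed
  thus ?thesis using K(1,2) unfolding M_def \<Sigma>_def by blast
qed

theorem theorem1:
  assumes "riemann_hypothesis"
  shows "\<exists>C::real. \<forall>T::real. T > 2 * pi \<longrightarrow>
    finite (zeta2_zeros T) \<and>
    \<bar>(\<Sum>\<rho>\<in>zeta2_zeros T. of_int (zorder zeta2 \<rho>) * (Re \<rho> - 1 / 2))
      - (2 * T / (2 * pi) * ln (ln (T / (2 * pi)))
         + 1 / (2 * pi) * (1 / 2 * ln 2 - 2 * ln (ln 2)) * T
         - 2 * Li (T / (2 * pi)))\<bar>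
    \<le> C * (ln (ln T))\<^sup>2"
proof -
  define \<kappa> where "\<kappa> = ln 2 / 2 - 2 * ln (ln (2::real))"
  define M where "M = (\<lambda>T. T * \<kappa> + 4 * pi * main_prim (T / (2 * pi)))"
  define \<Sigma> where "\<Sigma> = (\<lambda>T. \<Sum>\<rho>\<in>zeta2_zeros T. of_int (zorder zeta2 \<rho>) * (Re \<rho> - 1/2))"
  obtain K T2 where K: "K > 0" "T2 \<ge> exp 20" "\<And>T. T \<ge> T2 \<Longrightarrow> \<bar>2 * pi * \<Sigma> T - M T\<bar> \<le> K * (ln (ln T))\<^sup>2"
    using zeta2_zero_sum_large[OF assms] unfolding M_def \<Sigma>_def \<kappa>_def by blast
  obtain B where B: "\<And>x. 1 < x \<Longrightarrow> x \<le> T2 / (2 * pi) \<Longrightarrow> \<bar>main_prim x\<bar> \<le> B"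
    using main_prim_bounded[of "T2 / (2 * pi)"] by blast
  \<comment> \<open>Bounds the difference for every T below \<open>T2\<close>, where only zeros from
    the finite set \<open>zeta2_zeros T2\<close> occur.\<close>
  define A where "A = 2 * pi * (\<Sum>\<rho>\<in>zeta2_zeros T2. \<bar>of_int (zorder zeta2 \<rho>) * (Re \<rho> - 1/2)\<bar>) + T2 * \<bar>\<kappa>\<bar> + 4 * pi * B"
  \<comment> \<open>A positive lower bound for ln(ln T) on the whole range, since 2 pi > e. The
    quotient |A| / d^2 therefore lets the error term dominate the bounded part of the range as
    well.\<close>
  define d where "d = ln (ln (2 * pi))"
  have pi3: "2 * pi > 6" using pi_gt3 by simp
  have "ln (2 * pi) > 1" using pi3 e_less_272 ln_less_cancel_iff[of "exp 1" "2 * pi"] by simp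
  hence d: "d > 0" unfolding d_def by (rule ln_gt_zero)
  define C where "C = (K + \<bar>A\<bar> / d\<^sup>2) / (2 * pi)"
  have "\<bar>\<Sigma> T - M T / (2 * pi)\<bar> \<le> C * (ln (ln T))\<^sup>2" if T: "T > 2 * pi" for T
  proof -
    have "ln (2 * pi) \<le> ln T" using T pi3 by (intro ln_mono) auto
    hence "d \<le> ln (ln T)" unfolding d_def by (rule ln_mono) (use \<open>ln (2 * pi) > 1\<close> in linarith)
    hence dk: "d\<^sup>2 \<le> (ln (ln T))\<^sup>2" using d by (intro power_mono) auto
    have "\<bar>2 * pi * \<Sigma> T - M T\<bar> \<le> (K + \<bar>A\<bar> / d\<^sup>2) * (ln (ln T))\<^sup>2"
    proof (cases "T \<ge> T2")
      case True
      have "\<bar>A\<bar> / d\<^sup>2 * (ln (ln T))\<^sup>2 \<ge> 0" by simp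
      thus ?thesis using K(3)[OF True] unfolding distrib_right by linarith
    next
      case False
      have "\<bar>\<Sigma> T\<bar> \<le> (\<Sum>\<rho>\<in>zeta2_zeros T. \<bar>of_int (zorder zeta2 \<rho>) * (Re \<rho> - 1/2)\<bar>)"
        unfolding \<Sigma>_def by (rule sum_abs)
      also have "\<dots> \<le> (\<Sum>\<rho>\<in>zeta2_zeros T2. \<bar>of_int (zorder zeta2 \<rho>) * (Re \<rho> - 1/2)\<bar>)"
        by (rule sum_mono2[OF finite_zeta2_zeros]) (use False in \<open>auto simp: zeta2_zeros_def\<close>)
      finally have 1: "2 * pi * \<bar>\<Sigma> T\<bar> \<le> 2 * pi * (\<Sum>\<rho>\<in>zeta2_zeros T2. \<bar>of_int (zorder zeta2 \<rho>) * (Re \<rho> - 1/2)\<bar>)"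
        by (intro mult_left_mono) auto
      have "\<bar>main_prim (T / (2 * pi))\<bar> \<le> B"
        by (rule B) (use T False in \<open>auto simp: divide_right_mono\<close>)
      hence "4 * pi * \<bar>main_prim (T / (2 * pi))\<bar> \<le> 4 * pi * B" by (intro mult_left_mono) auto
      moreover have "T * \<bar>\<kappa>\<bar> \<le> T2 * \<bar>\<kappa>\<bar>" using False by (intro mult_right_mono) auto
      moreover have "\<bar>2 * pi * \<Sigma> T - M T\<bar> \<le> \<bar>2 * pi * \<Sigma> T\<bar> + (\<bar>T * \<kappa>\<bar> + \<bar>4 * pi * main_prim (T / (2 * pi))\<bar>)"
        unfolding M_def by linarith
      moreover have "\<bar>2 * pi * \<Sigma> T\<bar> = 2 * pi * \<bar>\<Sigma> T\<bar>" "\<bar>T * \<kappa>\<bar> = T * \<bar>\<kappa>\<bar>"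
          "\<bar>4 * pi * main_prim (T / (2 * pi))\<bar> = 4 * pi * \<bar>main_prim (T / (2 * pi))\<bar>"
        using T pi3 by (auto simp: abs_mult)
      ultimately have "\<bar>2 * pi * \<Sigma> T - M T\<bar> \<le> A" using 1 unfolding A_def by linarith
      also have "\<dots> \<le> \<bar>A\<bar> / d\<^sup>2 * d\<^sup>2" using d by simp
      also have "\<dots> \<le> \<bar>A\<bar> / d\<^sup>2 * (ln (ln T))\<^sup>2" using dk by (intro mult_left_mono) auto
      also have "\<dots> \<le> (K + \<bar>A\<bar> / d\<^sup>2) * (ln (ln T))\<^sup>2" using K by (intro mult_right_mono) auto
      finally show ?thesis .
    qed
    moreover have "\<Sigma> T - M T / (2 * pi) = (2 * pi * \<Sigma> T - M T) / (2 * pi)" by (simp add: diff_divide_distrib)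
    hence "\<bar>\<Sigma> T - M T / (2 * pi)\<bar> = \<bar>2 * pi * \<Sigma> T - M T\<bar> / (2 * pi)" by (simp add: abs_divide)
    ultimately have "\<bar>\<Sigma> T - M T / (2 * pi)\<bar> \<le> (K + \<bar>A\<bar> / d\<^sup>2) * (ln (ln T))\<^sup>2 / (2 * pi)"
      by (simp only: divide_right_mono pi_ge_zero mult_nonneg_nonneg zero_le_numeral)
    thus ?thesis by (simp add: C_def)
  qed
  moreover have "M T / (2 * pi) = 2 * T / (2 * pi) * ln (ln (T / (2 * pi)))
         + 1 / (2 * pi) * (1 / 2 * ln 2 - 2 * ln (ln 2)) * T - 2 * Li (T / (2 * pi))" for T
    by (simp add: M_def \<kappa>_def main_prim_def field_simps)
  ultimately show ?thesis using finite_zeta2_zeros unfolding \<Sigma>_def by (intro exI[of _ C]) auto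
qed

end
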